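(* Let $K$ be an imaginary quadratic number field. There exists a probability measure $\mu$ on $[0,+\infty[$, absolutely continuous with respect to the Lebesgue measure, such that for every Borel subset $\mathcal{B}$ of $\mathbb{C}/\mathcal{O}_K$ with $dx(\mathcal{B})>0$ and $dx(\partial\mathcal{B})=0$, the measures $\mu_{t,\mathcal{B}}$ converge narrowly to $\mu$ as $t\to+\infty$. Furthermore, $\mu([0,1])=0$, and for every real number $\delta\ge 0$, $$\mu([0,\delta])=1-\frac{4}{\sqrt{|D_K|}}\int_{s=0}^{+\infty} dx\Big(\Big\{z\in\mathbb{C}/\mathcal{O}_K : \operatorname{card}\big(\mathfrak{C}(\overline{\rm D}(0,\delta))\cap a(-s)\,{}^{t}h(z)\,\widehat{\mathcal{O}_K^{\,2}}\big)=|\mathcal{O}_K^\times|\Big\}\Big)\,e^{-2s}\,ds.$$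
   Context: $K\subset\mathbb{C}$ is an imaginary quadratic number field with ring of integers $\mathcal{O}_K$, discriminant $D_K$ and unit group $\mathcal{O}_K^\times$. $\operatorname{pr}_{\mathcal{O}_K}:\mathbb{C}\to\mathbb{C}/\mathcal{O}_K$ is the canonical projection, $dx$ is the Haar measure on $\mathbb{C}/\mathcal{O}_K$ induced by Lebesgue measure on $\mathbb{C}$, of total mass $\frac{\sqrt{|D_K|}}{2}$, and $d$ is the quotient distance on $\mathbb{C}/\mathcal{O}_K$ induced by the Euclidean distance on $\mathbb{C}$. For $t\ge0$, $$\mathcal{F}_t=\Big\{\operatorname{pr}_{\mathcal{O}_K}\Big(\frac pq\Big): p,q\in\mathcal{O}_K,\ p\mathcal{O}_K+q\mathcal{O}_K=\mathcal{O}_K,\ 0<|q|\le e^{t/2}\Big\}.$$ $\Delta_x$ denotes the Dirac mass at $x$. For $t$ large enough (so that $\mathcal{F}_t\cap\mathcal{B}\neq\emptyset$ and $\mathcal{F}_t$ has at least two elements), $$\mu_{t,\mathcal{B}}=\frac{1}{\operatorname{card}(\mathcal{F}_t\cap\mathcal{B})}\sum_{r\in\mathcal{F}_t\cap\mathcal{B}}\Delta_{e^t d(r,\,\mathcal{F}_t\smallsetminus\{r\})},$$ a probability measure on $[0,+\infty[$. For $z\in\mathbb{C}$, $t\in\mathbb{R}$: $h(z)=\begin{pmatrix}1&z\\ 0&1\end{pmatrix}$, $a(t)=\begin{pmatrix}e^{-t/2}&0\\ 0&e^{t/2}\end{pmatrix}$; ${}^{t}g$ denotes the transpose of the matrix $g$.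 $\widehat{\mathcal{O}_K^{\,2}}$ is the set of column vectors $\begin{pmatrix}p\\ q\end{pmatrix}\in\mathcal{O}_K^2$ with $p\mathcal{O}_K+q\mathcal{O}_K=\mathcal{O}_K$. Since $\operatorname{SL}_2(\mathcal{O}_K)$ preserves $\widehat{\mathcal{O}_K^{\,2}}$, the set ${}^{t}h(z)\widehat{\mathcal{O}_K^{\,2}}$ depends only on the class of $z$ in $\mathbb{C}/\mathcal{O}_K$. $\overline{\rm D}(0,\delta)$ is the closed disk of radius $\delta$ centred at $0$ in $\mathbb{C}$, and for a Borel subset $\mathcal{A}\subset\mathbb{C}$ the cone of $\mathcal{A}$ is $$\mathfrak{C}(\mathcal{A})=\Big\{\begin{pmatrix}z\\ u\end{pmatrix}\in\mathbb{C}\times(\overline{\rm D}(0,1)\smallsetminus\{0\}) : z\in u\mathcal{A}\Big\}\subset\mathbb{C}^2.$$ *)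

theory Defs
  imports "HOL-Probability.Probability"
    "HOL-Computational_Algebra.Computational_Algebra"
begin

section \<open>Imaginary quadratic number fields\<close>

definition imaginary_quadratic_field :: "complex set \<Rightarrow> bool" where
  "imaginary_quadratic_field K \<longleftrightarrow>
     0 \<in> K \<and> 1 \<in> K \<and>
     (\<forall>x\<in>K. \<forall>y\<in>K. x + y \<in> K \<and> x * y \<in> K) \<and> (\<forall>x\<in>K. - x \<in> K \<and> inverse x \<in> K) \<and>
     vector_space.dim (\<lambda>(q::rat) (z::complex). of_rat q * z) K = 2 \<and>
     \<not> K \<subseteq> \<real>"

definition ring_of_integers :: "complex set \<Rightarrow> complex set" where
  "ring_of_integers K = {x \<in> K. algebraic_int x}"

definition unit_group :: "complex set \<Rightarrow> complex set" where
  "unit_group K = {u \<in> ring_of_integers K. \<exists>v \<in> ring_of_integers K. u * v = 1}"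

definition integral_basis :: "complex set \<Rightarrow> complex \<Rightarrow> complex \<Rightarrow> bool" where
  "integral_basis K w1 w2 \<longleftrightarrow>
     bij_betw (\<lambda>(m, n). of_int m * w1 + of_int n * w2) (UNIV :: (int \<times> int) set)
       (ring_of_integers K)"

text \<open>
  The two embeddings of \<open>K\<close> into the complex numbers are the inclusion and complex conjugation,
  so the discriminant is the square of the determinant with rows \<open>(w1, w2)\<close> and
  \<open>(cnj w1, cnj w2)\<close>, for any integral basis \<open>(w1, w2)\<close>.
\<close>

definition discriminant :: "complex set \<Rightarrow> int" where
  "discriminant K =
     (THE D. \<exists>w1 w2. integral_basis K w1 w2 \<and> of_int D = (w1 * cnj w2 - w2 * cnj w1)\<^sup>2)"

definition comaximal :: "complex set \<Rightarrow> complex \<Rightarrow> complex \<Rightarrow> bool" where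
  "comaximal K p q \<longleftrightarrow>
     {p * a + q * b | a b. a \<in> ring_of_integers K \<and> b \<in> ring_of_integers K} = ring_of_integers K"


section \<open>The quotient of the complex plane by the ring of integers\<close>

text \<open>Points of the quotient are the cosets \<open>z + ring_of_integers K\<close>.\<close>

definition proj :: "complex set \<Rightarrow> complex \<Rightarrow> complex set" where
  "proj K z = (\<lambda>x. z + x) ` ring_of_integers K"

definition torus_topology :: "complex set \<Rightarrow> complex set topology" where
  "torus_topology K = topology (\<lambda>U. U \<subseteq> range (proj K) \<and> open (proj K -` U))"

lemma openin_torus_topology:
  "openin (torus_topology K) U \<longleftrightarrow> U \<subseteq> range (proj K) \<and> open (proj K -` U)"
proof -
  have "istopology (\<lambda>U. U \<subseteq> range (proj K) \<and> open (proj K -` U))"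
    unfolding istopology_def vimage_Int vimage_Union by blast
  then show ?thesis
    unfolding torus_topology_def by (simp add: topology_inverse')
qed

lemma topspace_torus_topology: "topspace (torus_topology K) = range (proj K)"
proof
  show "topspace (torus_topology K) \<subseteq> range (proj K)"
    unfolding topspace_def openin_torus_topology by blast
  have "proj K -` range (proj K) = UNIV"
    by blast
  then have "openin (torus_topology K) (range (proj K))"
    unfolding openin_torus_topology by simp
  then show "range (proj K) \<subseteq> topspace (torus_topology K)"
    by (rule openin_subset)
qed

definition torus_borel :: "complex set \<Rightarrow> complex set measure" where
  "torus_borel K = sigma (range (proj K)) {U. openin (torus_topology K) U}"

text \<open>
  The Haar measure induced by Lebesgue measure, as the push-forward of Lebesgue measure on a Borel
  set of representatives; it does not depend on the choice of this set.
\<close>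

definition fundamental_domain :: "complex set \<Rightarrow> complex set" where
  "fundamental_domain K = (SOME F. F \<in> sets borel \<and> bij_betw (proj K) F (range (proj K)))"

definition torus_haar :: "complex set \<Rightarrow> complex set measure" where
  "torus_haar K =
     distr (restrict_space lborel (fundamental_domain K)) (torus_borel K) (proj K)"

text \<open>
  The quotient distance between two cosets is the infimum of the distances between their
  representatives, which is \<^const>\<open>setdist\<close> of the cosets as subsets of the plane.
\<close>

definition torus_dist :: "complex set \<Rightarrow> complex set \<Rightarrow> real" where
  "torus_dist x y = setdist x y"


section \<open>Farey fractions and their gap measures\<close>

definition farey :: "complex set \<Rightarrow> real \<Rightarrow> complex set set" where
  "farey K t = {proj K (p / q) | p q.
     p \<in> ring_of_integers K \<and> q \<in> ring_of_integers K \<and> comaximal K p q \<and>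
     0 < cmod q \<and> cmod q \<le> exp (t / 2)}"

text \<open>
  The normalised sum of Dirac masses is the push-forward of the uniform probability measure on
  \<open>farey K t \<inter> B\<close>. It lives on the half-line \<open>{0..}\<close>, not on the whole real line.
\<close>

definition gap_measure :: "complex set \<Rightarrow> real \<Rightarrow> complex set set \<Rightarrow> real measure" where
  "gap_measure K t B =
     distr (uniform_count_measure (farey K t \<inter> B)) (restrict_space borel {0..})
       (\<lambda>r. exp t * (INF s \<in> farey K t - {r}. torus_dist r s))"

definition narrowly_converges ::
  "('i \<Rightarrow> 'a::topological_space measure) \<Rightarrow> 'a measure \<Rightarrow> 'i filter \<Rightarrow> bool" where
  "narrowly_converges M N F \<longleftrightarrow>
     (\<forall>f :: 'a \<Rightarrow> real. continuous_on (space N) f \<and> bounded (f ` space N) \<longrightarrow>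
        ((\<lambda>i. \<integral>x. f x \<partial>M i) \<longlongrightarrow> (\<integral>x. f x \<partial>N)) F)"


section \<open>Matrices, primitive vectors and cones\<close>

definition h_mat :: "complex \<Rightarrow> complex^2^2" where
  "h_mat z = vector [vector [1, z], vector [0, 1]]"

definition a_mat :: "real \<Rightarrow> complex^2^2" where
  "a_mat t = vector [vector [of_real (exp (- t / 2)), 0], vector [0, of_real (exp (t / 2))]]"

definition primitive_vectors :: "complex set \<Rightarrow> (complex^2) set" where
  "primitive_vectors K = {vector [p, q] | p q.
     p \<in> ring_of_integers K \<and> q \<in> ring_of_integers K \<and> comaximal K p q}"

definition cone_of :: "complex set \<Rightarrow> (complex^2) set" where
  "cone_of A = {vector [z, u] | z u. u \<in> cball 0 1 - {0} \<and> z \<in> (\<lambda>w. u * w) ` A}"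

end

theory Submission
  imports Defs
begin

text \<open>
  Write \<open>Q = exp (t / 2)\<close>, let \<open>r = p / q\<close> be a Farey fraction with comaximal \<open>p\<close>, \<open>q\<close> and \<open>\<bar>q\<bar> \<le> Q\<close>, and let \<open>a\<close> be an inverse of
  \<open>p\<close> modulo \<open>q\<close>. A second fraction \<open>p' / q'\<close> has unique coordinates with
  \<open>q' = k * q + m * a\<close> and \<open>p * q' - q * p' = m\<close>. Put \<open>u = \<bar>q\<bar> / Q\<close> and \<open>x = a / q\<close>. Then \<open>\<bar>q'\<bar> \<le> Q\<close> reads
  \<open>u * \<bar>k + m * x\<bar> \<le> 1\<close>, and \<open>exp t * \<bar>r - p' / q'\<bar> \<le> \<delta>\<close> reads \<open>\<bar>m\<bar> \<le> \<delta> * u\<^sup>2 * \<bar>k + m * x\<bar>\<close>. So the rescaled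
  gap of \<open>r\<close> is at most \<open>\<delta>\<close> if and only if some comaximal pair \<open>(k, m)\<close> with \<open>m \<noteq> 0\<close> satisfies both
  inequalities, a condition on \<open>(u, x)\<close> alone (\<open>gap_val_le_iff\<close>). For \<open>u = exp (- s / 2)\<close> it says that the cone
  of the closed disc of radius \<open>\<delta>\<close> contains a point of the rescaled lattice besides the units, which
  are the pairs with \<open>m = 0\<close> (\<open>cone_card_iff\<close>).

  The theorem thus follows from the joint equidistribution of the triples \<open>(u, p / q, a / q)\<close>: the two
  torus coordinates become uniform and independent of each other and of \<open>u\<close>, and \<open>u = exp (- s / 2)\<close>
  with \<open>s\<close> exponentially distributed with rate 2. There are two inputs.

  \<^item> The torus coordinates. By Weyl's criterion it is enough that Kloosterman sums modulo \<open>q\<close> are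
    \<open>o(\<bar>q\<bar>\<^sup>2)\<close>. Scaling by units turns the fourth power of such a sum into a count of solutions of
    \<open>p1 - p2 = p3 - p4\<close> and the same equation for the inverses (\<open>kloo_fourth_moment\<close>); eliminating \<open>p4\<close> and
    the inverses leaves \<open>(p2 + p3) * (p1 - p2) * (p1 - p3) = 0\<close>, whose solutions are counted through
    annihilators (\<open>card_tris_le\<close>).

  \<^item> The height \<open>u\<close>. The number of \<open>p\<close> modulo \<open>q\<close> comaximal to \<open>q\<close> is \<open>\<bar>q\<bar>\<^sup>2\<close> times a density that a sieve over the rational
    primes approximates uniformly in the mean by periodic functions of \<open>q\<close>; its mean value exists and
    is positive (\<open>unit_density_mean\<close>), and summation by parts gives all moments of \<open>u\<close>
    (\<open>denominator_moments\<close>).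

  Trigonometric polynomials, continuous functions and finally sets with null boundary are treated
  in turn (\<open>continuity_set_limit\<close>). Near a given triple only finitely many pairs \<open>(k, m)\<close> compete,
  and off a null set none of their inequalities is an equality, so the sets in question have null boundary (\<open>near_frontier_null\<close>) and the distribution functions of the gaps converge
  to \<open>limit_cdf\<close>. Since fractions with large gaps are centres of disjoint discs, no mass escapes to
  infinity (\<open>limit_cdf_tail\<close>), and the limit is a probability measure. It is the law of the gap under
  the limiting distribution of the triples. The gap is one of the countably many functions
  \<open>\<bar>m\<bar> / (u\<^sup>2 * \<bar>k + m * x\<bar>)\<close>, each of which is a multiple of \<open>exp s\<close>; hence the law is absolutely continuous.
  As \<open>\<bar>m\<bar> \<ge> 1\<close> and \<open>u * \<bar>k + m * x\<bar> \<le> 1\<close>, the gap is at least \<open>1 / u\<close>, so almost surely larger than 1.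
\<close>

section \<open>Packing in the plane\<close>

lemma content_disc: "0 \<le> r \<Longrightarrow> measure lborel (ball (c::complex) r) = pi * r\<^sup>2"
  using content_ball[of r c] by (simp add: unit_ball_vol_2)

text \<open>The discs of radius \<open>d / 2\<close> around the points are disjoint and lie in a disc of radius \<open>r + d / 2\<close>.\<close>

lemma planar_packing:
  fixes S :: "complex set"
  assumes fin: "finite S" and sub: "\<And>z. z \<in> S \<Longrightarrow> cmod z \<le> r" and "0 < d" "0 \<le> r"
    and sep: "\<And>z z'. z \<in> S \<Longrightarrow> z' \<in> S \<Longrightarrow> z \<noteq> z' \<Longrightarrow> d \<le> cmod (z - z')"
  shows "real (card S) * (d/2)\<^sup>2 \<le> (r + d/2)\<^sup>2"
proof -
  have disj: "disjoint_family_on (\<lambda>z. ball z (d/2)) S"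
    unfolding disjoint_family_on_def
  proof (intro ballI impI)
    fix z z' assume "z \<in> S" "z' \<in> S" "z \<noteq> z'"
    then have "d \<le> dist z z'" using sep by (simp add: dist_norm)
    then have "d/2 + d/2 \<le> dist z z'" by simp
    then show "ball z (d/2) \<inter> ball z' (d/2) = {}"
      by (rule disjoint_ballI)
  qed
  have "real (card S) * (pi * (d/2)\<^sup>2) = (\<Sum>z\<in>S. measure lborel (ball z (d/2)))"
    using assms(3) by (simp add: content_disc)
  also have "\<dots> = measure lborel (\<Union>z\<in>S. ball z (d/2))"
    by (rule measure_finite_Union[symmetric])
      (use fin disj emeasure_lborel_ball_finite in \<open>auto simp: less_top[symmetric]\<close>)
  also have "\<dots> \<le> measure lborel (ball (0::complex) (r + d/2))"
  proof (rule measure_mono_fmeasurable)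
    show "(\<Union>z\<in>S. ball z (d/2)) \<subseteq> ball 0 (r + d/2)"
    proof
      fix y assume "y \<in> (\<Union>z\<in>S. ball z (d/2))"
      then obtain z where z: "z \<in> S" "cmod (z - y) < d/2" by (auto simp: dist_norm)
      have "cmod y \<le> cmod z + cmod (z - y)"
        by (metis norm_minus_commute norm_triangle_sub)
      then show "y \<in> ball 0 (r + d/2)" using z sub[OF z(1)] by simp
    qed
  qed (use fin in \<open>auto simp: fmeasurable_def emeasure_lborel_ball_finite[THEN less_imp_neq, unfolded infinity_ennreal_def] less_top[symmetric]\<close>)
  also have "\<dots> = pi * (r + d/2)\<^sup>2" using assms(3,4) by (simp add: content_disc)
  finally show ?thesis by (simp add: mult.left_commute[of _ pi])
qed

section \<open>Orders in the plane\<close>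

text \<open>The ring of integers through a basis \<open>1, w\<close>.\<close>

locale imaginary_order =
  fixes K :: "complex set" and w :: complex and tr nm :: int
  assumes Im_w: "Im w > 0"
    and w_sq: "w * w = of_int tr * w - of_int nm"
    and ring_eq: "ring_of_integers K = {of_int a + of_int b * w | a b. True}"
begin

abbreviation ring_O :: "complex set" ("\<O>") where "\<O> \<equiv> ring_of_integers K"

lemma O_I [intro]: "of_int a + of_int b * w \<in> \<O>"
  unfolding ring_eq by blast

lemma O_E [elim]:
  assumes "x \<in> \<O>" obtains a b where "x = of_int a + of_int b * w"
  using assms unfolding ring_eq by blast

lemma O_int [simp, intro]: "of_int a \<in> \<O>"
  using O_I[of a 0] by simp

lemma O_nat [simp, intro]: "of_nat a \<in> \<O>"
  using O_int[of "int a"] by simp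

lemma O_0 [simp, intro]: "0 \<in> \<O>" and O_1 [simp, intro]: "1 \<in> \<O>"
  using O_int[of 0] O_int[of 1] by simp_all

lemma O_numeral [simp, intro]: "numeral n \<in> \<O>"
  using O_int[of "numeral n"] by simp

lemma O_w [simp, intro]: "w \<in> \<O>"
  using O_I[of 0 1] by simp

lemma O_add [intro]: "x \<in> \<O> \<Longrightarrow> y \<in> \<O> \<Longrightarrow> x + y \<in> \<O>"
proof -
  assume "x \<in> \<O>" "y \<in> \<O>"
  then obtain a b c d where "x = of_int a + of_int b * w" "y = of_int c + of_int d * w" by (auto elim!: O_E)
  then have "x + y = of_int (a + c) + of_int (b + d) * w" by (simp add: algebra_simps)
  then show ?thesis by (simp only: O_I)
qed

lemma O_minus [intro]: "x \<in> \<O> \<Longrightarrow> - x \<in> \<O>"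
proof -
  assume "x \<in> \<O>"
  then obtain a b where "x = of_int a + of_int b * w" by (auto elim!: O_E)
  then have "- x = of_int (- a) + of_int (- b) * w" by (simp add: algebra_simps)
  then show ?thesis by (simp only: O_I)
qed

lemma O_diff [intro]: "x \<in> \<O> \<Longrightarrow> y \<in> \<O> \<Longrightarrow> x - y \<in> \<O>"
  using O_add[of x "- y"] O_minus[of y] by simp

lemma O_mult [intro]: "x \<in> \<O> \<Longrightarrow> y \<in> \<O> \<Longrightarrow> x * y \<in> \<O>"
proof -
  assume "x \<in> \<O>" "y \<in> \<O>"
  then obtain a b c d where xy: "x = of_int a + of_int b * w" "y = of_int c + of_int d * w" by (auto elim!: O_E)
  have "x * y = of_int a * of_int c + (of_int a * of_int d + of_int b * of_int c) * w
      + of_int b * of_int d * (w * w)"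
    unfolding xy by (simp add: algebra_simps)
  also have "\<dots> = of_int (a * c - b * d * nm) + of_int (a * d + b * c + b * d * tr) * w"
    unfolding w_sq by (simp add: algebra_simps)
  finally show ?thesis by (simp only: O_I)
qed

lemma Re_w: "2 * Re w = of_int tr"
proof -
  have "Im (w * w) = Im (of_int tr * w - of_int nm)" using w_sq by simp
  then have "2 * Re w * Im w = of_int tr * Im w" by simp
  then show ?thesis using Im_w by simp
qed

lemma cnj_w: "cnj w = of_int tr - w"
  using Re_w by (simp add: complex_eq_iff)

lemma O_cnj [intro]: "x \<in> \<O> \<Longrightarrow> cnj x \<in> \<O>"
  by (elim O_E) (auto simp: cnj_w)

text \<open>The coordinates of a complex number with respect to the basis \<open>(1, w)\<close>.\<close>

definition co2 :: "complex \<Rightarrow> real" where "co2 z = Im z / Im w"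
definition co1 :: "complex \<Rightarrow> real" where "co1 z = Re z - co2 z * Re w"

lemma co_eq: "z = of_real (co1 z) + of_real (co2 z) * w"
  using Im_w by (simp add: complex_eq_iff co1_def co2_def)

lemma co_unique: "co1 (of_real a + of_real b * w) = a" "co2 (of_real a + of_real b * w) = b"
  using Im_w by (simp_all add: co1_def co2_def)

lemma co_of_int [simp]: "co1 (of_int a + of_int b * w) = of_int a" "co2 (of_int a + of_int b * w) = of_int b"
  using co_unique[of "of_int a" "of_int b"] by simp_all

lemma co_add: "co1 (x + y) = co1 x + co1 y" "co2 (x + y) = co2 x + co2 y"
  using Im_w by (simp_all add: co1_def co2_def field_simps)

lemma co_diff: "co1 (x - y) = co1 x - co1 y" "co2 (x - y) = co2 x - co2 y"
  using Im_w by (simp_all add: co1_def co2_def field_simps)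

lemma O_iff: "z \<in> \<O> \<longleftrightarrow> co1 z \<in> \<int> \<and> co2 z \<in> \<int>"
proof
  assume "z \<in> \<O>" then show "co1 z \<in> \<int> \<and> co2 z \<in> \<int>" by (elim O_E) simp
next
  assume "co1 z \<in> \<int> \<and> co2 z \<in> \<int>"
  then obtain a b where "co1 z = of_int a" "co2 z = of_int b" by (auto elim!: Ints_cases)
  then have "z = of_int a + of_int b * w" using co_eq[of z] by simp
  then show "z \<in> \<O>" by (simp only: O_I)
qed

lemma O_real_int: "of_real r \<in> \<O> \<Longrightarrow> r \<in> \<int>"
  using O_iff[of "of_real r"] by (simp add: co1_def co2_def)

lemma O_norm_int: "x \<in> \<O> \<Longrightarrow> \<exists>n::nat. (cmod x)\<^sup>2 = real n \<and> x * cnj x = of_nat n"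
proof -
  assume "x \<in> \<O>"
  then have "x * cnj x \<in> \<O>" by (simp add: O_cnj O_mult)
  then have "of_real ((cmod x)\<^sup>2) \<in> \<O>" by (simp only: complex_norm_square)
  then have "(cmod x)\<^sup>2 \<in> (\<int> :: real set)" by (rule O_real_int)
  then obtain m :: int where "(cmod x)\<^sup>2 = of_int m" by (auto elim: Ints_cases)
  moreover from this have "0 \<le> m" by (metis of_int_0_le_iff zero_le_power2)
  ultimately have *: "(cmod x)\<^sup>2 = real (nat m)" by simp
  moreover have "x * cnj x = of_nat (nat m)"
    using arg_cong[OF *, of complex_of_real] unfolding complex_norm_square by simp
  ultimately show ?thesis by blast
qed

lemma O_norm_ge1: "x \<in> \<O> \<Longrightarrow> x \<noteq> 0 \<Longrightarrow> 1 \<le> cmod x"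
proof -
  assume x: "x \<in> \<O>" "x \<noteq> 0"
  then obtain n::nat where n: "(cmod x)\<^sup>2 = real n" using O_norm_int by blast
  with x have "n > 0" by (cases n) auto
  then have "1 \<le> (cmod x)\<^sup>2" using n by simp
  then show ?thesis by (simp add: power2_nonneg_ge_1_iff)
qed

lemma O_ball_count:
  assumes "finite S" "S \<subseteq> \<O>" "\<And>x. x \<in> S \<Longrightarrow> cmod x \<le> r" "0 \<le> r"
  shows "real (card S) \<le> (2 * r + 1)\<^sup>2"
proof -
  have "real (card S) * (1/2)\<^sup>2 \<le> (r + 1/2)\<^sup>2"
      proof (rule planar_packing)
    fix z z' assume "z \<in> S" "z' \<in> S" "z \<noteq> z'"
    then show "1 \<le> cmod (z - z')" using assms(2) by (intro O_norm_ge1) auto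
  qed (use assms in auto)
  then show ?thesis by (simp add: power2_eq_square algebra_simps)
qed

lemma finite_of_bounded_card:
  fixes n :: nat
  assumes "\<And>T. T \<subseteq> A \<Longrightarrow> finite T \<Longrightarrow> card T \<le> n"
  shows "finite A"
proof (rule ccontr)
  assume "infinite A"
  then obtain T where "T \<subseteq> A" "finite T" "card T = Suc n"
    using infinite_arbitrarily_large by blast
  then show False using assms[of T] by simp
qed

lemma O_ball_finite: "finite {x \<in> \<O>. cmod x \<le> r}"
proof (cases "0 \<le> r")
  case True
  show ?thesis
  proof (rule finite_of_bounded_card)
    fix T assume "T \<subseteq> {x \<in> \<O>. cmod x \<le> r}" "finite T"
    then have "real (card T) \<le> (2 * r + 1)\<^sup>2" using True by (intro O_ball_count) auto
    then show "card T \<le> nat \<lceil>(2 * r + 1)\<^sup>2\<rceil>" by linarith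
  qed
next
  case False
  then have "{x \<in> \<O>. cmod x \<le> r} = {}" by (auto simp: not_le intro: less_le_trans[OF _ norm_ge_zero])
  then show ?thesis by (simp only: finite.emptyI)
qed

lemma O_finite_subset: "A \<subseteq> \<O> \<Longrightarrow> (\<And>x. x \<in> A \<Longrightarrow> cmod x \<le> r) \<Longrightarrow> finite A"
  by (rule finite_subset[OF _ O_ball_finite[of r]]) auto

text \<open>The fundamental parallelogram and the lattice point below a complex number.\<close>

definition para :: "complex set" where
  "para = {z. 0 \<le> co1 z \<and> co1 z < 1 \<and> 0 \<le> co2 z \<and> co2 z < 1}"

definition fl :: "complex \<Rightarrow> complex" where
  "fl z = of_int \<lfloor>co1 z\<rfloor> + of_int \<lfloor>co2 z\<rfloor> * w"

lemma fl_O [simp, intro]: "fl z \<in> \<O>" unfolding fl_def ..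

lemma co_fl: "co1 (fl z) = of_int \<lfloor>co1 z\<rfloor>" "co2 (fl z) = of_int \<lfloor>co2 z\<rfloor>"
  unfolding fl_def by simp_all

lemma diff_fl_para: "z - fl z \<in> para"
  unfolding para_def by (simp add: co_diff co_fl) linarith

lemma para_unique: "x \<in> para \<Longrightarrow> y \<in> para \<Longrightarrow> x - y \<in> \<O> \<Longrightarrow> x = y"
proof -
  assume x: "x \<in> para" and y: "y \<in> para" and "x - y \<in> \<O>"
  then obtain a b where ab: "co1 x - co1 y = of_int a" "co2 x - co2 y = of_int b"
    unfolding O_iff co_diff by (auto elim!: Ints_cases)
  have "a = 0" "b = 0" using x y ab unfolding para_def by auto
  then show "x = y" using ab co_eq[of x] co_eq[of y] by simp
qed

lemma para_bound: "z \<in> para \<Longrightarrow> cmod z \<le> 1 + cmod w"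
proof -
  assume z: "z \<in> para"
  have "cmod z \<le> cmod (of_real (co1 z)) + cmod (of_real (co2 z) * w)"
    using norm_triangle_ineq[of "of_real (co1 z)" "of_real (co2 z) * w"] co_eq[of z] by simp
  also have "\<dots> \<le> 1 + cmod w" using z unfolding para_def
    by (intro add_mono) (auto simp: norm_mult mult_left_le_one_le)
  finally show ?thesis .
qed

section \<open>Residue systems\<close>

text \<open>Congruence modulo the principal ideal of \<open>q\<close>, and the residues in the parallelogram spanned by \<open>q\<close> and \<open>q * w\<close>.\<close>

definition cg :: "complex \<Rightarrow> complex \<Rightarrow> complex \<Rightarrow> bool" where
  "cg q x y \<longleftrightarrow> (\<exists>k\<in>\<O>. x - y = q * k)"

lemma cg_refl [simp]: "cg q x x" unfolding cg_def by (auto intro: bexI[of _ 0])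
lemma cg_sym: "cg q x y \<Longrightarrow> cg q y x" unfolding cg_def
  by (metis O_minus minus_diff_eq mult_minus_right)
lemma cg_trans [trans]: "cg q x y \<Longrightarrow> cg q y z \<Longrightarrow> cg q x z" unfolding cg_def
proof -
  assume "\<exists>k\<in>\<O>. x - y = q * k" "\<exists>k\<in>\<O>. y - z = q * k"
  then obtain k l where "k \<in> \<O>" "l \<in> \<O>" "x - y = q * k" "y - z = q * l" by blast
  then have "x - z = q * (k + l)" "k + l \<in> \<O>" by (auto simp: algebra_simps)
  then show "\<exists>k\<in>\<O>. x - z = q * k" by blast
qed
lemma cg_add: "cg q x y \<Longrightarrow> cg q x' y' \<Longrightarrow> cg q (x + x') (y + y')" unfolding cg_def
proof -
  assume "\<exists>k\<in>\<O>. x - y = q * k" "\<exists>k\<in>\<O>. x' - y' = q * k"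
  then obtain k l where "k \<in> \<O>" "l \<in> \<O>" "x - y = q * k" "x' - y' = q * l" by blast
  then have "x + x' - (y + y') = q * (k + l)" "k + l \<in> \<O>" by (auto simp: algebra_simps)
  then show "\<exists>k\<in>\<O>. x + x' - (y + y') = q * k" by blast
qed
lemma cg_mult_left: "cg q x y \<Longrightarrow> a \<in> \<O> \<Longrightarrow> cg q (a * x) (a * y)" unfolding cg_def
proof -
  assume "\<exists>k\<in>\<O>. x - y = q * k" "a \<in> \<O>"
  then obtain k where "k \<in> \<O>" "x - y = q * k" by blast
  then have "a * x - a * y = q * (a * k)" "a * k \<in> \<O>" using \<open>a \<in> \<O>\<close> by (auto simp: algebra_simps)
  then show "\<exists>k\<in>\<O>. a * x - a * y = q * k" by blast
qed
lemma cg_mult_right: "cg q x y \<Longrightarrow> a \<in> \<O> \<Longrightarrow> cg q (x * a) (y * a)"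
  using cg_mult_left[of q x y a] by (simp add: mult.commute)
lemma cg_minus: "cg q x y \<Longrightarrow> cg q (- x) (- y)"
  using cg_mult_left[of q x y "-1"] by (simp add: O_minus)
lemma cg_diff: "cg q x y \<Longrightarrow> cg q x' y' \<Longrightarrow> cg q (x - x') (y - y')"
  using cg_add[of q x y "- x'" "- y'"] cg_minus[of q x' y'] by simp
lemma cg_mult: "cg q x y \<Longrightarrow> cg q x' y' \<Longrightarrow> x' \<in> \<O> \<Longrightarrow> y \<in> \<O> \<Longrightarrow> cg q (x * x') (y * y')"
  by (rule cg_trans[of _ _ "y * x'"]) (auto intro: cg_mult_left cg_mult_right)
lemma cg_cancel: "cg q (a * x) (a * y) \<Longrightarrow> b \<in> \<O> \<Longrightarrow> cg q (b * a) 1 \<Longrightarrow> x \<in> \<O> \<Longrightarrow> y \<in> \<O> \<Longrightarrow> cg q x y"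
proof -
  assume 1: "cg q (a * x) (a * y)" "b \<in> \<O>" "cg q (b * a) 1" "x \<in> \<O>" "y \<in> \<O>"
  have "cg q (1 * x) (b * a * x)" "cg q (b * a * y) (1 * y)"
    using 1 cg_mult_right cg_sym by blast+
  moreover have "cg q (b * a * x) (b * a * y)" using cg_mult_left[OF 1(1,2)] by (simp add: mult.assoc)
  ultimately show ?thesis using cg_trans by (metis mult_1)
qed
lemma cg_0_iff: "cg q x y \<longleftrightarrow> cg q (x - y) 0" unfolding cg_def by simp
lemma cg_dvd: "cg (q * m) x y \<Longrightarrow> m \<in> \<O> \<Longrightarrow> cg q x y"
  unfolding cg_def by (metis O_mult mult.assoc)
definition res :: "complex \<Rightarrow> complex set" where
  "res q = {z \<in> \<O>. z / q \<in> para}"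

definition redu :: "complex \<Rightarrow> complex \<Rightarrow> complex" where
  "redu q z = z - q * fl (z / q)"

definition N :: "complex \<Rightarrow> nat" where "N q = card (res q)"

lemma res_O: "z \<in> res q \<Longrightarrow> z \<in> \<O>" unfolding res_def by blast

lemma finite_res [simp]: "q \<noteq> 0 \<Longrightarrow> finite (res q)"
proof (rule O_finite_subset)
  show "res q \<subseteq> \<O>" by (auto simp: res_def)
  fix z assume "q \<noteq> 0" "z \<in> res q"
  then have "cmod (z / q) \<le> 1 + cmod w" using para_bound by (auto simp: res_def)
  then show "cmod z \<le> (1 + cmod w) * cmod q" using \<open>q \<noteq> 0\<close> by (simp add: norm_divide field_simps)
qed

lemma redu_res: "q \<in> \<O> \<Longrightarrow> q \<noteq> 0 \<Longrightarrow> z \<in> \<O> \<Longrightarrow> redu q z \<in> res q"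
  using diff_fl_para[of "z/q"] unfolding res_def redu_def
  by (auto simp: diff_divide_distrib)

lemma redu_cg: "cg q (redu q z) z" "cg q z (redu q z)"
proof -
  show "cg q (redu q z) z" unfolding cg_def redu_def by (auto intro!: bexI[of _ "- fl (z/q)"])
  then show "cg q z (redu q z)" by (rule cg_sym)
qed

lemma res_unique: "q \<noteq> 0 \<Longrightarrow> x \<in> res q \<Longrightarrow> y \<in> res q \<Longrightarrow> cg q x y \<Longrightarrow> x = y"
proof -
  assume q: "q \<noteq> 0" "x \<in> res q" "y \<in> res q" "cg q x y"
  then obtain k where "k \<in> \<O>" "x - y = q * k" unfolding cg_def by blast
  then have "x / q - y / q \<in> \<O>" using q(1) by (simp add: diff_divide_distrib[symmetric])
  then have "x / q = y / q" using q para_unique unfolding res_def by blast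
  then show ?thesis using q(1) by simp
qed

text \<open>Reduction makes \<open>h\<close> an injective self-map of the finite set of residues.\<close>

lemma res_bij:
  assumes q: "q \<in> \<O>" "q \<noteq> 0" and h: "\<And>x. x \<in> \<O> \<Longrightarrow> h x \<in> \<O>"
    and inj: "\<And>x y. x \<in> \<O> \<Longrightarrow> y \<in> \<O> \<Longrightarrow> cg q (h x) (h y) \<Longrightarrow> cg q x y"
  shows "bij_betw (\<lambda>x. redu q (h x)) (res q) (res q)"
proof -
  have i: "inj_on (\<lambda>x. redu q (h x)) (res q)"
  proof (rule inj_onI)
    fix x y assume xy: "x \<in> res q" "y \<in> res q" "redu q (h x) = redu q (h y)"
    have "cg q (h x) (redu q (h x))" by (rule redu_cg)
    moreover have "cg q (redu q (h x)) (h y)" unfolding xy(3) by (rule redu_cg)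
    ultimately have "cg q (h x) (h y)" by (rule cg_trans)
    then have "cg q x y" by (rule inj[OF res_O res_O, OF xy(1,2)])
    then show "x = y" by (rule res_unique[OF q(2) xy(1,2)])
  qed
  have "(\<lambda>x. redu q (h x)) ` res q \<subseteq> res q" using redu_res q h res_O by blast
  then show ?thesis using i endo_inj_surj[of "res q"] q by (simp add: bij_betw_def)
qed

definition periodic :: "complex \<Rightarrow> (complex \<Rightarrow> 'b) \<Rightarrow> bool" where
  "periodic q g \<longleftrightarrow> (\<forall>x\<in>\<O>. \<forall>y\<in>\<O>. cg q x y \<longrightarrow> g x = g y)"

lemma periodicD: "periodic q g \<Longrightarrow> cg q x y \<Longrightarrow> x \<in> \<O> \<Longrightarrow> y \<in> \<O> \<Longrightarrow> g x = g y"
  unfolding periodic_def by blast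

lemma res_sum_reindex:
  fixes g :: "complex \<Rightarrow> 'b::comm_monoid_add"
  assumes q: "q \<in> \<O>" "q \<noteq> 0" and g: "periodic q g" and h: "\<And>x. x \<in> \<O> \<Longrightarrow> h x \<in> \<O>"
    and inj: "\<And>x y. x \<in> \<O> \<Longrightarrow> y \<in> \<O> \<Longrightarrow> cg q (h x) (h y) \<Longrightarrow> cg q x y"
  shows "(\<Sum>x\<in>res q. g (h x)) = (\<Sum>x\<in>res q. g x)"
proof -
  have "(\<Sum>x\<in>res q. g x) = (\<Sum>x\<in>res q. g (redu q (h x)))"
    by (rule sum.reindex_bij_betw[OF res_bij[OF q h inj], symmetric])
  also have "\<dots> = (\<Sum>x\<in>res q. g (h x))"
  proof (rule sum.cong[OF refl])
    fix x assume "x \<in> res q"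
    then have "h x \<in> \<O>" using h res_O by blast
    then show "g (redu q (h x)) = g (h x)"
      using periodicD[OF g redu_cg(1)] redu_res[OF q] res_O by blast
  qed
  finally show ?thesis by simp
qed

lemma res_sum_shift:
  fixes g :: "complex \<Rightarrow> 'b::comm_monoid_add"
  assumes q: "q \<in> \<O>" "q \<noteq> 0" and g: "periodic q g" and a: "a \<in> \<O>"
  shows "(\<Sum>x\<in>res q. g (x + a)) = (\<Sum>x\<in>res q. g x)"
proof (rule res_sum_reindex[OF q g])
  fix x y assume "cg q (x + a) (y + a)"
  from cg_diff[OF this cg_refl[of q a]] show "cg q x y" by simp
qed (use a in auto)

text \<open>Reduction modulo \<open>q\<close> maps \<open>S\<close> bijectively to the standard system.\<close>

lemma card_complete_system:
  assumes q: "q \<in> \<O>" "q \<noteq> 0" and S: "S \<subseteq> \<O>"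
    and inc: "\<And>x y. x \<in> S \<Longrightarrow> y \<in> S \<Longrightarrow> cg q x y \<Longrightarrow> x = y"
    and cov: "\<And>x. x \<in> \<O> \<Longrightarrow> \<exists>y\<in>S. cg q x y"
  shows "card S = N q"
  unfolding N_def
proof (rule bij_betw_same_card[of "redu q"])
  show "bij_betw (redu q) S (res q)"
    unfolding bij_betw_def
  proof
    show "inj_on (redu q) S"
    proof (rule inj_onI)
      fix x y assume "x \<in> S" "y \<in> S" and e: "redu q x = redu q y"
      have "cg q x (redu q x)" by (rule redu_cg)
      moreover have "cg q (redu q x) y" unfolding e by (rule redu_cg)
      ultimately have "cg q x y" by (rule cg_trans)
      then show "x = y" using \<open>x \<in> S\<close> \<open>y \<in> S\<close> inc by blast
    qed
    show "redu q ` S = res q"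
    proof
      show "redu q ` S \<subseteq> res q" using redu_res q S by blast
      show "res q \<subseteq> redu q ` S"
      proof
        fix x assume x: "x \<in> res q"
        then obtain y where y: "y \<in> S" "cg q x y" using cov res_O by blast
        then have "cg q x (redu q y)" using redu_cg(2) by (rule_tac cg_trans)
        moreover have "redu q y \<in> res q" using redu_res[OF q] y(1) S by blast
        ultimately have "x = redu q y" using res_unique[OF q(2) x] by blast
        then show "x \<in> redu q ` S" using y by blast
      qed
    qed
  qed
qed

text \<open>The residues modulo \<open>q * m\<close> are \<open>x + q * y\<close> with \<open>x\<close> modulo \<open>q\<close> and \<open>y\<close> modulo \<open>m\<close>.\<close>

lemma card_res_mult:
  assumes q: "q \<in> \<O>" "q \<noteq> 0" and m: "m \<in> \<O>" "m \<noteq> 0" and P: "periodic q P"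
  shows "card {x \<in> res (q * m). P x} = card {x \<in> res q. P x} * N m"
proof -
  have qm: "q * m \<in> \<O>" "q * m \<noteq> 0" using q m by auto
  let ?f = "\<lambda>(x, y). redu (q * m) (x + q * y)"
  have "bij_betw ?f ({x \<in> res q. P x} \<times> res m) {x \<in> res (q * m). P x}"
    unfolding bij_betw_def
  proof
    show "inj_on ?f ({x \<in> res q. P x} \<times> res m)"
    proof (rule inj_onI, clarify)
      fix x y x' y' assume *: "x \<in> res q" "y \<in> res m" "x' \<in> res q" "y' \<in> res m"
        "redu (q * m) (x + q * y) = redu (q * m) (x' + q * y')"
      have "cg (q * m) (x + q * y) (redu (q * m) (x + q * y))" by (rule redu_cg)
      moreover have "cg (q * m) (redu (q * m) (x + q * y)) (x' + q * y')" unfolding *(5) by (rule redu_cg)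
      ultimately
      have c: "cg (q * m) (x + q * y) (x' + q * y')" by (rule cg_trans)
      then have "cg q (x + q * y) (x' + q * y')" using cg_dvd m by blast
      moreover have "cg q x (x + q * y)" "cg q (x' + q * y') x'"
        unfolding cg_def by (rule bexI[of _ "- y"]; use *(2,4) res_O in auto)
          (rule bexI[of _ "y'"]; use *(2,4) res_O in auto)
      ultimately have "cg q x x'" by (meson cg_trans)
      then have "x = x'" using res_unique[OF q(2) *(1,3)] by blast
      with c obtain k where "k \<in> \<O>" "q * y - q * y' = q * m * k" unfolding cg_def by auto
      then have "y - y' = m * k" using q(2) by (metis mult.assoc mult_cancel_left right_diff_distrib)
      then have "y = y'" using res_unique[OF m(2) *(2,4)] \<open>k \<in> \<O>\<close> unfolding cg_def by blast
      then show "x = x' \<and> y = y'" using \<open>x = x'\<close> by simp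
    qed
    show "?f ` ({x \<in> res q. P x} \<times> res m) = {x \<in> res (q * m). P x}"
    proof (intro equalityI subsetI)
      fix z assume "z \<in> ?f ` ({x \<in> res q. P x} \<times> res m)"
      then obtain x y where xy: "x \<in> res q" "P x" "y \<in> res m" "z = redu (q * m) (x + q * y)" by auto
      then have O: "x \<in> \<O>" "y \<in> \<O>" "x + q * y \<in> \<O>" using res_O q by blast+
      then have z: "z \<in> res (q * m)" using redu_res qm xy by auto
      have "cg q z (x + q * y)" using redu_cg(1)[of "q * m" "x + q * y"] xy(4) cg_dvd m by blast
      moreover have "cg q (x + q * y) x" unfolding cg_def using O by auto
      ultimately have "cg q z x" by (rule cg_trans)
      then have "P z" using periodicD[OF P] xy(2) O z res_O by blast
      then show "z \<in> {x \<in> res (q * m). P x}" using z by blast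
    next
      fix z assume "z \<in> {x \<in> res (q * m). P x}"
      then have z: "z \<in> res (q * m)" "P z" "z \<in> \<O>" using res_O by auto
      let ?x = "redu q z"
      have x: "?x \<in> res q" "P ?x" using redu_res q z periodicD[OF P redu_cg(2)] res_O by blast+
      obtain k where k: "k \<in> \<O>" "z - ?x = q * k" using redu_cg(2) unfolding cg_def by blast
      let ?y = "redu m k"
      have y: "?y \<in> res m" using redu_res m k by blast
      obtain l where "l \<in> \<O>" "k - ?y = m * l" using redu_cg(2) unfolding cg_def by blast
      then have "z - (?x + q * ?y) = q * m * l" using k by (metis diff_diff_eq mult.assoc right_diff_distrib)
      then have "cg (q * m) z (?x + q * ?y)" unfolding cg_def using \<open>l \<in> \<O>\<close> by blast
      then have "cg (q * m) z (redu (q * m) (?x + q * ?y))" using redu_cg(2) by (rule cg_trans)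
      moreover have "redu (q * m) (?x + q * ?y) \<in> res (q * m)"
        by (intro redu_res[OF qm] O_add O_mult q(1) res_O[OF x(1)] res_O[OF y])
      ultimately have "z = redu (q * m) (?x + q * ?y)" using res_unique[OF qm(2) z(1)] by blast
      then have "z = ?f (?x, ?y)" by simp
      then show "z \<in> ?f ` ({x \<in> res q. P x} \<times> res m)" by (rule image_eqI) (use x y in simp)
    qed
  qed
  then have "card {x \<in> res (q * m). P x} = card ({x \<in> res q. P x} \<times> res m)"
    by (rule bij_betw_same_card[symmetric])
  then show ?thesis by (simp add: card_cartesian_product N_def)
qed

lemma N_mult: "q \<in> \<O> \<Longrightarrow> q \<noteq> 0 \<Longrightarrow> m \<in> \<O> \<Longrightarrow> m \<noteq> 0 \<Longrightarrow> N (q * m) = N q * N m"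
  using card_res_mult[of q m "\<lambda>_. True"] by (simp add: N_def periodic_def)

text \<open>The coordinates are reduced separately.\<close>

lemma N_of_nat: "0 < n \<Longrightarrow> N (of_nat n) = n\<^sup>2"
proof -
  assume n: "0 < n"
  let ?f = "\<lambda>(a::int, b::int). of_int a + of_int b * w"
  have inj: "inj_on ?f ({0..<int n} \<times> {0..<int n})"
    by (rule inj_onI, clarify) (metis co_of_int of_int_eq_iff)
  have "card (?f ` ({0..<int n} \<times> {0..<int n})) = N (of_nat n)"
  proof (rule card_complete_system)
    fix x y assume "x \<in> ?f ` ({0..<int n} \<times> {0..<int n})" "y \<in> ?f ` ({0..<int n} \<times> {0..<int n})" "cg (of_nat n) x y"
    then obtain a b c d e f where *: "x = of_int a + of_int b * w" "y = of_int c + of_int d * w"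
      "x - y = of_nat n * (of_int e + of_int f * w)" "{a,b,c,d} \<subseteq> {0..<int n}"
      unfolding cg_def by (auto elim!: O_E)
    have e1: "of_int (a - c) + of_int (b - d) * w = of_int (int n * e) + of_int (int n * f) * w"
      using *(3) unfolding *(1,2) by (simp add: algebra_simps)
    have "a - c = int n * e" using arg_cong[OF e1, of co1] unfolding co_of_int by linarith
    moreover have "b - d = int n * f" using arg_cong[OF e1, of co2] unfolding co_of_int by linarith
    ultimately have "a mod int n = c mod int n" "b mod int n = d mod int n"
      by (simp_all add: mod_eq_dvd_iff)
    then show "x = y" using * by auto
  next
    fix x assume "x \<in> \<O>"
    then obtain a b where x: "x = of_int a + of_int b * w" by (auto elim!: O_E)
    have d: "of_int i = (of_int (i mod int n) + of_nat n * of_int (i div int n) :: complex)" for i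
    proof -
      have "of_int i = (of_int (i mod int n + int n * (i div int n)) :: complex)" by simp
      also have "\<dots> = of_int (i mod int n) + of_nat n * of_int (i div int n)"
        by (simp only: of_int_add of_int_mult of_int_of_nat_eq)
      finally show ?thesis .
    qed
    have "cg (of_nat n) x (of_int (a mod int n) + of_int (b mod int n) * w)"
      unfolding cg_def x
      by (rule bexI[of _ "of_int (a div int n) + of_int (b div int n) * w"])
        (use d[of a] d[of b] in \<open>auto simp: algebra_simps\<close>)
    then show "\<exists>y\<in>?f ` ({0..<int n} \<times> {0..<int n}). cg (of_nat n) x y" using n
      by (intro bexI[of _ "?f (a mod int n, b mod int n)"]) auto
  qed (use n in auto)
  then show ?thesis using inj by (simp add: card_image card_cartesian_product power2_eq_square)
qed

text \<open>Both \<open>q\<close> and its conjugate have \<open>N q\<close> residues, and their product is an integer.\<close>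

lemma N_cnj:
  assumes q: "q \<in> \<O>" "q \<noteq> 0"
  shows "N (cnj q) = N q"
proof -
  have "card (cnj ` res q) = N (cnj q)"
  proof (rule card_complete_system)
    fix x y assume "x \<in> cnj ` res q" "y \<in> cnj ` res q" "cg (cnj q) x y"
    then obtain x' y' k where *: "x = cnj x'" "y = cnj y'" "x' \<in> res q" "y' \<in> res q" "k \<in> \<O>" "x - y = cnj q * k"
      unfolding cg_def by auto
    then have "cnj (x' - y') = cnj (q * cnj k)" by simp
    then have "x' - y' = q * cnj k" by (simp only: complex_cnj_cancel_iff)
    then have "x' = y'" using res_unique[OF q(2)] * O_cnj unfolding cg_def by blast
    then show "x = y" using * by simp
  next
    fix x assume "x \<in> \<O>"
    then have "cnj x \<in> \<O>" ..
    moreover obtain k where "k \<in> \<O>" "cnj x - redu q (cnj x) = q * k" using redu_cg(2) unfolding cg_def by blast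
    ultimately have "x - cnj (redu q (cnj x)) = cnj q * cnj k"
      by (metis complex_cnj_cnj complex_cnj_diff complex_cnj_mult)
    then show "\<exists>y\<in>cnj ` res q. cg (cnj q) x y"
      using redu_res[OF q \<open>cnj x \<in> \<O>\<close>] \<open>k \<in> \<O>\<close> O_cnj unfolding cg_def by blast
  qed (use q res_O in auto)
  moreover have "inj_on cnj (res q)" by (simp add: inj_on_def)
  ultimately show ?thesis by (simp add: card_image N_def)
qed

lemma N_eq: "q \<in> \<O> \<Longrightarrow> q \<noteq> 0 \<Longrightarrow> real (N q) = (cmod q)\<^sup>2"
proof -
  assume q: "q \<in> \<O>" "q \<noteq> 0"
  obtain n :: nat where n: "(cmod q)\<^sup>2 = of_nat n" "q * cnj q = of_nat n" using O_norm_int q by blast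
  with q have "n > 0" by (cases n) auto
  have "N q * N q = n\<^sup>2"
    using N_mult[OF q O_cnj[OF q(1)]] N_cnj[OF q] N_of_nat[OF \<open>n > 0\<close>] q n by simp
  then have "N q = n" by (metis power2_eq_square power2_eq_iff_nonneg zero_le)
  then show ?thesis using n by simp
qed

lemma N_pos: "q \<in> \<O> \<Longrightarrow> q \<noteq> 0 \<Longrightarrow> 0 < N q"
  using N_eq[of q] by (metis of_nat_0_less_iff zero_less_norm_iff zero_less_power)

text \<open>Both densities are equal to the density modulo \<open>q * m\<close>.\<close>

lemma density_eq:
  assumes "q \<in> \<O>" "q \<noteq> 0" "m \<in> \<O>" "m \<noteq> 0" "periodic q P" "periodic m P"
  shows "real (card {x \<in> res q. P x}) / N q = real (card {x \<in> res m. P x}) / N m"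
proof -
  have "card {x \<in> res q. P x} * N m = card {x \<in> res m. P x} * N q"
    using card_res_mult[of q m P] card_res_mult[of m q P] assms by (simp add: mult.commute)
  then have "real (card {x \<in> res q. P x}) * N m = real (card {x \<in> res m. P x}) * N q"
    by (metis of_nat_mult)
  moreover have "0 < N q" "0 < N m" using N_pos assms by auto
  ultimately show ?thesis by (simp add: field_simps)
qed

end

section \<open>Kloosterman sums\<close>

context imaginary_order
begin

lemma comaximal_iff:
  assumes "p \<in> \<O>" "q \<in> \<O>"
  shows "comaximal K p q \<longleftrightarrow> (\<exists>a\<in>\<O>. \<exists>b\<in>\<O>. p * a + q * b = 1)"
proof
  assume "comaximal K p q"
  then have "1 \<in> {p * a + q * b | a b. a \<in> \<O> \<and> b \<in> \<O>}" unfolding comaximal_def by simp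
  then show "\<exists>a\<in>\<O>. \<exists>b\<in>\<O>. p * a + q * b = 1" by fastforce
next
  assume "\<exists>a\<in>\<O>. \<exists>b\<in>\<O>. p * a + q * b = 1"
  then obtain a b where ab: "a \<in> \<O>" "b \<in> \<O>" "p * a + q * b = 1" by blast
  show "comaximal K p q" unfolding comaximal_def
  proof
    show "{p * a + q * b | a b. a \<in> \<O> \<and> b \<in> \<O>} \<subseteq> \<O>" using assms by auto
    show "\<O> \<subseteq> {p * a + q * b | a b. a \<in> \<O> \<and> b \<in> \<O>}"
    proof
      fix x assume x: "x \<in> \<O>"
      have "x = (p * a + q * b) * x" using ab by simp
      then have "x = p * (a * x) + q * (b * x)" by (simp add: algebra_simps)
      moreover have "a * x \<in> \<O>" "b * x \<in> \<O>" using ab x by auto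
      ultimately show "x \<in> {p * a + q * b | a b. a \<in> \<O> \<and> b \<in> \<O>}" by blast
    qed
  qed
qed

lemma comaximal_cg:
  assumes "p \<in> \<O>" "q \<in> \<O>"
  shows "comaximal K p q \<longleftrightarrow> (\<exists>a\<in>\<O>. cg q (p * a) 1)"
proof
  assume "comaximal K p q"
  then obtain a b where ab: "a \<in> \<O>" "b \<in> \<O>" "p * a + q * b = 1" using comaximal_iff[OF assms] by blast
  have "p * a - 1 = q * (- b)" using ab(3) by (simp add: algebra_simps)
  then show "\<exists>a\<in>\<O>. cg q (p * a) 1" unfolding cg_def using ab O_minus by blast
next
  assume "\<exists>a\<in>\<O>. cg q (p * a) 1"
  then obtain a k where "a \<in> \<O>" "k \<in> \<O>" "p * a - 1 = q * k" unfolding cg_def by blast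
  moreover from this have "p * a + q * (- k) = 1" by (simp add: algebra_simps)
  ultimately show "comaximal K p q" using comaximal_iff[OF assms] O_minus by blast
qed

text \<open>An inverse of \<open>p\<close> modulo \<open>q\<close>. It is only determined modulo \<open>q\<close>, so it is always used through
  functions that are periodic modulo \<open>q\<close>.\<close>

definition invq :: "complex \<Rightarrow> complex \<Rightarrow> complex" where
  "invq q p = (SOME a. a \<in> \<O> \<and> cg q (p * a) 1)"

definition ures :: "complex \<Rightarrow> complex set" where
  "ures q = {p \<in> res q. comaximal K p q}"

lemma invq:
  assumes "p \<in> \<O>" "q \<in> \<O>" "comaximal K p q"
  shows "invq q p \<in> \<O>" "cg q (p * invq q p) 1"
  using someI_ex[of "\<lambda>a. a \<in> \<O> \<and> cg q (p * a) 1"] comaximal_cg[of p q] assms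
  unfolding invq_def by auto

lemma ures_O: "p \<in> ures q \<Longrightarrow> p \<in> \<O>" unfolding ures_def using res_O by blast
lemma ures_res: "p \<in> ures q \<Longrightarrow> p \<in> res q" unfolding ures_def by blast
lemma ures_comax: "p \<in> ures q \<Longrightarrow> comaximal K p q" unfolding ures_def by blast
lemma finite_ures [simp]: "q \<noteq> 0 \<Longrightarrow> finite (ures q)" unfolding ures_def by simp
lemma invq_ures: "p \<in> ures q \<Longrightarrow> q \<in> \<O> \<Longrightarrow> invq q p \<in> \<O>" "p \<in> ures q \<Longrightarrow> q \<in> \<O> \<Longrightarrow> cg q (p * invq q p) 1"
  using invq ures_O ures_comax by auto

lemma comaximal_cong:
  assumes "p \<in> \<O>" "p' \<in> \<O>" "q \<in> \<O>" "cg q p p'" "comaximal K p q"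
  shows "comaximal K p' q"
proof -
  obtain a where a: "a \<in> \<O>" "cg q (p * a) 1" using comaximal_cg assms by blast
  have "cg q (p' * a) (p * a)" using cg_mult_right[OF cg_sym[OF assms(4)] a(1)] .
  then have "cg q (p' * a) 1" using a(2) cg_trans by (meson)
  then show ?thesis using comaximal_cg assms a(1) by blast
qed

lemma inv_unique:
  assumes "p \<in> \<O>" "q \<in> \<O>" "a \<in> \<O>" "b \<in> \<O>" "cg q (p * a) 1" "cg q (p * b) 1"
  shows "cg q a b"
proof (rule cg_cancel)
  show "cg q (p * a) (p * b)" using cg_trans[OF assms(5) cg_sym[OF assms(6)]] .
  show "cg q (a * p) 1" using assms(5) by (simp add: mult.commute)
qed (use assms in auto)

lemma invq_cong:
  assumes "p \<in> \<O>" "p' \<in> \<O>" "q \<in> \<O>" "cg q p p'" "comaximal K p q"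
  shows "cg q (invq q p) (invq q p')"
proof -
  have c: "comaximal K p' q" using comaximal_cong assms by blast
  note i = invq[OF assms(1,3,5)] and i' = invq[OF assms(2,3) c]
  have "cg q (p' * invq q p) (p * invq q p)" using cg_mult_right[OF cg_sym[OF assms(4)] i(1)] .
  then have "cg q (p' * invq q p) 1" using i(2) by (rule cg_trans)
  then show ?thesis using inv_unique[OF assms(2,3) i(1) i'(1)] i'(2) by blast
qed

lemma comaximal_mult:
  assumes "p \<in> \<O>" "l \<in> \<O>" "q \<in> \<O>" "comaximal K l q"
  shows "comaximal K (l * p) q \<longleftrightarrow> comaximal K p q"
    and "comaximal K p q \<Longrightarrow> cg q (invq q (l * p)) (invq q l * invq q p)"
proof -
  note l = invq[OF assms(2,3,4)]
  show "comaximal K (l * p) q \<longleftrightarrow> comaximal K p q"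
  proof
    assume "comaximal K (l * p) q"
    then obtain a where a: "a \<in> \<O>" "cg q (l * p * a) 1" using comaximal_cg assms by blast
    have "cg q (p * (l * a)) 1" using a(2) by (simp add: ac_simps)
    then show "comaximal K p q" using comaximal_cg assms a by blast
  next
    assume "comaximal K p q"
    note p = invq[OF assms(1,3) this]
    have "cg q (l * invq q l * (p * invq q p)) (1 * 1)" by (rule cg_mult) (use l p assms in auto)
    then have "cg q (l * p * (invq q l * invq q p)) 1" by (simp add: ac_simps)
    then show "comaximal K (l * p) q" using comaximal_cg assms l p by blast
  qed
  assume c: "comaximal K p q"
  note p = invq[OF assms(1,3) c]
  have "cg q (l * invq q l * (p * invq q p)) (1 * 1)" by (rule cg_mult) (use l p assms in auto)
  then have 1: "cg q (l * p * (invq q l * invq q p)) 1" by (simp add: ac_simps)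
  have c': "comaximal K (l * p) q" using 1 comaximal_cg assms l p by blast
  have lp: "l * p \<in> \<O>" using assms by blast
  show "cg q (invq q (l * p)) (invq q l * invq q p)"
    by (rule inv_unique[OF lp assms(3) _ _ _ 1]) (use invq[OF lp assms(3) c'] l p in auto)
qed

text \<open>Characters of the plane that are trivial on the lattice, that is, characters of the torus.\<close>

definition is_char :: "(complex \<Rightarrow> complex) \<Rightarrow> bool" where
  "is_char c \<longleftrightarrow> (\<forall>x y. c (x + y) = c x * c y) \<and> (\<forall>x. cmod (c x) = 1) \<and> (\<forall>x\<in>\<O>. c x = 1)"

lemma char_add: "is_char c \<Longrightarrow> c (x + y) = c x * c y"
  and char_norm: "is_char c \<Longrightarrow> cmod (c x) = 1"
  and char_O: "is_char c \<Longrightarrow> x \<in> \<O> \<Longrightarrow> c x = 1"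
  unfolding is_char_def by blast+

lemma char_diff:
  assumes "is_char c" shows "c (x - y) = c x * cnj (c y)"
proof -
  have "c (x - y) * c y = c x" using char_add[OF assms, of "x - y" y] by simp
  then have "c (x - y) * (c y * cnj (c y)) = c x * cnj (c y)" by (metis mult.assoc)
  moreover have "c y * cnj (c y) = 1" using char_norm[OF assms, of y] by (metis complex_norm_square of_real_1 power_one)
  ultimately show ?thesis by simp
qed

lemma char_shift:
  assumes "is_char c" "x - y \<in> \<O>" shows "c x = c y"
  using char_add[OF assms(1), of "x - y" y] char_O[OF assms] by simp

lemma char_cg:
  assumes "is_char c" "cg q x y" "q \<noteq> 0" shows "c (x / q) = c (y / q)"
proof -
  obtain k where "k \<in> \<O>" "x - y = q * k" using assms unfolding cg_def by blast
  then have "x / q - y / q \<in> \<O>" using assms(3) by (simp add: diff_divide_distrib[symmetric])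
  then show ?thesis by (rule char_shift[OF assms(1)])
qed

text \<open>A nontrivial character of a finite group sums to zero: a shift of the summation variable multiplies the
  sum by a value different from 1.\<close>

lemma char_res_sum:
  assumes c: "is_char c" and q: "q \<in> \<O>" "q \<noteq> 0" and m: "m \<in> \<O>"
  shows "(\<Sum>a\<in>res q. c (m * a / q)) = (if \<forall>a\<in>\<O>. c (m * a / q) = 1 then of_nat (N q) else 0)"
proof (cases "\<forall>a\<in>\<O>. c (m * a / q) = 1")
  case True
  then have "(\<Sum>a\<in>res q. c (m * a / q)) = (\<Sum>a\<in>res q. 1)" by (intro sum.cong refl) (use res_O in blast)
  then show ?thesis using True by (simp add: N_def)
next
  case False
  then obtain b where b: "b \<in> \<O>" "c (m * b / q) \<noteq> 1" by blast
  have per: "periodic q (\<lambda>a. c (m * a / q))"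
    unfolding periodic_def by (intro ballI impI char_cg[OF c] cg_mult_left m q)
  let ?s = "\<Sum>a\<in>res q. c (m * a / q)"
  have "?s = (\<Sum>a\<in>res q. c (m * (a + b) / q))" by (rule res_sum_shift[OF q per b(1), symmetric])
  also have "\<dots> = c (m * b / q) * ?s"
    by (simp add: distrib_left add_divide_distrib char_add[OF c] sum_distrib_left mult.commute)
  finally have "?s = 0" using b(2) by (metis mult_cancel_right1)
  then show ?thesis using False by (simp only: if_False)
qed

text \<open>Kloosterman sums modulo \<open>q\<close>.\<close>

definition kloo :: "(complex \<Rightarrow> complex) \<Rightarrow> (complex \<Rightarrow> complex) \<Rightarrow> complex \<Rightarrow> complex" where
  "kloo c d q = (\<Sum>p\<in>ures q. c (p / q) * d (invq q p / q))"

text \<open>The number of multipliers that make the character trivial modulo \<open>q\<close>. For a fixed nontrivial character it is bounded in \<open>q\<close>.\<close>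

definition kernel_card :: "(complex \<Rightarrow> complex) \<Rightarrow> complex \<Rightarrow> nat" where
  "kernel_card c q = card {m \<in> res q. \<forall>a\<in>\<O>. c (m * a / q) = 1}"

text \<open>Multiplication by \<open>l\<close> permutes the invertible residues, and inversion is multiplicative.\<close>

lemma ures_sum_scale:
  fixes g :: "complex \<Rightarrow> complex \<Rightarrow> 'b::comm_monoid_add"
  assumes q: "q \<in> \<O>" "q \<noteq> 0" and l: "l \<in> ures q"
    and g: "\<And>x y x' y'. cg q x x' \<Longrightarrow> cg q y y' \<Longrightarrow> x \<in> \<O> \<Longrightarrow> x' \<in> \<O> \<Longrightarrow> y \<in> \<O> \<Longrightarrow> y' \<in> \<O> \<Longrightarrow> g x y = g x' y'"
  shows "(\<Sum>p\<in>ures q. g (l * p) (invq q l * invq q p)) = (\<Sum>p\<in>ures q. g p (invq q p))"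
proof -
  note lO = ures_O[OF l] and lc = ures_comax[OF l] and li = invq_ures[OF l q(1)]
  let ?G = "\<lambda>p. if comaximal K p q then g p (invq q p) else 0"
  have per: "periodic q ?G" unfolding periodic_def
  proof (intro ballI impI)
    fix x y assume xy: "x \<in> \<O>" "y \<in> \<O>" "cg q x y"
    have "comaximal K x q \<longleftrightarrow> comaximal K y q" using comaximal_cong xy q cg_sym by meson
    moreover have "g x (invq q x) = g y (invq q y)" if "comaximal K x q" "comaximal K y q"
      by (rule g) (use xy that q invq_cong invq in auto)
    ultimately show "?G x = ?G y" by auto
  qed
  have 1: "(\<Sum>p\<in>ures q. f p) = (\<Sum>p\<in>res q. if comaximal K p q then f p else 0)" for f :: "complex \<Rightarrow> 'b"
    unfolding ures_def using q by (simp add: sum.If_cases Int_def)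
  have "(\<Sum>p\<in>ures q. g p (invq q p)) = (\<Sum>p\<in>res q. ?G p)" by (rule 1)
  also have "\<dots> = (\<Sum>p\<in>res q. ?G (l * p))"
  proof (rule res_sum_reindex[OF q per, symmetric])
    fix x y assume "x \<in> \<O>" "y \<in> \<O>" "cg q (l * x) (l * y)"
    then show "cg q x y" by (intro cg_cancel[of q l x y "invq q l"]) (use li in \<open>auto simp: mult.commute\<close>)
  qed (use lO in auto)
  also have "\<dots> = (\<Sum>p\<in>res q. if comaximal K p q then g (l * p) (invq q l * invq q p) else 0)"
  proof (rule sum.cong[OF refl])
    fix p assume "p \<in> res q"
    then have p: "p \<in> \<O>" by (rule res_O)
    have "g (l * p) (invq q (l * p)) = g (l * p) (invq q l * invq q p)" if c: "comaximal K p q"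
    proof (rule g)
      show "cg q (invq q (l * p)) (invq q l * invq q p)" by (rule comaximal_mult(2)[OF p lO q(1) lc c])
      have "comaximal K (l * p) q" using comaximal_mult(1)[OF p lO q(1) lc] c by blast
      then show "invq q (l * p) \<in> \<O>" using invq p lO q by blast
      show "invq q l * invq q p \<in> \<O>" using invq[OF p q(1) c] li by blast
    qed (use p lO in auto)
    then show "?G (l * p) = (if comaximal K p q then g (l * p) (invq q l * invq q p) else 0)"
      using comaximal_mult(1)[OF p lO q(1) lc] by auto
  qed
  also have "\<dots> = (\<Sum>p\<in>ures q. g (l * p) (invq q l * invq q p))" by (rule 1[symmetric])
  finally show ?thesis by simp
qed

text \<open>The average over the scaling \<open>(a, b) \<mapsto> (l * a, invq q l * b)\<close> under which Kloosterman sums are invariant.\<close>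

definition kk :: "(complex \<Rightarrow> complex) \<Rightarrow> (complex \<Rightarrow> complex) \<Rightarrow> complex \<Rightarrow> complex \<Rightarrow> complex \<Rightarrow> complex" where
  "kk c d q a b = (\<Sum>l\<in>ures q. c (l * a / q) * d (invq q l * b / q))"

lemma kk_cong:
  assumes "is_char c" "is_char d" "q \<in> \<O>" "q \<noteq> 0" "cg q a a'" "cg q b b'"
  shows "kk c d q a b = kk c d q a' b'"
  unfolding kk_def
proof (rule sum.cong[OF refl])
  fix l assume l: "l \<in> ures q"
  have "c (l * a / q) = c (l * a' / q)"
    by (rule char_cg[OF assms(1) cg_mult_left[OF assms(5) ures_O[OF l]] assms(4)])
  moreover have "d (invq q l * b / q) = d (invq q l * b' / q)"
    by (rule char_cg[OF assms(2) cg_mult_left[OF assms(6) invq_ures(1)[OF l assms(3)]] assms(4)])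
  ultimately show "c (l * a / q) * d (invq q l * b / q) = c (l * a' / q) * d (invq q l * b' / q)" by simp
qed

text \<open>Expand the square of the sum scaled by \<open>l\<close> and average over \<open>l\<close>.\<close>

lemma kloo_square:
  assumes c: "is_char c" and d: "is_char d" and q: "q \<in> \<O>" "q \<noteq> 0"
  shows "of_nat (card (ures q)) * (kloo c d q * cnj (kloo c d q))
    = (\<Sum>(p, p')\<in>ures q \<times> ures q. kk c d q (p - p') (invq q p - invq q p'))"
proof -
  have "kloo c d q * cnj (kloo c d q) = (\<Sum>(p, p')\<in>ures q \<times> ures q. c (l * (p - p') / q) * d (invq q l * (invq q p - invq q p') / q))"
    if l: "l \<in> ures q" for l
  proof -
    have k: "kloo c d q = (\<Sum>p\<in>ures q. c (l * p / q) * d (invq q l * invq q p / q))"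
      unfolding kloo_def
      by (rule ures_sum_scale[OF q l, of "\<lambda>x y. c (x / q) * d (y / q)", symmetric])
        (intro arg_cong2[of _ _ _ _ "(*)"] char_cg[OF c] char_cg[OF d] q(2))
    show ?thesis unfolding k cnj_sum sum_product sum.cartesian_product
      by (intro sum.cong refl)
        (auto simp: right_diff_distrib diff_divide_distrib char_diff[OF c] char_diff[OF d])
  qed
  note * = this
  have "of_nat (card (ures q)) * (kloo c d q * cnj (kloo c d q)) = (\<Sum>l\<in>ures q. kloo c d q * cnj (kloo c d q))"
    by simp
  also have "\<dots> = (\<Sum>l\<in>ures q. \<Sum>(p, p')\<in>ures q \<times> ures q. c (l * (p - p') / q) * d (invq q l * (invq q p - invq q p') / q))"
    by (rule sum.cong[OF refl *])
  also have "\<dots> = (\<Sum>(p, p')\<in>ures q \<times> ures q. kk c d q (p - p') (invq q p - invq q p'))"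
    unfolding kk_def by (subst sum.swap) (simp add: case_prod_unfold)
  finally show ?thesis .
qed

text \<open>Expanding the square and summing over \<open>a\<close> and \<open>b\<close> gives complete character sums. The sum over \<open>a\<close> vanishes
  unless \<open>l - l'\<close> lies in the kernel of \<open>c\<close>, and the sum over \<open>b\<close> is estimated trivially.\<close>

lemma kk_square_sum:
  assumes c: "is_char c" and d: "is_char d" and q: "q \<in> \<O>" "q \<noteq> 0"
  shows "(\<Sum>(a, b)\<in>res q \<times> res q. (cmod (kk c d q a b))\<^sup>2) \<le> (real (N q))\<^sup>2 * card (ures q) * kernel_card c q"
proof -
  define triv where "triv m \<longleftrightarrow> (\<forall>a\<in>\<O>. c (m * a / q) = 1)" for m
  have e: "of_real ((cmod (kk c d q a b))\<^sup>2)
     = (\<Sum>(l, l')\<in>ures q \<times> ures q. c ((l - l') * a / q) * d ((invq q l - invq q l') * b / q))" for a b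
    unfolding complex_norm_square kk_def cnj_sum sum_product sum.cartesian_product
    by (intro sum.cong refl)
      (auto simp: left_diff_distrib diff_divide_distrib char_diff[OF c] char_diff[OF d])
  have "of_real (\<Sum>(a, b)\<in>res q \<times> res q. (cmod (kk c d q a b))\<^sup>2)
    = (\<Sum>(a, b)\<in>res q \<times> res q. \<Sum>(l, l')\<in>ures q \<times> ures q. c ((l - l') * a / q) * d ((invq q l - invq q l') * b / q))"
    unfolding of_real_sum by (intro sum.cong refl) (auto simp: e[symmetric])
  also have "\<dots> = (\<Sum>(l, l')\<in>ures q \<times> ures q. \<Sum>(a, b)\<in>res q \<times> res q. c ((l - l') * a / q) * d ((invq q l - invq q l') * b / q))"
    unfolding case_prod_unfold by (rule sum.swap)
  also have "\<dots> = (\<Sum>(l, l')\<in>ures q \<times> ures q. (\<Sum>a\<in>res q. c ((l - l') * a / q)) * (\<Sum>b\<in>res q. d ((invq q l - invq q l') * b / q)))"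
    unfolding sum_product sum.cartesian_product by simp
  finally have eq: "of_real (\<Sum>(a, b)\<in>res q \<times> res q. (cmod (kk c d q a b))\<^sup>2) = \<dots>" .
  have "(\<Sum>(a, b)\<in>res q \<times> res q. (cmod (kk c d q a b))\<^sup>2) = cmod (of_real (\<Sum>(a, b)\<in>res q \<times> res q. (cmod (kk c d q a b))\<^sup>2))"
    by (simp only: norm_of_real) (intro abs_of_nonneg[symmetric] sum_nonneg, auto)
  also have "\<dots> \<le> (\<Sum>(l, l')\<in>ures q \<times> ures q. cmod ((\<Sum>a\<in>res q. c ((l - l') * a / q)) * (\<Sum>b\<in>res q. d ((invq q l - invq q l') * b / q))))"
    unfolding eq by (rule order_trans[OF norm_sum]) (simp add: case_prod_unfold)
  also have "\<dots> \<le> (\<Sum>(l, l')\<in>ures q \<times> ures q. (if triv (l - l') then real (N q) else 0) * real (N q))"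
  proof (rule sum_mono, clarify)
    fix l l' assume l: "l \<in> ures q" "l' \<in> ures q"
    have "cmod (\<Sum>a\<in>res q. c ((l - l') * a / q)) = (if triv (l - l') then real (N q) else 0)"
      unfolding triv_def by (subst char_res_sum[OF c q]) (use l ures_O in \<open>auto\<close>)
    moreover have "cmod (\<Sum>b\<in>res q. d ((invq q l - invq q l') * b / q)) \<le> real (N q)"
      by (subst char_res_sum[OF d q]) (use l invq_ures[OF _ q(1)] in auto)
    ultimately show "cmod ((\<Sum>a\<in>res q. c ((l - l') * a / q)) * (\<Sum>b\<in>res q. d ((invq q l - invq q l') * b / q)))
       \<le> (if triv (l - l') then real (N q) else 0) * real (N q)"
      unfolding norm_mult by (intro mult_mono) auto
  qed
  also have "\<dots> = (\<Sum>l\<in>ures q. \<Sum>l'\<in>ures q. if triv (l - l') then (real (N q))\<^sup>2 else 0)"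
    unfolding sum.cartesian_product by (intro sum.cong refl) (auto simp: power2_eq_square)
  also have "\<dots> \<le> (\<Sum>l\<in>ures q. real (kernel_card c q) * (real (N q))\<^sup>2)"
  proof (rule sum_mono)
    fix l assume l: "l \<in> ures q"
    have "card {l' \<in> ures q. triv (l - l')} \<le> kernel_card c q"
      unfolding kernel_card_def
    proof (rule card_inj_on_le[of "\<lambda>l'. redu q (l - l')"])
      show "inj_on (\<lambda>l'. redu q (l - l')) {l' \<in> ures q. triv (l - l')}"
      proof (rule inj_onI)
        fix x y assume xy: "x \<in> {l' \<in> ures q. triv (l - l')}" "y \<in> {l' \<in> ures q. triv (l - l')}"
          and e: "redu q (l - x) = redu q (l - y)"
        have "cg q (l - x) (redu q (l - y))" unfolding e[symmetric] by (rule redu_cg)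
        from cg_trans[OF this redu_cg(1)] have "cg q (l - x) (l - y)" .
        from cg_diff[OF cg_refl[of q l] this] have "cg q x y" by simp
        then show "x = y" using res_unique[OF q(2)] xy ures_res by blast
      qed
      show "(\<lambda>l'. redu q (l - l')) ` {l' \<in> ures q. triv (l - l')} \<subseteq> {m \<in> res q. \<forall>a\<in>\<O>. c (m * a / q) = 1}"
      proof clarify
        fix l' assume l': "l' \<in> ures q" "triv (l - l')"
        have O: "l - l' \<in> \<O>" using l l' ures_O by blast
        have "c (redu q (l - l') * a / q) = 1" if "a \<in> \<O>" for a
        proof -
          have "c (redu q (l - l') * a / q) = c ((l - l') * a / q)"
            by (rule char_cg[OF c cg_mult_right[OF redu_cg(1) that] q(2)])
          then show ?thesis using l'(2) that unfolding triv_def by simp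
        qed
        then show "redu q (l - l') \<in> res q \<and> (\<forall>a\<in>\<O>. c (redu q (l - l') * a / q) = 1)"
          using redu_res[OF q O] by blast
      qed
      show "finite {m \<in> res q. \<forall>a\<in>\<O>. c (m * a / q) = 1}" using q by simp
    qed
    then have "real (card {l' \<in> ures q. triv (l - l')}) * (real (N q))\<^sup>2 \<le> real (kernel_card c q) * (real (N q))\<^sup>2"
      by (intro mult_right_mono) auto
    moreover have "(\<Sum>l'\<in>ures q. if triv (l - l') then (real (N q))\<^sup>2 else 0) = real (card {l' \<in> ures q. triv (l - l')}) * (real (N q))\<^sup>2"
      using q by (simp add: sum.If_cases Int_def)
    ultimately show "(\<Sum>l'\<in>ures q. if triv (l - l') then (real (N q))\<^sup>2 else 0) \<le> real (kernel_card c q) * (real (N q))\<^sup>2"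
      by simp
  qed
  also have "\<dots> = (real (N q))\<^sup>2 * card (ures q) * kernel_card c q" by simp
  finally show ?thesis .
qed

text \<open>The pairs of differences that coincide both for the residues and for their inverses.\<close>

definition quads :: "complex \<Rightarrow> ((complex \<times> complex) \<times> (complex \<times> complex)) set" where
  "quads q = {((p1, p2), (p3, p4)). p1 \<in> ures q \<and> p2 \<in> ures q \<and> p3 \<in> ures q \<and> p4 \<in> ures q \<and>
     cg q (p1 - p2) (p3 - p4) \<and> cg q (invq q p1 - invq q p2) (invq q p3 - invq q p4)}"

text \<open>Collect the pairs in \<open>kloo_square\<close> according to their differences. The Cauchy-Schwarz inequality then separates the
  squared multiplicities, which add up to \<open>card (quads q)\<close>, from \<open>kk_square_sum\<close>.\<close>

lemma kloo_fourth_moment: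
  assumes c: "is_char c" and d: "is_char d" and q: "q \<in> \<O>" "q \<noteq> 0"
  shows "(cmod (kloo c d q))^4 * card (ures q) \<le> real (card (quads q)) * ((real (N q))\<^sup>2 * kernel_card c q)"
proof -
  let ?U = "ures q \<times> ures q" and ?R = "res q \<times> res q"
  define A where "A = (\<lambda>(p, p'). (redu q (p - p'), redu q (invq q p - invq q p')))"
  define k where "k = (\<lambda>(a, b). kk c d q a b)"
  define r where "r ab = card {p \<in> ?U. A p = ab}" for ab
  have fin: "finite ?U" "finite ?R" using q by auto
  have A: "A ` ?U \<subseteq> ?R" unfolding A_def
    using ures_O invq_ures(1)[OF _ q(1)] by (auto intro!: redu_res[OF q] O_diff)
  have "of_nat (card (ures q)) * (kloo c d q * cnj (kloo c d q)) = (\<Sum>p\<in>?U. k (A p))"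
    unfolding kloo_square[OF c d q]
    by (intro sum.cong refl) (auto simp: k_def A_def intro!: kk_cong[OF c d q] redu_cg)
  also have "\<dots> = (\<Sum>ab\<in>?R. \<Sum>p\<in>{p \<in> ?U. A p = ab}. k (A p))"
    by (rule sum.group[OF fin A, symmetric])
  also have "\<dots> = (\<Sum>ab\<in>?R. of_nat (r ab) * k ab)"
    unfolding r_def by (intro sum.cong refl) simp
  finally have "of_nat (card (ures q)) * of_real ((cmod (kloo c d q))\<^sup>2) = (\<Sum>ab\<in>?R. of_nat (r ab) * k ab)"
    unfolding complex_norm_square .
  then have "cmod (of_nat (card (ures q)) * of_real ((cmod (kloo c d q))\<^sup>2)) = cmod (\<Sum>ab\<in>?R. of_nat (r ab) * k ab)" by simp
  then have "real (card (ures q)) * (cmod (kloo c d q))\<^sup>2 \<le> (\<Sum>ab\<in>?R. real (r ab) * cmod (k ab))"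
    using norm_sum[of "\<lambda>ab. of_nat (r ab) * k ab" ?R] by (simp add: norm_mult norm_power)
  then have "(real (card (ures q)) * (cmod (kloo c d q))\<^sup>2)\<^sup>2 \<le> (\<Sum>ab\<in>?R. real (r ab) * cmod (k ab))\<^sup>2"
    by (intro power_mono) auto
  also have "\<dots> \<le> (\<Sum>ab\<in>?R. (real (r ab))\<^sup>2) * (\<Sum>ab\<in>?R. (cmod (k ab))\<^sup>2)"
    by (rule Cauchy_Schwarz_ineq_sum)
  also have "(\<Sum>ab\<in>?R. (real (r ab))\<^sup>2) = real (card (quads q))"
  proof -
    have "quads q = (SIGMA p:?U. {p' \<in> ?U. A p' = A p})" (is "_ = ?Q")
    proof (intro set_eqI iffI)
      fix z assume z: "z \<in> quads q"
      then obtain p1 p2 p3 p4 where *: "z = ((p1, p2), (p3, p4))" "p1 \<in> ures q" "p2 \<in> ures q" "p3 \<in> ures q" "p4 \<in> ures q"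
        "cg q (p1 - p2) (p3 - p4)" "cg q (invq q p1 - invq q p2) (invq q p3 - invq q p4)"
        unfolding quads_def by auto
      have "redu q x = redu q y" if "cg q x y" "x \<in> \<O>" "y \<in> \<O>" for x y
        by (rule res_unique[OF q(2)])
          (use that redu_res[OF q] cg_trans[OF redu_cg(1) cg_trans[OF _ redu_cg(2)]] in auto)
      from this[OF cg_sym[OF *(6)]] this[OF cg_sym[OF *(7)]] have "A (p3, p4) = A (p1, p2)" unfolding A_def
        using *(2-5) ures_O invq_ures(1)[OF _ q(1)] by (simp add: O_diff)
      then show "z \<in> ?Q" using * by simp
    next
      fix z assume "z \<in> ?Q"
      then obtain p1 p2 p3 p4 where *: "z = ((p1, p2), (p3, p4))" "p1 \<in> ures q" "p2 \<in> ures q" "p3 \<in> ures q" "p4 \<in> ures q"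
        "A (p3, p4) = A (p1, p2)" by auto
      have "cg q x y" if "redu q y = redu q x" for x y
        using redu_cg[of q x] redu_cg[of q y] that cg_trans[of q x "redu q x" y] by simp
      then show "z \<in> quads q" using * unfolding quads_def A_def by auto
    qed
    then have "real (card (quads q)) = (\<Sum>p\<in>?U. real (r (A p)))"
      unfolding r_def using fin by (simp add: card_SigmaI)
    also have "\<dots> = (\<Sum>ab\<in>?R. \<Sum>p\<in>{p \<in> ?U. A p = ab}. real (r (A p)))"
      by (rule sum.group[OF fin A, symmetric])
    also have "\<dots> = (\<Sum>ab\<in>?R. (real (r ab))\<^sup>2)"
      by (intro sum.cong refl) (simp add: r_def power2_eq_square)
    finally show ?thesis by simp
  qed
  also have "(\<Sum>ab\<in>?R. (cmod (k ab))\<^sup>2) = (\<Sum>(a, b)\<in>?R. (cmod (kk c d q a b))\<^sup>2)"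
    unfolding k_def by (intro sum.cong refl) auto
  finally have "(real (card (ures q)) * (cmod (kloo c d q))\<^sup>2)\<^sup>2 \<le> real (card (quads q)) * (\<Sum>(a, b)\<in>?R. (cmod (kk c d q a b))\<^sup>2)" .
  also have "\<dots> \<le> real (card (quads q)) * ((real (N q))\<^sup>2 * card (ures q) * kernel_card c q)"
    by (intro mult_left_mono kk_square_sum[OF c d q]) auto
  finally have "real (card (ures q)) * ((cmod (kloo c d q))^4 * card (ures q))
    \<le> real (card (ures q)) * (real (card (quads q)) * ((real (N q))\<^sup>2 * kernel_card c q))"
    by (simp add: power_mult_distrib power2_eq_square power4_eq_xxxx algebra_simps)
  then show ?thesis
    by (cases "card (ures q) = 0") (auto simp: mult_le_cancel_left)
qed

text \<open>The size of the annihilator of \<open>x\<close> modulo \<open>q\<close>.\<close>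

definition ann :: "complex \<Rightarrow> complex \<Rightarrow> nat" where
  "ann q x = card {p \<in> res q. cg q (x * p) 0}"

text \<open>The equation left by eliminating \<open>p4\<close> and the inverses from \<open>quads\<close>. It is obtained from
  \<open>(p1 + p4) * p2 * p3 = (p2 + p3) * p1 * p4\<close> by inserting \<open>p4 = p2 + p3 - p1\<close>.\<close>

definition tris :: "complex \<Rightarrow> (complex \<times> complex \<times> complex) set" where
  "tris q = {(p1, p2, p3). p1 \<in> res q \<and> p2 \<in> res q \<and> p3 \<in> res q \<and> cg q ((p2 + p3) * (p1 - p2) * (p1 - p3)) 0}"

lemma quads_le_tris:
  assumes q: "q \<in> \<O>" "q \<noteq> 0"
  shows "card (quads q) \<le> card (tris q)"
proof -
  define f :: "(complex \<times> complex) \<times> (complex \<times> complex) \<Rightarrow> complex \<times> complex \<times> complex"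
    where "f z = (fst (fst z), snd (fst z), fst (snd z))" for z
  show ?thesis
proof (rule card_inj_on_le[of f])
  show "finite (tris q)" by (rule finite_subset[of _ "res q \<times> res q \<times> res q"]) (use q in \<open>auto simp: tris_def\<close>)
  show "inj_on f (quads q)"
  proof (rule inj_onI)
    fix z z' assume z: "z \<in> quads q" "z' \<in> quads q"
      and e: "f z = f z'"
    obtain p1 p2 p3 p4 where zz: "z = ((p1, p2), (p3, p4))" by (metis surj_pair)
    with e obtain p4' where zz': "z' = ((p1, p2), (p3, p4'))" by (cases z') (auto simp: f_def)
    have a: "((p1, p2), (p3, p4)) \<in> quads q" "((p1, p2), (p3, p4')) \<in> quads q" using z zz zz' by auto
    then have "cg q (p3 - p4) (p1 - p2)" "cg q (p1 - p2) (p3 - p4')" unfolding quads_def by (auto intro: cg_sym)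
    then have "cg q (p3 - p4) (p3 - p4')" by (rule cg_trans)
    from cg_diff[OF cg_refl[of q p3] this] have "cg q p4 p4'" by simp
    then have "p4 = p4'" using res_unique[OF q(2)] a ures_res unfolding quads_def by blast
    then show "z = z'" using zz zz' by simp
  qed
  show "f ` quads q \<subseteq> tris q"
  proof (rule image_subsetI)
    fix z assume z: "z \<in> quads q"
    obtain p1 p2 p3 p4 where zz: "z = ((p1, p2), (p3, p4))" by (metis surj_pair)
    have U: "p1 \<in> ures q" "p2 \<in> ures q" "p3 \<in> ures q" "p4 \<in> ures q"
      and e1: "cg q (p1 - p2) (p3 - p4)" and e2: "cg q (invq q p1 - invq q p2) (invq q p3 - invq q p4)"
      using z unfolding zz quads_def by auto
    define v1 v2 v3 v4 where v: "v1 = invq q p1" "v2 = invq q p2" "v3 = invq q p3" "v4 = invq q p4"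
    have O: "p1 \<in> \<O>" "p2 \<in> \<O>" "p3 \<in> \<O>" "p4 \<in> \<O>" using U ures_O by auto
    obtain k where k: "k \<in> \<O>" "p1 - p2 - (p3 - p4) = q * k" using e1 unfolding cg_def by blast
    obtain k' where k': "k' \<in> \<O>" "v1 - v2 - (v3 - v4) = q * k'" using e2 unfolding cg_def v by blast
    obtain c1 where c1: "c1 \<in> \<O>" "p1 * v1 - 1 = q * c1" using invq_ures(2)[OF U(1) q(1)] unfolding cg_def v by blast
    obtain c2 where c2: "c2 \<in> \<O>" "p2 * v2 - 1 = q * c2" using invq_ures(2)[OF U(2) q(1)] unfolding cg_def v by blast
    obtain c3 where c3: "c3 \<in> \<O>" "p3 * v3 - 1 = q * c3" using invq_ures(2)[OF U(3) q(1)] unfolding cg_def v by blast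
    obtain c4 where c4: "c4 \<in> \<O>" "p4 * v4 - 1 = q * c4" using invq_ures(2)[OF U(4) q(1)] unfolding cg_def v by blast
    \<comment> \<open>Clearing the denominators of \<open>1/p1 + 1/p4 = 1/p2 + 1/p3\<close>.\<close>
    define X where "X = p2 * p3 * p4 * (1 + q * c1) + p1 * p2 * p3 * (1 + q * c4) - p1 * p3 * p4 * (1 + q * c2) - p1 * p2 * p4 * (1 + q * c3)"
    have "X = p1 * p2 * p3 * p4 * (v1 - v2 - (v3 - v4))"
    proof -
      have "1 + q * c1 = p1 * v1" "1 + q * c2 = p2 * v2" "1 + q * c3 = p3 * v3" "1 + q * c4 = p4 * v4"
        using c1 c2 c3 c4 by (simp_all add: algebra_simps)
      then show ?thesis unfolding X_def by (simp add: algebra_simps)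
    qed
    then have X: "X = q * (p1 * p2 * p3 * p4 * k')" unfolding k'(2) by simp
    have p4: "p4 = p2 + p3 - p1 + q * k" using k(2) by (simp add: algebra_simps)
    have "(p2 + p3) * (p1 - p2) * (p1 - p3)
      = X - q * (p2 * p3 * p4 * c1 + p1 * p2 * p3 * c4 - p1 * p3 * p4 * c2 - p1 * p2 * p4 * c3) - q * k * p2 * p3 + q * k * p1 * (p2 + p3)"
    proof -
      define Y where "Y = p2 * p3 * (p4 + p1) - p1 * p4 * (p3 + p2)"
      have "X = Y + q * (p2 * p3 * p4 * c1 + p1 * p2 * p3 * c4 - p1 * p3 * p4 * c2 - p1 * p2 * p4 * c3)"
        unfolding X_def Y_def by (simp add: algebra_simps)
      moreover have "Y = (p2 + p3) * (p1 - p2) * (p1 - p3) + q * k * p2 * p3 - q * k * p1 * (p2 + p3)"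
        unfolding Y_def p4 by (simp add: algebra_simps)
      ultimately show ?thesis by simp
    qed
    also have "\<dots> = q * (p1 * p2 * p3 * p4 * k' - (p2 * p3 * p4 * c1 + p1 * p2 * p3 * c4 - p1 * p3 * p4 * c2 - p1 * p2 * p4 * c3) - k * p2 * p3 + k * p1 * (p2 + p3))"
      unfolding X by (simp add: algebra_simps)
    finally have "cg q ((p2 + p3) * (p1 - p2) * (p1 - p3)) 0" unfolding cg_def
      by (intro bexI[of _ "p1 * p2 * p3 * p4 * k' - (p2 * p3 * p4 * c1 + p1 * p2 * p3 * c4 - p1 * p3 * p4 * c2 - p1 * p2 * p4 * c3) - k * p2 * p3 + k * p1 * (p2 + p3)"])
        (use O k k' c1 c2 c3 c4 in \<open>auto intro!: O_add O_diff O_mult\<close>)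
    then show "f z \<in> tris q" unfolding tris_def zz f_def using U ures_res by auto
  qed
qed
qed

text \<open>Two solutions differ by an element of the annihilator.\<close>

lemma card_linear_congruence_le:
  assumes q: "q \<in> \<O>" "q \<noteq> 0" and x: "x \<in> \<O>"
  shows "card {p \<in> res q. cg q (x * p) c} \<le> ann q x"
proof (cases "{p \<in> res q. cg q (x * p) c} = {}")
  case False
  then obtain p0 where p0: "p0 \<in> res q" "cg q (x * p0) c" by blast
  show ?thesis unfolding ann_def
  proof (rule card_inj_on_le[of "\<lambda>p. redu q (p - p0)"])
    show "inj_on (\<lambda>p. redu q (p - p0)) {p \<in> res q. cg q (x * p) c}"
    proof (rule inj_onI)
      fix a b assume ab: "a \<in> {p \<in> res q. cg q (x * p) c}" "b \<in> {p \<in> res q. cg q (x * p) c}"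
        and e: "redu q (a - p0) = redu q (b - p0)"
      have "cg q (a - p0) (redu q (b - p0))" unfolding e[symmetric] by (rule redu_cg)
      from cg_add[OF cg_trans[OF this redu_cg(1)] cg_refl[of q p0]] have "cg q a b" by simp
      then show "a = b" using res_unique[OF q(2)] ab by blast
    qed
    show "(\<lambda>p. redu q (p - p0)) ` {p \<in> res q. cg q (x * p) c} \<subseteq> {p \<in> res q. cg q (x * p) 0}"
    proof clarify
      fix p assume p: "p \<in> res q" "cg q (x * p) c"
      have O: "p - p0 \<in> \<O>" using p p0 res_O by blast
      have 1: "cg q (x * redu q (p - p0)) (x * (p - p0))" by (rule cg_mult_left[OF redu_cg(1) x])
      have "cg q (x * (p - p0)) 0" using cg_diff[OF p(2) p0(2)] by (simp add: right_diff_distrib)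
      from cg_trans[OF 1 this] show "redu q (p - p0) \<in> res q \<and> cg q (x * redu q (p - p0)) 0"
        using redu_res[OF q O] by blast
    qed
    show "finite {p \<in> res q. cg q (x * p) 0}" using q by simp
  qed
qed (simp only: card.empty zero_le)

text \<open>The multiples of \<open>x\<close> modulo \<open>q\<close> have fibres of size \<open>ann q x\<close>, so a large annihilator
  makes two of the first multiples coincide.\<close>

lemma large_annihilator_torsion:
  assumes q: "q \<in> \<O>" "q \<noteq> 0" and x: "x \<in> \<O>" and big: "N q < D * ann q x"
  shows "\<exists>d. 0 < d \<and> d < D \<and> cg q (of_nat d * x) 0"
proof (rule ccontr)
  assume no: "\<not> ?thesis"
  define A where "A j = {p \<in> res q. cg q (x * p) (of_nat j * x)}" for j :: nat
  have cA: "card (A j) = ann q x" for j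
  proof (rule antisym)
    show "card (A j) \<le> ann q x" unfolding A_def by (rule card_linear_congruence_le[OF q x])
    show "ann q x \<le> card (A j)" unfolding ann_def A_def
    proof (rule card_inj_on_le[of "\<lambda>p. redu q (p + of_nat j)"])
      show "inj_on (\<lambda>p. redu q (p + of_nat j)) {p \<in> res q. cg q (x * p) 0}"
      proof (rule inj_onI)
        fix a b assume ab: "a \<in> {p \<in> res q. cg q (x * p) 0}" "b \<in> {p \<in> res q. cg q (x * p) 0}"
          and e: "redu q (a + of_nat j) = redu q (b + of_nat j)"
        have "cg q (a + of_nat j) (redu q (b + of_nat j))" unfolding e[symmetric] by (rule redu_cg)
        from cg_diff[OF cg_trans[OF this redu_cg(1)] cg_refl[of q "of_nat j"]] have "cg q a b" by simp
        then show "a = b" using res_unique[OF q(2)] ab by blast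
      qed
      show "(\<lambda>p. redu q (p + of_nat j)) ` {p \<in> res q. cg q (x * p) 0} \<subseteq> {p \<in> res q. cg q (x * p) (of_nat j * x)}"
      proof clarify
        fix p assume p: "p \<in> res q" "cg q (x * p) 0"
        have O: "p + of_nat j \<in> \<O>" using p res_O by blast
        have 1: "cg q (x * redu q (p + of_nat j)) (x * (p + of_nat j))" by (rule cg_mult_left[OF redu_cg(1) x])
        have "cg q (x * (p + of_nat j)) (of_nat j * x)"
          using cg_add[OF p(2) cg_refl[of q "of_nat j * x"]] by (simp add: algebra_simps)
        from cg_trans[OF 1 this] show "redu q (p + of_nat j) \<in> res q \<and> cg q (x * redu q (p + of_nat j)) (of_nat j * x)"
          using redu_res[OF q O] by blast
      qed
      show "finite {p \<in> res q. cg q (x * p) (of_nat j * x)}" using q by simp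
    qed
  qed
  have d: "A i \<inter> A j = {}" if "i < j" "j < D" for i j
  proof (rule ccontr)
    assume "A i \<inter> A j \<noteq> {}"
    then obtain p where "cg q (x * p) (of_nat i * x)" "cg q (x * p) (of_nat j * x)" unfolding A_def by blast
    from cg_diff[OF this(2,1)] have "cg q 0 (of_nat (j - i) * x)" using that by (simp add: of_nat_diff left_diff_distrib)
    then have "cg q (of_nat (j - i) * x) 0" by (rule cg_sym)
    moreover have "0 < j - i" "j - i < D" using that by auto
    ultimately show False using no by blast
  qed
  have d': "A i \<inter> A j = {}" if "i < D" "j < D" "i \<noteq> j" for i j
    using d[of i j] d[of j i] that by (cases "i < j") auto
  have "(\<Sum>j<D. card (A j)) = card (\<Union>j<D. A j)"
    by (rule card_UN_disjoint[symmetric]) (use q d' in \<open>auto simp: A_def\<close>)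
  also have "\<dots> \<le> N q" unfolding N_def by (rule card_mono) (use q in \<open>auto simp: A_def\<close>)
  finally show False using big by (simp add: cA)
qed

text \<open>Such a \<open>y\<close> is \<open>q * k / d\<close> for some \<open>k\<close>, which only matters modulo \<open>d\<close>.\<close>

lemma card_torsion:
  assumes q: "q \<in> \<O>" "q \<noteq> 0" and d: "0 < d"
  shows "card {y \<in> res q. cg q (of_nat d * y) 0} \<le> d\<^sup>2"
proof -
  define f where "f y = of_nat d * y / q" for y
  have f: "f y \<in> \<O>" if "cg q (of_nat d * y) 0" for y
    using that q unfolding cg_def f_def by auto
  have "card {y \<in> res q. cg q (of_nat d * y) 0} \<le> card (res (of_nat d))"
  proof (rule card_inj_on_le[of "\<lambda>y. redu (of_nat d) (f y)"])
    show "inj_on (\<lambda>y. redu (of_nat d) (f y)) {y \<in> res q. cg q (of_nat d * y) 0}"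
    proof (rule inj_onI)
      fix a b assume ab: "a \<in> {y \<in> res q. cg q (of_nat d * y) 0}" "b \<in> {y \<in> res q. cg q (of_nat d * y) 0}"
        and e: "redu (of_nat d) (f a) = redu (of_nat d) (f b)"
      have "cg (of_nat d) (f a) (redu (of_nat d) (f b))" unfolding e[symmetric] by (rule redu_cg)
      from cg_trans[OF this redu_cg(1)] obtain k where k: "k \<in> \<O>" "f a - f b = of_nat d * k" unfolding cg_def by blast
      have "of_nat d * (a - b) = q * (f a - f b)" unfolding f_def using q by (simp add: algebra_simps)
      then have "of_nat d * (a - b) = of_nat d * (q * k)" unfolding k(2) by (simp add: ac_simps)
      then have "a - b = q * k" using d by simp
      then show "a = b" using res_unique[OF q(2)] ab k(1) unfolding cg_def by blast
    qed
    show "(\<lambda>y. redu (of_nat d) (f y)) ` {y \<in> res q. cg q (of_nat d * y) 0} \<subseteq> res (of_nat d)"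
      using redu_res[of "of_nat d"] f d by auto
    show "finite (res (of_nat d))" using d by simp
  qed
  also have "\<dots> = d\<^sup>2" using N_of_nat[OF d] by (simp add: N_def)
  finally show ?thesis .
qed

lemma card_large_annihilator:
  assumes q: "q \<in> \<O>" "q \<noteq> 0" and e: "0 < e"
  shows "card {x \<in> res q. N q < D * ann q (of_nat e * x)} \<le> D * (D * e)\<^sup>2"
proof -
  have "card {x \<in> res q. N q < D * ann q (of_nat e * x)} \<le> card (\<Union>d\<in>{0<..<D}. {y \<in> res q. cg q (of_nat (d * e) * y) 0})"
  proof (rule card_mono)
    show "{x \<in> res q. N q < D * ann q (of_nat e * x)} \<subseteq> (\<Union>d\<in>{0<..<D}. {y \<in> res q. cg q (of_nat (d * e) * y) 0})"
    proof clarify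
      fix x assume x: "x \<in> res q" "N q < D * ann q (of_nat e * x)"
      have "of_nat e * x \<in> \<O>" using x res_O by blast
      from large_annihilator_torsion[OF q this x(2)] obtain d where "0 < d" "d < D" "cg q (of_nat d * (of_nat e * x)) 0" by blast
      then show "x \<in> (\<Union>d\<in>{0<..<D}. {y \<in> res q. cg q (of_nat (d * e) * y) 0})"
        using x by (auto simp: mult.assoc)
    qed
  qed (use q in auto)
  also have "\<dots> \<le> (\<Sum>d\<in>{0<..<D}. card {y \<in> res q. cg q (of_nat (d * e) * y) 0})" by (rule card_UN_le) simp
  also have "\<dots> \<le> (\<Sum>d\<in>{0<..<D}. (D * e)\<^sup>2)"
  proof (rule sum_mono)
    fix d assume d: "d \<in> {0<..<D}"
    then have "card {y \<in> res q. cg q (of_nat (d * e) * y) 0} \<le> (d * e)\<^sup>2" using e by (intro card_torsion[OF q]) auto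
    also have "\<dots> \<le> (D * e)\<^sup>2" using d by (intro power_mono) auto
    finally show "card {y \<in> res q. cg q (of_nat (d * e) * y) 0} \<le> (D * e)\<^sup>2" .
  qed
  also have "\<dots> \<le> D * (D * e)\<^sup>2" by simp
  finally show ?thesis .
qed

lemma ann_le_N: "q \<noteq> 0 \<Longrightarrow> ann q x \<le> N q"
  unfolding ann_def N_def by (rule card_mono) auto

lemma sum_ann_le:
  assumes q: "q \<in> \<O>" "q \<noteq> 0" and e: "0 < (e::nat)" and D: "0 < (D::nat)"
  shows "(\<Sum>x\<in>res q. real (ann q (of_nat e * x))) \<le> (real (N q))\<^sup>2 / D + real (N q) * (D * (D * e)\<^sup>2)"
proof -
  have "(\<Sum>x\<in>res q. real (ann q (of_nat e * x))) \<le>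
      (\<Sum>x\<in>res q. real (N q) / D + (if N q < D * ann q (of_nat e * x) then real (N q) else 0))"
  proof (rule sum_mono)
    fix x
    show "real (ann q (of_nat e * x)) \<le> real (N q) / D + (if N q < D * ann q (of_nat e * x) then real (N q) else 0)"
    proof (cases "N q < D * ann q (of_nat e * x)")
      case True
      have "real (ann q (of_nat e * x)) \<le> real (N q)" using ann_le_N[OF q(2)] by simp
      moreover have "0 \<le> real (N q) / D" by simp
      ultimately have "real (ann q (of_nat e * x)) \<le> real (N q) / D + real (N q)" by linarith
      then show ?thesis using True by simp
    next
      case False
      then have "real (D * ann q (of_nat e * x)) \<le> real (N q)" by linarith
      then show ?thesis using False D by (simp add: field_simps)
    qed
  qed
  also have "\<dots> = (real (N q))\<^sup>2 / D + real (card {x \<in> res q. N q < D * ann q (of_nat e * x)}) * real (N q)"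
    using q by (simp add: sum.distrib sum.If_cases Int_def N_def power2_eq_square)
  also have "\<dots> \<le> (real (N q))\<^sup>2 / D + real (D * (D * e)\<^sup>2) * real (N q)"
    by (intro add_left_mono mult_right_mono of_nat_mono card_large_annihilator[OF q e]) auto
  finally show ?thesis by (simp add: mult.commute)
qed

text \<open>With \<open>p2 = p1 - x\<close> and \<open>p3 = p1 - y\<close> the equation is linear in \<open>p1\<close>, so it has at most \<open>ann q (2 * x * y)\<close>
  solutions. This exceeds \<open>N q / D\<close> only if \<open>2 * d * x * y\<close> vanishes for some \<open>d < D\<close>, and the number
  of such \<open>y\<close> is again the size of an annihilator, which is small on average over \<open>x\<close>.\<close>

lemma card_tris_le:
  assumes q: "q \<in> \<O>" "q \<noteq> 0" and D: "0 < (D::nat)"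
  shows "real (card (tris q)) \<le> (real (N q))^3 * (2 / D) + 4 * (real (N q))\<^sup>2 * D^9"
proof -
  define R where "R = res q"
  define ind where "ind p1 p2 p3 = (if cg q ((p2 + p3) * (p1 - p2) * (p1 - p3)) 0 then 1 else 0 :: real)" for p1 p2 p3
  have fR: "finite R" unfolding R_def using q by simp
  have RO: "\<And>x. x \<in> R \<Longrightarrow> x \<in> \<O>" unfolding R_def by (rule res_O)
  have cgi: "cg q x 0 \<longleftrightarrow> cg q y 0" if "cg q x y" for x y
    using that cg_trans[of q x y 0] cg_trans[of q y x 0] cg_sym by blast
  have "tris q = {t \<in> R \<times> R \<times> R. cg q ((fst (snd t) + snd (snd t)) * (fst t - fst (snd t)) * (fst t - snd (snd t))) 0}"
    unfolding tris_def R_def by auto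
  then have "real (card (tris q)) = (\<Sum>t\<in>R \<times> R \<times> R. ind (fst t) (fst (snd t)) (snd (snd t)))"
    unfolding ind_def using fR by (simp add: sum.If_cases Int_def)
  also have "\<dots> = (\<Sum>p1\<in>R. \<Sum>p2\<in>R. \<Sum>p3\<in>R. ind p1 p2 p3)"
    by (simp add: sum.cartesian_product case_prod_unfold)
  also have "\<dots> = (\<Sum>p1\<in>R. \<Sum>x\<in>R. \<Sum>y\<in>R. ind p1 (p1 - x) (p1 - y))"
  proof (rule sum.cong[OF refl])
    fix p1 assume p1: "p1 \<in> R"
    have inj: "cg q x y" if "cg q (p1 - x) (p1 - y)" for x y
      using cg_diff[OF cg_refl[of q p1] that] by simp
    have 1: "(\<Sum>y\<in>R. ind p1 p2 (p1 - y)) = (\<Sum>p3\<in>R. ind p1 p2 p3)" if "p2 \<in> \<O>" for p2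
      unfolding R_def
    proof (rule res_sum_reindex[OF q])
      show "periodic q (ind p1 p2)" unfolding periodic_def ind_def
        by (intro ballI impI if_cong refl cgi cg_mult cg_add cg_diff cg_refl) (use p1 RO that in auto)
    qed (use inj p1 RO in auto)
    have "(\<Sum>x\<in>R. \<Sum>y\<in>R. ind p1 (p1 - x) (p1 - y)) = (\<Sum>x\<in>R. \<Sum>p3\<in>R. ind p1 (p1 - x) p3)"
      by (intro sum.cong refl 1) (use p1 RO in auto)
    also have "\<dots> = (\<Sum>p2\<in>R. \<Sum>p3\<in>R. ind p1 p2 p3)"
      unfolding R_def
    proof (rule res_sum_reindex[OF q, where g = "\<lambda>p2. \<Sum>p3\<in>res q. ind p1 p2 p3"])
      show "periodic q (\<lambda>p2. \<Sum>p3\<in>res q. ind p1 p2 p3)" unfolding periodic_def ind_def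
        by (intro ballI impI sum.cong if_cong refl cgi cg_mult cg_add cg_diff cg_refl)
          (use p1 RO res_O in \<open>auto intro!: O_mult O_add O_diff\<close>)
    qed (use inj p1 RO in auto)
    finally show "(\<Sum>p2\<in>R. \<Sum>p3\<in>R. ind p1 p2 p3) = (\<Sum>x\<in>R. \<Sum>y\<in>R. ind p1 (p1 - x) (p1 - y))" by simp
  qed
  also have "\<dots> = (\<Sum>x\<in>R. \<Sum>y\<in>R. \<Sum>p1\<in>R. ind p1 (p1 - x) (p1 - y))"
    by (subst sum.swap, rule sum.cong[OF refl], rule sum.swap)
  also have "\<dots> \<le> (\<Sum>x\<in>R. \<Sum>y\<in>R. real (ann q (2 * x * y)))"
  proof (intro sum_mono)
    fix x y assume xy: "x \<in> R" "y \<in> R"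
    have e: "ind p (p - x) (p - y) = (if cg q (2 * x * y * p) ((x + y) * x * y) then 1 else 0)" for p
      unfolding ind_def cg_0_iff[of q "2 * x * y * p"] by (simp add: algebra_simps)
    have "(\<Sum>p1\<in>R. ind p1 (p1 - x) (p1 - y)) = real (card {p \<in> res q. cg q (2 * x * y * p) ((x + y) * x * y)})"
      unfolding e using fR unfolding R_def by (simp add: sum.If_cases Int_def)
    also have "\<dots> \<le> real (ann q (2 * x * y))"
      by (intro of_nat_mono card_linear_congruence_le[OF q]) (use xy RO in auto)
    finally show "(\<Sum>p1\<in>R. ind p1 (p1 - x) (p1 - y)) \<le> real (ann q (2 * x * y))" .
  qed
  also have "\<dots> \<le> (\<Sum>x\<in>R. \<Sum>y\<in>R. real (N q) / D + real (N q) * (\<Sum>d\<in>{0<..<D}. if cg q (of_nat (2 * d) * x * y) 0 then 1 else 0))"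
  proof (intro sum_mono)
    fix x y assume xy: "x \<in> R" "y \<in> R"
    have nn: "0 \<le> (\<Sum>d\<in>{0<..<D}. if cg q (of_nat (2 * d) * x * y) 0 then 1 else 0 :: real)"
      by (intro sum_nonneg) auto
    show "real (ann q (2 * x * y)) \<le> real (N q) / D + real (N q) * (\<Sum>d\<in>{0<..<D}. if cg q (of_nat (2 * d) * x * y) 0 then 1 else 0)"
    proof (cases "N q < D * ann q (2 * x * y)")
      case True
      have "2 * x * y \<in> \<O>" using xy RO by auto
      from large_annihilator_torsion[OF q this True] obtain d where d: "0 < d" "d < D" "cg q (of_nat d * (2 * x * y)) 0" by blast
      have "cg q (of_nat (2 * d) * x * y) 0" using d(3) by (simp add: ac_simps)
      then have "1 \<le> (\<Sum>d\<in>{0<..<D}. if cg q (of_nat (2 * d) * x * y) 0 then 1 else 0 :: real)"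
        using member_le_sum[of d "{0<..<D}" "\<lambda>d. if cg q (of_nat (2 * d) * x * y) 0 then 1 else 0 :: real"] d by auto
      then have "real (N q) * 1 \<le> real (N q) * (\<Sum>d\<in>{0<..<D}. if cg q (of_nat (2 * d) * x * y) 0 then 1 else 0 :: real)"
        by (intro mult_left_mono) auto
      moreover have "real (ann q (2 * x * y)) \<le> real (N q)" using ann_le_N[OF q(2)] by simp
      moreover have "0 \<le> real (N q) / D" by simp
      ultimately show ?thesis by linarith
    next
      case False
      then have "real (D * ann q (2 * x * y)) \<le> real (N q)" by linarith
      then have "real (ann q (2 * x * y)) \<le> real (N q) / D" using D by (simp add: field_simps)
      then show ?thesis using nn by (simp add: add_increasing2)
    qed
  qed
  also have "\<dots> = (real (N q))^3 / D + real (N q) * (\<Sum>x\<in>R. \<Sum>y\<in>R. \<Sum>d\<in>{0<..<D}. if cg q (of_nat (2 * d) * x * y) 0 then 1 else 0)"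
    by (simp add: sum.distrib sum_distrib_left[symmetric] N_def R_def power3_eq_cube)
  also have "(\<Sum>x\<in>R. \<Sum>y\<in>R. \<Sum>d\<in>{0<..<D}. if cg q (of_nat (2 * d) * x * y) 0 then 1 else 0)
      = (\<Sum>d\<in>{0<..<D}. \<Sum>x\<in>R. real (ann q (of_nat (2 * d) * x)))"
  proof -
    have "(\<Sum>x\<in>R. \<Sum>y\<in>R. \<Sum>d\<in>{0<..<D}. if cg q (of_nat (2 * d) * x * y) 0 then 1 else 0 :: real)
       = (\<Sum>x\<in>R. \<Sum>d\<in>{0<..<D}. \<Sum>y\<in>R. if cg q (of_nat (2 * d) * x * y) 0 then 1 else 0)"
      by (rule sum.cong[OF refl], rule sum.swap)
    also have "\<dots> = (\<Sum>x\<in>R. \<Sum>d\<in>{0<..<D}. real (ann q (of_nat (2 * d) * x)))"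
      unfolding ann_def using fR by (simp add: R_def sum.If_cases Int_def)
    also have "\<dots> = (\<Sum>d\<in>{0<..<D}. \<Sum>x\<in>R. real (ann q (of_nat (2 * d) * x)))" by (rule sum.swap)
    finally show ?thesis .
  qed
  also have "\<dots> \<le> (\<Sum>d\<in>{0<..<D}. (real (N q))\<^sup>2 / D\<^sup>2 + 4 * real (N q) * D^8)"
  proof (rule sum_mono)
    fix d assume d: "d \<in> {0<..<D}"
    have "(\<Sum>x\<in>R. real (ann q (of_nat (2 * d) * x))) \<le> (real (N q))\<^sup>2 / real (D\<^sup>2) + real (N q) * real (D\<^sup>2 * (D\<^sup>2 * (2 * d))\<^sup>2)"
      unfolding R_def by (rule sum_ann_le[OF q]) (use d D in auto)
    also have "\<dots> \<le> (real (N q))\<^sup>2 / real (D\<^sup>2) + real (N q) * real (D\<^sup>2 * (D\<^sup>2 * (2 * D))\<^sup>2)"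
      using d by (intro add_left_mono mult_left_mono of_nat_mono power_mono) auto
    finally show "(\<Sum>x\<in>R. real (ann q (of_nat (2 * d) * x))) \<le> (real (N q))\<^sup>2 / D\<^sup>2 + 4 * real (N q) * D^8"
      by (simp add: power_mult_distrib power_add[symmetric] power_mult[symmetric] mult.assoc mult.left_commute[of _ 4])
  qed
  also have "(\<Sum>d\<in>{0<..<D}. (real (N q))\<^sup>2 / D\<^sup>2 + 4 * real (N q) * D^8) \<le> D * ((real (N q))\<^sup>2 / D\<^sup>2 + 4 * real (N q) * D^8)"
    by (simp add: mult_right_mono)
  also have "\<dots> = (real (N q))\<^sup>2 / D + 4 * real (N q) * D^9"
    using D by (simp add: field_simps power2_eq_square power_Suc[symmetric] numeral_eq_Suc)
  finally have "real (card (tris q)) \<le> (real (N q))^3 / D + real (N q) * ((real (N q))\<^sup>2 / D + 4 * real (N q) * D^9)"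
    by (simp add: mult_left_mono)
  also have "\<dots> = (real (N q))^3 * (2 / D) + 4 * (real (N q))\<^sup>2 * D^9"
    by (simp add: algebra_simps power2_eq_square power3_eq_cube)
  finally show ?thesis by simp
qed

lemma kloo_trivial: "is_char c \<Longrightarrow> is_char d \<Longrightarrow> cmod (kloo c d q) \<le> card (ures q)"
proof -
  assume "is_char c" "is_char d"
  then have "cmod (c x * d y) = 1" for x y by (simp add: norm_mult char_norm)
  then show ?thesis unfolding kloo_def using norm_sum[of "\<lambda>p. c (p / q) * d (invq q p / q)" "ures q"] by simp
qed

text \<open>Bounding one factor trivially replaces the fourth moment by the fifth power and avoids a lower bound for
  the number of invertible residues.\<close>

lemma kloo_small:
  assumes c: "is_char c" and d: "is_char d" and "0 < e"
    and C: "\<And>q. q \<in> \<O> \<Longrightarrow> q \<noteq> 0 \<Longrightarrow> kernel_card c q \<le> C"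
  shows "\<exists>r>0. \<forall>q\<in>\<O>. r \<le> cmod q \<longrightarrow> cmod (kloo c d q) \<le> e * real (N q)"
proof -
  \<comment> \<open>A large \<open>D\<close> makes the first term of \<open>card_tris_le\<close> small, and a large \<open>q\<close>, depending on \<open>D\<close>, the second one.\<close>
  obtain D :: nat where "4 * (real C + 1) / e^5 < real D" using reals_Archimedean2 by blast
  moreover have "0 < 4 * (real C + 1) / e^5" using assms(3) by simp
  ultimately have D: "D > 0" "4 * (real C + 1) < e^5 * real D" using assms(3) by (auto simp: field_simps intro: gr0I)
  define r where "r = 1 + sqrt (8 * real C * D^9 / e^5)"
  have "r > 0" unfolding r_def using assms(3) by (simp add: add_pos_nonneg)
  moreover have "cmod (kloo c d q) \<le> e * real (N q)" if q: "q \<in> \<O>" "r \<le> cmod q" for q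
  proof -
    have q0: "q \<noteq> 0" using q \<open>r > 0\<close> by auto
    let ?S = "cmod (kloo c d q)" and ?N = "real (N q)"
    have "sqrt (8 * real C * D^9 / e^5) \<le> cmod q" using q unfolding r_def by simp
    then have "(sqrt (8 * real C * D^9 / e^5))\<^sup>2 \<le> (cmod q)\<^sup>2" using assms(3) by (intro power_mono) auto
    then have Nbig: "8 * real C * D^9 / e^5 \<le> ?N" using assms(3) N_eq[OF q(1) q0] by simp
    have N0: "?N > 0" using N_pos[OF q(1) q0] by simp
    have "?S^5 = ?S^4 * ?S" by (simp add: numeral_eq_Suc)
    also have "\<dots> \<le> ?S^4 * card (ures q)" by (intro mult_left_mono kloo_trivial[OF c d]) auto
    also have "\<dots> \<le> real (card (quads q)) * (?N\<^sup>2 * kernel_card c q)" by (rule kloo_fourth_moment[OF c d q(1) q0])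
    also have "\<dots> \<le> (?N^3 * (2 / D) + 4 * ?N\<^sup>2 * D^9) * (?N\<^sup>2 * real C)"
    proof (intro mult_mono)
      show "real (card (quads q)) \<le> ?N^3 * (2 / D) + 4 * ?N\<^sup>2 * D^9"
        using card_tris_le[OF q(1) q0 D(1)] quads_le_tris[OF q(1) q0] unfolding of_nat_power by linarith
    qed (use C[OF q(1) q0] in auto)
    also have "\<dots> = ?N^5 * (2 * real C / D) + ?N^4 * (4 * real C * D^9)"
      by (simp add: algebra_simps power2_eq_square numeral_eq_Suc)
    also have "\<dots> \<le> ?N^5 * (e^5 / 2) + ?N^4 * (e^5 / 2 * ?N)"
    proof (intro add_mono mult_left_mono)
      show "2 * real C / D \<le> e^5 / 2" using D by (simp add: field_simps)
      show "4 * real C * D^9 \<le> e^5 / 2 * ?N" using Nbig assms(3) by (simp add: field_simps)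
    qed auto
    also have "\<dots> = (e * ?N)^5" by (simp add: algebra_simps numeral_eq_Suc)
    finally have "?S^5 \<le> (e * ?N)^5" .
    moreover have "0 \<le> e * ?N" using assms(3) by simp
    ultimately show ?thesis using power_mono_iff[of ?S "e * ?N" 5] by simp
  qed
  ultimately show ?thesis by blast
qed

end

section \<open>Translation of Lebesgue measure\<close>

lemma translate_sets_borel:
  fixes S :: "'a::euclidean_space set"
  assumes "S \<in> sets borel" shows "(+) a ` S \<in> sets borel"
proof -
  have "(+) a ` S = (\<lambda>x. x - a) -` S \<inter> space borel" by (auto intro: image_eqI[of _ _ "x - a" for x])
  moreover have "(\<lambda>x. x - a) \<in> borel_measurable borel" by simp
  ultimately show ?thesis using measurable_sets[OF _ assms] by metis
qed

lemma emeasure_lborel_translate: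
  fixes S :: "'a::euclidean_space set"
  assumes S: "S \<in> sets borel" shows "emeasure lborel ((+) a ` S) = emeasure lborel S"
proof -
  have "emeasure lborel ((+) a ` S) = emeasure (distr lborel borel ((+) a)) ((+) a ` S)"
    by (simp add: lborel_distr_plus)
  also have "\<dots> = emeasure lborel ((+) a -` ((+) a ` S) \<inter> space lborel)"
    by (rule emeasure_distr) (use translate_sets_borel[OF S] in auto)
  also have "(+) a -` ((+) a ` S) \<inter> space lborel = S" by auto
  finally show ?thesis .
qed

section \<open>The density of comaximal pairs\<close>

context imaginary_order
begin

text \<open>Failure of comaximality modulo \<open>l\<close>.\<close>

definition bad :: "nat \<Rightarrow> complex \<Rightarrow> complex \<Rightarrow> bool" where
  "bad l p q \<longleftrightarrow> \<not> (\<exists>a\<in>\<O>. \<exists>b\<in>\<O>. \<exists>c\<in>\<O>. p * a + q * b + of_nat l * c = 1)"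

text \<open>Failure at a composite number implies failure at one of its factors, and \<open>q\<close> divides the positive integer \<open>\<bar>q\<bar>\<^sup>2\<close>.\<close>

lemma comaximal_local:
  assumes O: "p \<in> \<O>" "q \<in> \<O>" and q: "q \<noteq> 0"
  shows "comaximal K p q \<longleftrightarrow> (\<forall>l. prime l \<longrightarrow> \<not> bad l p q)"
proof
  assume "comaximal K p q"
  then obtain a b where "a \<in> \<O>" "b \<in> \<O>" "p * a + q * b = 1" using comaximal_iff[OF O] by blast
  then show "\<forall>l. prime l \<longrightarrow> \<not> bad l p q"
    unfolding bad_def by (intro allI impI notI) (metis O_0 add.right_neutral mult_zero_right)
next
  assume good: "\<forall>l. prime l \<longrightarrow> \<not> bad l p q"
  have *: "0 < n \<Longrightarrow> \<not> bad n p q" for n :: nat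
  proof (induction n rule: less_induct)
    case (less n)
    show ?case
    proof (cases "n = 1")
      case True
      have "p * 0 + q * 0 + of_nat n * 1 = 1" using True by simp
      then show ?thesis unfolding bad_def using O_0 O_1 by blast
    next
      case False
      then obtain l where l: "prime l" "l dvd n" using prime_factor_nat by blast
      then obtain m where m: "n = l * m" by blast
      have "m < n" "0 < m" using less.prems l(1) m prime_gt_1_nat[OF l(1)] by auto
      then have "\<not> bad m p q" using less.IH by blast
      then obtain a' b' c' where 1: "a' \<in> \<O>" "b' \<in> \<O>" "c' \<in> \<O>" "p * a' + q * b' + of_nat m * c' = 1"
        unfolding bad_def by blast
      have "\<not> bad l p q" using good l by blast
      then obtain a b c where 2: "a \<in> \<O>" "b \<in> \<O>" "c \<in> \<O>" "p * a + q * b + of_nat l * c = 1"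
        unfolding bad_def by blast
      have "1 = p * a + q * b + of_nat l * c * (p * a' + q * b' + of_nat m * c')" using 1(4) 2(4) by simp
      also have "\<dots> = p * (a + of_nat l * c * a') + q * (b + of_nat l * c * b') + of_nat n * (c * c')"
        unfolding m by (simp add: algebra_simps)
      finally have "p * (a + of_nat l * c * a') + q * (b + of_nat l * c * b') + of_nat n * (c * c') = 1" by simp
      moreover have "a + of_nat l * c * a' \<in> \<O>" "b + of_nat l * c * b' \<in> \<O>" "c * c' \<in> \<O>" using 1 2 by auto
      ultimately show ?thesis unfolding bad_def by blast
    qed
  qed
  obtain n :: nat where n: "(cmod q)\<^sup>2 = real n" "q * cnj q = of_nat n" using O_norm_int O by blast
  then have "n > 0" using q by (cases n) auto
  from *[OF this] obtain a b c where 1: "a \<in> \<O>" "b \<in> \<O>" "c \<in> \<O>" "p * a + q * b + of_nat n * c = 1"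
    unfolding bad_def by blast
  then have "p * a + q * (b + cnj q * c) = 1" unfolding n(2)[symmetric] by (simp add: algebra_simps)
  moreover have "b + cnj q * c \<in> \<O>" using 1 O O_cnj by blast
  ultimately show "comaximal K p q" using comaximal_iff[OF O] 1(1) by blast
qed

definition roots :: "nat \<Rightarrow> int set" where
  "roots l = {r \<in> {0..<int l}. int l dvd r\<^sup>2 - tr * r + nm}"

text \<open>The kernel of the homomorphism to the integers modulo \<open>l\<close> that sends \<open>w\<close> to the root \<open>r\<close> of its minimal polynomial.\<close>

definition root_ideal :: "nat \<Rightarrow> int \<Rightarrow> complex set" where
  "root_ideal l r = {of_int a + of_int b * w | a b. int l dvd a + b * r}"

definition multiples :: "nat \<Rightarrow> complex set" where
  "multiples l = (\<lambda>x. of_nat l * x) ` \<O>"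

text \<open>The ideals that can witness that two elements fail to be comaximal at a rational prime:
  the primes of residue degree one, or the prime itself if it is inert.\<close>

definition witnesses :: "nat \<Rightarrow> complex set set" where
  "witnesses l = (if roots l = {} then {multiples l} else root_ideal l ` roots l)"

lemma root_ideal_iff: "of_int a + of_int b * w \<in> root_ideal l r \<longleftrightarrow> int l dvd a + b * r"
proof
  assume "of_int a + of_int b * w \<in> root_ideal l r"
  then obtain c d where "of_int a + of_int b * w = of_int c + of_int d * w" "int l dvd c + d * r"
    unfolding root_ideal_def by blast
  moreover from this have "a = c" "b = d" by (metis co_of_int of_int_eq_iff)+
  ultimately show "int l dvd a + b * r" by simp
qed (auto simp: root_ideal_def)

lemma multiples_iff: "of_int a + of_int b * w \<in> multiples l \<longleftrightarrow> int l dvd a \<and> int l dvd b"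
proof
  assume "of_int a + of_int b * w \<in> multiples l"
  then obtain c d where "of_int a + of_int b * w = of_nat l * (of_int c + of_int d * w)"
    unfolding multiples_def by (auto elim!: O_E)
  then have "of_int a + of_int b * w = of_int (int l * c) + of_int (int l * d) * w" by (simp add: algebra_simps)
  then have "a = int l * c" "b = int l * d" by (metis co_of_int of_int_eq_iff)+
  then show "int l dvd a \<and> int l dvd b" by simp
next
  assume "int l dvd a \<and> int l dvd b"
  then obtain c d where "a = int l * c" "b = int l * d" by (auto elim!: dvdE)
  then have "of_int a + of_int b * w = of_nat l * (of_int c + of_int d * w)" by (simp add: algebra_simps)
  then show "of_int a + of_int b * w \<in> multiples l" unfolding multiples_def using O_I by blast
qed

lemma multiples_le_root_ideal: "multiples l \<subseteq> root_ideal l r"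
proof
  fix x assume x: "x \<in> multiples l"
  then have "x \<in> \<O>" unfolding multiples_def by auto
  then obtain a b where ab: "x = of_int a + of_int b * w" by (auto elim!: O_E)
  show "x \<in> root_ideal l r" using x unfolding ab multiples_iff root_ideal_iff by simp
qed

lemma witnesses_O: "J \<in> witnesses l \<Longrightarrow> J \<subseteq> \<O>"
  unfolding witnesses_def root_ideal_def multiples_def by (auto split: if_splits)

lemma witnesses_multiples: "J \<in> witnesses l \<Longrightarrow> multiples l \<subseteq> J"
  unfolding witnesses_def using multiples_le_root_ideal by (auto split: if_splits)

lemma witnesses_diff: "J \<in> witnesses l \<Longrightarrow> x \<in> J \<Longrightarrow> y \<in> J \<Longrightarrow> x - y \<in> J"
proof -
  assume J: "J \<in> witnesses l" "x \<in> J" "y \<in> J"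
  then obtain a b c d where xy: "x = of_int a + of_int b * w" "y = of_int c + of_int d * w"
    using witnesses_O by (meson O_E subsetD)
  have e: "x - y = of_int (a - c) + of_int (b - d) * w" unfolding xy by (simp add: algebra_simps)
  show ?thesis
  proof (cases "roots l = {}")
    case True
    then have "J = multiples l" using J(1) unfolding witnesses_def by simp
    then show ?thesis using J(2,3) unfolding e unfolding xy by (metis multiples_iff dvd_diff)
  next
    case False
    then obtain r where r: "J = root_ideal l r" using J(1) unfolding witnesses_def by auto
    have "a - c + (b - d) * r = (a + b * r) - (c + d * r)" by (simp add: algebra_simps)
    then show ?thesis using J(2,3) unfolding r e unfolding xy root_ideal_iff by (metis dvd_diff)
  qed
qed

lemma witnesses_mult: "J \<in> witnesses l \<Longrightarrow> x \<in> J \<Longrightarrow> k \<in> \<O> \<Longrightarrow> x * k \<in> J"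
proof -
  assume J: "J \<in> witnesses l" "x \<in> J" "k \<in> \<O>"
  then obtain a b c d where xy: "x = of_int a + of_int b * w" "k = of_int c + of_int d * w"
    using witnesses_O by (meson O_E subsetD)
  have e: "x * k = of_int (a * c - b * d * nm) + of_int (a * d + b * c + b * d * tr) * w"
  proof -
    have "x * k = of_int a * of_int c + (of_int a * of_int d + of_int b * of_int c) * w + of_int b * of_int d * (w * w)"
      unfolding xy by (simp add: algebra_simps)
    then show ?thesis unfolding w_sq by (simp add: algebra_simps)
  qed
  show ?thesis
  proof (cases "roots l = {}")
    case True
    then have "J = multiples l" using J(1) unfolding witnesses_def by simp
    then obtain y where "y \<in> \<O>" "x = of_nat l * y" using J(2) unfolding multiples_def by blast
    then show ?thesis using J(3) \<open>J = multiples l\<close> unfolding multiples_def by (auto simp: mult.assoc)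
  next
    case False
    then have "J \<in> root_ideal l ` roots l" using J(1) unfolding witnesses_def by simp
    then obtain r where r: "J = root_ideal l r" "int l dvd r\<^sup>2 - tr * r + nm"
      unfolding roots_def by blast
    have "a * c - b * d * nm + (a * d + b * c + b * d * tr) * r
        = (c + d * r) * (a + b * r) - b * d * (r\<^sup>2 - tr * r + nm)"
      by (simp add: algebra_simps power2_eq_square)
    moreover have "int l dvd (c + d * r) * (a + b * r) - b * d * (r\<^sup>2 - tr * r + nm)"
      using J(2) r(2) unfolding r(1) xy root_ideal_iff by (intro dvd_diff dvd_mult) auto
    ultimately show ?thesis unfolding r(1) e root_ideal_iff by simp
  qed
qed

text \<open>The ideal contains the norm \<open>n\<close> of \<open>x\<close>, and a rational integer in it is divisible by \<open>l\<close>.\<close>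

lemma witnesses_norm:
  assumes "J \<in> witnesses l" "x \<in> J" "x \<noteq> 0" "(cmod x)\<^sup>2 = real n"
  shows "l dvd n"
proof -
  have xO: "x \<in> \<O>" using assms witnesses_O by blast
  have "x * cnj x \<in> J" using witnesses_mult assms O_cnj[OF xO] by blast
  moreover have "x * cnj x = of_int (int n) + of_int 0 * w"
    using arg_cong[OF assms(4), of complex_of_real] unfolding complex_norm_square by simp
  ultimately have "of_int (int n) + of_int 0 * w \<in> J" by simp
  moreover have "J = multiples l \<or> (\<exists>r. J = root_ideal l r)" using assms(1) unfolding witnesses_def by (auto split: if_splits)
  ultimately have "int l dvd int n" using multiples_iff[of "int n" 0 l] root_ideal_iff[of "int n" 0 l] by auto
  then show ?thesis by simp
qed

lemma witnesses_norm_ge: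
  assumes "J \<in> witnesses l" "x \<in> J" "x \<noteq> 0" shows "real l \<le> (cmod x)\<^sup>2"
proof -
  have "x \<in> \<O>" using assms witnesses_O by blast
  then obtain n where n: "(cmod x)\<^sup>2 = real n" using O_norm_int by blast
  then have "n > 0" using assms(3) by (cases n) auto
  then show ?thesis using witnesses_norm[OF assms n] n by (simp add: dvd_imp_le)
qed

lemma card_roots:
  assumes l: "prime l" shows "card (roots l) \<le> 2" "finite (roots l)"
proof -
  show fin: "finite (roots l)" unfolding roots_def by (rule finite_subset[of _ "{0..<int l}"]) auto
  show "card (roots l) \<le> 2"
  proof (cases "roots l = {}")
    case False
    then obtain r where r: "r \<in> roots l" by blast
    have "roots l \<subseteq> {r, (tr - r) mod int l}"
    proof
      fix s assume s: "s \<in> roots l"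
      have "int l dvd (r\<^sup>2 - tr * r + nm) - (s\<^sup>2 - tr * s + nm)"
        by (rule dvd_diff) (use r s in \<open>unfold roots_def, blast\<close>)+
      also have "(r\<^sup>2 - tr * r + nm) - (s\<^sup>2 - tr * s + nm) = (r - s) * (r + s - tr)"
        by (simp add: algebra_simps power2_eq_square)
      finally have "int l dvd r - s \<or> int l dvd r + s - tr" using l by (simp add: prime_dvd_mult_iff)
      then show "s \<in> {r, (tr - r) mod int l}"
      proof
        assume "int l dvd r - s"
        then have "r mod int l = s mod int l" by (simp add: mod_eq_dvd_iff)
        then show ?thesis using r s unfolding roots_def by simp
      next
        assume "int l dvd r + s - tr"
        then have "s mod int l = (tr - r) mod int l" by (simp add: mod_eq_dvd_iff algebra_simps)
        then show ?thesis using s unfolding roots_def by simp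
      qed
    qed
    then have "card (roots l) \<le> card {r, (tr - r) mod int l}" by (intro card_mono) auto
    also have "\<dots> \<le> 2" by (simp add: card_insert_if)
    finally show ?thesis .
  qed simp
qed

lemma card_witnesses: "prime l \<Longrightarrow> card (witnesses l) \<le> 2" "prime l \<Longrightarrow> finite (witnesses l)"
  unfolding witnesses_def using card_image_le[of "roots l" "root_ideal l"] card_roots[of l] by auto

text \<open>The ideal \<open>J\<close> generated by \<open>p\<close>, \<open>q\<close> and \<open>l\<close> is proper. It consists of multiples of \<open>l\<close>, or it contains
  an element \<open>a + b * w\<close> with \<open>b\<close> invertible modulo \<open>l\<close>, which makes \<open>w\<close> congruent to an integer.\<close>

lemma bad_witness:
  assumes l: "prime l" and O: "p \<in> \<O>" "q \<in> \<O>" and bad: "bad l p q"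
  shows "\<exists>J\<in>witnesses l. p \<in> J \<and> q \<in> J"
proof -
  define J where "J = {p * a + q * b + of_nat l * c | a b c. a \<in> \<O> \<and> b \<in> \<O> \<and> c \<in> \<O>}"
  have J1: "1 \<notin> J"
  proof
    assume "1 \<in> J"
    then obtain a b c where "a \<in> \<O>" "b \<in> \<O>" "c \<in> \<O>" "1 = p * a + q * b + of_nat l * c" unfolding J_def by blast
    then show False using bad unfolding bad_def by metis
  qed
  have Jmult: "x * k \<in> J" if "x \<in> J" "k \<in> \<O>" for x k
  proof -
    obtain a b c where "a \<in> \<O>" "b \<in> \<O>" "c \<in> \<O>" "x = p * a + q * b + of_nat l * c" using \<open>x \<in> J\<close> unfolding J_def by blast
    moreover from this have "x * k = p * (a * k) + q * (b * k) + of_nat l * (c * k)" by (simp add: algebra_simps)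
    ultimately show ?thesis using that(2) unfolding J_def by blast
  qed
  have Jdiff: "x - y \<in> J" if "x \<in> J" "y \<in> J" for x y
  proof -
    obtain a b c where 1: "a \<in> \<O>" "b \<in> \<O>" "c \<in> \<O>" "x = p * a + q * b + of_nat l * c" using \<open>x \<in> J\<close> unfolding J_def by blast
    obtain a' b' c' where 2: "a' \<in> \<O>" "b' \<in> \<O>" "c' \<in> \<O>" "y = p * a' + q * b' + of_nat l * c'" using \<open>y \<in> J\<close> unfolding J_def by blast
    have "x - y = p * (a - a') + q * (b - b') + of_nat l * (c - c')" unfolding 1(4) 2(4) by (simp add: algebra_simps)
    then show ?thesis using 1 2 unfolding J_def by blast
  qed
  have Jc: "p * a + q * b + of_nat l * c \<in> J" if "a \<in> \<O>" "b \<in> \<O>" "c \<in> \<O>" for a b c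
    using that unfolding J_def by blast
  have Jp: "p \<in> J" and Jq: "q \<in> J" and Jl: "of_nat l \<in> J"
    using Jc[of 1 0 0] Jc[of 0 1 0] Jc[of 0 0 1] by auto
  have JO: "J \<subseteq> \<O>" unfolding J_def using O by auto
  have J0: "0 \<in> J" using Jdiff[OF Jp Jp] by simp
  have Jadd: "x + y \<in> J" if "x \<in> J" "y \<in> J" for x y
    using Jdiff[OF that(1) Jdiff[OF J0 that(2)]] by simp
  have Jint: "int l dvd n" if "of_int n \<in> J" for n
  proof (rule ccontr)
    assume "\<not> int l dvd n"
    moreover have "prime (int l)" using l by simp
    ultimately have "coprime (int l) n" by (simp add: prime_imp_coprime)
    then obtain u v where "u * int l + v * n = 1" using bezout_int[of "int l" n] by auto
    then have "of_nat l * of_int u + of_int n * of_int v = (1 :: complex)"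
      by (metis mult.commute of_int_1 of_int_add of_int_mult of_int_of_nat_eq)
    moreover have "of_nat l * of_int u \<in> J" "of_int n * of_int v \<in> J" using Jmult[OF Jl] Jmult[OF that] by auto
    ultimately show False using Jadd J1 by metis
  qed
  show ?thesis
  proof (cases "\<exists>a b. of_int a + of_int b * w \<in> J \<and> \<not> int l dvd b")
    case True
    then obtain a b where ab: "of_int a + of_int b * w \<in> J" "\<not> int l dvd b" by blast
    moreover have "prime (int l)" using l by simp
    ultimately have "coprime (int l) b" by (simp add: prime_imp_coprime)
    then obtain u v where uv: "u * int l + v * b = 1" using bezout_int[of "int l" b] by auto
    have "(of_int a + of_int b * w) * of_int v + of_nat l * (of_int u * w) \<in> J"
      by (intro Jadd Jmult ab Jl) auto
    also have "(of_int a + of_int b * w) * of_int v + of_nat l * (of_int u * w) = of_int (a * v) + of_int (u * int l + v * b) * w"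
      by (simp add: algebra_simps)
    finally have s: "of_int (a * v) + w \<in> J" unfolding uv by simp
    \<comment> \<open>So \<open>w\<close> is congruent to a rational integer \<open>r\<close> modulo \<open>J\<close>, and \<open>r\<close> is a root.\<close>
    define r where "r = (- (a * v)) mod int l"
    have "of_int (a * v) + w + of_nat l * of_int ((- (a * v)) div int l) \<in> J" by (intro Jadd Jmult s Jl) auto
    moreover have "w - of_int r = of_int (a * v) + w + of_nat l * of_int ((- (a * v)) div int l)"
    proof -
      have "- (a * v) = int l * ((- (a * v)) div int l) + r" unfolding r_def by simp
      then have h: "of_int (- (a * v)) = (of_int (int l * ((- (a * v)) div int l) + r) :: complex)" by simp
      have "of_int r = - of_int (a * v) - of_nat l * (of_int ((- (a * v)) div int l) :: complex)"
        using h unfolding of_int_add of_int_mult[of "int l"] of_int_of_nat_eq of_int_minus by (simp only: add_diff_cancel_left')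
      then show ?thesis by (simp only: diff_minus_eq_add diff_diff_eq2 minus_diff_eq) simp
    qed
    ultimately have wr: "w - of_int r \<in> J" by (simp only:)
    have "(w - of_int r) * (cnj w - of_int r) \<in> J" by (rule Jmult[OF wr]) (auto intro: O_cnj)
    also have "(w - of_int r) * (cnj w - of_int r) = of_int (r\<^sup>2 - tr * r + nm)"
    proof -
      have "(w - of_int r) * (cnj w - of_int r) = of_int tr * w - w * w - of_int tr * of_int r + of_int r * of_int r"
        unfolding cnj_w by (simp add: algebra_simps)
      then show ?thesis unfolding w_sq by (simp add: power2_eq_square algebra_simps)
    qed
    finally have "int l dvd r\<^sup>2 - tr * r + nm" by (rule Jint)
    then have r: "r \<in> roots l" unfolding roots_def r_def using prime_gt_0_nat[OF l] by simp
    have "x \<in> root_ideal l r" if "x \<in> J" for x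
    proof -
      obtain c d where x: "x = of_int c + of_int d * w" using \<open>x \<in> J\<close> JO by (meson O_E subsetD)
      have "x - (w - of_int r) * of_int d \<in> J" by (intro Jdiff Jmult that wr) auto
      also have "x - (w - of_int r) * of_int d = of_int (c + d * r)" unfolding x by (simp add: algebra_simps)
      finally show ?thesis unfolding x root_ideal_iff by (rule Jint)
    qed
    moreover have "root_ideal l r \<in> witnesses l" unfolding witnesses_def using r by auto
    ultimately show ?thesis using Jp Jq by blast
  next
    case False
    have m: "x \<in> multiples l" if "x \<in> J" for x
    proof -
      obtain a b where x: "x = of_int a + of_int b * w" using \<open>x \<in> J\<close> JO by (meson O_E subsetD)
      have b: "int l dvd b" using False that unfolding x by blast
      have "x * w \<in> J" using Jmult[OF that] by simp
      also have "x * w = of_int a * w + of_int b * (w * w)" unfolding x by (simp add: algebra_simps)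
      also have "\<dots> = of_int (- b * nm) + of_int (a + b * tr) * w" unfolding w_sq by (simp add: algebra_simps)
      finally have "of_int (- b * nm) + of_int (a + b * tr) * w \<in> J" .
      then have "int l dvd a + b * tr" using False by blast
      then have "int l dvd a" using b by (metis dvd_add_left_iff dvd_mult2)
      then show ?thesis using b unfolding x multiples_iff by blast
    qed
    obtain I where "I \<in> witnesses l" unfolding witnesses_def by (cases "roots l = {}") auto
    then show ?thesis using m[OF Jp] m[OF Jq] witnesses_multiples by blast
  qed
qed

lemma card_witness_res:
  assumes l: "prime l" and J: "J \<in> witnesses l"
  shows "card {x \<in> res (of_nat l). x \<in> J} \<le> l"
proof -
  have l0: "of_nat l \<noteq> (0::complex)" using prime_gt_0_nat[OF l] by simp
  define g where "g x = \<lfloor>co2 x\<rfloor> mod int l" for x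
  have "card {x \<in> res (of_nat l). x \<in> J} \<le> card {0..<int l}"
  proof (rule card_inj_on_le[of g])
    show "inj_on g {x \<in> res (of_nat l). x \<in> J}"
    proof (rule inj_onI)
      fix x y assume x: "x \<in> {x \<in> res (of_nat l). x \<in> J}" and y: "y \<in> {x \<in> res (of_nat l). x \<in> J}" and e: "g x = g y"
      have d: "x - y \<in> J" using witnesses_diff J x y by blast
      have "x \<in> \<O>" "y \<in> \<O>" using x y res_O by auto
      then obtain a b c d where ab: "x = of_int a + of_int b * w" "y = of_int c + of_int d * w"
        by (auto elim!: O_E)
      have bd: "int l dvd b - d" using e unfolding g_def ab co_of_int floor_of_int by (simp add: mod_eq_dvd_iff)
      have e2: "x - y = of_int (a - c) + of_int (b - d) * w" unfolding ab by (simp add: algebra_simps)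
      have "int l dvd a - c"
      proof (cases "roots l = {}")
        case True
        then have "J = multiples l" using J unfolding witnesses_def by simp
        then show ?thesis using d unfolding e2 multiples_iff by (simp only: multiples_iff)
      next
        case False
        then obtain r where r: "J = root_ideal l r" using J unfolding witnesses_def by auto
        show ?thesis using d bd unfolding r e2 root_ideal_iff by (metis dvd_add_left_iff dvd_mult2)
      qed
      then have "x - y \<in> multiples l" using bd unfolding e2 multiples_iff by blast
      then have "cg (of_nat l) x y" unfolding multiples_def cg_def by auto
      then show "x = y" using res_unique[OF l0] x y by blast
    qed
    show "g ` {x \<in> res (of_nat l). x \<in> J} \<subseteq> {0..<int l}" unfolding g_def using prime_gt_0_nat[OF l] by auto
  qed simp
  then show ?thesis by simp
qed

text \<open>Membership in \<open>J\<close> is periodic modulo \<open>q\<close> and modulo \<open>l\<close>, so the density can be computed modulo \<open>l\<close>.\<close>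

lemma witness_density:
  assumes l: "prime l" and J: "J \<in> witnesses l" and q: "q \<in> \<O>" "q \<noteq> 0" "q \<in> J"
  shows "real (card {x \<in> res q. x \<in> J}) / N q \<le> 1 / l"
proof -
  have l0: "of_nat l \<noteq> (0::complex)" using prime_gt_0_nat[OF l] by simp
  have lJ: "of_nat l \<in> J" using witnesses_multiples[OF J] unfolding multiples_def using O_1 by force
  have per: "periodic m (\<lambda>x. x \<in> J)" if "m \<in> J" for m
  proof -
    have *: "x \<in> J" if y: "y \<in> J" and c: "cg m x y" for x y
    proof -
      obtain k where "k \<in> \<O>" "x - y = m * k" using c unfolding cg_def by blast
      then have "x - y \<in> J" using witnesses_mult[OF J \<open>m \<in> J\<close>] by simp
      moreover have "0 \<in> J" using witnesses_diff[OF J y y] by simp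
      then have "0 - y \<in> J" using witnesses_diff[OF J _ y] by blast
      ultimately have "(x - y) - (0 - y) \<in> J" using witnesses_diff[OF J] by blast
      then show ?thesis by simp
    qed
    show ?thesis unfolding periodic_def using * cg_sym by blast
  qed
  have "real (card {x \<in> res q. x \<in> J}) / N q = real (card {x \<in> res (of_nat l). x \<in> J}) / N (of_nat l)"
    by (rule density_eq[OF q(1,2) _ l0 per[OF q(3)] per[OF lJ]]) simp
  also have "\<dots> \<le> real l / (real l)\<^sup>2"
    unfolding N_of_nat[OF prime_gt_0_nat[OF l]] of_nat_power
    by (intro divide_right_mono of_nat_mono card_witness_res[OF l J]) auto
  also have "\<dots> = 1 / l" using l0 by (simp add: power2_eq_square)
  finally show ?thesis .
qed

lemma bad_periodic1: "q \<in> \<O> \<Longrightarrow> periodic q (\<lambda>p. bad l p q)"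
proof -
  assume q: "q \<in> \<O>"
  have *: "\<not> bad l y q" if xy: "x \<in> \<O>" "y \<in> \<O>" "cg q x y" "\<not> bad l x q" for x y
  proof -
    obtain k where k: "k \<in> \<O>" "x - y = q * k" using xy unfolding cg_def by blast
    obtain a b c where 1: "a \<in> \<O>" "b \<in> \<O>" "c \<in> \<O>" "x * a + q * b + of_nat l * c = 1" using xy(4) unfolding bad_def by blast
    have "x = y + q * k" using k by (simp add: algebra_simps)
    then have "y * a + q * (b + k * a) + of_nat l * c = 1" using 1(4) by (simp add: algebra_simps)
    moreover have "b + k * a \<in> \<O>" using 1 k by blast
    ultimately show ?thesis unfolding bad_def using 1 by blast
  qed
  show ?thesis unfolding periodic_def using * cg_sym by blast
qed

lemma bad_sym: "bad l p q \<longleftrightarrow> bad l q p"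
  unfolding bad_def by (simp add: add.commute) metis

lemma bad_periodic2: "periodic (of_nat l) (\<lambda>p. bad l p q)"
proof -
  have *: "\<not> bad l y q" if xy: "x \<in> \<O>" "y \<in> \<O>" "cg (of_nat l) x y" "\<not> bad l x q" for x y
  proof -
    obtain k where k: "k \<in> \<O>" "x - y = of_nat l * k" using xy unfolding cg_def by blast
    obtain a b c where 1: "a \<in> \<O>" "b \<in> \<O>" "c \<in> \<O>" "x * a + q * b + of_nat l * c = 1" using xy(4) unfolding bad_def by blast
    have "x = y + of_nat l * k" using k by (simp add: algebra_simps)
    then have "y * a + q * b + of_nat l * (c + k * a) = 1" using 1(4) by (simp add: algebra_simps)
    moreover have "c + k * a \<in> \<O>" using 1 k by blast
    ultimately show ?thesis unfolding bad_def using 1 by blast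
  qed
  show ?thesis unfolding periodic_def using * cg_sym by blast
qed

definition unit_density :: "complex \<Rightarrow> real" where
  "unit_density q = real (card (ures q)) / N q"

text \<open>The density of the residues that are not excluded by the primes up to \<open>M\<close>.\<close>

definition sieved :: "nat \<Rightarrow> complex \<Rightarrow> complex \<Rightarrow> bool" where
  "sieved M p q \<longleftrightarrow> (\<forall>l. prime l \<and> l \<le> M \<longrightarrow> \<not> bad l p q)"

definition sieve_density :: "nat \<Rightarrow> complex \<Rightarrow> real" where
  "sieve_density M q = real (card {p \<in> res (of_nat (fact M)). sieved M p q}) / N (of_nat (fact M))"

lemma sieved_periodic1: "q \<in> \<O> \<Longrightarrow> periodic q (\<lambda>p. sieved M p q)"
  unfolding periodic_def sieved_def using bad_periodic1 unfolding periodic_def by blast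

lemma sieved_periodic2: "periodic (of_nat (fact M)) (\<lambda>p. sieved M p q)"
proof -
  have "bad l x q = bad l y q" if "x \<in> \<O>" "y \<in> \<O>" "cg (of_nat (fact M)) x y" "prime l" "l \<le> M" for l x y
  proof -
    have "l dvd fact M" using that prime_gt_0_nat[of l] by (intro dvd_fact) auto
    then obtain m where "(fact M :: nat) = l * m" by blast
    then have "cg (of_nat l) x y" using that(3) cg_dvd[of "of_nat l" "of_nat m" x y] by simp
    then show ?thesis using bad_periodic2[of l q] that(1,2) unfolding periodic_def by blast
  qed
  then show ?thesis unfolding periodic_def sieved_def by blast
qed

lemma sieve_density_periodic: "periodic (of_nat (fact M)) (sieve_density M)"
proof -
  have "sieved M p q = sieved M p q'" if "q \<in> \<O>" "q' \<in> \<O>" "cg (of_nat (fact M)) q q'" for p q q'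
    using sieved_periodic2[of M p] that unfolding periodic_def sieved_def bad_sym[of _ p] by blast
  note * = this
  show ?thesis unfolding periodic_def sieve_density_def
  proof (intro ballI impI)
    fix x y assume "x \<in> \<O>" "y \<in> \<O>" "cg (of_nat (fact M)) x y"
    from *[OF this] show "real (card {p \<in> res (of_nat (fact M)). sieved M p x}) / N (of_nat (fact M))
        = real (card {p \<in> res (of_nat (fact M)). sieved M p y}) / N (of_nat (fact M))" by (simp only:)
  qed
qed

lemma sieve_density_eq:
  assumes q: "q \<in> \<O>" "q \<noteq> 0"
  shows "sieve_density M q = real (card {p \<in> res q. sieved M p q}) / N q"
  unfolding sieve_density_def
  by (rule density_eq[OF O_nat _ q sieved_periodic2 sieved_periodic1[OF q(1)]]) simp

lemma unit_density_bounds: "0 \<le> unit_density q" "q \<noteq> 0 \<Longrightarrow> unit_density q \<le> 1"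
proof -
  show "0 \<le> unit_density q" unfolding unit_density_def by simp
  assume "q \<noteq> 0"
  then have "card (ures q) \<le> N q" unfolding N_def ures_def by (intro card_mono) auto
  then show "unit_density q \<le> 1" unfolding unit_density_def by (auto simp: divide_le_eq_1)
qed

text \<open>A pair that passes the sieve without being comaximal has a common witness ideal at a prime
  \<open>l > M\<close>, and \<open>l \<le> \<bar>q\<bar>\<^sup>2\<close> because the ideal contains \<open>q\<close>.\<close>

lemma sieve_tail:
  assumes q: "q \<in> \<O>" "q \<noteq> 0" "(cmod q)\<^sup>2 \<le> B"
  shows "\<bar>sieve_density M q - unit_density q\<bar>
    \<le> (\<Sum>l\<in>{l. prime l \<and> M < l \<and> real l \<le> B}. \<Sum>J\<in>{J \<in> witnesses l. q \<in> J}. 1 / l)"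
proof -
  let ?L = "{l. prime l \<and> M < l \<and> real l \<le> B}"
  have "?L \<subseteq> {..nat \<lfloor>B\<rfloor>}" by (auto simp: le_nat_floor)
  then have finL: "finite ?L" by (rule finite_subset) simp
  let ?S = "{p \<in> res q. sieved M p q}"
  let ?V = "\<Union>l\<in>?L. \<Union>J\<in>{J \<in> witnesses l. q \<in> J}. {p \<in> res q. p \<in> J}"
  have N0: "0 < real (N q)" using N_pos q by simp
  have U: "ures q = {p \<in> res q. \<forall>l. prime l \<longrightarrow> \<not> bad l p q}"
    unfolding ures_def using comaximal_local[OF _ q(1,2)] res_O by blast
  have 1: "ures q \<subseteq> ?S" unfolding U sieved_def by blast
  have "?S - ures q \<subseteq> ?V"
  proof
    fix p assume p: "p \<in> ?S - ures q"
    then obtain l where l: "prime l" "bad l p q" unfolding U by blast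
    then have "M < l" using p unfolding sieved_def by (auto simp: not_le[symmetric])
    obtain J where J: "J \<in> witnesses l" "p \<in> J" "q \<in> J" using bad_witness[OF l(1) _ q(1) l(2)] p res_O by blast
    have "real l \<le> B" using witnesses_norm_ge[OF J(1,3) q(2)] q(3) by linarith
    then show "p \<in> ?V" using p l \<open>M < l\<close> J by blast
  qed
  then have "card (?S - ures q) \<le> card ?V"
    by (rule card_mono[rotated]) (rule finite_subset[of _ "res q"], use q in auto)
  also have "\<dots> \<le> (\<Sum>l\<in>?L. card (\<Union>J\<in>{J \<in> witnesses l. q \<in> J}. {p \<in> res q. p \<in> J}))"
    by (rule card_UN_le[OF finL])
  also have "\<dots> \<le> (\<Sum>l\<in>?L. \<Sum>J\<in>{J \<in> witnesses l. q \<in> J}. card {p \<in> res q. p \<in> J})"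
    by (intro sum_mono card_UN_le) (use card_witnesses(2) in auto)
  finally have "card (?S - ures q) \<le> (\<Sum>l\<in>?L. \<Sum>J\<in>{J \<in> witnesses l. q \<in> J}. card {p \<in> res q. p \<in> J})" .
  then have *: "real (card (?S - ures q)) \<le> (\<Sum>l\<in>?L. \<Sum>J\<in>{J \<in> witnesses l. q \<in> J}. real (card {p \<in> res q. p \<in> J}))"
    by (simp only: of_nat_sum[symmetric] of_nat_le_iff)
  have c: "real (card (?S - ures q)) = real (card ?S) - real (card (ures q))"
    using 1 q by (simp add: card_Diff_subset card_mono of_nat_diff)
  have "card (ures q) \<le> card ?S" using 1 q by (intro card_mono) auto
  then have "\<bar>sieve_density M q - unit_density q\<bar> = real (card (?S - ures q)) / N q"
    unfolding sieve_density_eq[OF q(1,2)] unit_density_def c using N0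
    by (simp add: diff_divide_distrib[symmetric] abs_of_nonneg)
  also have "\<dots> \<le> (\<Sum>l\<in>?L. \<Sum>J\<in>{J \<in> witnesses l. q \<in> J}. real (card {p \<in> res q. p \<in> J})) / N q"
    using * N0 by (intro divide_right_mono) auto
  also have "\<dots> = (\<Sum>l\<in>?L. \<Sum>J\<in>{J \<in> witnesses l. q \<in> J}. real (card {p \<in> res q. p \<in> J}) / N q)"
    by (simp add: sum_divide_distrib)
  also have "\<dots> \<le> (\<Sum>l\<in>?L. \<Sum>J\<in>{J \<in> witnesses l. q \<in> J}. 1 / l)"
    by (intro sum_mono witness_density) (use q in auto)
  finally show ?thesis .
qed

end

section \<open>Mean values over lattice points in discs\<close>

lemma sum_inverse_squares_tail:
  assumes "0 < M" "finite L" "L \<subseteq> {M<..}"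
  shows "(\<Sum>l\<in>L. 1 / (real l)\<^sup>2) \<le> 1 / M"
proof -
  have *: "(\<Sum>l\<in>{M<..M + k}. 1 / (real l)\<^sup>2) \<le> 1 / M - 1 / real (M + k)" for k
  proof (induction k)
    case (Suc k)
    have e: "{M<..M + Suc k} = insert (M + Suc k) {M<..M + k}" by auto
    have "1 / (real (M + Suc k))\<^sup>2 \<le> 1 / (real (M + k) * real (M + Suc k))"
      unfolding power2_eq_square using assms(1) by (intro divide_left_mono mult_right_mono mult_pos_pos) auto
    also have "\<dots> = 1 / real (M + k) - 1 / real (M + Suc k)" using assms(1) by (simp add: field_simps)
    finally show ?case using Suc.IH unfolding e by simp
  qed simp
  obtain k where k: "L \<subseteq> {..k}" using assms(2) finite_nat_iff_bounded_le by blast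
  have "(\<Sum>l\<in>L. 1 / (real l)\<^sup>2) \<le> (\<Sum>l\<in>{M<..M + k}. 1 / (real l)\<^sup>2)"
  proof (rule sum_mono2)
    show "L \<subseteq> {M<..M + k}"
    proof
      fix x assume "x \<in> L"
      then have "x \<in> {M<..}" "x \<in> {..k}" using assms(3) k by blast+
      then show "x \<in> {M<..M + k}" by simp
    qed
  qed auto
  also have "\<dots> \<le> 1 / M - 1 / real (M + k)" by (rule *)
  also have "\<dots> \<le> 1 / M" by simp
  finally show ?thesis .
qed

text \<open>The sum over the primes is below one half: the summands 2, 3, 5 are explicit and the
  remaining odd numbers \<open>2k+1\<close> are compared with the telescoping \<open>1 / (4k(k+1))\<close>.\<close>

lemma sum_prime_inverse_squares:
  assumes "finite L" "\<And>l. l \<in> L \<Longrightarrow> prime l"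
  shows "(\<Sum>l\<in>L. 1 / (real l)\<^sup>2) \<le> 49 / 100"
proof -
  obtain k where k: "L \<subseteq> {..k}" using assms(1) finite_nat_iff_bounded_le by blast
  have *: "(\<Sum>i\<in>{3..<3 + k}. 1 / (real (2 * i + 1))\<^sup>2) \<le> 1 / 12 - 1 / (4 * real (3 + k))" for k
  proof (induction k)
    case (Suc k)
    let ?i = "3 + k"
    have "1 / (real (2 * ?i + 1))\<^sup>2 \<le> 1 / (4 * real ?i * real (?i + 1))"
    proof (intro divide_left_mono)
      show "4 * real ?i * real (?i + 1) \<le> (real (2 * ?i + 1))\<^sup>2" by (simp add: power2_eq_square algebra_simps)
      have "0 < real (2 * ?i + 1)" "0 < real ?i" "0 < real (?i + 1)" by linarith+
      then show "0 < (real (2 * ?i + 1))\<^sup>2 * (4 * real ?i * real (?i + 1))" by (intro mult_pos_pos zero_less_power) auto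
    qed simp
    also have "\<dots> = 1 / (4 * real ?i) - 1 / (4 * real (?i + 1))"
    proof -
      have "1 / (4 * x * (x + 1)) = 1 / (4 * x) - 1 / (4 * (x + 1))" if "0 < x" for x :: real
        using that by (simp add: field_simps)
      from this[of "real ?i"] show ?thesis by (simp add: add.commute)
    qed
    finally have 1: "1 / (real (2 * ?i + 1))\<^sup>2 \<le> 1 / (4 * real ?i) - 1 / (4 * real (?i + 1))" .
    have 2: "(\<Sum>i\<in>{3..<3 + Suc k}. 1 / (real (2 * i + 1))\<^sup>2) = (\<Sum>i\<in>{3..<3 + k}. 1 / (real (2 * i + 1))\<^sup>2) + 1 / (real (2 * ?i + 1))\<^sup>2"
      unfolding add_Suc_right by (rule sum.atLeastLessThan_Suc) simp
    have 3: "?i + 1 = 3 + Suc k" by simp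
    show ?case using 1 Suc.IH unfolding 2 3 by linarith
  qed simp
  have "L \<subseteq> {2, 3, 5} \<union> (\<lambda>i. 2 * i + 1) ` {3..<3 + k}"
  proof
    fix l assume l: "l \<in> L"
    then have p: "prime l" using assms(2) by blast
    show "l \<in> {2, 3, 5} \<union> (\<lambda>i. 2 * i + 1) ` {3..<3 + k}"
    proof (cases "l \<le> 6")
      case True
      then have "l \<in> {0,1,2,3,4,5,6}" by auto
      then show ?thesis using p prime_odd_nat[of l] by auto
    next
      case False
      then have "odd l" using p prime_odd_nat[of l] by simp
      then obtain i where "l = 2 * i + 1" by (elim oddE)
      then show ?thesis using False k l by auto
    qed
  qed
  then have "(\<Sum>l\<in>L. 1 / (real l)\<^sup>2) \<le> (\<Sum>l\<in>{2, 3, 5} \<union> (\<lambda>i. 2 * i + 1) ` {3..<3 + k}. 1 / (real l)\<^sup>2)"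
    by (intro sum_mono2) auto
  also have "\<dots> \<le> (\<Sum>l\<in>{2, 3, 5::nat}. 1 / (real l)\<^sup>2) + (\<Sum>l\<in>(\<lambda>i. 2 * i + 1) ` {3..<3 + k}. 1 / (real l)\<^sup>2)"
    by (subst sum.union_disjoint) auto
  also have "(\<Sum>l\<in>(\<lambda>i. 2 * i + 1) ` {3..<3 + k}. 1 / (real l)\<^sup>2) = (\<Sum>i\<in>{3..<3 + k}. 1 / (real (2 * i + 1))\<^sup>2)"
    by (rule sum.reindex_cong[of "\<lambda>i. 2 * i + 1"]) (auto simp: inj_on_def)
  also have "\<dots> \<le> 1 / 12 - 1 / (4 * real (3 + k))" by (rule *)
  also have "\<dots> \<le> 1 / 12" by simp
  also have "(\<Sum>l\<in>{2, 3, 5::nat}. 1 / (real l)\<^sup>2) = 1/4 + 1/9 + 1/25" by simp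
  finally show ?thesis by simp
qed

text \<open>If the partial sums of nonnegative weights grow quadratically, then the moments of the weights
  are those of the density \<open>2 u\<close> on the unit interval (summation by parts).\<close>

lemma moments_of_quadratic_growth:
  fixes a :: "'a \<Rightarrow> real" and s :: "'a \<Rightarrow> real" and X :: "'a set"
  assumes fin: "\<And>R. finite {x \<in> X. s x \<le> R}" and s: "\<And>x. x \<in> X \<Longrightarrow> 0 \<le> s x"
    and bound: "\<And>R. 0 \<le> R \<Longrightarrow> \<bar>\<Sum>x\<in>{x \<in> X. s x \<le> R}. a x\<bar> \<le> C * R\<^sup>2"
    and lim: "((\<lambda>R. (\<Sum>x\<in>{x \<in> X. s x \<le> R}. a x) / R\<^sup>2) \<longlongrightarrow> k) at_top"
  shows "((\<lambda>R. (\<Sum>x\<in>{x \<in> X. s x \<le> R}. a x * (s x / R) ^ j) / R\<^sup>2) \<longlongrightarrow> 2 * k / (real j + 2)) at_top"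
proof (cases j)
  case 0
  then show ?thesis using lim by simp
next
  case (Suc i)
  define A where "A R = (\<Sum>x\<in>{x \<in> X. s x \<le> R}. a x)" for R
  define I where "I R = (\<integral>u. A (R * u) / R\<^sup>2 * (real j * u ^ i) * indicator {0..1} u \<partial>lborel)" for R
  have C0: "0 \<le> C" using bound[of 1] by simp
  have pw: "(\<integral>u. real j * u ^ i * indicator {c..1} u \<partial>lborel) = 1 - c ^ j" if "0 \<le> c" "c \<le> 1" for c
  proof -
    have "(\<integral>u. real j * u ^ i * indicator {c..1} u \<partial>lborel) = real j * (\<integral>u. u ^ i * indicator {c..1} u \<partial>lborel)"
      by (simp add: mult.assoc)
    also have "\<dots> = 1 - c ^ j" using integral_power[OF that(2), of i] Suc by simp
    finally show ?thesis .
  qed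
  have int_pw: "integrable lborel (\<lambda>u. real j * u ^ i * indicator {c..1} u)" for c
  proof -
    have "set_integrable lborel {c..1} (\<lambda>u. real j * u ^ i)"
      by (rule borel_integrable_atLeastAtMost') (intro continuous_intros)
    then show ?thesis unfolding set_integrable_def by (simp add: mult.commute)
  qed
  have rewrite: "A (R * u) / R\<^sup>2 * (real j * u ^ i) * indicator {0..1} u
      = (\<Sum>x\<in>{x \<in> X. s x \<le> R}. a x / R\<^sup>2 * (real j * u ^ i * indicator {s x / R..1} u))" if R: "0 < R" for R u
  proof (cases "0 \<le> u \<and> u \<le> 1")
    case True
    then have "R * u \<le> R" using R by simp
    have "{x \<in> X. s x \<le> R * u} = {x \<in> X. s x \<le> R} \<inter> {x. s x / R \<le> u}"
      using R order_trans[OF _ \<open>R * u \<le> R\<close>] by (auto simp: field_simps)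
    then have "A (R * u) = (\<Sum>x\<in>{x \<in> X. s x \<le> R}. if s x / R \<le> u then a x else 0)"
      unfolding A_def using fin[of R] by (simp add: sum.inter_restrict)
    then have "A (R * u) / R\<^sup>2 * (real j * u ^ i) * indicator {0..1} u
      = (\<Sum>x\<in>{x \<in> X. s x \<le> R}. (if s x / R \<le> u then a x else 0) / R\<^sup>2 * (real j * u ^ i))"
      using True by (simp add: sum_divide_distrib sum_distrib_right)
    also have "\<dots> = (\<Sum>x\<in>{x \<in> X. s x \<le> R}. a x / R\<^sup>2 * (real j * u ^ i * indicator {s x / R..1} u))"
      using True by (intro sum.cong refl) (auto simp: indicator_def)
    finally show ?thesis .
  next
    case False
    have "indicator {s x / R..1} u = (0::real)" if "x \<in> X" for x
    proof -
      have "0 \<le> s x / R" using s[OF that] R by simp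
      then show ?thesis using False by (auto simp: indicator_def)
    qed
    then show ?thesis using False by (auto intro!: sum.neutral[symmetric])
  qed
  have IR: "I R = A R / R\<^sup>2 - (\<Sum>x\<in>{x \<in> X. s x \<le> R}. a x * (s x / R) ^ j) / R\<^sup>2" if R: "0 < R" for R
  proof -
    have "I R = (\<integral>u. (\<Sum>x\<in>{x \<in> X. s x \<le> R}. a x / R\<^sup>2 * (real j * u ^ i * indicator {s x / R..1} u)) \<partial>lborel)"
      unfolding I_def rewrite[OF R] ..
    also have "\<dots> = (\<Sum>x\<in>{x \<in> X. s x \<le> R}. \<integral>u. a x / R\<^sup>2 * (real j * u ^ i * indicator {s x / R..1} u) \<partial>lborel)"
      by (rule Bochner_Integration.integral_sum) (intro integrable_mult_right int_pw)
    also have "\<dots> = (\<Sum>x\<in>{x \<in> X. s x \<le> R}. a x / R\<^sup>2 * (1 - (s x / R) ^ j))"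
      by (intro sum.cong refl) (use s R in \<open>simp add: pw\<close>)
    also have "\<dots> = A R / R\<^sup>2 - (\<Sum>x\<in>{x \<in> X. s x \<le> R}. a x * (s x / R) ^ j) / R\<^sup>2"
      unfolding A_def by (simp add: right_diff_distrib sum_subtractf sum_divide_distrib)
    finally show ?thesis .
  qed
  have meas: "(\<lambda>u. A (R * u) / R\<^sup>2 * (real j * u ^ i) * indicator {0..1} u) \<in> borel_measurable lborel" if "0 < R" for R
    unfolding rewrite[OF that] by measurable
  have Ilim: "(I \<longlongrightarrow> (\<integral>u. k * u\<^sup>2 * (real j * u ^ i) * indicator {0..1} u \<partial>lborel)) at_top"
  proof (rule tendsto_at_topI_sequentially)
    fix Y :: "nat \<Rightarrow> real" assume Y: "filterlim Y at_top sequentially"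
    then obtain n0 where n0: "\<And>n. n \<ge> n0 \<Longrightarrow> 0 < Y n"
      unfolding filterlim_at_top_dense eventually_sequentially by meson
    have Y': "filterlim (\<lambda>n. Y (n + n0)) at_top sequentially"
      using filterlim_compose[OF Y filterlim_add_const_nat_at_top] by simp
    have "(\<lambda>n. I (Y (n + n0))) \<longlonglongrightarrow> (\<integral>u. k * u\<^sup>2 * (real j * u ^ i) * indicator {0..1} u \<partial>lborel)"
      unfolding I_def
    proof (rule integral_dominated_convergence[where w = "\<lambda>u. C * real j * indicator {0..1} u"])
      show "(\<lambda>u. A (Y (n + n0) * u) / (Y (n + n0))\<^sup>2 * (real j * u ^ i) * indicator {0..1} u) \<in> borel_measurable lborel" for n
        by (rule meas) (simp add: n0)
      show "integrable lborel (\<lambda>u. C * real j * indicator {0..1::real} u)" by simp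
      show "AE u in lborel. norm (A (Y (n + n0) * u) / (Y (n + n0))\<^sup>2 * (real j * u ^ i) * indicator {0..1} u) \<le> C * real j * indicator {0..1} u" for n
      proof (rule AE_I2)
        fix u :: real
        have R: "0 < Y (n + n0)" by (simp add: n0)
        show "norm (A (Y (n + n0) * u) / (Y (n + n0))\<^sup>2 * (real j * u ^ i) * indicator {0..1} u) \<le> C * real j * indicator {0..1} u"
        proof (cases "0 \<le> u \<and> u \<le> 1")
          case True
          have "\<bar>A (Y (n + n0) * u)\<bar> / (Y (n + n0))\<^sup>2 \<le> C * u\<^sup>2"
            using bound[of "Y (n + n0) * u"] R True unfolding A_def by (simp add: field_simps power_mult_distrib)
          also have "\<dots> \<le> C" using True C0 by (simp add: mult_left_le power_le_one)
          finally have "\<bar>A (Y (n + n0) * u)\<bar> / (Y (n + n0))\<^sup>2 * (real j * u ^ i) \<le> C * real j"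
            using True C0 by (intro mult_mono) (auto simp: mult_left_le power_le_one)
          then show ?thesis using True by (simp add: abs_mult)
        qed auto
      qed
      show "AE u in lborel. (\<lambda>n. A (Y (n + n0) * u) / (Y (n + n0))\<^sup>2 * (real j * u ^ i) * indicator {0..1} u)
          \<longlonglongrightarrow> k * u\<^sup>2 * (real j * u ^ i) * indicator {0..1} u"
      proof (rule AE_I2)
        fix u :: real
        show "(\<lambda>n. A (Y (n + n0) * u) / (Y (n + n0))\<^sup>2 * (real j * u ^ i) * indicator {0..1} u)
          \<longlonglongrightarrow> k * u\<^sup>2 * (real j * u ^ i) * indicator {0..1} u"
        proof (cases "0 < u")
          case True
          have "filterlim (\<lambda>n. Y (n + n0) * u) at_top sequentially"
            by (rule filterlim_at_top_mult_tendsto_pos[OF tendsto_const True Y'])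
          from filterlim_compose[OF lim[folded A_def] this]
          have "(\<lambda>n. A (Y (n + n0) * u) / (Y (n + n0) * u)\<^sup>2 * u\<^sup>2) \<longlonglongrightarrow> k * u\<^sup>2"
            by (intro tendsto_mult_right)
          moreover have "A (Y (n + n0) * u) / (Y (n + n0) * u)\<^sup>2 * u\<^sup>2 = A (Y (n + n0) * u) / (Y (n + n0))\<^sup>2" for n
            using True by (simp add: power_mult_distrib)
          ultimately show ?thesis by (intro tendsto_mult_right) simp
        next
          case False
          have "A 0 = 0" using bound[of 0] unfolding A_def by simp
          then show ?thesis using False by (cases "u = 0") auto
        qed
      qed
    qed simp
    then show "(\<lambda>n. I (Y n)) \<longlonglongrightarrow> (\<integral>u. k * u\<^sup>2 * (real j * u ^ i) * indicator {0..1} u \<partial>lborel)"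
      using LIMSEQ_offset[of "\<lambda>n. I (Y n)" n0] by simp
  qed
  have val: "(\<integral>u. k * u\<^sup>2 * (real j * u ^ i) * indicator {0..1} u \<partial>lborel) = k * real j / (j + 2)"
  proof -
    have "(\<integral>u. k * u\<^sup>2 * (real j * u ^ i) * indicator {0..1} u \<partial>lborel)
      = (\<integral>u. (k * real j) * (u ^ (i + 2) * indicator {0..1} u) \<partial>lborel)"
      by (intro Bochner_Integration.integral_cong refl) (simp add: power_add power2_eq_square)
    also have "\<dots> = (k * real j) * (1 / real (Suc (i + 2)))"
      using integral_power[of 0 1 "i + 2"] by simp
    finally show ?thesis using Suc by (simp add: add.commute)
  qed
  have "((\<lambda>R. A R / R\<^sup>2 - I R) \<longlongrightarrow> k - k * real j / (j + 2)) at_top"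
    using tendsto_diff[OF lim[folded A_def] Ilim] unfolding val .
  also have "k - k * real j / (j + 2) = 2 * k / (real j + 2)" by (simp add: field_simps)
  finally show ?thesis
    by (rule Lim_transform_eventually)
      (use IR in \<open>auto intro!: eventually_mono[OF eventually_gt_at_top[of 0]]\<close>)
qed

context imaginary_order
begin

lemma co_cont: "continuous_on UNIV co1" "continuous_on UNIV co2"
  unfolding co1_def co2_def by (intro continuous_intros; use Im_w in simp)+

lemma co_measurable [measurable]: "co1 \<in> borel_measurable borel" "co2 \<in> borel_measurable borel"
  using co_cont by (auto intro: borel_measurable_continuous_onI)

lemma para_borel [measurable]: "para \<in> sets borel"
  unfolding para_def by measurable

definition diam :: real where "diam = 1 + cmod w"

lemma diam_pos: "0 < diam" unfolding diam_def by (simp add: add_pos_nonneg)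

definition area :: real where "area = measure lborel para"

lemma para_finite: "emeasure lborel para < \<infinity>"
proof -
  have "para \<subseteq> cball 0 diam" using para_bound unfolding diam_def by auto
  then have "emeasure lborel para \<le> emeasure lborel (cball (0::complex) diam)" by (intro emeasure_mono) auto
  also have "\<dots> < \<infinity>" by (rule emeasure_lborel_cball_finite)
  finally show ?thesis .
qed

text \<open>The translates of the parallelogram by lattice points are disjoint.\<close>

lemma cells_measure:
  assumes "finite S" "S \<subseteq> \<O>"
  shows "measure lborel (\<Union>k\<in>S. (+) k ` para) = card S * area"
proof -
  have e: "emeasure lborel ((+) k ` para) = emeasure lborel para" for k
    by (rule emeasure_lborel_translate[OF para_borel])
  have "measure lborel (\<Union>k\<in>S. (+) k ` para) = (\<Sum>k\<in>S. measure lborel ((+) k ` para))"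
  proof (rule measure_finite_Union[OF assms(1)])
    show "(\<lambda>k. (+) k ` para) ` S \<subseteq> sets lborel" using translate_sets_borel[OF para_borel] by auto
    show "disjoint_family_on (\<lambda>k. (+) k ` para) S" unfolding disjoint_family_on_def
    proof (intro ballI impI)
      fix m n assume mn: "m \<in> S" "n \<in> S" "m \<noteq> n"
      show "(+) m ` para \<inter> (+) n ` para = {}"
      proof (rule ccontr)
        assume "(+) m ` para \<inter> (+) n ` para \<noteq> {}"
        then obtain x y where xy: "x \<in> para" "y \<in> para" "m + x = n + y" by auto
        then have "x - y = n - m" by (simp add: algebra_simps)
        then have "x - y \<in> \<O>" using mn assms(2) by auto
        then have "x = y" using para_unique xy by blast
        then show False using xy mn by simp
      qed
    qed
    show "emeasure lborel ((+) i ` para) \<noteq> \<infinity>" if "i \<in> S" for i using e para_finite by simp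
  qed
  then show ?thesis using e by (simp add: measure_def area_def)
qed

definition disc_count :: "real \<Rightarrow> nat" where "disc_count R = card {k \<in> \<O>. cmod k \<le> R}"

lemma disc_count_upper: "0 \<le> R \<Longrightarrow> disc_count R * area \<le> pi * (R + diam)\<^sup>2"
proof -
  assume R: "0 \<le> R"
  have "disc_count R * area = measure lborel (\<Union>k\<in>{k \<in> \<O>. cmod k \<le> R}. (+) k ` para)"
    unfolding disc_count_def by (rule cells_measure[symmetric]) (auto intro: O_ball_finite)
  also have "\<dots> \<le> measure lborel (cball (0::complex) (R + diam))"
  proof (rule measure_mono_fmeasurable)
    show "(\<Union>k\<in>{k \<in> \<O>. cmod k \<le> R}. (+) k ` para) \<subseteq> cball 0 (R + diam)"
    proof
      fix y assume "y \<in> (\<Union>k\<in>{k \<in> \<O>. cmod k \<le> R}. (+) k ` para)"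
      then obtain k z where "cmod k \<le> R" "z \<in> para" "y = k + z" by auto
      then show "y \<in> cball 0 (R + diam)" using norm_triangle_mono[OF _ para_bound] unfolding diam_def by simp
    qed
    show "(\<Union>k\<in>{k \<in> \<O>. cmod k \<le> R}. (+) k ` para) \<in> sets lborel"
      using translate_sets_borel[OF para_borel] O_ball_finite by (auto intro!: sets.finite_UN)
  qed (use emeasure_lborel_cball_finite[of "0::complex" "R + diam"] in \<open>simp add: fmeasurable_def\<close>)
  also have "\<dots> = pi * (R + diam)\<^sup>2"
    using content_cball[of "R + diam" "0::complex"] R diam_pos by (simp add: unit_ball_vol_2)
  finally show ?thesis .
qed

lemma disc_count_lower: "diam \<le> R \<Longrightarrow> pi * (R - diam)\<^sup>2 \<le> disc_count R * area"
proof -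
  assume R: "diam \<le> R"
  have "pi * (R - diam)\<^sup>2 = measure lborel (cball (0::complex) (R - diam))"
    using content_cball[of "R - diam" "0::complex"] R by (simp add: unit_ball_vol_2)
  also have "\<dots> \<le> measure lborel (\<Union>k\<in>{k \<in> \<O>. cmod k \<le> R}. (+) k ` para)"
  proof (rule measure_mono_fmeasurable)
    show "cball 0 (R - diam) \<subseteq> (\<Union>k\<in>{k \<in> \<O>. cmod k \<le> R}. (+) k ` para)"
    proof
      fix z assume z: "z \<in> cball (0::complex) (R - diam)"
      have "cmod (fl z) \<le> cmod z + cmod (z - fl z)" by (metis norm_minus_commute norm_triangle_sub)
      also have "\<dots> \<le> (R - diam) + diam"
        using z para_bound[OF diff_fl_para[of z]] unfolding diam_def by (intro add_mono) auto
      finally show "z \<in> (\<Union>k\<in>{k \<in> \<O>. cmod k \<le> R}. (+) k ` para)"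
        using diff_fl_para[of z] by (intro UN_I[of "fl z"]) (auto intro: image_eqI[of _ _ "z - fl z"])
    qed
    have fin: "finite {k \<in> \<O>. cmod k \<le> R}" by (rule O_ball_finite)
    have "emeasure lborel (\<Union>k\<in>{k \<in> \<O>. cmod k \<le> R}. (+) k ` para) \<le> (\<Sum>k\<in>{k \<in> \<O>. cmod k \<le> R}. emeasure lborel ((+) k ` para))"
      by (rule emeasure_subadditive_finite) (use fin translate_sets_borel[OF para_borel] in auto)
    also have "\<dots> < \<infinity>" unfolding emeasure_lborel_translate[OF para_borel] using para_finite
      by (simp add: ennreal_mult_less_top of_nat_less_top)
    finally show "(\<Union>k\<in>{k \<in> \<O>. cmod k \<le> R}. (+) k ` para) \<in> fmeasurable lborel"
      by (intro fmeasurableI sets.finite_UN fin) (use translate_sets_borel[OF para_borel] in simp_all)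
  qed auto
  also have "\<dots> = disc_count R * area"
    unfolding disc_count_def by (rule cells_measure) (auto intro: O_ball_finite)
  finally show ?thesis .
qed

lemma area_pos: "0 < area"
proof (rule ccontr)
  assume "\<not> 0 < area"
  then have "area = 0" unfolding area_def using measure_nonneg[of lborel para] by linarith
  then show False using disc_count_lower[of "diam + 1"] pi_gt_zero by simp
qed

lemma shifted_square_limit: "((\<lambda>R::real. c * (R + b)\<^sup>2 / R\<^sup>2) \<longlongrightarrow> c) at_top"
proof -
  have "((\<lambda>R::real. b / R) \<longlongrightarrow> 0) at_top"
    by (rule tendsto_divide_0[OF tendsto_const filterlim_at_top_imp_at_infinity[OF filterlim_ident]])
  then have "((\<lambda>R::real. c * (1 + b / R)\<^sup>2) \<longlongrightarrow> c * (1 + 0)\<^sup>2) at_top"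
    by (intro tendsto_intros)
  then have "((\<lambda>R::real. c * (1 + b / R)\<^sup>2) \<longlongrightarrow> c) at_top" by simp
  then show ?thesis
  proof (rule Lim_transform_eventually)
    show "\<forall>\<^sub>F R in at_top. c * (1 + b / R)\<^sup>2 = c * (R + b)\<^sup>2 / R\<^sup>2"
      by (rule eventually_mono[OF eventually_gt_at_top[of 0]]) (simp add: field_simps)
  qed
qed

text \<open>The counts for all shifts are squeezed between \<open>disc_count (R - \<bar>z\<bar>)\<close> and \<open>disc_count (R + \<bar>z\<bar>)\<close>.\<close>

lemma shifted_count_limit:
  "((\<lambda>R. card {k \<in> \<O>. cmod (k + z) \<le> R} / R\<^sup>2) \<longlongrightarrow> pi / area) at_top"
proof (rule tendsto_sandwich)
  let ?c = "\<lambda>R. card {k \<in> \<O>. cmod (k + z) \<le> R}"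
  have sub1: "{k \<in> \<O>. cmod (k + z) \<le> R} \<subseteq> {k \<in> \<O>. cmod k \<le> R + cmod z}" for R
    by (auto) (metis add_diff_cancel_right' add_right_mono norm_triangle_ineq4 order_trans)
  have sub2: "{k \<in> \<O>. cmod k \<le> R - cmod z} \<subseteq> {k \<in> \<O>. cmod (k + z) \<le> R}" for R
    by (auto intro: order_trans[OF norm_triangle_ineq])
  show "\<forall>\<^sub>F R in at_top. (pi / area) * (R + (- (cmod z + diam)))\<^sup>2 / R\<^sup>2 \<le> ?c R / R\<^sup>2"
  proof (rule eventually_mono[OF eventually_ge_at_top[of "cmod z + diam"]])
    fix R assume R: "cmod z + diam \<le> R"
    have "disc_count (R - cmod z) \<le> ?c R" unfolding disc_count_def
      by (rule card_mono[OF finite_subset[OF sub1 O_ball_finite] sub2])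
    then have 1: "real (disc_count (R - cmod z)) * area \<le> real (?c R) * area" using area_pos by (intro mult_right_mono) auto
    have 2: "pi * (R - cmod z - diam)\<^sup>2 \<le> disc_count (R - cmod z) * area" using R by (intro disc_count_lower) simp
    have "pi * (R - cmod z - diam)\<^sup>2 / area \<le> real (?c R)" using area_pos order_trans[OF 2 1] by (simp add: pos_divide_le_eq)
    then show "(pi / area) * (R + (- (cmod z + diam)))\<^sup>2 / R\<^sup>2 \<le> ?c R / R\<^sup>2"
      by (intro divide_right_mono) (auto simp: algebra_simps)
  qed
  show "\<forall>\<^sub>F R in at_top. ?c R / R\<^sup>2 \<le> (pi / area) * (R + (cmod z + diam))\<^sup>2 / R\<^sup>2"
  proof (rule eventually_mono[OF eventually_ge_at_top[of 0]])
    fix R :: real assume R: "0 \<le> R"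
    have "?c R \<le> disc_count (R + cmod z)" unfolding disc_count_def
      by (rule card_mono[OF O_ball_finite sub1])
    then have 1: "real (?c R) * area \<le> real (disc_count (R + cmod z)) * area" using area_pos by (intro mult_right_mono) auto
    have 2: "disc_count (R + cmod z) * area \<le> pi * (R + cmod z + diam)\<^sup>2" using R by (intro disc_count_upper) simp
    have "real (?c R) \<le> pi * (R + cmod z + diam)\<^sup>2 / area" using area_pos order_trans[OF 1 2] by (simp add: pos_le_divide_eq)
    then show "?c R / R\<^sup>2 \<le> (pi / area) * (R + (cmod z + diam))\<^sup>2 / R\<^sup>2"
      by (intro divide_right_mono) (auto simp: algebra_simps)
  qed
qed (rule shifted_square_limit)+

text \<open>A progression modulo \<open>n\<close> is a shifted lattice scaled by \<open>n\<close>.\<close>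

lemma progression_count_limit:
  assumes n: "0 < n" and q0: "q0 \<in> \<O>"
  shows "((\<lambda>R. card {q \<in> \<O>. cmod q \<le> R \<and> cg (of_nat n) q q0} / R\<^sup>2) \<longlongrightarrow> pi / area / (real n)\<^sup>2) at_top"
proof -
  let ?z = "q0 / of_nat n"
  have eq: "card {q \<in> \<O>. cmod q \<le> R \<and> cg (of_nat n) q q0} = card {k \<in> \<O>. cmod (k + ?z) \<le> R / n}" for R
  proof -
    have 1: "cmod (of_nat n * k + q0) \<le> R \<longleftrightarrow> cmod (k + ?z) \<le> R / n" for k
    proof -
      have "of_nat n * k + q0 = of_nat n * (k + ?z)" using n by (simp add: field_simps)
      then have "cmod (of_nat n * k + q0) = n * cmod (k + ?z)" by (simp add: norm_mult)
      then show ?thesis using n by (simp add: field_simps)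
    qed
    have "{q \<in> \<O>. cmod q \<le> R \<and> cg (of_nat n) q q0} = (\<lambda>k. of_nat n * k + q0) ` {k \<in> \<O>. cmod (k + ?z) \<le> R / n}"
    proof (intro equalityI subsetI)
      fix q assume q: "q \<in> {q \<in> \<O>. cmod q \<le> R \<and> cg (of_nat n) q q0}"
      then obtain k where k: "k \<in> \<O>" "q - q0 = of_nat n * k" unfolding cg_def by blast
      then have "q = of_nat n * k + q0" by (simp add: algebra_simps)
      then show "q \<in> (\<lambda>k. of_nat n * k + q0) ` {k \<in> \<O>. cmod (k + ?z) \<le> R / n}" using k q 1 by auto
    next
      fix q assume "q \<in> (\<lambda>k. of_nat n * k + q0) ` {k \<in> \<O>. cmod (k + ?z) \<le> R / n}"
      then obtain k where k: "k \<in> \<O>" "cmod (k + ?z) \<le> R / n" "q = of_nat n * k + q0" by blast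
      then have "cg (of_nat n) q q0" unfolding cg_def by auto
      then show "q \<in> {q \<in> \<O>. cmod q \<le> R \<and> cg (of_nat n) q q0}" using k 1 q0 by auto
    qed
    moreover have "inj_on (\<lambda>k. of_nat n * k + q0) {k \<in> \<O>. cmod (k + ?z) \<le> R / n}" using n by (auto simp: inj_on_def)
    ultimately show ?thesis by (simp add: card_image)
  qed
  have "filterlim (\<lambda>R::real. R / n) at_top at_top"
    using n filterlim_at_top_mult_tendsto_pos[OF tendsto_const[of "1 / real n"] _ filterlim_ident] by simp
  from filterlim_compose[OF shifted_count_limit this]
  have "((\<lambda>R. card {k \<in> \<O>. cmod (k + ?z) \<le> R / n} / (R / n)\<^sup>2 / (real n)\<^sup>2) \<longlongrightarrow> pi / area / (real n)\<^sup>2) at_top"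
    by (rule tendsto_divide[OF _ tendsto_const]) (use n in auto)
  then show ?thesis unfolding eq using n by (simp add: power_divide)
qed

definition qs :: "real \<Rightarrow> complex set" where "qs R = {q \<in> \<O> - {0}. cmod q \<le> R}"

lemma finite_qs [simp]: "finite (qs R)"
  unfolding qs_def by (rule finite_subset[OF _ O_ball_finite[of R]]) auto

lemma card_qs: "0 \<le> R \<Longrightarrow> real (card (qs R)) \<le> 9 * R\<^sup>2"
proof (cases "1 \<le> R")
  case True
  then have "real (card (qs R)) \<le> (2 * R + 1)\<^sup>2" by (intro O_ball_count finite_qs) (auto simp: qs_def)
  also have "\<dots> \<le> (3 * R)\<^sup>2" using True by (intro power_mono) auto
  finally show ?thesis by (simp add: power_mult_distrib)
next
  case False
  then have "x \<notin> qs R" for x unfolding qs_def using O_norm_ge1[of x] by auto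
  then have "qs R = {}" by blast
  then show ?thesis by simp
qed

lemma periodic_mean:
  fixes g :: "complex \<Rightarrow> real"
  assumes n: "0 < n" and g: "periodic (of_nat n) g"
  shows "((\<lambda>R. (\<Sum>q\<in>qs R. g q) / R\<^sup>2) \<longlongrightarrow> pi / area * ((\<Sum>q\<in>res (of_nat n). g q) / (real n)\<^sup>2)) at_top"
proof -
  have n0: "of_nat n \<noteq> (0::complex)" using n by simp
  let ?B = "\<lambda>R. {q \<in> \<O>. cmod q \<le> R}"
  have eq: "(\<Sum>q\<in>?B R. g q) = (\<Sum>q0\<in>res (of_nat n). g q0 * card {q \<in> \<O>. cmod q \<le> R \<and> cg (of_nat n) q q0})" for R
  proof -
    have "(\<Sum>q\<in>?B R. g q) = (\<Sum>q0\<in>res (of_nat n). \<Sum>q\<in>{q \<in> ?B R. redu (of_nat n) q = q0}. g q)"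
      by (rule sum.group[symmetric]) (use n0 O_ball_finite redu_res in auto)
    also have "\<dots> = (\<Sum>q0\<in>res (of_nat n). g q0 * card {q \<in> \<O>. cmod q \<le> R \<and> cg (of_nat n) q q0})"
    proof (rule sum.cong[OF refl])
      fix q0 assume q0: "q0 \<in> res (of_nat n)"
      have c: "redu (of_nat n) q = q0 \<longleftrightarrow> cg (of_nat n) q q0" if "q \<in> \<O>" for q
      proof
        assume "redu (of_nat n) q = q0" then show "cg (of_nat n) q q0" using redu_cg(2) by blast
      next
        assume "cg (of_nat n) q q0"
        with redu_cg(1) have "cg (of_nat n) (redu (of_nat n) q) q0" by (rule cg_trans)
        then show "redu (of_nat n) q = q0" by (intro res_unique[OF n0 _ q0]) (use that n0 redu_res in auto)
      qed
      have "{q \<in> ?B R. redu (of_nat n) q = q0} = {q \<in> \<O>. cmod q \<le> R \<and> cg (of_nat n) q q0}" using c by auto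
      moreover have "g q = g q0" if "q \<in> {q \<in> \<O>. cmod q \<le> R \<and> cg (of_nat n) q q0}" for q
        using periodicD[OF g] that q0 res_O by blast
      ultimately show "(\<Sum>q\<in>{q \<in> ?B R. redu (of_nat n) q = q0}. g q) = g q0 * card {q \<in> \<O>. cmod q \<le> R \<and> cg (of_nat n) q q0}"
        by simp
    qed
    finally show ?thesis .
  qed
  have "((\<lambda>R. \<Sum>q0\<in>res (of_nat n). g q0 * (card {q \<in> \<O>. cmod q \<le> R \<and> cg (of_nat n) q q0} / R\<^sup>2)) \<longlongrightarrow> (\<Sum>q0\<in>res (of_nat n). g q0 * (pi / area / (real n)\<^sup>2))) at_top"
    by (intro tendsto_sum tendsto_mult_left progression_count_limit[OF n]) (rule res_O)
  then have "((\<lambda>R. (\<Sum>q\<in>?B R. g q) / R\<^sup>2) \<longlongrightarrow> (\<Sum>q0\<in>res (of_nat n). g q0 * (pi / area / (real n)\<^sup>2))) at_top"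
    unfolding eq by (simp add: sum_divide_distrib)
  moreover have "((\<lambda>R::real. g 0 / R\<^sup>2) \<longlongrightarrow> 0) at_top"
    by (intro tendsto_divide_0[OF tendsto_const] filterlim_at_top_imp_at_infinity filterlim_pow_at_top filterlim_ident) simp
  ultimately have "((\<lambda>R. (\<Sum>q\<in>?B R. g q) / R\<^sup>2 - g 0 / R\<^sup>2) \<longlongrightarrow> (\<Sum>q0\<in>res (of_nat n). g q0 * (pi / area / (real n)\<^sup>2)) - 0) at_top"
    by (rule tendsto_diff)
  moreover have "(\<Sum>q0\<in>res (of_nat n). g q0 * (pi / area / (real n)\<^sup>2)) - 0 = pi / area * ((\<Sum>q\<in>res (of_nat n). g q) / (real n)\<^sup>2)"
    by (simp add: sum_distrib_right[symmetric] sum_divide_distrib[symmetric])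
  moreover have "\<forall>\<^sub>F R in at_top. (\<Sum>q\<in>?B R. g q) / R\<^sup>2 - g 0 / R\<^sup>2 = (\<Sum>q\<in>qs R. g q) / R\<^sup>2"
  proof (rule eventually_mono[OF eventually_ge_at_top[of 0]])
    fix R :: real assume "0 \<le> R"
    then have "?B R = insert 0 (qs R)" "0 \<notin> qs R" unfolding qs_def by auto
    then show "(\<Sum>q\<in>?B R. g q) / R\<^sup>2 - g 0 / R\<^sup>2 = (\<Sum>q\<in>qs R. g q) / R\<^sup>2"
      by (simp add: diff_divide_distrib[symmetric])
  qed
  ultimately show ?thesis using Lim_transform_eventually by fastforce
qed

definition sieve_mean :: "nat \<Rightarrow> real" where
  "sieve_mean M = (\<Sum>q\<in>res (of_nat (fact M)). sieve_density M q) / (real (fact M))\<^sup>2"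

lemma sieve_mean_limit:
  "((\<lambda>R. (\<Sum>q\<in>qs R. sieve_density M q) / R\<^sup>2) \<longlongrightarrow> pi / area * sieve_mean M) at_top"
  using periodic_mean[OF _ sieve_density_periodic, of M] unfolding sieve_mean_def by simp

text \<open>A witness ideal at \<open>l\<close> has minimal distance \<open>sqrt l\<close>, which bounds its points in a disc.\<close>

lemma card_witness_disc:
  assumes J: "J \<in> witnesses l" and l: "0 < l" "real l \<le> R\<^sup>2" and R: "0 \<le> R"
  shows "real (card {q \<in> qs R. q \<in> J}) \<le> 9 * R\<^sup>2 / l"
proof -
  have sl: "sqrt l \<le> R" using l R by (simp add: real_le_lsqrt)
  have "real (card {q \<in> qs R. q \<in> J}) * (sqrt l / 2)\<^sup>2 \<le> (R + sqrt l / 2)\<^sup>2"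
  proof (rule planar_packing)
    fix z z' assume "z \<in> {q \<in> qs R. q \<in> J}" "z' \<in> {q \<in> qs R. q \<in> J}" "z \<noteq> z'"
    then have "real l \<le> (cmod (z - z'))\<^sup>2" using witnesses_norm_ge[OF J witnesses_diff[OF J]] by simp
    then show "sqrt l \<le> cmod (z - z')" by (simp add: real_le_lsqrt)
  next
    show "finite {q \<in> qs R. q \<in> J}" by simp
  qed (use l R in \<open>auto simp: qs_def\<close>)
  also have "\<dots> \<le> (R + R / 2)\<^sup>2" using sl R by (intro power_mono) auto
  finally show ?thesis using l by (simp add: field_simps power2_eq_square)
qed

text \<open>Exchange the sums: each witness ideal at \<open>l\<close> contains at most \<open>9 * R\<^sup>2 / l\<close> of the denominators and excludes a
  proportion \<open>1 / l\<close> of the residues, and there are at most two such ideals.\<close>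

lemma sieve_tail_mean:
  assumes M: "0 < M" and R: "0 < R"
  shows "\<bar>(\<Sum>q\<in>qs R. sieve_density M q) / R\<^sup>2 - (\<Sum>q\<in>qs R. unit_density q) / R\<^sup>2\<bar> \<le> 18 / M"
proof -
  let ?L = "{l. prime l \<and> M < l \<and> real l \<le> R\<^sup>2}"
  have "?L \<subseteq> {..nat \<lfloor>R\<^sup>2\<rfloor>}" by (auto simp: le_nat_floor)
  then have finL: "finite ?L" by (rule finite_subset) simp
  have "\<bar>(\<Sum>q\<in>qs R. sieve_density M q) - (\<Sum>q\<in>qs R. unit_density q)\<bar> \<le> (\<Sum>q\<in>qs R. \<bar>sieve_density M q - unit_density q\<bar>)"
    unfolding sum_subtractf[symmetric] by (rule sum_abs)
  also have "\<dots> \<le> (\<Sum>q\<in>qs R. \<Sum>l\<in>?L. \<Sum>J\<in>{J \<in> witnesses l. q \<in> J}. 1 / l)"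
    by (intro sum_mono sieve_tail) (auto simp: qs_def power_mono)
  also have "\<dots> = (\<Sum>q\<in>qs R. \<Sum>l\<in>?L. \<Sum>J\<in>witnesses l. if q \<in> J then 1 / l else 0)"
    using card_witnesses(2) by (intro sum.cong refl sum.inter_filter) auto
  also have "\<dots> = (\<Sum>l\<in>?L. \<Sum>q\<in>qs R. \<Sum>J\<in>witnesses l. if q \<in> J then 1 / l else 0)"
    by (rule sum.swap)
  also have "\<dots> = (\<Sum>l\<in>?L. \<Sum>J\<in>witnesses l. \<Sum>q\<in>qs R. if q \<in> J then 1 / l else 0)"
    by (rule sum.cong[OF refl], rule sum.swap)
  also have "\<dots> = (\<Sum>l\<in>?L. \<Sum>J\<in>witnesses l. 1 / l * card {q \<in> qs R. q \<in> J})"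
    by (simp add: sum.If_cases Int_def)
  also have "\<dots> \<le> (\<Sum>l\<in>?L. \<Sum>J\<in>witnesses l. 1 / l * (9 * R\<^sup>2 / l))"
    using R M by (intro sum_mono mult_left_mono card_witness_disc) auto
  also have "\<dots> = (\<Sum>l\<in>?L. real (card (witnesses l)) * (9 * R\<^sup>2 * (1 / (real l)\<^sup>2)))"
    by (simp add: power2_eq_square)
  also have "\<dots> \<le> (\<Sum>l\<in>?L. 2 * (9 * R\<^sup>2 * (1 / (real l)\<^sup>2)))"
    by (intro sum_mono mult_right_mono) (use card_witnesses(1) in auto)
  also have "\<dots> = 18 * R\<^sup>2 * (\<Sum>l\<in>?L. 1 / (real l)\<^sup>2)" by (simp add: sum_distrib_left)
  also have "\<dots> \<le> 18 * R\<^sup>2 * (1 / M)"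
    by (intro mult_left_mono sum_inverse_squares_tail M finL) auto
  finally show ?thesis using R by (simp add: diff_divide_distrib[symmetric] abs_divide divide_le_eq mult.commute)
qed

text \<open>By the union bound the excluded pairs have density at most twice the sum of \<open>1 / l\<^sup>2\<close> over the primes, which is where
  it matters that this sum is below one half.\<close>

lemma sieve_mean_lower: "1 / 50 \<le> sieve_mean M"
proof -
  let ?n = "of_nat (fact M) :: complex"
  let ?L = "{l. prime l \<and> l \<le> M}"
  have finL: "finite ?L" by (rule finite_subset[of _ "{..M}"]) auto
  have n0: "?n \<noteq> 0" "?n \<in> \<O>" by (simp, rule O_nat)
  have Nn: "real (N ?n) = (real (fact M))\<^sup>2" using N_of_nat[of "fact M"] by simp
  have N0: "0 < real (N ?n)" using N_pos n0 by simp
  have dens: "real (card {x \<in> res ?n. x \<in> J}) / N ?n \<le> 1 / l" if J: "J \<in> witnesses l" "l \<in> ?L" for J l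
  proof (rule witness_density[OF _ J(1) n0(2,1)])
    have "l dvd fact M" using J prime_gt_0_nat[of l] by (intro dvd_fact) auto
    then obtain m where "(fact M :: nat) = l * m" by blast
    then have "?n \<in> multiples l" unfolding multiples_def by (intro image_eqI[of _ _ "of_nat m"]) auto
    then show "?n \<in> J" using witnesses_multiples J(1) by blast
  qed (use J in auto)
  have one: "1 - sieve_density M q \<le> (\<Sum>l\<in>?L. \<Sum>J\<in>witnesses l. if q \<in> J then real (card {p \<in> res ?n. p \<in> J}) / N ?n else 0)"
    if q: "q \<in> \<O>" for q
  proof -
    have "res ?n - {p \<in> res ?n. sieved M p q} \<subseteq> (\<Union>l\<in>?L. \<Union>J\<in>{J \<in> witnesses l. q \<in> J}. {p \<in> res ?n. p \<in> J})"
    proof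
      fix p assume p: "p \<in> res ?n - {p \<in> res ?n. sieved M p q}"
      then obtain l where l: "prime l" "l \<le> M" "bad l p q" unfolding sieved_def by auto
      then obtain J where "J \<in> witnesses l" "p \<in> J" "q \<in> J" using bad_witness[OF l(1) _ q l(3)] p res_O by blast
      then show "p \<in> (\<Union>l\<in>?L. \<Union>J\<in>{J \<in> witnesses l. q \<in> J}. {p \<in> res ?n. p \<in> J})" using p l by blast
    qed
    then have "card (res ?n - {p \<in> res ?n. sieved M p q}) \<le> card (\<Union>l\<in>?L. \<Union>J\<in>{J \<in> witnesses l. q \<in> J}. {p \<in> res ?n. p \<in> J})"
      by (rule card_mono[rotated]) (rule finite_subset[of _ "res ?n"], use n0 finite_res in auto)
    also have "\<dots> \<le> (\<Sum>l\<in>?L. card (\<Union>J\<in>{J \<in> witnesses l. q \<in> J}. {p \<in> res ?n. p \<in> J}))"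
      by (rule card_UN_le[OF finL])
    also have "\<dots> \<le> (\<Sum>l\<in>?L. \<Sum>J\<in>{J \<in> witnesses l. q \<in> J}. card {p \<in> res ?n. p \<in> J})"
      by (intro sum_mono card_UN_le) (use card_witnesses(2) in auto)
    also have "\<dots> = (\<Sum>l\<in>?L. \<Sum>J\<in>witnesses l. if q \<in> J then card {p \<in> res ?n. p \<in> J} else 0)"
      using card_witnesses(2) by (intro sum.cong refl sum.inter_filter) auto
    finally have "real (card (res ?n - {p \<in> res ?n. sieved M p q})) \<le> real (\<Sum>l\<in>?L. \<Sum>J\<in>witnesses l. if q \<in> J then card {p \<in> res ?n. p \<in> J} else 0)"
      by (rule of_nat_mono)
    moreover have "real (card (res ?n - {p \<in> res ?n. sieved M p q})) = real (N ?n) - real (card {p \<in> res ?n. sieved M p q})"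
      unfolding N_def using finite_res[OF n0(1)] by (subst card_Diff_subset) (auto simp: of_nat_diff card_mono)
    ultimately have "(real (N ?n) - real (card {p \<in> res ?n. sieved M p q})) / N ?n
       \<le> real (\<Sum>l\<in>?L. \<Sum>J\<in>witnesses l. if q \<in> J then card {p \<in> res ?n. p \<in> J} else 0) / N ?n"
      by (intro divide_right_mono) auto
    also have "\<dots> = (\<Sum>l\<in>?L. \<Sum>J\<in>witnesses l. if q \<in> J then real (card {p \<in> res ?n. p \<in> J}) / N ?n else 0)"
      unfolding of_nat_sum sum_divide_distrib by (intro sum.cong refl) simp
    finally show ?thesis unfolding sieve_density_def using N0 by (simp add: diff_divide_distrib)
  qed
  have "1 - sieve_mean M = (\<Sum>q\<in>res ?n. 1 - sieve_density M q) / N ?n"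
    unfolding sieve_mean_def Nn[symmetric] sum_subtractf using N0 by (simp add: diff_divide_distrib N_def[symmetric])
  also have "\<dots> \<le> (\<Sum>q\<in>res ?n. \<Sum>l\<in>?L. \<Sum>J\<in>witnesses l. if q \<in> J then real (card {p \<in> res ?n. p \<in> J}) / N ?n else 0) / N ?n"
    using N0 by (intro divide_right_mono sum_mono one res_O) auto
  also have "(\<Sum>q\<in>res ?n. \<Sum>l\<in>?L. \<Sum>J\<in>witnesses l. if q \<in> J then real (card {p \<in> res ?n. p \<in> J}) / N ?n else 0)
      = (\<Sum>l\<in>?L. \<Sum>J\<in>witnesses l. \<Sum>q\<in>res ?n. if q \<in> J then real (card {p \<in> res ?n. p \<in> J}) / N ?n else 0)"
    by (subst sum.swap, rule sum.cong[OF refl], rule sum.swap)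
  also have "\<dots> = (\<Sum>l\<in>?L. \<Sum>J\<in>witnesses l. (real (card {p \<in> res ?n. p \<in> J}))\<^sup>2 / N ?n)"
    using finite_res[OF n0(1)] by (simp add: sum.If_cases Int_def power2_eq_square)
  also have "\<dots> / N ?n = (\<Sum>l\<in>?L. \<Sum>J\<in>witnesses l. (real (card {p \<in> res ?n. p \<in> J}) / N ?n)\<^sup>2)"
    by (simp add: sum_divide_distrib power2_eq_square)
  also have "\<dots> \<le> (\<Sum>l\<in>?L. \<Sum>J\<in>witnesses l. (1 / real l)\<^sup>2)"
    by (intro sum_mono power_mono dens) auto
  also have "\<dots> = (\<Sum>l\<in>?L. real (card (witnesses l)) * (1 / (real l)\<^sup>2))" by (simp add: power_divide)
  also have "\<dots> \<le> (\<Sum>l\<in>?L. 2 * (1 / (real l)\<^sup>2))"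
    by (intro sum_mono mult_right_mono) (use card_witnesses(1) in auto)
  also have "\<dots> = 2 * (\<Sum>l\<in>?L. 1 / (real l)\<^sup>2)" by (simp add: sum_distrib_left)
  also have "\<dots> \<le> 2 * (49 / 100)" by (intro mult_left_mono sum_prime_inverse_squares finL) auto
  finally show ?thesis by simp
qed

text \<open>The mean values of the sieved densities form a Cauchy sequence because \<open>sieve_tail_mean\<close> is uniform in \<open>R\<close>.\<close>

lemma unit_density_mean:
  obtains k where "0 < k" "((\<lambda>R. (\<Sum>q\<in>qs R. unit_density q) / R\<^sup>2) \<longlongrightarrow> k) at_top"
proof -
  define G where "G M = pi / area * sieve_mean M" for M
  define s where "s M R = (\<Sum>q\<in>qs R. sieve_density M q) / R\<^sup>2" for M R
  define h where "h R = (\<Sum>q\<in>qs R. unit_density q) / R\<^sup>2" for R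
  have sl: "(s M \<longlongrightarrow> G M) at_top" for M unfolding s_def G_def by (rule sieve_mean_limit)
  have sh: "\<bar>s M R - h R\<bar> \<le> 18 / M" if "0 < M" "0 < R" for M R
    unfolding s_def h_def by (rule sieve_tail_mean[OF that])
  have GG: "\<bar>G M - G M'\<bar> \<le> 18 / M + 18 / M'" if M: "0 < M" "0 < M'" for M M'
  proof (rule tendsto_upperbound)
    show "((\<lambda>R. \<bar>s M R - s M' R\<bar>) \<longlongrightarrow> \<bar>G M - G M'\<bar>) at_top" by (intro tendsto_intros sl)
    show "\<forall>\<^sub>F R in at_top. \<bar>s M R - s M' R\<bar> \<le> 18 / M + 18 / M'"
    proof (rule eventually_mono[OF eventually_gt_at_top[of 0]])
      fix R :: real assume "0 < R"
      then show "\<bar>s M R - s M' R\<bar> \<le> 18 / M + 18 / M'" using sh[OF M(1)] sh[OF M(2)] by (smt (verit))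
    qed
  qed simp
  have small: "\<exists>M0>0. \<forall>M\<ge>M0. 18 / real M < e" if "0 < e" for e :: real
  proof -
    obtain M0 where M0: "18 / e < real M0" using reals_Archimedean2 by blast
    then have "0 < M0" using that by (metis divide_pos_pos gr0I less_numeral_extra(3) of_nat_0 order_less_trans zero_less_numeral)
    moreover have "18 / real M < e" if "M \<ge> M0" for M
    proof -
      have "18 / e < real M" using M0 that by linarith
      then show ?thesis using \<open>0 < e\<close> \<open>0 < M0\<close> that by (simp add: field_simps)
    qed
    ultimately show ?thesis by blast
  qed
  have "Cauchy G"
  proof (rule metric_CauchyI)
    fix e :: real assume "0 < e"
    then obtain M0 where M0: "0 < M0" "\<And>M. M \<ge> M0 \<Longrightarrow> 18 / real M < e / 2" using small[of "e/2"] by auto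
    have "dist (G m) (G n) < e" if "m \<ge> M0" "n \<ge> M0" for m n
      using GG[of m n] M0(2)[OF that(1)] M0(2)[OF that(2)] M0(1) that unfolding dist_real_def by linarith
    then show "\<exists>M. \<forall>m\<ge>M. \<forall>n\<ge>M. dist (G m) (G n) < e" by blast
  qed
  then obtain k where k: "G \<longlonglongrightarrow> k" using Cauchy_convergent_iff convergent_def by blast
  have "pi / area * (1 / 50) \<le> k"
  proof (rule tendsto_lowerbound[OF k])
    show "\<forall>\<^sub>F M in sequentially. pi / area * (1 / 50) \<le> G M"
      unfolding G_def by (intro always_eventually allI mult_left_mono sieve_mean_lower) (use area_pos in auto)
  qed simp
  moreover have "0 < pi / area * (1 / 50)" using area_pos by simp
  ultimately have "0 < k" by linarith
  moreover have "(h \<longlongrightarrow> k) at_top"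
  proof (rule tendstoI)
    fix e :: real assume e: "0 < e"
    obtain M1 where M1: "0 < M1" "\<And>M. M \<ge> M1 \<Longrightarrow> 18 / real M < e / 3" using small[of "e/3"] e by auto
    obtain M2 where M2: "\<And>M. M \<ge> M2 \<Longrightarrow> dist (G M) k < e / 3" using metric_LIMSEQ_D[OF k, of "e/3"] e by auto
    define M where "M = max M1 M2"
    have "\<forall>\<^sub>F R in at_top. dist (s M R) (G M) < e / 3" using tendstoD[OF sl[of M], of "e/3"] e by simp
    then show "\<forall>\<^sub>F R in at_top. dist (h R) k < e"
      using eventually_gt_at_top[of 0]
    proof eventually_elim
      case (elim R)
      have "\<bar>s M R - h R\<bar> \<le> 18 / M" using M1(1) elim by (intro sh) (auto simp: M_def)
      moreover have "18 / real M < e / 3" using M1(2)[of M] by (simp add: M_def)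
      moreover have "dist (G M) k < e / 3" using M2[of M] by (simp add: M_def)
      ultimately show ?case using elim unfolding dist_real_def by linarith
    qed
  qed
  ultimately show ?thesis using that unfolding h_def by blast
qed

text \<open>The number of numerators is \<open>\<bar>q\<bar>\<^sup>2 * unit_density q\<close>. The factor \<open>\<bar>q\<bar>\<^sup>2\<close> raises the exponent of the moments by two,
  which turns the density \<open>2 * u\<close> into a multiple of \<open>u ^ 3\<close>.\<close>

lemma denominator_moments:
  obtains k where "0 < k"
    "\<And>j::nat. ((\<lambda>R. (\<Sum>q\<in>qs R. card (ures q) * (cmod q / R) ^ j) / R ^ 4) \<longlongrightarrow> k * (4 / (4 + real j))) at_top"
proof -
  obtain k where k: "0 < k" "((\<lambda>R. (\<Sum>q\<in>qs R. unit_density q) / R\<^sup>2) \<longlongrightarrow> k) at_top"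
    by (rule unit_density_mean)
  have "((\<lambda>R. (\<Sum>q\<in>qs R. unit_density q * (cmod q / R) ^ (j + 2)) / R\<^sup>2) \<longlongrightarrow> 2 * k / (real (j + 2) + 2)) at_top" for j
    unfolding qs_def
  proof (rule moments_of_quadratic_growth[where C = 9 and s = cmod and a = unit_density and X = "\<O> - {0}" and j = "j + 2" and k = k])
    show "finite {q \<in> \<O> - {0}. cmod q \<le> R}" for R using finite_qs[of R] unfolding qs_def .
    show "((\<lambda>R. (\<Sum>q\<in>{q \<in> \<O> - {0}. cmod q \<le> R}. unit_density q) / R\<^sup>2) \<longlongrightarrow> k) at_top"
      using k(2) unfolding qs_def .
    fix R :: real assume R: "0 \<le> R"
    have "\<bar>\<Sum>q\<in>qs R. unit_density q\<bar> \<le> (\<Sum>q\<in>qs R. 1)"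
      by (rule order_trans[OF sum_abs sum_mono]) (use unit_density_bounds in \<open>auto simp: qs_def\<close>)
    also have "\<dots> \<le> 9 * R\<^sup>2" using card_qs[OF R] by simp
    finally show "\<bar>\<Sum>q\<in>{q \<in> \<O> - {0}. cmod q \<le> R}. unit_density q\<bar> \<le> 9 * R\<^sup>2" unfolding qs_def .
  qed simp
  moreover have "\<forall>\<^sub>F R in at_top. (\<Sum>q\<in>qs R. unit_density q * (cmod q / R) ^ (j + 2)) / R\<^sup>2
      = (\<Sum>q\<in>qs R. card (ures q) * (cmod q / R) ^ j) / R ^ 4" for j
  proof (rule eventually_mono[OF eventually_gt_at_top[of 0]])
    fix R :: real assume R: "0 < R"
    have "unit_density q * (cmod q / R) ^ (j + 2) = card (ures q) * (cmod q / R) ^ j / R\<^sup>2" if "q \<in> qs R" for q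
    proof -
      have q: "q \<in> \<O>" "q \<noteq> 0" using that unfolding qs_def by auto
      have "unit_density q * (cmod q)\<^sup>2 = card (ures q)"
        unfolding unit_density_def using N_eq[OF q] N_pos[OF q] q(2) by simp
      note * = this
      show ?thesis unfolding *[symmetric] by (simp add: power_add power_divide power2_eq_square mult_ac)
    qed
    then have "(\<Sum>q\<in>qs R. unit_density q * (cmod q / R) ^ (j + 2)) = (\<Sum>q\<in>qs R. card (ures q) * (cmod q / R) ^ j) / R\<^sup>2"
      by (simp add: sum_divide_distrib)
    then show "(\<Sum>q\<in>qs R. unit_density q * (cmod q / R) ^ (j + 2)) / R\<^sup>2 = (\<Sum>q\<in>qs R. card (ures q) * (cmod q / R) ^ j) / R ^ 4"
      by (simp add: power2_eq_square power4_eq_xxxx)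
  qed
  ultimately have "((\<lambda>R. (\<Sum>q\<in>qs R. card (ures q) * (cmod q / R) ^ j) / R ^ 4) \<longlongrightarrow> 2 * k / (real (j + 2) + 2)) at_top" for j
    by (rule Lim_transform_eventually)
  moreover have "2 * k / (real (j + 2) + 2) = (k / 2) * (4 / (4 + real j))" for j by (simp add: field_simps)
  ultimately show ?thesis using that[of "k / 2"] k(1) by simp
qed

end

section \<open>The uniform distribution modulo the lattice\<close>

context imaginary_order
begin

lemma countable_O: "countable \<O>"
proof -
  have "\<O> = (\<lambda>(a, b). of_int a + of_int b * w) ` (UNIV :: (int \<times> int) set)" unfolding ring_eq by auto
  then show ?thesis by simp
qed

definition latper :: "complex set \<Rightarrow> bool" where
  "latper A \<longleftrightarrow> (\<forall>z. \<forall>a\<in>\<O>. z + a \<in> A \<longleftrightarrow> z \<in> A)"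

definition fundamental :: "complex set \<Rightarrow> bool" where
  "fundamental F \<longleftrightarrow> F \<in> sets borel \<and> (\<forall>x\<in>F. \<forall>y\<in>F. x - y \<in> \<O> \<longrightarrow> x = y) \<and> (\<forall>z. \<exists>x\<in>F. z - x \<in> \<O>)"

lemma fundamental_para: "fundamental para"
  unfolding fundamental_def
proof (intro conjI ballI allI impI)
  fix z show "\<exists>x\<in>para. z - x \<in> \<O>" using diff_fl_para[of z] by (intro bexI[of _ "z - fl z"]) auto
qed (auto intro: para_unique)

lemma fundamental_translate:
  assumes "fundamental F" shows "fundamental ((+) b ` F)"
  unfolding fundamental_def
proof (intro conjI ballI allI impI)
  show "(+) b ` F \<in> sets borel" using assms translate_sets_borel unfolding fundamental_def by blast
next
  fix x y assume "x \<in> (+) b ` F" "y \<in> (+) b ` F" "x - y \<in> \<O>"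
  then show "x = y" using assms unfolding fundamental_def by auto
next
  fix z
  obtain x where "x \<in> F" "(z - b) - x \<in> \<O>" using assms unfolding fundamental_def by blast
  then show "\<exists>x\<in>(+) b ` F. z - x \<in> \<O>" by (intro bexI[of _ "b + x"]) (auto simp: algebra_simps)
qed

text \<open>Cutting one fundamental domain along the translates of another and moving the pieces.\<close>

lemma fundamental_measure_eq:
  assumes F: "fundamental F" and G: "fundamental G" and A: "A \<in> sets borel" "latper A"
  shows "emeasure lborel (A \<inter> F) = emeasure lborel (A \<inter> G)"
proof -
  have bF: "F \<in> sets borel" and bG: "G \<in> sets borel" using F G unfolding fundamental_def by auto
  define X where "X a = A \<inter> F \<inter> (+) a ` G" for a
  define Y where "Y a = A \<inter> G \<inter> (+) (- a) ` F" for a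
  have XY: "X a = (+) a ` Y a" if "a \<in> \<O>" for a
  proof (intro equalityI subsetI)
    fix z assume "z \<in> X a"
    then obtain g where g: "g \<in> G" "z = a + g" "z \<in> A" "z \<in> F" unfolding X_def by auto
    then have "g \<in> A" using A(2) that unfolding latper_def by (metis add.commute)
    moreover have "g \<in> (+) (- a) ` F" using g by (intro image_eqI[of _ _ z]) auto
    ultimately show "z \<in> (+) a ` Y a" unfolding Y_def using g by auto
  next
    fix z assume "z \<in> (+) a ` Y a"
    then obtain f where g: "z = a + (- a + f)" "- a + f \<in> A" "- a + f \<in> G" "f \<in> F" unfolding Y_def by auto
    then have "f \<in> A" using A(2) that unfolding latper_def by (metis add.commute add_minus_cancel)
    then show "z \<in> X a" unfolding X_def using g by (auto intro: image_eqI[of _ _ "- a + f"])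
  qed
  have sX: "X a \<in> sets lborel" for a unfolding X_def sets_lborel by (intro sets.Int A bF translate_sets_borel[OF bG])
  have sY: "Y a \<in> sets lborel" for a unfolding Y_def sets_lborel by (intro sets.Int A bG translate_sets_borel[OF bF])
  have dX: "disjoint_family_on X \<O>" unfolding disjoint_family_on_def
  proof (intro ballI impI)
    fix a b assume ab: "a \<in> \<O>" "b \<in> \<O>" "a \<noteq> b"
    show "X a \<inter> X b = {}"
    proof (rule ccontr)
      assume "X a \<inter> X b \<noteq> {}"
      then obtain g h where gh: "g \<in> G" "h \<in> G" "a + g = b + h" unfolding X_def by auto
      then have "g - h = b - a" by (simp add: algebra_simps)
      then have "g - h \<in> \<O>" using ab by auto
      then have "g = h" using G gh(1,2) unfolding fundamental_def by blast
      then show False using gh ab by simp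
    qed
  qed
  have dY: "disjoint_family_on Y \<O>" unfolding disjoint_family_on_def
  proof (intro ballI impI)
    fix a b assume ab: "a \<in> \<O>" "b \<in> \<O>" "a \<noteq> b"
    show "Y a \<inter> Y b = {}"
    proof (rule ccontr)
      assume "Y a \<inter> Y b \<noteq> {}"
      then obtain g h where gh: "g \<in> F" "h \<in> F" "- a + g = - b + h" unfolding Y_def by auto
      then have "g - h = a - b" by (simp add: algebra_simps)
      then have "g - h \<in> \<O>" using ab by auto
      then have "g = h" using F gh(1,2) unfolding fundamental_def by blast
      then show False using gh ab by simp
    qed
  qed
  have "A \<inter> F = (\<Union>a\<in>\<O>. X a)"
  proof (intro equalityI subsetI)
    fix z assume z: "z \<in> A \<inter> F"
    obtain g where "g \<in> G" "z - g \<in> \<O>" using G unfolding fundamental_def by blast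
    then show "z \<in> (\<Union>a\<in>\<O>. X a)" unfolding X_def using z by (auto intro!: bexI[of _ "z - g"] image_eqI[of _ _ g])
  qed (auto simp: X_def)
  then have "emeasure lborel (A \<inter> F) = (\<integral>\<^sup>+a. emeasure lborel (X a) \<partial>count_space \<O>)"
    using emeasure_UN_countable[OF sX countable_O dX] by simp
  also have "\<dots> = (\<integral>\<^sup>+a. emeasure lborel (Y a) \<partial>count_space \<O>)"
    by (rule nn_integral_cong) (use sY in \<open>simp add: XY emeasure_lborel_translate\<close>)
  also have "\<dots> = emeasure lborel (\<Union>a\<in>\<O>. Y a)"
    using emeasure_UN_countable[OF sY countable_O dY] by simp
  also have "(\<Union>a\<in>\<O>. Y a) = A \<inter> G"
  proof (intro equalityI subsetI)
    fix z assume z: "z \<in> A \<inter> G"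
    obtain f where "f \<in> F" "z - f \<in> \<O>" using F unfolding fundamental_def by blast
    then have "f - z \<in> \<O>" using O_minus by (metis minus_diff_eq)
    then show "z \<in> (\<Union>a\<in>\<O>. Y a)" unfolding Y_def using z \<open>f \<in> F\<close> by (auto intro!: bexI[of _ "f - z"] image_eqI[of _ _ f])
  qed (auto simp: Y_def)
  finally show ?thesis .
qed

text \<open>The fractional part with respect to the lattice.\<close>

definition frc :: "complex \<Rightarrow> complex" where "frc z = z - fl z"

lemma frc_measurable [measurable]: "frc \<in> borel_measurable borel"
  unfolding frc_def fl_def by measurable

lemma frc_para: "frc z \<in> para" unfolding frc_def by (rule diff_fl_para)

lemma frc_eq: "z \<in> para \<Longrightarrow> frc z = z"
  using para_unique[OF frc_para, of z z] unfolding frc_def by (simp add: O_minus)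

lemma fl_add: "a \<in> \<O> \<Longrightarrow> fl (z + a) = fl z + a"
proof -
  assume "a \<in> \<O>"
  then obtain m n where a: "a = of_int m + of_int n * w" by (auto elim!: O_E)
  have "co1 (z + a) = co1 z + of_int m" "co2 (z + a) = co2 z + of_int n" unfolding a by (simp_all only: co_add(1)[of z] co_add(2)[of z] co_of_int)
  then show ?thesis unfolding fl_def by (simp add: a algebra_simps)
qed

lemma frc_add: "a \<in> \<O> \<Longrightarrow> frc (z + a) = frc z"
  unfolding frc_def by (simp add: fl_add)

definition unif :: "complex measure" where "unif = uniform_measure lborel para"

lemma emeasure_para: "emeasure lborel para = ennreal area"
  unfolding area_def using para_finite by (simp add: emeasure_eq_ennreal_measure)

lemma prob_unif: "prob_space unif"
  unfolding unif_def
  by (rule prob_space_uniform_measure) (use area_pos in \<open>auto simp: emeasure_para\<close>)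

lemma sets_unif [simp, measurable_cong]: "sets unif = sets borel" and space_unif [simp]: "space unif = UNIV"
  unfolding unif_def by simp_all

lemma emeasure_unif: "A \<in> sets borel \<Longrightarrow> emeasure unif A = emeasure lborel (para \<inter> A) / ennreal area"
  unfolding unif_def by (simp add: emeasure_para)

lemma measure_unif: "A \<in> sets borel \<Longrightarrow> measure unif A = measure lborel (para \<inter> A) / area"
proof -
  assume A: "A \<in> sets borel"
  have "emeasure lborel (para \<inter> A) \<le> emeasure lborel para" using A by (intro emeasure_mono) auto
  then have "emeasure lborel (para \<inter> A) = ennreal (measure lborel (para \<inter> A))"
    using para_finite by (intro emeasure_eq_ennreal_measure) auto
  then have "emeasure unif A = ennreal (measure lborel (para \<inter> A) / area)"
    unfolding emeasure_unif[OF A] using area_pos by (simp add: divide_ennreal)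
  then show ?thesis using area_pos by (simp add: measure_def)
qed

lemma unif_null_iff: "A \<in> sets borel \<Longrightarrow> emeasure unif A = 0 \<longleftrightarrow> emeasure lborel (para \<inter> A) = 0"
  by (simp add: emeasure_unif ennreal_divide_eq_0_iff)

text \<open>A translate of the parallelogram is another fundamental domain.\<close>

lemma unif_rotation: "distr unif borel (\<lambda>z. frc (z + b)) = unif"
proof (rule measure_eqI)
  show "sets (distr unif borel (\<lambda>z. frc (z + b))) = sets unif" by simp
  fix B assume "B \<in> sets (distr unif borel (\<lambda>z. frc (z + b)))"
  then have B: "B \<in> sets borel" by simp
  define A where "A = frc -` B"
  have A: "A \<in> sets borel" unfolding A_def using measurable_sets[OF frc_measurable B] by simp
  have pA: "latper A" unfolding latper_def A_def by (simp add: frc_add)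
  have Ab: "(\<lambda>z. frc (z + b)) -` B \<in> sets borel" using measurable_sets[of "\<lambda>z. frc (z + b)" borel borel, OF _ B] by simp
  have "(+) b ` (para \<inter> (\<lambda>z. frc (z + b)) -` B) = A \<inter> (+) b ` para"
    unfolding A_def by (auto simp: add.commute)
  then have "emeasure lborel (para \<inter> (\<lambda>z. frc (z + b)) -` B) = emeasure lborel (A \<inter> (+) b ` para)"
    using emeasure_lborel_translate[of "para \<inter> (\<lambda>z. frc (z + b)) -` B" b] Ab by auto
  also have "\<dots> = emeasure lborel (A \<inter> para)"
    by (rule fundamental_measure_eq[OF fundamental_translate[OF fundamental_para] fundamental_para A pA])
  also have "A \<inter> para = para \<inter> B" unfolding A_def by (auto simp: frc_eq)
  finally show "emeasure (distr unif borel (\<lambda>z. frc (z + b))) B = emeasure unif B"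
    using B Ab by (simp add: emeasure_distr emeasure_unif)
qed

text \<open>A rotation by \<open>b\<close> preserves the integral and multiplies it by \<open>c b\<close>.\<close>

lemma char_integral_zero:
  assumes c: "is_char c" and m [measurable]: "c \<in> borel_measurable borel" and b: "c b \<noteq> 1"
  shows "(\<integral>z. c z \<partial>unif) = 0"
proof -
  have "(\<integral>z. c z \<partial>unif) = (\<integral>z. c z \<partial>distr unif borel (\<lambda>z. frc (z + b)))" by (simp add: unif_rotation)
  also have "\<dots> = (\<integral>z. c (frc (z + b)) \<partial>unif)" by (rule integral_distr) measurable
  also have "\<dots> = (\<integral>z. c b * c z \<partial>unif)"
  proof (rule Bochner_Integration.integral_cong[OF refl])
    fix z
    have "c (frc (z + b)) = c (z + b)" by (rule char_shift[OF c]) (simp add: frc_def O_minus)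
    then show "c (frc (z + b)) = c b * c z" by (simp add: char_add[OF c])
  qed
  also have "\<dots> = c b * (\<integral>z. c z \<partial>unif)" by simp
  finally show ?thesis using b by (metis mult_cancel_right1)
qed

section \<open>The characters of the torus\<close>

definition ch :: "int \<Rightarrow> int \<Rightarrow> complex \<Rightarrow> complex" where
  "ch j k z = cis (2 * pi * (of_int j * co1 z + of_int k * co2 z))"

lemma ch_cont: "continuous_on UNIV (ch j k)"
  unfolding ch_def cis_conv_exp using co_cont by (intro continuous_intros) auto

lemma ch_measurable [measurable]: "ch j k \<in> borel_measurable borel"
  using ch_cont by (rule borel_measurable_continuous_onI)

lemma cis_eq_1: "cis (2 * pi * x) = 1 \<longleftrightarrow> x \<in> \<int>"
proof
  assume "cis (2 * pi * x) = 1"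
  then have "cos (2 * pi * x) = 1" by (metis cis.simps(1) one_complex.simps(1))
  then obtain n :: int where "2 * pi * x = of_int n * 2 * pi" using cos_one_2pi_int by blast
  then show "x \<in> \<int>" by simp
qed (auto elim!: Ints_cases)

lemma ch_mult: "ch j k z * ch j' k' z = ch (j + j') (k + k') z"
  unfolding ch_def by (simp add: cis_mult algebra_simps)

lemma ch_cnj: "cnj (ch j k z) = ch (- j) (- k) z"
  unfolding ch_def by (simp add: cis_cnj algebra_simps)

lemma ch_0: "ch 0 0 z = 1"
  unfolding ch_def by simp

lemma ch_eq_1: "ch j k z = 1 \<longleftrightarrow> of_int j * co1 z + of_int k * co2 z \<in> \<int>"
  unfolding ch_def cis_eq_1 ..

lemma is_char_ch: "is_char (ch j k)"
  unfolding is_char_def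
proof (intro conjI allI ballI)
  show "ch j k (x + y) = ch j k x * ch j k y" for x y
    unfolding ch_def by (simp add: cis_mult co_add algebra_simps)
  show "cmod (ch j k x) = 1" for x unfolding ch_def by simp
  show "ch j k x = 1" if "x \<in> \<O>" for x
    using that unfolding ch_eq_1 O_iff by auto
qed

lemma ch_nontrivial: "(j, k) \<noteq> (0, 0) \<Longrightarrow> \<exists>b. ch j k b \<noteq> 1"
proof -
  assume jk: "(j, k) \<noteq> (0, 0)"
  have half: "(1 / 2 :: real) \<notin> \<int>" by (auto elim!: Ints_cases simp: field_simps)
  show ?thesis
  proof (cases "j = 0")
    case False
    have "ch j k (of_real (1 / (2 * of_int j)) + of_real 0 * w) \<noteq> 1" unfolding ch_eq_1 co_unique using half False by simp
    then show ?thesis by blast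
  next
    case True
    have "ch j k (of_real 0 + of_real (1 / (2 * of_int k)) * w) \<noteq> 1" unfolding ch_eq_1 co_unique using half True jk by simp
    then show ?thesis by blast
  qed
qed

lemma ch_integral: "(\<integral>z. ch j k z \<partial>unif) = (if (j, k) = (0, 0) then 1 else 0)"
proof (cases "(j, k) = (0, 0)")
  case True
  then show ?thesis using prob_space.prob_space[OF prob_unif] by (simp add: ch_0)
next
  case False
  then obtain b where "ch j k b \<noteq> 1" using ch_nontrivial by blast
  then show ?thesis using char_integral_zero[OF is_char_ch ch_measurable] False by auto
qed

lemma co_mult_w: "co1 (z * w) = - (of_int nm * co2 z)" "co2 (z * w) = co1 z + of_int tr * co2 z"
proof -
  have "z * w = of_real (co1 z) * w + of_real (co2 z) * (w * w)"
    by (subst co_eq[of z]) (simp add: algebra_simps)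
  also have "\<dots> = of_real (- (of_int nm * co2 z)) + of_real (co1 z + of_int tr * co2 z) * w"
    unfolding w_sq by (simp add: algebra_simps)
  finally show "co1 (z * w) = - (of_int nm * co2 z)" "co2 (z * w) = co1 z + of_int tr * co2 z"
    by (simp_all only: co_unique)
qed

lemma norm_form_pos: "(j, k) \<noteq> (0::int, 0::int) \<Longrightarrow> k\<^sup>2 - tr * j * k + nm * j\<^sup>2 \<noteq> 0"
proof
  assume jk: "(j, k) \<noteq> (0, 0)" and z: "k\<^sup>2 - tr * j * k + nm * j\<^sup>2 = 0"
  let ?x = "of_int k + of_int (- j) * w"
  have "?x * cnj ?x = (of_int k)\<^sup>2 - of_int tr * of_int j * of_int k + of_int j * of_int j * (of_int tr * w - w * w)"
    unfolding complex_cnj_add complex_cnj_mult complex_cnj_of_int cnj_w by (simp add: algebra_simps power2_eq_square)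
  also have "\<dots> = of_int (k\<^sup>2 - tr * j * k + nm * j\<^sup>2)" unfolding w_sq by (simp add: power2_eq_square)
  finally have "?x * cnj ?x = 0" unfolding z by simp
  then have "?x = 0" by (simp only: mult_eq_0_iff complex_cnj_zero_iff simp_thms)
  then have "co1 ?x = 0" "co2 ?x = 0" by (simp_all add: co1_def co2_def)
  then show False using jk unfolding co_of_int by auto
qed

text \<open>A nontrivial character composed with a multiplication is trivial for boundedly many multipliers:
  \<open>z = m / q\<close> is determined by the two integers \<open>L z\<close> and \<open>L (z * w)\<close>, where \<open>L\<close> is the linear form
  of the character.\<close>

lemma kernel_card_ch:
  assumes jk: "(j, k) \<noteq> (0, 0)"
  shows "\<exists>C. \<forall>q\<in>\<O>. q \<noteq> 0 \<longrightarrow> kernel_card (ch j k) q \<le> C"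
proof -
  define L where "L z = of_int j * co1 z + of_int k * co2 z" for z
  \<comment> \<open>A bound for both linear forms on the parallelogram.\<close>
  define B where "B = \<bar>j\<bar> + \<bar>k\<bar> + \<bar>j * nm\<bar> + \<bar>k * tr\<bar> + 1"
  have bd: "\<bar>L z\<bar> \<le> of_int B" "\<bar>L (z * w)\<bar> \<le> of_int B" if "z \<in> para" for z
  proof -
    have c: "0 \<le> co1 z" "co1 z \<le> 1" "0 \<le> co2 z" "co2 z \<le> 1" using that unfolding para_def by auto
    have m: "\<bar>of_int i * co1 z\<bar> \<le> \<bar>of_int i\<bar>" "\<bar>of_int i * co2 z\<bar> \<le> \<bar>of_int i\<bar>" for i :: int
      using c by (auto simp: abs_mult mult_left_le)
    have "\<bar>L z\<bar> \<le> \<bar>of_int j\<bar> + \<bar>of_int k\<bar>" unfolding L_def using m(1)[of j] m(2)[of k] by linarith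
    also have "\<dots> \<le> of_int B" unfolding B_def by simp
    finally show "\<bar>L z\<bar> \<le> of_int B" .
    have "L (z * w) = - (of_int (j * nm) * co2 z) + of_int k * co1 z + of_int (k * tr) * co2 z"
      unfolding L_def co_mult_w by (simp add: algebra_simps)
    then have "\<bar>L (z * w)\<bar> \<le> \<bar>of_int (j * nm)\<bar> + \<bar>of_int k\<bar> + \<bar>of_int (k * tr)\<bar>"
      using m(2)[of "j * nm"] m(1)[of k] m(2)[of "k * tr"] by linarith
    also have "\<dots> \<le> of_int B" unfolding B_def by simp
    finally show "\<bar>L (z * w)\<bar> \<le> of_int B" .
  qed
  have inj: "x = y" if "L x = L y" "L (x * w) = L (y * w)" for x y
  proof -
    define s where "s = co1 x - co1 y"
    define t where "t = co2 x - co2 y"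
    have 1: "of_int j * s + of_int k * t = 0" using that(1) unfolding L_def s_def t_def by (simp add: algebra_simps)
    have 2: "of_int k * s + of_int (k * tr - j * nm) * t = 0"
      using that(2) unfolding L_def co_mult_w s_def t_def by (simp add: algebra_simps)
    let ?D = "of_int (k\<^sup>2 - tr * j * k + nm * j\<^sup>2) :: real"
    have D: "?D \<noteq> 0" using norm_form_pos[OF jk] by (simp only: of_int_eq_0_iff not_False_eq_True)
    have "?D * t = of_int k * (of_int j * s + of_int k * t) - of_int j * (of_int k * s + of_int (k * tr - j * nm) * t)"
      by (simp add: algebra_simps power2_eq_square)
    then have "t = 0" using D 1 2 by simp
    have "?D * s = of_int k * (of_int k * s + of_int (k * tr - j * nm) * t) - of_int (k * tr - j * nm) * (of_int j * s + of_int k * t)"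
      by (simp add: algebra_simps power2_eq_square)
    then have "s = 0" using D 1 2 by simp
    then show ?thesis using \<open>t = 0\<close> co_eq[of x] co_eq[of y] unfolding s_def t_def by simp
  qed
  have "kernel_card (ch j k) q \<le> card ({- B..B} \<times> {- B..B})" if q: "q \<in> \<O>" "q \<noteq> 0" for q
    unfolding kernel_card_def
  proof (rule card_inj_on_le[of "\<lambda>m. (\<lfloor>L (m / q)\<rfloor>, \<lfloor>L (m / q * w)\<rfloor>)"])
    have int: "L (m / q) \<in> \<int> \<and> L (m / q * w) \<in> \<int>" if "m \<in> {m \<in> res q. \<forall>a\<in>\<O>. ch j k (m * a / q) = 1}" for m
    proof -
      have "ch j k (m * 1 / q) = 1" "ch j k (m * w / q) = 1" using that O_1 O_w by blast+
      then show ?thesis unfolding ch_eq_1 L_def by simp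
    qed
    show "inj_on (\<lambda>m. (\<lfloor>L (m / q)\<rfloor>, \<lfloor>L (m / q * w)\<rfloor>)) {m \<in> res q. \<forall>a\<in>\<O>. ch j k (m * a / q) = 1}"
    proof (rule inj_onI)
      fix x y assume x: "x \<in> {m \<in> res q. \<forall>a\<in>\<O>. ch j k (m * a / q) = 1}" and y: "y \<in> {m \<in> res q. \<forall>a\<in>\<O>. ch j k (m * a / q) = 1}"
        and e: "(\<lfloor>L (x / q)\<rfloor>, \<lfloor>L (x / q * w)\<rfloor>) = (\<lfloor>L (y / q)\<rfloor>, \<lfloor>L (y / q * w)\<rfloor>)"
      have "L (x / q) = L (y / q)" "L (x / q * w) = L (y / q * w)"
        using int[OF x] int[OF y] e by (metis Ints_cases floor_of_int prod.inject)+
      then have "x / q = y / q" by (rule inj)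
      then show "x = y" using q by simp
    qed
    show "(\<lambda>m. (\<lfloor>L (m / q)\<rfloor>, \<lfloor>L (m / q * w)\<rfloor>)) ` {m \<in> res q. \<forall>a\<in>\<O>. ch j k (m * a / q) = 1} \<subseteq> {- B..B} \<times> {- B..B}"
    proof (rule image_subsetI)
      fix m assume m: "m \<in> {m \<in> res q. \<forall>a\<in>\<O>. ch j k (m * a / q) = 1}"
      then have "m / q \<in> para" unfolding res_def by blast
      have "\<lfloor>x\<rfloor> \<in> {- B..B}" if "\<bar>x\<bar> \<le> of_int B" for x :: real
        using that by (auto simp: le_floor_iff) linarith+
      then show "(\<lfloor>L (m / q)\<rfloor>, \<lfloor>L (m / q * w)\<rfloor>) \<in> {- B..B} \<times> {- B..B}"
        using bd[OF \<open>m / q \<in> para\<close>] by blast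
    qed
  qed simp
  then show ?thesis by blast
qed

text \<open>Inversion permutes the invertible residues. Hence it does not matter which of the two characters is nontrivial.\<close>

lemma kloo_sym:
  assumes c: "is_char c" and d: "is_char d" and q: "q \<in> \<O>" "q \<noteq> 0"
  shows "kloo c d q = kloo d c q"
proof -
  define f where "f p = redu q (invq q p)" for p
  have f: "f p \<in> ures q" "f (f p) = p" "cg q (f p) (invq q p)" "cg q (invq q (f p)) p" if p: "p \<in> ures q" for p
  proof -
    note pO = ures_O[OF p] and i = invq_ures[OF p q(1)]
    show 1: "cg q (f p) (invq q p)" unfolding f_def by (rule redu_cg)
    have fr: "f p \<in> res q" unfolding f_def by (rule redu_res[OF q i(1)])
    have "cg q (f p * p) (invq q p * p)" by (rule cg_mult_right[OF 1 pO])
    then have 2: "cg q (f p * p) 1" using i(2) by (metis cg_trans mult.commute)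
    then have cm: "comaximal K (f p) q" using comaximal_cg[OF res_O[OF fr] q(1)] pO by blast
    then show U: "f p \<in> ures q" unfolding ures_def using fr by blast
    show 3: "cg q (invq q (f p)) p"
      by (rule inv_unique[OF ures_O[OF U] q(1) invq_ures(1)[OF U q(1)] pO invq_ures(2)[OF U q(1)] 2])
    show "f (f p) = p"
    proof (rule res_unique[OF q(2) _ ures_res[OF p]])
      show "f (f p) \<in> res q" unfolding f_def[of "f p"] by (rule redu_res[OF q invq_ures(1)[OF U q(1)]])
      show "cg q (f (f p)) p" unfolding f_def[of "f p"] by (rule cg_trans[OF redu_cg(1) 3])
    qed
  qed
  show ?thesis unfolding kloo_def
  proof (rule sum.reindex_bij_witness[of _ f f])
    fix p assume p: "p \<in> ures q"
    have "d (f p / q) = d (invq q p / q)" by (rule char_cg[OF d f(3)[OF p] q(2)])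
    moreover have "c (invq q (f p) / q) = c (p / q)" by (rule char_cg[OF c f(4)[OF p] q(2)])
    ultimately show "d (f p / q) * c (invq q (f p) / q) = c (p / q) * d (invq q p / q)" by simp
  qed (use f in auto)
qed

lemma kloo_ch_small:
  assumes "(j, k, j', k') \<noteq> (0, 0, 0, 0)" and e: "0 < e"
  shows "\<exists>r>0. \<forall>q\<in>\<O>. r \<le> cmod q \<longrightarrow> cmod (kloo (ch j k) (ch j' k') q) \<le> e * real (N q)"
proof (cases "(j, k) = (0, 0)")
  case False
  from kernel_card_ch[OF this] obtain C where C: "\<forall>q\<in>\<O>. q \<noteq> 0 \<longrightarrow> kernel_card (ch j k) q \<le> C" by blast
  show ?thesis by (rule kloo_small[OF is_char_ch is_char_ch e]) (use C in blast)
next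
  case True
  then have "(j', k') \<noteq> (0, 0)" using assms by auto
  from kernel_card_ch[OF this] obtain C where C: "\<forall>q\<in>\<O>. q \<noteq> 0 \<longrightarrow> kernel_card (ch j' k') q \<le> C" by blast
  have "\<exists>r>0. \<forall>q\<in>\<O>. r \<le> cmod q \<longrightarrow> cmod (kloo (ch j' k') (ch j k) q) \<le> e * real (N q)"
    by (rule kloo_small[OF is_char_ch is_char_ch e]) (use C in blast)
  then obtain r where r: "r > 0" "\<And>q. q \<in> \<O> \<Longrightarrow> r \<le> cmod q \<Longrightarrow> cmod (kloo (ch j' k') (ch j k) q) \<le> e * real (N q)"
    by blast
  have "cmod (kloo (ch j k) (ch j' k') q) \<le> e * real (N q)" if "q \<in> \<O>" "r \<le> cmod q" for q
  proof -
    have "q \<noteq> 0" using that(2) r(1) by auto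
    from kloo_sym[OF is_char_ch is_char_ch that(1) this, of j k j' k'] show ?thesis using r(2)[OF that] by simp
  qed
  then show ?thesis using r(1) by blast
qed

section \<open>Equidistribution of Farey data: trigonometric test functions\<close>

definition expo :: "real measure" where "expo = density lborel (exponential_density 2)"

text \<open>The limiting distribution of the triples. With \<open>u = exp (- s / 2)\<close> the fourth power of the height \<open>u\<close> is uniform on
  the unit interval, in accordance with the growth of the number of pairs like \<open>Q ^ 4\<close>. The absolute
  value keeps the height in the unit interval for negative \<open>s\<close>, which have density 0.\<close>

definition nu :: "(real \<times> complex \<times> complex) measure" where
  "nu = distr (expo \<Otimes>\<^sub>M (unif \<Otimes>\<^sub>M unif)) borel (\<lambda>(s, z, x). (exp (- \<bar>s\<bar> / 2), z, x))"

definition pairs :: "real \<Rightarrow> (complex \<times> complex) set" where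
  "pairs Q = Sigma (qs Q) ures"

definition pt :: "real \<Rightarrow> complex \<times> complex \<Rightarrow> real \<times> complex \<times> complex" where
  "pt Q = (\<lambda>(q, p). (cmod q / Q, p / q, invq q p / q))"

definition avg :: "real \<Rightarrow> (real \<times> complex \<times> complex \<Rightarrow> 'b::real_vector) \<Rightarrow> 'b" where
  "avg Q f = (\<Sum>qp\<in>pairs Q. f (pt Q qp)) /\<^sub>R real (card (pairs Q))"

lemma prob_expo: "prob_space expo"
  unfolding expo_def by (rule prob_space_exponential_density) simp

lemma sets_expo [simp, measurable_cong]: "sets expo = sets borel" and space_expo [simp]: "space expo = UNIV"
  unfolding expo_def by simp_all

lemma nu_measurable [measurable]:
  "(\<lambda>(s::real, z, x). (exp (- \<bar>s\<bar> / 2), z, x)) \<in> borel_measurable (expo \<Otimes>\<^sub>M (unif \<Otimes>\<^sub>M unif))"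
proof -
  have "(\<lambda>(s::real, z, x). (exp (- \<bar>s\<bar> / 2), z, x)) \<in> measurable (expo \<Otimes>\<^sub>M (unif \<Otimes>\<^sub>M unif)) (borel \<Otimes>\<^sub>M (borel \<Otimes>\<^sub>M borel))"
    by measurable
  then show ?thesis by (simp add: borel_prod)
qed

lemma prob_unif2: "prob_space (unif \<Otimes>\<^sub>M unif)"
proof -
  interpret u: prob_space unif by (rule prob_unif)
  interpret pair_prob_space unif unif ..
  show ?thesis by unfold_locales
qed

lemma prob_base: "prob_space (expo \<Otimes>\<^sub>M (unif \<Otimes>\<^sub>M unif))"
proof -
  interpret e: prob_space expo by (rule prob_expo)
  interpret u: prob_space "unif \<Otimes>\<^sub>M unif" by (rule prob_unif2)
  interpret pair_prob_space expo "unif \<Otimes>\<^sub>M unif" ..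
  show ?thesis by unfold_locales
qed

lemma prob_nu: "prob_space nu"
  unfolding nu_def by (rule prob_space.prob_space_distr[OF prob_base nu_measurable])

lemma sets_nu [simp, measurable_cong]: "sets nu = sets borel" and space_nu [simp]: "space nu = UNIV"
  unfolding nu_def by simp_all

definition tri :: "nat \<Rightarrow> int \<Rightarrow> int \<Rightarrow> int \<Rightarrow> int \<Rightarrow> real \<times> complex \<times> complex \<Rightarrow> complex" where
  "tri n j k j' k' = (\<lambda>(u, z, x). of_real u ^ n * ch j k z * ch j' k' x)"

lemma expo_moment: "(\<integral>s. exp (- \<bar>s\<bar> / 2) ^ n \<partial>expo) = 4 / (4 + real n)"
proof -
  define l where "l = 2 + real n / 2"
  have l: "0 < l" unfolding l_def by simp
  have "(\<integral>s. exp (- \<bar>s\<bar> / 2) ^ n \<partial>expo) = (\<integral>s. exponential_density 2 s *\<^sub>R exp (- \<bar>s\<bar> / 2) ^ n \<partial>lborel)"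
    unfolding expo_def
    by (rule integral_density) (auto simp: exponential_density_def)
  also have "\<dots> = (\<integral>s. (2 / l) * exponential_density l s \<partial>lborel)"
  proof (rule Bochner_Integration.integral_cong[OF refl])
    fix s :: real
    show "exponential_density 2 s *\<^sub>R exp (- \<bar>s\<bar> / 2) ^ n = (2 / l) * exponential_density l s"
    proof (cases "s < 0")
      case False
      have "exp (- s * 2) * exp (- s / 2) ^ n = exp (- s * l)"
        unfolding exp_of_nat_mult[symmetric] exp_add[symmetric] l_def by (simp add: algebra_simps)
      then show ?thesis using False l unfolding exponential_density_def by simp
    qed (simp add: exponential_density_def)
  qed
  also have "\<dots> = (2 / l) * (\<integral>s. exponential_density l s \<partial>lborel)" by simp
  also have "(\<integral>s. exponential_density l s \<partial>lborel) = 1"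
  proof -
    have "(\<integral>s. 1 \<partial>density lborel (exponential_density l)) = (\<integral>s. exponential_density l s *\<^sub>R (1::real) \<partial>lborel)"
      by (rule integral_density) (use l in \<open>auto simp: exponential_density_def\<close>)
    then show ?thesis using prob_space.prob_space[OF prob_space_exponential_density[OF l]] by simp
  qed
  finally show ?thesis unfolding l_def by (simp add: field_simps)
qed

lemma pair_integral_mult:
  fixes f :: "'a \<Rightarrow> complex" and g :: "'b \<Rightarrow> complex"
  assumes M: "prob_space M" and M2: "prob_space M2" and [measurable]: "f \<in> borel_measurable M" "g \<in> borel_measurable M2"
    and f: "\<And>x. cmod (f x) \<le> 1" and g: "\<And>y. cmod (g y) \<le> 1"
  shows "(\<integral>p. f (fst p) * g (snd p) \<partial>(M \<Otimes>\<^sub>M M2)) = (\<integral>x. f x \<partial>M) * (\<integral>y. g y \<partial>M2)"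
proof -
  interpret M: prob_space M by (rule M)
  interpret M2: prob_space M2 by (rule M2)
  interpret P: pair_prob_space M M2 ..
  have "integrable (M \<Otimes>\<^sub>M M2) (\<lambda>(x, y). f x * g y)"
  proof (rule P.integrable_const_bound[of _ 1])
    show "AE p in M \<Otimes>\<^sub>M M2. cmod (case p of (x, y) \<Rightarrow> f x * g y) \<le> 1"
      by (rule AE_I2) (auto simp: norm_mult split: prod.splits intro!: mult_le_one f g)
  qed measurable
  from P.integral_fst[OF this] show ?thesis by (simp add: case_prod_unfold)
qed

lemma tri_measurable [measurable]: "tri n j k j' k' \<in> borel_measurable borel"
proof -
  have "tri n j k j' k' \<in> borel_measurable (borel \<Otimes>\<^sub>M (borel \<Otimes>\<^sub>M borel))"
    unfolding tri_def by measurable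
  then show ?thesis by (simp add: borel_prod)
qed

lemma ch_norm: "cmod (ch j k z) = 1" by (rule char_norm[OF is_char_ch])

lemma tri_integral: "(\<integral>p. tri n j k j' k' p \<partial>nu) = (if (j, k, j', k') = (0, 0, 0, 0) then of_real (4 / (4 + real n)) else 0)"
proof -
  have "(\<integral>p. tri n j k j' k' p \<partial>nu) = (\<integral>p. tri n j k j' k' (case p of (s, z, x) \<Rightarrow> (exp (- \<bar>s\<bar> / 2), z, x)) \<partial>(expo \<Otimes>\<^sub>M (unif \<Otimes>\<^sub>M unif)))"
    unfolding nu_def by (rule integral_distr) (use nu_measurable in auto)
  also have "\<dots> = (\<integral>p. of_real (exp (- \<bar>fst p\<bar> / 2) ^ n) * (ch j k (fst (snd p)) * ch j' k' (snd (snd p))) \<partial>(expo \<Otimes>\<^sub>M (unif \<Otimes>\<^sub>M unif)))"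
    by (rule Bochner_Integration.integral_cong[OF refl]) (auto simp: tri_def mult.assoc)
  also have "\<dots> = (\<integral>s. of_real (exp (- \<bar>s\<bar> / 2) ^ n) \<partial>expo) * (\<integral>p. ch j k (fst p) * ch j' k' (snd p) \<partial>(unif \<Otimes>\<^sub>M unif))"
  proof (rule pair_integral_mult[OF prob_expo prob_unif2, where f = "\<lambda>s. of_real (exp (- \<bar>s\<bar> / 2) ^ n)" and g = "\<lambda>p. ch j k (fst p) * ch j' k' (snd p)"])
    show "(\<lambda>p. ch j k (fst p) * ch j' k' (snd p)) \<in> borel_measurable (unif \<Otimes>\<^sub>M unif)" by measurable
  qed (auto simp: norm_mult norm_power ch_norm power_le_one)
  also have "(\<integral>p. ch j k (fst p) * ch j' k' (snd p) \<partial>(unif \<Otimes>\<^sub>M unif)) = (\<integral>z. ch j k z \<partial>unif) * (\<integral>x. ch j' k' x \<partial>unif)"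
    by (rule pair_integral_mult[OF prob_unif prob_unif]) (auto simp: ch_norm)
  also have "(\<integral>s. of_real (exp (- \<bar>s\<bar> / 2) ^ n) \<partial>expo) = (of_real (\<integral>s. exp (- \<bar>s\<bar> / 2) ^ n \<partial>expo) :: complex)"
    by (rule integral_complex_of_real)
  finally show ?thesis unfolding expo_moment ch_integral by auto
qed

lemma qs_D: "q \<in> qs R \<Longrightarrow> q \<in> \<O> \<and> q \<noteq> 0 \<and> cmod q \<le> R"
  unfolding qs_def by blast

lemma finite_pairs [simp]: "finite (pairs Q)"
  unfolding pairs_def by (rule finite_SigmaI) (auto dest: qs_D)

lemma card_pairs: "card (pairs Q) = (\<Sum>q\<in>qs Q. card (ures q))"
  unfolding pairs_def by (subst card_SigmaI) (auto dest: qs_D)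

lemma sum_pairs: "(\<Sum>qp\<in>pairs Q. f qp) = (\<Sum>q\<in>qs Q. \<Sum>p\<in>ures q. f (q, p))"
  unfolding pairs_def by (subst sum.Sigma) (auto dest: qs_D)

lemma pairs_growth: obtains k where "0 < k" "((\<lambda>Q. card (pairs Q) / Q ^ 4) \<longlongrightarrow> k) at_top"
  "\<And>n. ((\<lambda>Q. (\<Sum>q\<in>qs Q. card (ures q) * (cmod q / Q) ^ n) / Q ^ 4) \<longlongrightarrow> k * (4 / (4 + real n))) at_top"
proof -
  obtain k where k: "0 < k"
    "\<And>n. ((\<lambda>Q. (\<Sum>q\<in>qs Q. card (ures q) * (cmod q / Q) ^ n) / Q ^ 4) \<longlongrightarrow> k * (4 / (4 + real n))) at_top"
    using denominator_moments by blast
  have "((\<lambda>Q. card (pairs Q) / Q ^ 4) \<longlongrightarrow> k) at_top" using k(2)[of 0] by (simp add: card_pairs)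
  then show ?thesis using that k by blast
qed

lemma pairs_nonempty: "\<forall>\<^sub>F Q in at_top. 0 < card (pairs Q)"
proof -
  obtain k where k: "0 < k" "((\<lambda>Q. card (pairs Q) / Q ^ 4) \<longlongrightarrow> k) at_top" using pairs_growth by blast
  have "\<forall>\<^sub>F Q in at_top. 0 < card (pairs Q) / Q ^ 4" using order_tendstoD(1)[OF k(2,1)] .
  then show ?thesis by (rule eventually_mono) (auto simp: zero_less_divide_iff)
qed

text \<open>The sum over the numerators of a fixed \<open>q\<close> is a Kloosterman sum. It is negligible unless both characters are
  trivial, and in that case the moments of the denominators remain.\<close>

lemma avg_tri: "((\<lambda>Q. avg Q (tri n j k j' k')) \<longlongrightarrow> (\<integral>p. tri n j k j' k' p \<partial>nu)) at_top"
proof -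
  obtain c where c: "0 < c" "((\<lambda>Q. card (pairs Q) / Q ^ 4) \<longlongrightarrow> c) at_top"
    "\<And>n. ((\<lambda>Q. (\<Sum>q\<in>qs Q. card (ures q) * (cmod q / Q) ^ n) / Q ^ 4) \<longlongrightarrow> c * (4 / (4 + real n))) at_top"
    using pairs_growth by blast
  define S where "S Q = (\<Sum>qp\<in>pairs Q. tri n j k j' k' (pt Q qp))" for Q
  have S: "S Q = (\<Sum>q\<in>qs Q. of_real ((cmod q / Q) ^ n) * kloo (ch j k) (ch j' k') q)" for Q
    unfolding S_def sum_pairs kloo_def sum_distrib_left tri_def pt_def by (simp add: mult.assoc)
  have lim: "((\<lambda>Q. S Q / of_real (Q ^ 4)) \<longlongrightarrow> of_real c * (\<integral>p. tri n j k j' k' p \<partial>nu)) at_top"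
  proof (cases "(j, k, j', k') = (0, 0, 0, 0)")
    case True
    then have "kloo (ch j k) (ch j' k') q = of_nat (card (ures q))" for q unfolding kloo_def by (simp add: ch_0)
    then have e: "S Q / of_real (Q ^ 4) = of_real ((\<Sum>q\<in>qs Q. card (ures q) * (cmod q / Q) ^ n) / Q ^ 4)" for Q
      unfolding S by (simp add: mult.commute)
    have 1: "((\<lambda>Q. of_real ((\<Sum>q\<in>qs Q. card (ures q) * (cmod q / Q) ^ n) / Q ^ 4)) \<longlongrightarrow> (of_real (c * (4 / (4 + real n))) :: complex)) at_top"
      by (rule tendsto_of_real[OF c(3)])
    have 2: "of_real (c * (4 / (4 + real n))) = of_real c * (\<integral>p. tri n j k j' k' p \<partial>nu)"
      unfolding tri_integral using True by simp
    show ?thesis unfolding e using 1 unfolding 2 .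
  next
    case False
    have "((\<lambda>Q. S Q / of_real (Q ^ 4)) \<longlongrightarrow> 0) at_top"
    proof (rule tendstoI)
      fix e :: real assume e: "0 < e"
      obtain r where r: "r > 0" "\<And>q. q \<in> \<O> \<Longrightarrow> r \<le> cmod q \<Longrightarrow> cmod (kloo (ch j k) (ch j' k') q) \<le> e / 20 * real (N q)"
        using kloo_ch_small[OF False, of "e / 20"] e by auto
      have bound: "cmod (kloo (ch j k) (ch j' k') q) \<le> e / 20 * Q\<^sup>2 + r\<^sup>2" if q: "q \<in> qs Q" for q Q
      proof (cases "r \<le> cmod q")
        case True
        have qO: "q \<in> \<O>" "q \<noteq> 0" "cmod q \<le> Q" using q unfolding qs_def by auto
        have "cmod (kloo (ch j k) (ch j' k') q) \<le> e / 20 * (cmod q)\<^sup>2" using r(2)[OF qO(1) True] N_eq[OF qO(1,2)] by simp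
        also have "\<dots> \<le> e / 20 * Q\<^sup>2" using qO e by (intro mult_left_mono power_mono) auto
        finally show ?thesis by (simp add: add_increasing2)
      next
        case False
        have qO: "q \<in> \<O>" "q \<noteq> 0" using q unfolding qs_def by auto
        have "cmod (kloo (ch j k) (ch j' k') q) \<le> card (ures q)" by (rule kloo_trivial[OF is_char_ch is_char_ch])
        also have "\<dots> \<le> real (N q)" unfolding N_def ures_def using qO by (intro of_nat_mono card_mono) auto
        also have "\<dots> \<le> r\<^sup>2" unfolding N_eq[OF qO] using False by (intro power_mono) auto
        finally show ?thesis using e by (simp add: add_increasing)
      qed
      have main: "cmod (S Q) \<le> 9 * Q\<^sup>2 * (e / 20 * Q\<^sup>2 + r\<^sup>2)" if Q: "0 < Q" for Q
      proof -
        have "cmod (S Q) \<le> (\<Sum>q\<in>qs Q. cmod (of_real ((cmod q / Q) ^ n) * kloo (ch j k) (ch j' k') q))"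
          unfolding S by (rule norm_sum)
        also have "\<dots> \<le> (\<Sum>q\<in>qs Q. 1 * (e / 20 * Q\<^sup>2 + r\<^sup>2))"
        proof (rule sum_mono)
          fix q assume q: "q \<in> qs Q"
          have "(cmod q / Q) ^ n \<le> 1" using q Q by (intro power_le_one) (auto simp: qs_def)
          moreover have "0 \<le> (cmod q / Q) ^ n" using Q by simp
          ultimately have "cmod (of_real ((cmod q / Q) ^ n)) \<le> 1" by (simp only: norm_of_real abs_of_nonneg)
          then show "cmod (of_real ((cmod q / Q) ^ n) * kloo (ch j k) (ch j' k') q) \<le> 1 * (e / 20 * Q\<^sup>2 + r\<^sup>2)"
            unfolding norm_mult by (intro mult_mono bound[OF q]) auto
        qed
        also have "\<dots> = real (card (qs Q)) * (e / 20 * Q\<^sup>2 + r\<^sup>2)" by simp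
        also have "\<dots> \<le> 9 * Q\<^sup>2 * (e / 20 * Q\<^sup>2 + r\<^sup>2)"
          using card_qs[of Q] Q e by (intro mult_right_mono) auto
        finally show ?thesis .
      qed
      have "((\<lambda>Q::real. 9 * (e / 20 + r\<^sup>2 / Q\<^sup>2)) \<longlongrightarrow> 9 * (e / 20 + 0)) at_top"
        by (intro tendsto_intros tendsto_divide_0[OF tendsto_const] filterlim_at_top_imp_at_infinity filterlim_pow_at_top filterlim_ident) simp
      then have "\<forall>\<^sub>F Q in at_top. 9 * (e / 20 + r\<^sup>2 / Q\<^sup>2) < e" by (rule order_tendstoD(2)) (use e in simp)
      then show "\<forall>\<^sub>F Q in at_top. dist (S Q / of_real (Q ^ 4)) 0 < e"
        using eventually_gt_at_top[of 0]
      proof eventually_elim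
        case (elim Q)
        have "cmod (S Q) / Q ^ 4 \<le> 9 * Q\<^sup>2 * (e / 20 * Q\<^sup>2 + r\<^sup>2) / Q ^ 4"
          using main[OF elim(2)] elim(2) by (intro divide_right_mono) auto
        also have "\<dots> = 9 * (e / 20 + r\<^sup>2 / Q\<^sup>2)" using elim(2) by (simp add: field_simps power2_eq_square power4_eq_xxxx)
        finally have "cmod (S Q) / Q ^ 4 < e" using elim(1) by linarith
        then show ?case using elim(2) by (simp add: norm_divide norm_power)
      qed
    qed
    moreover have "(\<integral>p. tri n j k j' k' p \<partial>nu) = 0" unfolding tri_integral using False by (simp only: if_False)
    ultimately show ?thesis by simp
  qed
  have "((\<lambda>Q. of_real (card (pairs Q) / Q ^ 4)) \<longlongrightarrow> (of_real c :: complex)) at_top" by (rule tendsto_of_real[OF c(2)])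
  from tendsto_divide[OF lim this] c(1)
  have "((\<lambda>Q. S Q / of_real (Q ^ 4) / of_real (card (pairs Q) / Q ^ 4)) \<longlongrightarrow> (\<integral>p. tri n j k j' k' p \<partial>nu)) at_top" by simp
  then show ?thesis
  proof (rule Lim_transform_eventually)
    show "\<forall>\<^sub>F Q in at_top. S Q / of_real (Q ^ 4) / of_real (card (pairs Q) / Q ^ 4) = avg Q (tri n j k j' k')"
      by (rule eventually_mono[OF eventually_gt_at_top[of 0]])
        (simp add: avg_def S_def[symmetric] scaleR_conv_of_real field_simps)
  qed
qed

end

section \<open>Equidistribution of Farey data: continuity sets\<close>

context imaginary_order
begin

text \<open>An algebra of test functions that contains all real polynomials in the coordinates of \<open>emb\<close> below.\<close>

inductive trig :: "(real \<times> complex \<times> complex \<Rightarrow> complex) \<Rightarrow> bool" where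
  trig_tri: "trig (tri n j k j' k')"
| trig_add: "trig f \<Longrightarrow> trig g \<Longrightarrow> trig (\<lambda>p. f p + g p)"
| trig_scale: "trig f \<Longrightarrow> trig (\<lambda>p. c * f p)"

lemma trig_const: "trig (\<lambda>_. c)"
proof -
  have "(\<lambda>p. c * tri 0 0 0 0 0 p) = (\<lambda>_. c)" by (auto simp: tri_def ch_0)
  then show ?thesis using trig_scale[OF trig_tri, of c 0 0 0 0 0] by simp
qed

lemma tri_mult: "tri n j k j' k' p * tri n' l m l' m' p = tri (n + n') (j + l) (k + m) (j' + l') (k' + m') p"
  unfolding tri_def by (cases p) (simp add: power_add ch_mult[symmetric] mult_ac)

lemma trig_mult: "trig f \<Longrightarrow> trig g \<Longrightarrow> trig (\<lambda>p. f p * g p)"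
proof (induction f rule: trig.induct)
  case (trig_tri n j k j' k')
  then show ?case
  proof (induction g rule: trig.induct)
    case (trig_tri n' l m l' m')
    show ?case unfolding tri_mult by (rule trig.trig_tri)
  next
    case (trig_add f g)
    then show ?case using trig.trig_add by (simp add: distrib_left)
  next
    case (trig_scale f c)
    then show ?case using trig.trig_scale by (simp add: mult.left_commute)
  qed
next
  case (trig_add f g')
  then show ?case using trig.trig_add by (simp add: distrib_right)
next
  case (trig_scale f c)
  then show ?case using trig.trig_scale by (simp add: mult.assoc)
qed

lemma nu_integral:
  fixes f :: "real \<times> complex \<times> complex \<Rightarrow> 'b::{banach, second_countable_topology}"
  assumes "f \<in> borel_measurable borel"
  shows "(\<integral>p. f p \<partial>nu) = (\<integral>p. f (case p of (s, z, x) \<Rightarrow> (exp (- \<bar>s\<bar> / 2), z, x)) \<partial>(expo \<Otimes>\<^sub>M (unif \<Otimes>\<^sub>M unif)))"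
  unfolding nu_def by (rule integral_distr[OF nu_measurable assms])

lemma AE_nu: "AE p in nu. 0 < fst p \<and> fst p \<le> 1"
proof -
  have [measurable]: "fst \<in> borel_measurable (borel :: (real \<times> complex \<times> complex) measure)"
    by (intro borel_measurable_continuous_onI continuous_intros)
  have "{p \<in> space (borel :: (real \<times> complex \<times> complex) measure). 0 < fst p \<and> fst p \<le> 1} \<in> sets borel" by measurable
  then show ?thesis unfolding nu_def by (subst AE_distr_iff[OF nu_measurable]) auto
qed

lemma trig_measurable: "trig f \<Longrightarrow> f \<in> borel_measurable borel"
  by (induction rule: trig.induct) auto

lemma trig_integrable: "trig f \<Longrightarrow> integrable nu f"
proof (induction rule: trig.induct)
  case (trig_tri n j k j' k')
  interpret prob_space nu by (rule prob_nu)
  show ?case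
  proof (rule integrable_const_bound[of _ 1])
    show "AE p in nu. cmod (tri n j k j' k' p) \<le> 1"
      using AE_nu by (rule AE_mp) (auto simp: tri_def norm_mult norm_power ch_norm power_le_one intro!: AE_I2)
  qed measurable
qed auto

lemma avg_add: "avg Q (\<lambda>p. f p + g p) = avg Q f + avg Q g"
  unfolding avg_def by (simp add: sum.distrib scaleR_add_right)

lemma avg_scale: "avg Q (\<lambda>p. c * f p :: complex) = c * avg Q f"
  unfolding avg_def by (simp add: sum_distrib_left[symmetric])

lemma avg_of_real: "avg Q (\<lambda>p. complex_of_real (f p)) = of_real (avg Q f)"
  unfolding avg_def by (simp add: scaleR_conv_of_real)

lemma trig_limit: "trig f \<Longrightarrow> ((\<lambda>Q. avg Q f) \<longlongrightarrow> (\<integral>p. f p \<partial>nu)) at_top"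
proof (induction rule: trig.induct)
  case (trig_tri n j k j' k')
  show ?case by (rule avg_tri)
next
  case (trig_add f g)
  then show ?case by (simp add: avg_add trig_integrable tendsto_add)
next
  case (trig_scale f c)
  then show ?case by (simp add: avg_scale tendsto_mult_left)
qed

text \<open>The embedding of the parameter space modulo the lattices into a Euclidean space.\<close>

definition emb :: "real \<times> complex \<times> complex \<Rightarrow> real \<times> (complex \<times> complex) \<times> (complex \<times> complex)" where
  "emb = (\<lambda>(u, z, x). (u, (ch 1 0 z, ch 0 1 z), (ch 1 0 x, ch 0 1 x)))"

lemma trig_Re: "trig f \<Longrightarrow> trig (\<lambda>p. cnj (f p)) \<Longrightarrow> trig (\<lambda>p. of_real (Re (f p)))"
  and trig_Im: "trig f \<Longrightarrow> trig (\<lambda>p. cnj (f p)) \<Longrightarrow> trig (\<lambda>p. of_real (Im (f p)))"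
proof -
  assume f: "trig f" "trig (\<lambda>p. cnj (f p))"
  have "(\<lambda>p. of_real (Re (f p))) = (\<lambda>p. (1/2) * (f p + cnj (f p)))" by (auto simp: complex_eq_iff)
  then show "trig (\<lambda>p. of_real (Re (f p)))" using trig_scale[OF trig_add[OF f], of "1/2"] by simp
  have "(\<lambda>p. of_real (Im (f p))) = (\<lambda>p. (- \<i> / 2) * (f p + (- 1) * cnj (f p)))" by (auto simp: complex_eq_iff)
  then show "trig (\<lambda>p. of_real (Im (f p)))" using trig_scale[OF trig_add[OF f(1) trig_scale[OF f(2), of "- 1"]], of "- \<i> / 2"] by simp
qed

lemma trig_ch: "trig (\<lambda>p. ch j k (fst (snd p)))" "trig (\<lambda>p. cnj (ch j k (fst (snd p))))"
    "trig (\<lambda>p. ch j k (snd (snd p)))" "trig (\<lambda>p. cnj (ch j k (snd (snd p))))"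
proof -
  have "tri 0 j k 0 0 = (\<lambda>p. ch j k (fst (snd p)))" "tri 0 (- j) (- k) 0 0 = (\<lambda>p. cnj (ch j k (fst (snd p))))"
    "tri 0 0 0 j k = (\<lambda>p. ch j k (snd (snd p)))" "tri 0 0 0 (- j) (- k) = (\<lambda>p. cnj (ch j k (snd (snd p))))"
    by (auto simp: tri_def ch_0 ch_cnj)
  then show "trig (\<lambda>p. ch j k (fst (snd p)))" "trig (\<lambda>p. cnj (ch j k (fst (snd p))))"
    "trig (\<lambda>p. ch j k (snd (snd p)))" "trig (\<lambda>p. cnj (ch j k (snd (snd p))))"
    by (metis trig_tri)+
qed

lemma trig_fst: "trig (\<lambda>p. of_real (fst p))"
proof -
  have "tri 1 0 0 0 0 = (\<lambda>p. of_real (fst p))" by (auto simp: tri_def ch_0)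
  then show ?thesis by (metis trig_tri)
qed

lemma trig_linear:
  assumes "bounded_linear h"
  shows "trig (\<lambda>p. of_real (h (emb p)))"
proof -
  interpret bounded_linear h by (rule assms)
  define e where "e = [(1, (0, 0), (0, 0)), (0, (1, 0), (0, 0)), (0, (\<i>, 0), (0, 0)), (0, (0, 1), (0, 0)), (0, (0, \<i>), (0, 0)),
     (0, (0, 0), (1, 0)), (0, (0, 0), (\<i>, 0)), (0, (0, 0), (0, 1)), (0, (0, 0), (0, \<i>)) :: real \<times> (complex \<times> complex) \<times> (complex \<times> complex)]"
  have dec: "(u, (a, b), (c, d)) = u *\<^sub>R e!0 + Re a *\<^sub>R e!1 + Im a *\<^sub>R e!2 + Re b *\<^sub>R e!3 + Im b *\<^sub>R e!4
     + Re c *\<^sub>R e!5 + Im c *\<^sub>R e!6 + Re d *\<^sub>R e!7 + Im d *\<^sub>R e!8" for u a b c d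
    unfolding e_def by (simp add: complex_eq_iff)
  have h: "h (u, (a, b), (c, d)) = u * h (e!0) + Re a * h (e!1) + Im a * h (e!2) + Re b * h (e!3) + Im b * h (e!4)
     + Re c * h (e!5) + Im c * h (e!6) + Re d * h (e!7) + Im d * h (e!8)" for u a b c d
    by (subst dec) (simp only: add scaleR real_scaleR_def)
  have "trig (\<lambda>p. of_real (h (e!0)) * of_real (fst p) + of_real (h (e!1)) * of_real (Re (ch 1 0 (fst (snd p))))
     + of_real (h (e!2)) * of_real (Im (ch 1 0 (fst (snd p)))) + of_real (h (e!3)) * of_real (Re (ch 0 1 (fst (snd p))))
     + of_real (h (e!4)) * of_real (Im (ch 0 1 (fst (snd p)))) + of_real (h (e!5)) * of_real (Re (ch 1 0 (snd (snd p))))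
     + of_real (h (e!6)) * of_real (Im (ch 1 0 (snd (snd p)))) + of_real (h (e!7)) * of_real (Re (ch 0 1 (snd (snd p))))
     + of_real (h (e!8)) * of_real (Im (ch 0 1 (snd (snd p)))))"
    by (intro trig_add trig_scale trig_fst trig_Re trig_Im trig_ch)
  moreover have "(\<lambda>p. of_real (h (emb p))) = (\<lambda>p. of_real (h (e!0)) * of_real (fst p) + of_real (h (e!1)) * of_real (Re (ch 1 0 (fst (snd p))))
     + of_real (h (e!2)) * of_real (Im (ch 1 0 (fst (snd p)))) + of_real (h (e!3)) * of_real (Re (ch 0 1 (fst (snd p))))
     + of_real (h (e!4)) * of_real (Im (ch 0 1 (fst (snd p)))) + of_real (h (e!5)) * of_real (Re (ch 1 0 (snd (snd p))))
     + of_real (h (e!6)) * of_real (Im (ch 1 0 (snd (snd p)))) + of_real (h (e!7)) * of_real (Re (ch 0 1 (snd (snd p))))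
     + of_real (h (e!8)) * (of_real (Im (ch 0 1 (snd (snd p)))) :: complex))"
  proof
    fix p
    show "of_real (h (emb p)) = of_real (h (e!0)) * of_real (fst p) + of_real (h (e!1)) * of_real (Re (ch 1 0 (fst (snd p))))
     + of_real (h (e!2)) * of_real (Im (ch 1 0 (fst (snd p)))) + of_real (h (e!3)) * of_real (Re (ch 0 1 (fst (snd p))))
     + of_real (h (e!4)) * of_real (Im (ch 0 1 (fst (snd p)))) + of_real (h (e!5)) * of_real (Re (ch 1 0 (snd (snd p))))
     + of_real (h (e!6)) * of_real (Im (ch 1 0 (snd (snd p)))) + of_real (h (e!7)) * of_real (Re (ch 0 1 (snd (snd p))))
     + of_real (h (e!8)) * (of_real (Im (ch 0 1 (snd (snd p)))) :: complex)"
      unfolding emb_def by (cases p) (simp add: h mult.commute)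
  qed
  ultimately show ?thesis by simp
qed

lemma trig_polynomial: "real_polynomial_function g \<Longrightarrow> trig (\<lambda>p. of_real (g (emb p)))"
proof (induction rule: real_polynomial_function.induct)
  case (linear h)
  then show ?case by (rule trig_linear)
next
  case (const c)
  show ?case by (rule trig_const)
next
  case (add f g)
  then show ?case using trig_add by simp
next
  case (mult f g)
  then show ?case using trig_mult by simp
qed

lemma emb_cont: "continuous_on UNIV emb"
proof -
  have c: "continuous_on UNIV (\<lambda>p. ch j k (fst (snd p)))" "continuous_on UNIV (\<lambda>p. ch j k (snd (snd p)))"
    for j k and p :: "real \<times> complex \<times> complex"
    by (rule continuous_on_compose2[OF ch_cont], auto intro!: continuous_intros)+
  show ?thesis unfolding emb_def case_prod_unfold by (intro continuous_intros c)
qed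

lemma emb_measurable [measurable]: "emb \<in> borel_measurable borel"
  using emb_cont by (rule borel_measurable_continuous_onI)

definition tube :: "(real \<times> (complex \<times> complex) \<times> (complex \<times> complex)) set" where
  "tube = cball 0 1 \<times> (sphere 0 1 \<times> sphere 0 1) \<times> (sphere 0 1 \<times> sphere 0 1)"

lemma compact_tube: "compact tube"
  unfolding tube_def by (intro compact_Times) auto

lemma emb_tube: "\<bar>fst p\<bar> \<le> 1 \<Longrightarrow> emb p \<in> tube"
  unfolding emb_def tube_def by (cases p) (simp add: ch_norm)

lemma pt_range:
  assumes "qp \<in> pairs Q" shows "0 < fst (pt Q qp)" "fst (pt Q qp) \<le> 1"
proof -
  obtain q p where qp: "qp = (q, p)" "q \<in> qs Q" using assms unfolding pairs_def by auto
  then have "q \<noteq> 0" "cmod q \<le> Q" using qs_D by auto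
  then have "0 < cmod q" "0 < Q" by (auto intro: less_le_trans[of _ "cmod q"])
  then show "0 < fst (pt Q qp)" "fst (pt Q qp) \<le> 1" unfolding pt_def qp(1) using \<open>cmod q \<le> Q\<close> by auto
qed

lemma avg_mono:
  fixes f g :: "real \<times> complex \<times> complex \<Rightarrow> real"
  assumes "\<And>p. 0 < fst p \<Longrightarrow> fst p \<le> 1 \<Longrightarrow> f p \<le> g p"
  shows "avg Q f \<le> avg Q g"
  unfolding avg_def real_scaleR_def
  by (intro mult_left_mono sum_mono assms pt_range) auto

lemma avg_const: "0 < card (pairs Q) \<Longrightarrow> avg Q (\<lambda>_. c :: real) = c"
proof -
  assume "0 < card (pairs Q)"
  then have n: "real (card (pairs Q)) \<noteq> 0" by linarith
  show ?thesis
    by (simp only: avg_def sum_constant real_scaleR_def mult.assoc[symmetric] left_inverse[OF n] mult_1)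
qed

text \<open>By the Weierstrass theorem, \<open>F\<close> is uniformly close to a polynomial on the compact set \<open>tube\<close>, which contains
  the images of all triples.\<close>

lemma continuous_limit:
  assumes F: "continuous_on UNIV (F :: _ \<Rightarrow> real)"
  shows "((\<lambda>Q. avg Q (\<lambda>p. F (emb p))) \<longlongrightarrow> (\<integral>p. F (emb p) \<partial>nu)) at_top"
proof (rule tendstoI)
  fix e :: real assume e: "0 < e"
  interpret prob_space nu by (rule prob_nu)
  have [measurable]: "F \<in> borel_measurable borel" using F by (rule borel_measurable_continuous_onI)
  obtain g where g: "real_polynomial_function g" "\<And>y. y \<in> tube \<Longrightarrow> \<bar>F y - g y\<bar> < e / 4"
    using Stone_Weierstrass_real_polynomial_function[OF compact_tube continuous_on_subset[OF F], of "e / 4"] e by auto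
  have g': "\<bar>F (emb p) - g (emb p)\<bar> \<le> e / 4" if "0 < fst p" "fst p \<le> 1" for p
    using g(2)[OF emb_tube[of p]] that by simp
  have tg: "trig (\<lambda>p. of_real (g (emb p)))" by (rule trig_polynomial[OF g(1)])
  have ig: "integrable nu (\<lambda>p. g (emb p))" using trig_integrable[OF tg] by (simp only: complex_of_real_integrable_eq)
  have iF: "integrable nu (\<lambda>p. F (emb p))"
  proof -
    have "bounded (F ` tube)" by (intro compact_imp_bounded compact_continuous_image compact_tube continuous_on_subset[OF F]) auto
    then obtain B where B: "\<And>y. y \<in> tube \<Longrightarrow> \<bar>F y\<bar> \<le> B" unfolding bounded_iff by auto
    show ?thesis
    proof (rule integrable_const_bound[of _ B])
      show "AE p in nu. norm (F (emb p)) \<le> B"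
        using AE_nu by (rule AE_mp) (auto intro!: AE_I2 B emb_tube)
    qed measurable
  qed
  have "((\<lambda>Q. avg Q (\<lambda>p. g (emb p))) \<longlongrightarrow> (\<integral>p. g (emb p) \<partial>nu)) at_top"
    using trig_limit[OF tg] unfolding avg_of_real integral_complex_of_real by (simp only: tendsto_of_real_iff)
  then have ev: "\<forall>\<^sub>F Q in at_top. dist (avg Q (\<lambda>p. g (emb p))) (\<integral>p. g (emb p) \<partial>nu) < e / 4"
    using e by (intro tendstoD) auto
  have d: "\<bar>(\<integral>p. F (emb p) \<partial>nu) - (\<integral>p. g (emb p) \<partial>nu)\<bar> \<le> e / 4"
  proof -
    have "\<bar>\<integral>p. F (emb p) - g (emb p) \<partial>nu\<bar> \<le> (\<integral>p. \<bar>F (emb p) - g (emb p)\<bar> \<partial>nu)" by (rule integral_abs_bound)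
    also have "\<dots> \<le> (\<integral>p. e / 4 \<partial>nu)"
    proof (rule integral_mono_AE)
      show "AE p in nu. \<bar>F (emb p) - g (emb p)\<bar> \<le> e / 4" using AE_nu by (rule AE_mp) (use g' in auto)
    qed (use iF ig in auto)
    also have "\<dots> = e / 4" using prob_space by simp
    finally show ?thesis using iF ig by simp
  qed
  from ev pairs_nonempty
  show "\<forall>\<^sub>F Q in at_top. dist (avg Q (\<lambda>p. F (emb p))) (\<integral>p. F (emb p) \<partial>nu) < e"
  proof eventually_elim
    case (elim Q)
    have c: "avg Q (\<lambda>p. g (emb p) + e / 4) = avg Q (\<lambda>p. g (emb p)) + e / 4"
      "avg Q (\<lambda>p. g (emb p) + - (e / 4)) = avg Q (\<lambda>p. g (emb p)) + - (e / 4)"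
      unfolding avg_add avg_const[OF elim(2)] by auto
    have "avg Q (\<lambda>p. F (emb p)) \<le> avg Q (\<lambda>p. g (emb p) + e / 4)"
    proof (rule avg_mono)
      fix p :: "real \<times> complex \<times> complex" assume "0 < fst p" "fst p \<le> 1"
      from g'[OF this] show "F (emb p) \<le> g (emb p) + e / 4" by linarith
    qed
    moreover have "avg Q (\<lambda>p. g (emb p) + - (e / 4)) \<le> avg Q (\<lambda>p. F (emb p))"
    proof (rule avg_mono)
      fix p :: "real \<times> complex \<times> complex" assume "0 < fst p" "fst p \<le> 1"
      from g'[OF this] show "g (emb p) + - (e / 4) \<le> F (emb p)" by linarith
    qed
    ultimately show ?case using elim(1) d e unfolding c dist_real_def by linarith
  qed
qed

definition periodic3 :: "(real \<times> complex \<times> complex) set \<Rightarrow> bool" where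
  "periodic3 A \<longleftrightarrow> (\<forall>u z x. \<forall>a\<in>\<O>. \<forall>b\<in>\<O>. (u, z + a, x + b) \<in> A \<longleftrightarrow> (u, z, x) \<in> A)"

lemma periodic3D: "periodic3 A \<Longrightarrow> a \<in> \<O> \<Longrightarrow> b \<in> \<O> \<Longrightarrow> (u, z + a, x + b) \<in> A \<longleftrightarrow> (u, z, x) \<in> A"
  unfolding periodic3_def by blast

lemma emb_eq_iff: "emb (u, z, x) = emb (u', z', x') \<longleftrightarrow> u = u' \<and> z - z' \<in> \<O> \<and> x - x' \<in> \<O>"
proof -
  have 1: "ch j k z = ch j k z' \<longleftrightarrow> ch j k (z - z') = 1" for j k z z'
  proof -
    have "ch j k (z - z') * ch j k z' = ch j k z" using char_add[OF is_char_ch, of j k "z - z'" z'] by simp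
    moreover have "ch j k z' \<noteq> 0" using ch_norm[of j k z'] by auto
    ultimately show ?thesis by (metis mult_cancel_right1 mult_1)
  qed
  have 2: "ch 1 0 z = ch 1 0 z' \<and> ch 0 1 z = ch 0 1 z' \<longleftrightarrow> z - z' \<in> \<O>" for z z'
    unfolding 1 ch_eq_1 O_iff by simp
  show ?thesis unfolding emb_def using 2[of z z'] 2[of x x'] by auto
qed

text \<open>Upper semicontinuity on closed sets, by comparison with continuous functions of the distance.\<close>

lemma closed_upper:
  assumes C: "closed C" "periodic3 C" and e: "0 < e"
  shows "\<forall>\<^sub>F Q in at_top. avg Q (indicator C) \<le> measure nu C + e"
proof -
  interpret prob_space nu by (rule prob_nu)
  define D where "D = emb ` (C \<inter> ({0..1} \<times> closure para \<times> closure para))"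
  have "bounded para" using para_bound unfolding bounded_iff by blast
  then have "compact (closure para)" by simp
  then have cD: "compact D" unfolding D_def
    by (intro compact_continuous_image continuous_on_subset[OF emb_cont] closed_Int_compact C compact_Times) auto
  have iff: "emb p \<in> D \<longleftrightarrow> p \<in> C" if p: "0 < fst p" "fst p \<le> 1" for p
  proof -
    obtain u z x where pe: "p = (u, z, x)" by (metis surj_pair)
    show ?thesis
    proof
      assume "emb p \<in> D"
      then obtain p' where p': "p' \<in> C" "emb p = emb p'" unfolding D_def by auto
      obtain u' z' x' where pe': "p' = (u', z', x')" by (metis surj_pair)
      have "u = u'" "z - z' \<in> \<O>" "x - x' \<in> \<O>" using p'(2) unfolding pe pe' emb_eq_iff by auto
      then show "p \<in> C" using periodic3D[OF C(2), of "z - z'" "x - x'" u' z' x'] p'(1) unfolding pe pe' by simp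
    next
      assume "p \<in> C"
      then have c: "(u, frc z, frc x) \<in> C" using periodic3D[OF C(2), of "- fl z" "- fl x" u z x] unfolding pe frc_def by (simp add: O_minus)
      moreover have "emb (u, frc z, frc x) = emb p" unfolding pe emb_eq_iff frc_def by (simp add: O_minus)
      moreover have "(u, frc z, frc x) \<in> {0..1} \<times> closure para \<times> closure para"
        using p frc_para closure_subset unfolding pe by auto
      ultimately show "emb p \<in> D" unfolding D_def by (metis IntI image_eqI)
    qed
  qed
  have Cm: "C \<in> sets borel" using C(1) by (rule borel_closed)
  show ?thesis
  proof (cases "D = {}")
    case True
    have "avg Q (indicator C :: _ \<Rightarrow> real) \<le> avg Q (\<lambda>_. 0)" for Q
    proof (rule avg_mono)
      fix p :: "real \<times> complex \<times> complex" assume "0 < fst p" "fst p \<le> 1"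
      then have "p \<notin> C" using iff[of p] True by blast
      then show "indicator C p \<le> (0::real)" by simp
    qed
    moreover have "avg Q (\<lambda>_. 0 :: real) = 0" for Q unfolding avg_def by simp
    ultimately have "avg Q (indicator C) \<le> measure nu C + e" for Q
      using e measure_nonneg[of nu C] by (smt (verit))
    then show ?thesis by simp
  next
    case False
    define g :: "nat \<Rightarrow> _ \<Rightarrow> real" where "g n y = max 0 (1 - real n * infdist y D)" for n y
    have gc: "continuous_on UNIV (g n)" for n unfolding g_def by (intro continuous_intros)
    have gm [measurable]: "g n \<in> borel_measurable borel" for n using gc by (rule borel_measurable_continuous_onI)
    have "(\<lambda>n. \<integral>p. g n (emb p) \<partial>nu) \<longlonglongrightarrow> (\<integral>p. indicator C p \<partial>nu)"
    proof (rule integral_dominated_convergence[where w = "\<lambda>_. 1"])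
      show "AE p in nu. (\<lambda>n. g n (emb p)) \<longlonglongrightarrow> indicator C p"
        using AE_nu
      proof (rule AE_mp, intro AE_I2 impI)
        fix p :: "real \<times> complex \<times> complex" assume p: "0 < fst p \<and> fst p \<le> 1"
        show "(\<lambda>n. g n (emb p)) \<longlonglongrightarrow> indicator C p"
        proof (cases "p \<in> C")
          case True
          then have "infdist (emb p) D = 0" using iff p by simp
          then show ?thesis unfolding g_def using True by simp
        next
          case notC: False
          then have "emb p \<notin> D" using iff p by blast
          then have i: "0 < infdist (emb p) D"
            using in_closed_iff_infdist_zero[OF compact_imp_closed[OF cD] False] infdist_nonneg[of "emb p" D] by (metis less_eq_real_def)
          obtain n0 where n0: "1 / infdist (emb p) D < real n0" using reals_Archimedean2 by blast
          have "g n (emb p) = 0" if "n \<ge> n0" for n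
          proof -
            have "1 / infdist (emb p) D < real n" using n0 that by linarith
            then have "1 < real n * infdist (emb p) D" using i by (simp add: field_simps)
            then show ?thesis unfolding g_def by simp
          qed
          then have "\<forall>\<^sub>F n in sequentially. g n (emb p) = 0" unfolding eventually_sequentially by blast
          then show ?thesis using notC by (simp add: tendsto_eventually)
        qed
      qed
      show "AE p in nu. norm (g n (emb p)) \<le> 1" for n
        by (rule AE_I2) (simp add: g_def infdist_nonneg)
    qed (use Cm in auto)
    then have "(\<lambda>n. \<integral>p. g n (emb p) \<partial>nu) \<longlonglongrightarrow> measure nu C" using Cm by simp
    then have "\<forall>\<^sub>F n in sequentially. (\<integral>p. g n (emb p) \<partial>nu) < measure nu C + e / 2" using e by (intro order_tendstoD(2)) auto
    then obtain n where n: "(\<integral>p. g n (emb p) \<partial>nu) < measure nu C + e / 2" by (auto simp: eventually_sequentially)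
    have "\<forall>\<^sub>F Q in at_top. avg Q (\<lambda>p. g n (emb p)) < measure nu C + e / 2"
      by (rule order_tendstoD(2)[OF continuous_limit[OF gc] n])
    then show ?thesis
    proof eventually_elim
      case (elim Q)
      have "avg Q (indicator C) \<le> avg Q (\<lambda>p. g n (emb p))"
      proof (rule avg_mono)
        fix p :: "real \<times> complex \<times> complex" assume "0 < fst p" "fst p \<le> 1"
        then show "indicator C p \<le> g n (emb p)" using iff[of p] by (cases "p \<in> C") (auto simp: g_def)
      qed
      then show ?case using elim e by linarith
    qed
  qed
qed

lemma periodic3_closure: "periodic3 A \<Longrightarrow> periodic3 (closure A)"
proof -
  assume A: "periodic3 A"
  have *: "(u, z + a, x + b) \<in> closure A" if "(u, z, x) \<in> closure A" "a \<in> \<O>" "b \<in> \<O>" for u z x a b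
  proof -
    have "(+) (0, a, b) ` A \<subseteq> A"
    proof
      fix y assume "y \<in> (+) (0, a, b) ` A"
      then obtain u' z' x' where "y = (u', z' + a, x' + b)" "(u', z', x') \<in> A" by (auto simp: add.commute)
      then show "y \<in> A" using periodic3D[OF A that(2,3)] by simp
    qed
    then have "closure ((+) (0, a, b) ` A) \<subseteq> closure A" by (rule closure_mono)
    then have "(+) (0, a, b) ` closure A \<subseteq> closure A" by (simp only: closure_translation)
    moreover have "(u, z + a, x + b) = (0, a, b) + (u, z, x)" by (simp add: add.commute)
    ultimately show ?thesis using that(1) by blast
  qed
  show ?thesis unfolding periodic3_def
  proof (intro allI ballI iffI)
    fix u z x a b assume "a \<in> \<O>" "b \<in> \<O>" "(u, z + a, x + b) \<in> closure A"
    then show "(u, z, x) \<in> closure A" using *[of u "z + a" "x + b" "- a" "- b"] by (simp add: O_minus)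
  qed (use * in blast)
qed

text \<open>Apply the upper bound for closed sets to the closure of \<open>A\<close> and to that of its complement.\<close>

lemma continuity_set_limit:
  assumes A: "A \<in> sets borel" "periodic3 A" and null: "emeasure nu (frontier A) = 0"
  shows "((\<lambda>Q. avg Q (indicator A :: _ \<Rightarrow> real)) \<longlongrightarrow> measure nu A) at_top"
proof -
  interpret prob_space nu by (rule prob_nu)
  have fm: "frontier A \<in> sets borel" by (simp add: frontier_closed)
  then have fn: "measure nu (frontier A) = 0" using null by (simp add: measure_def)
  have cl: "measure nu (closure X) \<le> measure nu X" if "X \<in> sets borel" "frontier X = frontier A" for X
  proof -
    have "closure X \<subseteq> X \<union> frontier X" using interior_subset unfolding frontier_def by auto
    then have "measure nu (closure X) \<le> measure nu (X \<union> frontier X)" using that fm by (intro finite_measure_mono) auto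
    also have "\<dots> \<le> measure nu X + measure nu (frontier X)" using that fm by (intro measure_Un_le) auto
    finally show ?thesis using fn that by simp
  qed
  have pc: "periodic3 (- A)" using A(2) unfolding periodic3_def by simp
  have mc: "measure nu (- A) = 1 - measure nu A" using prob_compl[of A] A by (simp add: Compl_eq_Diff_UNIV)
  show ?thesis
  proof (rule tendstoI)
    fix e :: real assume e: "0 < e"
    have "\<forall>\<^sub>F Q in at_top. avg Q (indicator (closure A)) \<le> measure nu (closure A) + e / 2"
      by (rule closed_upper[OF closed_closure periodic3_closure[OF A(2)]]) (use e in simp)
    moreover have "\<forall>\<^sub>F Q in at_top. avg Q (indicator (closure (- A))) \<le> measure nu (closure (- A)) + e / 2"
      by (rule closed_upper[OF closed_closure periodic3_closure[OF pc]]) (use e in simp)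
    ultimately show "\<forall>\<^sub>F Q in at_top. dist (avg Q (indicator A :: _ \<Rightarrow> real)) (measure nu A) < e"
      using pairs_nonempty
    proof eventually_elim
      case (elim Q)
      have 1: "avg Q (indicator A :: _ \<Rightarrow> real) \<le> avg Q (indicator (closure A))"
        by (rule avg_mono) (use closure_subset in \<open>auto simp: indicator_def\<close>)
      have 2: "avg Q (indicator (- A) :: _ \<Rightarrow> real) \<le> avg Q (indicator (closure (- A)))"
        by (rule avg_mono) (use closure_subset[of "- A"] in \<open>auto simp: indicator_def\<close>)
      have "avg Q (\<lambda>p. indicator A p + indicator (- A) p :: real) = avg Q (\<lambda>_. 1)"
        by (rule arg_cong[of _ _ "avg Q"]) (auto simp: indicator_def)
      then have 3: "avg Q (indicator A :: _ \<Rightarrow> real) + avg Q (indicator (- A)) = 1"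
        unfolding avg_add avg_const[OF elim(3)] .
      have 4: "measure nu (closure A) \<le> measure nu A" by (rule cl[OF A(1) refl])
      have 5: "measure nu (closure (- A)) \<le> measure nu (- A)" by (rule cl) (use A(1) frontier_complement in auto)
      show ?case unfolding dist_real_def using elim 1 2 3 4 5 mc e by linarith
    qed
  qed
qed

end

section \<open>The neighbour condition\<close>

context imaginary_order
begin

definition cop :: "(complex \<times> complex) set" where
  "cop = {(k, m). k \<in> \<O> \<and> m \<in> \<O> \<and> m \<noteq> 0 \<and> comaximal K k m}"

text \<open>The pair \<open>(k, m)\<close> describes a fraction with denominator of absolute value at most \<open>Q\<close> at rescaled distance at most \<open>\<delta>\<close>.
  The second inequality is written without a division, so that it is meaningful for \<open>k + m * x = 0\<close>;
  it is then false because \<open>m \<noteq> 0\<close>.\<close>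

definition reach :: "real \<Rightarrow> real \<Rightarrow> complex \<Rightarrow> complex \<times> complex \<Rightarrow> bool" where
  "reach \<delta> u x = (\<lambda>(k, m). u * cmod (k + m * x) \<le> 1 \<and> cmod m \<le> \<delta> * u\<^sup>2 * cmod (k + m * x))"

definition hit :: "real \<Rightarrow> real \<Rightarrow> complex \<Rightarrow> bool" where
  "hit \<delta> u x \<longleftrightarrow> (\<exists>km\<in>cop. reach \<delta> u x km)"

lemma countable_cop: "countable cop"
  by (rule countable_subset[of _ "\<O> \<times> \<O>"]) (auto simp: cop_def countable_O)

text \<open>Multiplying the two inequalities gives \<open>\<bar>m\<bar> \<le> \<delta> * u\<close>, and \<open>\<bar>m\<bar> \<ge> 1\<close> since \<open>m\<close> is a nonzero integer of the field.\<close>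

lemma reach_bounds:
  assumes c: "(k, m) \<in> cop" and u: "0 < u" and r: "reach \<delta> u x (k, m)"
  shows "0 < cmod (k + m * x)" "cmod m \<le> \<delta> * u" "cmod k \<le> 1 / u + \<delta> * u * cmod x" "1 \<le> \<delta> * u"
proof -
  have m: "1 \<le> cmod m" using c O_norm_ge1 unfolding cop_def by auto
  have r1: "u * cmod (k + m * x) \<le> 1" and r2: "cmod m \<le> \<delta> * u\<^sup>2 * cmod (k + m * x)" using r unfolding reach_def by auto
  show p: "0 < cmod (k + m * x)" using r2 m by (cases "k + m * x = 0") auto
  have d: "0 < \<delta>"
  proof (rule ccontr)
    assume "\<not> 0 < \<delta>"
    then have "\<delta> * (u\<^sup>2 * cmod (k + m * x)) \<le> 0" by (intro mult_nonpos_nonneg) auto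
    then show False using r2 m by (simp add: mult.assoc)
  qed
  have "cmod m \<le> \<delta> * u * (u * cmod (k + m * x))" using r2 by (simp add: power2_eq_square mult_ac)
  also have "\<dots> \<le> \<delta> * u * 1" using r1 d u by (intro mult_left_mono) auto
  finally show m': "cmod m \<le> \<delta> * u" by simp
  then show "1 \<le> \<delta> * u" using m by simp
  have "cmod k \<le> cmod (k + m * x) + cmod (m * x)" using norm_triangle_ineq4[of "k + m * x" "m * x"] by simp
  also have "\<dots> \<le> 1 / u + \<delta> * u * cmod x"
  proof (rule add_mono)
    show "cmod (k + m * x) \<le> 1 / u" using r1 u by (simp add: field_simps)
    show "cmod (m * x) \<le> \<delta> * u * cmod x" unfolding norm_mult by (rule mult_right_mono[OF m']) simp
  qed
  finally show "cmod k \<le> 1 / u + \<delta> * u * cmod x" .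
qed

lemma hit_ge: "0 < u \<Longrightarrow> hit \<delta> u x \<Longrightarrow> 1 \<le> \<delta> * u"
  unfolding hit_def using reach_bounds(4) by fastforce

lemma hit_ge1: "0 < u \<Longrightarrow> u \<le> 1 \<Longrightarrow> hit \<delta> u x \<Longrightarrow> 1 \<le> \<delta>"
proof -
  assume u: "0 < u" "u \<le> 1" "hit \<delta> u x"
  have h: "1 \<le> \<delta> * u" using hit_ge u by blast
  then have "0 < \<delta> * u" by linarith
  then have "0 < \<delta>" using u(1) by (simp add: zero_less_mult_iff)
  then have "\<delta> * u \<le> \<delta>" using u by (simp add: mult_left_le)
  then show ?thesis using h by linarith
qed

lemma hit_mono: "hit \<delta> u x \<Longrightarrow> \<delta> \<le> \<delta>' \<Longrightarrow> hit \<delta>' u x"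
proof -
  assume h: "hit \<delta> u x" "\<delta> \<le> \<delta>'"
  have "reach \<delta>' u x km" if "reach \<delta> u x km" for km
  proof -
    obtain k m where km: "km = (k, m)" by (cases km)
    have "\<delta> * (u\<^sup>2 * cmod (k + m * x)) \<le> \<delta>' * (u\<^sup>2 * cmod (k + m * x))" using h(2) by (intro mult_right_mono) auto
    then show ?thesis using that unfolding reach_def km by (auto simp: mult.assoc)
  qed
  then show ?thesis using h(1) unfolding hit_def by blast
qed

lemma finite_cop_bounded: "finite {(k, m) \<in> cop. cmod k \<le> A \<and> cmod m \<le> B}"
  by (rule finite_subset[of _ "{k \<in> \<O>. cmod k \<le> A} \<times> {m \<in> \<O>. cmod m \<le> B}"])
    (auto simp: cop_def intro: O_ball_finite)

text \<open>The admissible pairs \<open>(k, m)\<close> for bounded \<open>\<delta>\<close> are finite in number, so one pair serves for arbitrarily small excess.\<close>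

lemma hit_closed:
  assumes u: "0 < u" and h: "\<And>\<delta>'. \<delta> < \<delta>' \<Longrightarrow> hit \<delta>' u x"
  shows "hit \<delta> u x"
proof (rule ccontr)
  assume no: "\<not> hit \<delta> u x"
  define S where "S = {(k, m) \<in> cop. cmod k \<le> 1 / u + (\<bar>\<delta>\<bar> + 1) * u * cmod x \<and> cmod m \<le> (\<bar>\<delta>\<bar> + 1) * u} \<inter> {(k, m). u * cmod (k + m * x) \<le> 1}"
  have fin: "finite S" unfolding S_def using finite_cop_bounded by blast
  have ex: "\<exists>d>\<delta>. \<not> reach d u x km" if "km \<in> S" for km
  proof -
    obtain k m where km: "km = (k, m)" by (cases km)
    have "\<not> reach \<delta> u x km" using no that unfolding S_def hit_def km by auto
    then have lt: "\<delta> * (u\<^sup>2 * cmod (k + m * x)) < cmod m" using that unfolding S_def reach_def km by (auto simp: mult.assoc)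
    have "((\<lambda>d. d * (u\<^sup>2 * cmod (k + m * x))) \<longlongrightarrow> \<delta> * (u\<^sup>2 * cmod (k + m * x))) (at_right \<delta>)" by (intro tendsto_intros)
    then have "\<forall>\<^sub>F d in at_right \<delta>. d * (u\<^sup>2 * cmod (k + m * x)) < cmod m" using lt by (rule order_tendstoD)
    moreover have "\<forall>\<^sub>F d in at_right \<delta>. \<delta> < d" by (simp add: eventually_at_right_less)
    ultimately have "\<exists>d. d * (u\<^sup>2 * cmod (k + m * x)) < cmod m \<and> \<delta> < d"
      using eventually_conj eventually_happens trivial_limit_at_right_real by blast
    then show ?thesis unfolding reach_def km by (auto simp: mult.assoc)
  qed
  then obtain f where f: "\<And>km. km \<in> S \<Longrightarrow> \<delta> < f km \<and> \<not> reach (f km) u x km" by metis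
  define d where "d = Min (insert (\<bar>\<delta>\<bar> + 1) (f ` S))"
  have d1: "\<delta> < d" unfolding d_def using fin f by (subst Min_gr_iff) auto
  have d2: "d \<le> \<bar>\<delta>\<bar> + 1" "\<And>km. km \<in> S \<Longrightarrow> d \<le> f km" unfolding d_def using fin by (auto intro: Min_le)
  obtain k m where km: "(k, m) \<in> cop" "reach d u x (k, m)" using h[OF d1] unfolding hit_def by auto
  note b = reach_bounds[OF km(1) u km(2)]
  have a1: "d * u \<le> (\<bar>\<delta>\<bar> + 1) * u" using d2(1) u by (intro mult_right_mono) auto
  have a2: "d * u * cmod x \<le> (\<bar>\<delta>\<bar> + 1) * u * cmod x" by (rule mult_right_mono[OF a1]) simp
  have "cmod k \<le> 1 / u + (\<bar>\<delta>\<bar> + 1) * u * cmod x" "cmod m \<le> (\<bar>\<delta>\<bar> + 1) * u" using a1 a2 b by linarith+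
  moreover have "u * cmod (k + m * x) \<le> 1" using km(2) unfolding reach_def by simp
  ultimately have "(k, m) \<in> S" unfolding S_def using km(1) by simp
  then have "\<not> reach (f (k, m)) u x (k, m)" "d \<le> f (k, m)" using f d2 by blast+
  moreover from \<open>d \<le> f (k, m)\<close> have "d * (u\<^sup>2 * cmod (k + m * x)) \<le> f (k, m) * (u\<^sup>2 * cmod (k + m * x))"
    by (intro mult_right_mono) auto
  ultimately show False using km(2) unfolding reach_def by (auto simp: mult.assoc)
qed

lemma comaximal_shear:
  assumes "k \<in> \<O>" "m \<in> \<O>" "b \<in> \<O>" "comaximal K k m" shows "comaximal K (k + m * b) m"
proof -
  obtain c d where cd: "c \<in> \<O>" "d \<in> \<O>" "k * c + m * d = 1" using comaximal_iff[OF assms(1,2)] assms(4) by blast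
  then have "(k + m * b) * c + m * (d - b * c) = 1" by (simp add: algebra_simps)
  moreover have "d - b * c \<in> \<O>" using cd assms by blast
  moreover have "k + m * b \<in> \<O>" using assms by blast
  ultimately show ?thesis using comaximal_iff[OF _ assms(2), of "k + m * b"] cd(1) by blast
qed

text \<open>A lattice shift of \<open>x\<close> is absorbed by the unimodular substitution \<open>k + m * b\<close>.\<close>

lemma hit_shift:
  assumes b: "b \<in> \<O>" shows "hit \<delta> u (x + b) \<longleftrightarrow> hit \<delta> u x"
proof -
  have *: "hit \<delta> u x" if b: "b \<in> \<O>" and h: "hit \<delta> u (x + b)" for x b
  proof -
    obtain k m where km: "(k, m) \<in> cop" "reach \<delta> u (x + b) (k, m)" using h unfolding hit_def by auto
    have "(k + m * b, m) \<in> cop" using km(1) b comaximal_shear[of k m b] unfolding cop_def by auto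
    moreover have "reach \<delta> u x (k + m * b, m)" using km(2) unfolding reach_def by (simp add: algebra_simps)
    ultimately show ?thesis unfolding hit_def by blast
  qed
  show ?thesis using *[OF b] *[of "- b" "x + b"] b by (auto simp: O_minus)
qed

text \<open>The value 0 is a default for the null set of points without neighbours.\<close>

definition gap :: "real \<Rightarrow> complex \<Rightarrow> real" where
  "gap u x = (if \<exists>\<delta>. hit \<delta> u x then Inf {\<delta>. hit \<delta> u x} else 0)"

lemma gap_le_iff:
  assumes u: "0 < u" "u \<le> 1" and h: "hit \<delta>0 u x"
  shows "gap u x \<le> \<delta> \<longleftrightarrow> hit \<delta> u x"
proof -
  let ?S = "{\<delta>. hit \<delta> u x}"
  have g: "gap u x = Inf ?S" using h unfolding gap_def by auto
  have bdd: "bdd_below ?S" using hit_ge1[OF u] by (auto intro!: bdd_belowI[of _ 1])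
  have ne: "?S \<noteq> {}" using h by auto
  show ?thesis
  proof
    assume "hit \<delta> u x" then show "gap u x \<le> \<delta>" unfolding g using bdd by (auto intro: cInf_lower)
  next
    assume le: "gap u x \<le> \<delta>"
    show "hit \<delta> u x"
    proof (rule hit_closed[OF u(1)])
      fix \<delta>' assume "\<delta> < \<delta>'"
      then have "Inf ?S < \<delta>'" using le unfolding g by simp
      then obtain d where "hit d u x" "d < \<delta>'" using cInf_lessD[OF ne] by auto
      then show "hit \<delta>' u x" using hit_mono by (metis less_imp_le)
    qed
  qed
qed

lemma gap_attained:
  assumes u: "0 < u" "u \<le> 1" and h: "hit \<delta>0 u x"
  obtains k m where "(k, m) \<in> cop" "0 < cmod (k + m * x)" "gap u x = cmod m / (u\<^sup>2 * cmod (k + m * x))"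
proof -
  have "hit (gap u x) u x" using gap_le_iff[OF u h, of "gap u x"] by simp
  then obtain k m where km: "(k, m) \<in> cop" "reach (gap u x) u x (k, m)" unfolding hit_def by auto
  have p: "0 < cmod (k + m * x)" by (rule reach_bounds(1)[OF km(1) u(1) km(2)])
  let ?d = "cmod m / (u\<^sup>2 * cmod (k + m * x))"
  have "?d \<le> gap u x" using km(2) u p unfolding reach_def by (simp add: divide_le_eq mult.assoc)
  moreover have "reach ?d u x (k, m)" using km(2) u p unfolding reach_def by simp
  then have "hit ?d u x" using km(1) unfolding hit_def by blast
  then have "gap u x \<le> ?d" using gap_le_iff[OF u h] by blast
  ultimately show ?thesis using that km(1) p by simp
qed

section \<open>The distribution function of the limit\<close>

text \<open>The preimage of a null set under \<open>s \<mapsto> c * exp s\<close> is its image under a differentiable logarithm.\<close>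

lemma AE_expo_avoid:
  assumes c: "0 < c" and N: "NN \<in> null_sets lborel"
  shows "AE s in expo. c * exp \<bar>s\<bar> \<notin> NN"
proof -
  define T where "T = (\<lambda>y. ln (y / c)) ` (NN \<inter> {0<..})"
  have "NN \<in> null_sets lebesgue" using N by (rule null_sets_completionI)
  then have "negligible (NN \<inter> {0<..})" by (simp add: negligible_iff_null_sets null_set_Int2)
  then have "negligible T" unfolding T_def
  proof (rule negligible_differentiable_image_negligible[rotated])
    show "(\<lambda>y. ln (y / c)) differentiable_on (NN \<inter> {0<..})"
      unfolding differentiable_on_def
    proof
      fix y assume "y \<in> NN \<inter> {0<..}"
      then have y: "0 < y" by simp
      have "((\<lambda>y. ln (y / c)) has_real_derivative (1 / y)) (at y)"
        using y c by (auto intro!: derivative_eq_intros simp: field_simps)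
      then show "(\<lambda>y. ln (y / c)) differentiable at y within NN \<inter> {0<..}"
        using differentiable_at_withinI real_differentiable_def by blast
    qed
  qed simp
  then have "T \<in> null_sets lebesgue" by (simp add: negligible_iff_null_sets)
  then have "AE s in lebesgue. s \<notin> T" by (rule AE_not_in)
  then have "AE s in lborel. s \<notin> T" by (simp add: AE_completion_iff)
  moreover have nT: "c * exp s \<notin> NN" if "s \<notin> T" for s
  proof
    assume "c * exp s \<in> NN"
    then have "c * exp s \<in> NN \<inter> {0<..}" using c by simp
    then have "ln (c * exp s / c) \<in> T" unfolding T_def by (rule imageI)
    then show False using that c by simp
  qed
  ultimately have "AE s in lborel. 0 \<le> s \<longrightarrow> c * exp \<bar>s\<bar> \<notin> NN"
    by (elim AE_mp) (auto intro!: AE_I2 dest: nT)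
  then show ?thesis unfolding expo_def
    by (subst AE_density) (auto simp: exponential_density_def)
qed

lemma prob_measure_times:
  assumes "prob_space M1" "prob_space M2" and A: "A \<in> sets M1" and B: "B \<in> sets M2"
  shows "measure (M1 \<Otimes>\<^sub>M M2) (A \<times> B) = measure M1 A * measure M2 B"
proof -
  interpret M2: prob_space M2 by fact
  show ?thesis unfolding measure_def M2.emeasure_pair_measure_Times[OF A B] by (rule enn2real_mult)
qed

text \<open>It suffices to control the height coordinate for every fixed point of the torus.\<close>

lemma AE_nuI:
  assumes m: "{p. P p} \<in> sets borel" and ae: "AE z in unif. \<forall>x. AE s in expo. P (exp (- \<bar>s\<bar> / 2), z, x)"
  shows "AE p in nu. P p"
proof -
  interpret e: prob_space expo by (rule prob_expo)
  interpret u: prob_space unif by (rule prob_unif)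
  interpret uu: prob_space "unif \<Otimes>\<^sub>M unif" by (rule prob_unif2)
  interpret E: pair_prob_space expo "unif \<Otimes>\<^sub>M unif" ..
  interpret U: pair_prob_space unif unif ..
  let ?T = "\<lambda>(s::real, z, x). (exp (- \<bar>s\<bar> / 2), z :: complex, x :: complex)"
  have mp: "{y \<in> space (expo \<Otimes>\<^sub>M (unif \<Otimes>\<^sub>M unif)). P (?T y)} \<in> sets (expo \<Otimes>\<^sub>M (unif \<Otimes>\<^sub>M unif))"
    using measurable_sets[OF nu_measurable m] by (simp add: vimage_def Int_def conj_commute)
  from AE_E[OF ae] obtain Z where "{z \<in> space unif. \<not> (\<forall>x. AE s in expo. P (exp (- \<bar>s\<bar> / 2), z, x))} \<subseteq> Z"
    "emeasure unif Z = 0" "Z \<in> sets unif" by blast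
  then have Z: "Z \<in> null_sets unif" "\<And>z. z \<notin> Z \<Longrightarrow> \<forall>x. AE s in expo. P (?T (s, z, x))" by auto
  have AEZ: "AE zx in unif \<Otimes>\<^sub>M unif. fst zx \<notin> Z"
  proof (rule U.AE_pair_measure)
    have [measurable]: "Z \<in> sets borel" using null_setsD2[OF Z(1)] by simp
    show "{zx \<in> space (unif \<Otimes>\<^sub>M unif). fst zx \<notin> Z} \<in> sets (unif \<Otimes>\<^sub>M unif)" by measurable
    show "AE z in unif. AE x in unif. fst (z, x) \<notin> Z" using AE_not_in[OF Z(1)] by simp
  qed
  have fib: "AE zx in unif \<Otimes>\<^sub>M unif. AE s in expo. P (?T (s, zx))"
  proof (rule AE_mp[OF AEZ], rule AE_I2, rule impI)
    fix zx :: "complex \<times> complex" assume "fst zx \<notin> Z"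
    then show "AE s in expo. P (?T (s, zx))" using Z(2)[of "fst zx"] by (cases zx) simp
  qed
  define A where "A = space (expo \<Otimes>\<^sub>M (unif \<Otimes>\<^sub>M unif)) - {y \<in> space (expo \<Otimes>\<^sub>M (unif \<Otimes>\<^sub>M unif)). P (?T y)}"
  have A: "A \<in> sets (expo \<Otimes>\<^sub>M (unif \<Otimes>\<^sub>M unif))" unfolding A_def using mp by blast
  have "emeasure (expo \<Otimes>\<^sub>M (unif \<Otimes>\<^sub>M unif)) A = (\<integral>\<^sup>+zx. emeasure expo ((\<lambda>s. (s, zx)) -` A) \<partial>(unif \<Otimes>\<^sub>M unif))"
    by (rule E.emeasure_pair_measure_alt2[OF A])
  also have "\<dots> = (\<integral>\<^sup>+zx. 0 \<partial>(unif \<Otimes>\<^sub>M unif))"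
  proof (rule nn_integral_cong_AE, rule AE_mp[OF fib], rule AE_I2, rule impI)
    fix zx :: "complex \<times> complex" assume ae: "AE s in expo. P (?T (s, zx))"
    have "(\<lambda>s. (s, zx)) -` A \<inter> space expo \<in> sets expo"
      by (rule measurable_sets[OF _ A]) (auto simp: space_pair_measure)
    then have m: "(\<lambda>s. (s, zx)) -` A \<in> sets expo" by simp
    have "{s \<in> space expo. \<not> P (?T (s, zx))} = (\<lambda>s. (s, zx)) -` A" unfolding A_def by (auto simp: space_pair_measure)
    then show "emeasure expo ((\<lambda>s. (s, zx)) -` A) = 0"
      using ae m by (subst (asm) AE_iff_measurable[OF m]) auto
  qed
  finally have "emeasure (expo \<Otimes>\<^sub>M (unif \<Otimes>\<^sub>M unif)) A = 0" by simp
  then have "AE y in expo \<Otimes>\<^sub>M (unif \<Otimes>\<^sub>M unif). P (?T y)"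
    by (subst AE_iff_measurable[OF A]) (auto simp: A_def)
  then show ?thesis unfolding nu_def using m by (subst AE_distr_iff[OF nu_measurable]) auto
qed

definition near :: "complex set \<Rightarrow> real \<Rightarrow> (real \<times> complex \<times> complex) set" where
  "near B \<delta> = {(u, z, x). 0 < u \<and> z \<in> B \<and> hit \<delta> u x}"

lemma prod_measurable [measurable]:
  "(fst :: real \<times> complex \<times> complex \<Rightarrow> real) \<in> borel_measurable borel"
  "(\<lambda>p :: real \<times> complex \<times> complex. fst (snd p)) \<in> borel_measurable borel"
  "(\<lambda>p :: real \<times> complex \<times> complex. snd (snd p)) \<in> borel_measurable borel"
  by (intro borel_measurable_continuous_onI continuous_intros)+

lemma hit_measurable: "{p :: real \<times> complex \<times> complex. hit \<delta> (fst p) (snd (snd p))} \<in> sets borel"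
proof -
  have "{p :: real \<times> complex \<times> complex. hit \<delta> (fst p) (snd (snd p))} = (\<Union>km\<in>cop. {p \<in> space borel. reach \<delta> (fst p) (snd (snd p)) km})"
    unfolding hit_def by auto
  also have "\<dots> \<in> sets borel"
  proof (rule sets.countable_UN'[OF countable_cop])
    have "{p :: real \<times> complex \<times> complex. p \<in> space borel \<and> reach \<delta> (fst p) (snd (snd p)) km} \<in> sets borel" for km
      unfolding reach_def case_prod_unfold by measurable
    then show "(\<lambda>km. {p :: real \<times> complex \<times> complex. p \<in> space borel \<and> reach \<delta> (fst p) (snd (snd p)) km}) ` cop \<subseteq> sets borel" by blast
  qed
  finally show ?thesis .
qed

lemma near_borel:
  assumes [measurable]: "B \<in> sets borel" shows "near B \<delta> \<in> sets borel"
proof -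
  have "near B \<delta> = {p \<in> space borel. 0 < fst p \<and> fst (snd p) \<in> B} \<inter> {p. hit \<delta> (fst p) (snd (snd p))}"
    unfolding near_def by auto
  moreover have "{p :: real \<times> complex \<times> complex. p \<in> space borel \<and> 0 < fst p \<and> fst (snd p) \<in> B} \<in> sets borel" by measurable
  ultimately show ?thesis using hit_measurable by auto
qed

lemma near_periodic: "latper B \<Longrightarrow> periodic3 (near B \<delta>)"
  unfolding periodic3_def near_def latper_def by (auto simp: hit_shift)

lemma locally_constant_le:
  fixes f :: "'a::t2_space \<Rightarrow> real"
  assumes "continuous_on UNIV f" "f p \<noteq> c"
  shows "\<forall>\<^sub>F p' in nhds p. f p' \<le> c \<longleftrightarrow> f p \<le> c"
proof -
  have "isCont f p" using assms(1) by (simp add: continuous_on_eq_continuous_at)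
  then have t: "(f \<longlongrightarrow> f p) (nhds p)" by (simp add: isCont_def tendsto_at_iff_tendsto_nhds)
  show ?thesis
  proof (cases "f p < c")
    case True
    then show ?thesis using order_tendstoD(2)[OF t True] by (auto elim!: eventually_mono)
  next
    case False
    then have "c < f p" using assms(2) by simp
    then show ?thesis using order_tendstoD(1)[OF t] by (auto simp: not_le elim!: eventually_mono)
  qed
qed

text \<open>Off the boundary of \<open>B\<close> and off countably many exceptional heights, only finitely many
  neighbours matter nearby and each of their defining inequalities is locally constant.\<close>

lemma near_frontier:
  assumes u: "0 < u" "u < 1" and z: "z \<notin> frontier B"
    and ex: "\<And>k m. (k, m) \<in> cop \<Longrightarrow> u * cmod (k + m * x) \<noteq> 1 \<and> cmod m \<noteq> \<delta> * u\<^sup>2 * cmod (k + m * x)"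
  shows "(u, z, x) \<notin> frontier (near B \<delta>)"
proof -
  let ?p = "(u, z, x)"
  define d where "d = \<bar>\<delta>\<bar>"
  define S where "S = {(k, m) \<in> cop. cmod k \<le> 2 / u + d * (cmod x + 1) \<and> cmod m \<le> d}"
  have fin: "finite S" unfolding S_def by (rule finite_cop_bounded)
  have id: "((\<lambda>p. p) \<longlongrightarrow> ?p) (nhds ?p)" by (rule filterlim_ident)
  have t1: "(fst \<longlongrightarrow> u) (nhds ?p)" using tendsto_fst[OF id] by simp
  have t2: "((\<lambda>p. fst (snd p)) \<longlongrightarrow> z) (nhds ?p)" using tendsto_fst[OF tendsto_snd[OF id]] by simp
  have t3: "((\<lambda>p. cmod (snd (snd p))) \<longlongrightarrow> cmod x) (nhds ?p)" using tendsto_norm[OF tendsto_snd[OF tendsto_snd[OF id]]] by simp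
  have o1: "\<forall>\<^sub>F p in nhds ?p. u / 2 < fst p"
    by (rule order_tendstoD(1)[OF t1]) (use u in simp)
  have o2: "\<forall>\<^sub>F p in nhds ?p. fst p < 1"
    by (rule order_tendstoD(2)[OF t1]) (use u in simp)
  have o3: "\<forall>\<^sub>F p in nhds ?p. cmod (snd (snd p)) < cmod x + 1"
    by (rule order_tendstoD(2)[OF t3]) simp
  have o4: "\<forall>\<^sub>F p in nhds ?p. fst (snd p) \<in> B \<longleftrightarrow> z \<in> B"
  proof -
    note t = t2
    show ?thesis
    proof (cases "z \<in> interior B")
      case True
      then have "\<forall>\<^sub>F p in nhds ?p. fst (snd p) \<in> interior B" using topological_tendstoD[OF t] by blast
      then show ?thesis
      proof (rule eventually_mono)
        fix p :: "real \<times> complex \<times> complex" assume "fst (snd p) \<in> interior B"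
        then show "fst (snd p) \<in> B \<longleftrightarrow> z \<in> B" using True interior_subset[of B] by blast
      qed
    next
      case False
      then have "z \<in> - closure B" using z unfolding frontier_def by blast
      then have "\<forall>\<^sub>F p in nhds ?p. fst (snd p) \<in> - closure B" using topological_tendstoD[OF t] by blast
      then show ?thesis
      proof (rule eventually_mono)
        fix p :: "real \<times> complex \<times> complex" assume "fst (snd p) \<in> - closure B"
        then show "fst (snd p) \<in> B \<longleftrightarrow> z \<in> B" using \<open>z \<in> - closure B\<close> closure_subset[of B] by blast
      qed
    qed
  qed
  have o5: "\<forall>\<^sub>F p in nhds ?p. \<forall>km\<in>S. reach \<delta> (fst p) (snd (snd p)) km \<longleftrightarrow> reach \<delta> u x km"
  proof (rule eventually_ball_finite[OF fin], rule ballI)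
    fix km assume "km \<in> S"
    then obtain k m where km: "km = (k, m)" "(k, m) \<in> cop" unfolding S_def by auto
    have "\<forall>\<^sub>F p in nhds ?p. fst p * cmod (k + m * snd (snd p)) \<le> 1 \<longleftrightarrow> fst ?p * cmod (k + m * snd (snd ?p)) \<le> 1"
      by (rule locally_constant_le) (use ex[OF km(2)] in \<open>auto intro!: continuous_intros\<close>)
    moreover have "\<forall>\<^sub>F p in nhds ?p. cmod m - \<delta> * (fst p)\<^sup>2 * cmod (k + m * snd (snd p)) \<le> 0 \<longleftrightarrow> cmod m - \<delta> * (fst ?p)\<^sup>2 * cmod (k + m * snd (snd ?p)) \<le> 0"
      by (rule locally_constant_le) (use ex[OF km(2)] in \<open>auto intro!: continuous_intros\<close>)
    ultimately show "\<forall>\<^sub>F p in nhds ?p. reach \<delta> (fst p) (snd (snd p)) km \<longleftrightarrow> reach \<delta> u x km"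
      by eventually_elim (auto simp: reach_def km(1))
  qed
  have rel: "km \<in> S" if "km \<in> cop" "u / 2 < u'" "u' < 1" "cmod x' < cmod x + 1" "reach \<delta> u' x' km" for km u' x'
  proof -
    obtain k m where km: "km = (k, m)" by (cases km)
    have u': "0 < u'" using that(2) u by linarith
    note b = reach_bounds[OF that(1)[unfolded km] u' that(5)[unfolded km]]
    have "\<delta> * u' \<le> d * 1" unfolding d_def using that(3) u' by (intro mult_mono) auto
    then have 1: "\<delta> * u' \<le> d" by simp
    have "\<delta> * u' * cmod x' \<le> d * (cmod x + 1)" using 1 that(4) b(4) by (intro mult_mono) auto
    moreover have "1 / u' \<le> 2 / u" using that(2) u u' by (simp add: field_simps)
    ultimately show ?thesis using that(1) b 1 unfolding S_def km by auto
  qed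
  have "\<forall>\<^sub>F p in nhds ?p. p \<in> near B \<delta> \<longleftrightarrow> ?p \<in> near B \<delta>"
    using o1 o2 o3 o4 o5
  proof eventually_elim
    case (elim p)
    have "hit \<delta> (fst p) (snd (snd p)) \<longleftrightarrow> (\<exists>km\<in>S. reach \<delta> (fst p) (snd (snd p)) km)"
      unfolding hit_def using rel[OF _ elim(1,2,3)] unfolding S_def by blast
    also have "\<dots> \<longleftrightarrow> (\<exists>km\<in>S. reach \<delta> u x km)" using elim(5) by blast
    also have "\<dots> \<longleftrightarrow> hit \<delta> u x"
      unfolding hit_def using rel[of _ u x] u unfolding S_def by auto
    finally show ?case unfolding near_def using elim(1,4) u by (cases p) auto
  qed
  then obtain V where V: "open V" "?p \<in> V" "\<And>p. p \<in> V \<Longrightarrow> p \<in> near B \<delta> \<longleftrightarrow> ?p \<in> near B \<delta>"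
    unfolding eventually_nhds by blast
  show ?thesis
  proof (cases "?p \<in> near B \<delta>")
    case True
    then have "V \<subseteq> near B \<delta>" using V by blast
    then have "?p \<in> interior (near B \<delta>)" using V(1,2) interior_maximal by blast
    then show ?thesis unfolding frontier_def by blast
  next
    case False
    then have "V \<inter> near B \<delta> = {}" using V by blast
    then have "V \<inter> closure (near B \<delta>) = {}" using V(1) open_Int_closure_eq_empty by blast
    then show ?thesis using V(2) unfolding frontier_def by blast
  qed
qed

text \<open>For a fixed \<open>x\<close> each pair \<open>(k, m)\<close> excludes at most two heights, and there are countably many pairs.\<close>

lemma near_frontier_null:
  assumes B: "B \<in> sets borel" "emeasure unif (frontier B) = 0"
  shows "emeasure nu (frontier (near B \<delta>)) = 0"
proof -
  have fm: "frontier (near B \<delta>) \<in> sets borel" by (simp add: frontier_closed)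
  have exc: "AE s in expo. \<forall>km\<in>cop. exp (- \<bar>s\<bar> / 2) * cmod (fst km + snd km * x) \<noteq> 1 \<and>
      cmod (snd km) \<noteq> \<delta> * (exp (- \<bar>s\<bar> / 2))\<^sup>2 * cmod (fst km + snd km * x)" for x
  proof (subst AE_ball_countable[OF countable_cop], rule ballI)
    fix km assume "km \<in> cop"
    then have m: "0 < cmod (snd km)" unfolding cop_def by auto
    let ?r = "cmod (fst km + snd km * x)"
    have n1: "{?r\<^sup>2} \<in> null_sets lborel" "{\<delta> * ?r} \<in> null_sets lborel" "{1} \<in> null_sets (lborel :: real measure)" by auto
    have sq: "(exp (- \<bar>s\<bar> / 2))\<^sup>2 * exp \<bar>s\<bar> = 1" for s :: real
      by (simp add: power2_eq_square exp_add[symmetric])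
    have "AE s in expo. 1 * exp \<bar>s\<bar> \<notin> {?r\<^sup>2}" by (rule AE_expo_avoid) (use n1 in auto)
    moreover have "AE s in expo. cmod (snd km) * exp \<bar>s\<bar> \<notin> {\<delta> * ?r}" by (rule AE_expo_avoid) (use n1 m in auto)
    ultimately show "AE s in expo. exp (- \<bar>s\<bar> / 2) * ?r \<noteq> 1 \<and> cmod (snd km) \<noteq> \<delta> * (exp (- \<bar>s\<bar> / 2))\<^sup>2 * ?r"
    proof eventually_elim
      case (elim s)
      have "exp (- \<bar>s\<bar> / 2) * ?r \<noteq> 1"
      proof
        assume "exp (- \<bar>s\<bar> / 2) * ?r = 1"
        then have "(exp (- \<bar>s\<bar> / 2))\<^sup>2 * ?r\<^sup>2 = 1" by (metis power_mult_distrib power_one)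
        then have "(exp (- \<bar>s\<bar> / 2))\<^sup>2 * ?r\<^sup>2 = (exp (- \<bar>s\<bar> / 2))\<^sup>2 * exp \<bar>s\<bar>" using sq[of s] by simp
        then have "?r\<^sup>2 = exp \<bar>s\<bar>" by (metis exp_not_eq_zero mult_left_cancel power_not_zero)
        then show False using elim(1) by simp
      qed
      moreover have "cmod (snd km) \<noteq> \<delta> * (exp (- \<bar>s\<bar> / 2))\<^sup>2 * ?r"
      proof
        assume "cmod (snd km) = \<delta> * (exp (- \<bar>s\<bar> / 2))\<^sup>2 * ?r"
        then have "cmod (snd km) * exp \<bar>s\<bar> = \<delta> * ?r * ((exp (- \<bar>s\<bar> / 2))\<^sup>2 * exp \<bar>s\<bar>)" by (simp add: mult_ac)
        then show False using elim(2) unfolding sq by simp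
      qed
      ultimately show ?case by blast
    qed
  qed
  have one: "AE s in expo. exp (- \<bar>s\<bar> / 2) < (1::real)"
  proof -
    have "AE s in expo. 1 * exp \<bar>s\<bar> \<notin> {1}" by (rule AE_expo_avoid) auto
    then show ?thesis by (rule AE_mp) (auto intro!: AE_I2)
  qed
  have "AE p in nu. p \<notin> frontier (near B \<delta>)"
  proof (rule AE_nuI)
    show "{p. p \<notin> frontier (near B \<delta>)} \<in> sets borel" using fm by (metis Compl_eq sets.compl_sets space_borel Compl_eq_Diff_UNIV)
    have "frontier B \<in> null_sets unif" using B(2) by (auto simp: null_sets_def frontier_closed)
    then have zB: "AE z in unif. z \<notin> frontier B" by (rule AE_not_in)
    show "AE z in unif. \<forall>x. AE s in expo. (exp (- \<bar>s\<bar> / 2), z, x) \<notin> frontier (near B \<delta>)"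
    proof (rule AE_mp[OF zB], rule AE_I2, intro impI allI)
      fix z x assume z: "z \<notin> frontier B"
      show "AE s in expo. (exp (- \<bar>s\<bar> / 2), z, x) \<notin> frontier (near B \<delta>)"
        using one exc[of x]
      proof eventually_elim
        case (elim s)
        show ?case
        proof (rule near_frontier[OF _ elim(1) z])
          fix k m assume "(k, m) \<in> cop"
          from elim(2)[rule_format, OF this]
          show "exp (- \<bar>s\<bar> / 2) * cmod (k + m * x) \<noteq> 1 \<and> cmod m \<noteq> \<delta> * (exp (- \<bar>s\<bar> / 2))\<^sup>2 * cmod (k + m * x)"
            by (simp only: fst_conv snd_conv simp_thms)
        qed simp
      qed
    qed
  qed
  then show ?thesis using fm by (subst (asm) AE_iff_measurable[of "frontier (near B \<delta>)"]) auto
qed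

text \<open>The limit of the proportion of the gaps that are at most \<open>\<delta>\<close>.\<close>

definition limit_cdf :: "real \<Rightarrow> real" where
  "limit_cdf \<delta> = (\<integral>s. measure unif {x. hit \<delta> (exp (- \<bar>s\<bar> / 2)) x} \<partial>expo)"

lemma near_measure:
  assumes B [measurable]: "B \<in> sets borel"
  shows "measure nu (near B \<delta>) = measure unif B * limit_cdf \<delta>"
proof -
  interpret e: prob_space expo by (rule prob_expo)
  interpret u: prob_space unif by (rule prob_unif)
  interpret uu: prob_space "unif \<Otimes>\<^sub>M unif" by (rule prob_unif2)
  interpret E: pair_prob_space expo "unif \<Otimes>\<^sub>M unif" ..
  interpret U: pair_prob_space unif unif ..
  interpret nu: prob_space nu by (rule prob_nu)
  let ?h = "\<lambda>s x. hit \<delta> (exp (- \<bar>s\<bar> / 2)) x"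
  have nb: "near B \<delta> \<in> sets borel" by (rule near_borel[OF B])
  let ?f = "\<lambda>p. indicator (near B \<delta>) (case p of (s, z, x) \<Rightarrow> (exp (- \<bar>s\<bar> / 2), z, x)) :: real"
  have fm: "?f \<in> borel_measurable (expo \<Otimes>\<^sub>M (unif \<Otimes>\<^sub>M unif))"
    by (rule measurable_compose[OF nu_measurable]) (use nb in auto)
  have "measure nu (near B \<delta>) = (\<integral>p. indicator (near B \<delta>) p \<partial>nu)" using nb by simp
  also have "\<dots> = (\<integral>p. ?f p \<partial>(expo \<Otimes>\<^sub>M (unif \<Otimes>\<^sub>M unif)))" by (rule nu_integral) (use nb in auto)
  also have "\<dots> = (\<integral>s. (\<integral>zx. ?f (s, zx) \<partial>(unif \<Otimes>\<^sub>M unif)) \<partial>expo)"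
    by (rule E.integral_fst'[symmetric], rule E.integrable_const_bound[of _ 1]) (use fm in \<open>auto intro!: AE_I2 simp: indicator_def\<close>)
  also have "\<dots> = (\<integral>s. measure unif B * measure unif {x. ?h s x} \<partial>expo)"
  proof (rule Bochner_Integration.integral_cong[OF refl])
    fix s
    have hm: "{x. ?h s x} \<in> sets borel"
    proof -
      have "(\<lambda>x. (exp (- \<bar>s\<bar> / 2), 0 :: complex, x)) \<in> borel_measurable borel"
        by (intro borel_measurable_continuous_onI continuous_intros)
      from measurable_sets[OF this hit_measurable] show ?thesis by simp
    qed
    have "(\<lambda>zx. ?f (s, zx)) = indicator (B \<times> {x. ?h s x})"
      unfolding near_def by (auto simp: indicator_def fun_eq_iff)
    then have "(\<integral>zx. ?f (s, zx) \<partial>(unif \<Otimes>\<^sub>M unif)) = measure (unif \<Otimes>\<^sub>M unif) (B \<times> {x. ?h s x})"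
      using hm B by simp
    also have "\<dots> = measure unif B * measure unif {x. ?h s x}"
      by (rule prob_measure_times[OF prob_unif prob_unif]) (use hm in auto)
    finally show "(\<integral>zx. ?f (s, zx) \<partial>(unif \<Otimes>\<^sub>M unif)) = measure unif B * measure unif {x. ?h s x}" .
  qed
  also have "\<dots> = measure unif B * limit_cdf \<delta>" unfolding limit_cdf_def by simp
  finally show ?thesis .
qed

text \<open>Convergence of distribution functions at every \<open>\<delta>\<close>, before the normalization by the number of fractions in \<open>B\<close>.\<close>

lemma near_limit:
  assumes B: "B \<in> sets borel" "latper B" "emeasure unif (frontier B) = 0"
  shows "((\<lambda>Q. avg Q (indicator (near B \<delta>) :: _ \<Rightarrow> real)) \<longlongrightarrow> measure unif B * limit_cdf \<delta>) at_top"
  using continuity_set_limit[OF near_borel[OF B(1)] near_periodic[OF B(2)] near_frontier_null[OF B(1,3)], of \<delta>]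
  unfolding near_measure[OF B(1)] .

definition slab :: "complex set \<Rightarrow> (real \<times> complex \<times> complex) set" where
  "slab B = {p. fst (snd p) \<in> B}"

lemma slab_limit:
  assumes B: "B \<in> sets borel" "latper B" "emeasure unif (frontier B) = 0"
  shows "((\<lambda>Q. avg Q (indicator (slab B) :: _ \<Rightarrow> real)) \<longlongrightarrow> measure unif B) at_top"
proof -
  interpret e: prob_space expo by (rule prob_expo)
  interpret u: prob_space unif by (rule prob_unif)
  interpret uu: prob_space "unif \<Otimes>\<^sub>M unif" by (rule prob_unif2)
  note [measurable] = B(1)
  have sm: "slab B \<in> sets borel"
  proof -
    have "{p :: real \<times> complex \<times> complex. p \<in> space borel \<and> fst (snd p) \<in> B} \<in> sets borel" by measurable
    then show ?thesis unfolding slab_def by simp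
  qed
  have "frontier (slab B) \<subseteq> {p. fst (snd p) \<in> frontier B}"
  proof -
    have s: "slab B = UNIV \<times> (B \<times> UNIV)" unfolding slab_def by auto
    have c: "closure (slab B) = UNIV \<times> (closure B \<times> UNIV)" unfolding s closure_Times by simp
    have i: "interior (slab B) = UNIV \<times> (interior B \<times> UNIV)" unfolding s interior_Times by simp
    show ?thesis unfolding frontier_def c i by auto
  qed
  then have "emeasure nu (frontier (slab B)) \<le> emeasure nu {p. fst (snd p) \<in> frontier B}"
  proof (rule emeasure_mono)
    have [measurable]: "frontier B \<in> sets borel" by (simp add: frontier_closed)
    have "{p :: real \<times> complex \<times> complex. p \<in> space borel \<and> fst (snd p) \<in> frontier B} \<in> sets borel" by measurable
    then show "{p :: real \<times> complex \<times> complex. fst (snd p) \<in> frontier B} \<in> sets nu" by simp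
  qed
  also have "\<dots> = 0"
  proof -
    have [measurable]: "frontier B \<in> sets borel" by (simp add: frontier_closed)
    have m: "{p :: real \<times> complex \<times> complex. fst (snd p) \<in> frontier B} \<in> sets borel"
    proof -
      have "{p :: real \<times> complex \<times> complex. p \<in> space borel \<and> fst (snd p) \<in> frontier B} \<in> sets borel" by measurable
      then show ?thesis by simp
    qed
    have "AE p in nu. fst (snd p) \<notin> frontier B"
    proof (rule AE_nuI)
      show "{p :: real \<times> complex \<times> complex. fst (snd p) \<notin> frontier B} \<in> sets borel"
      proof -
        have "{p :: real \<times> complex \<times> complex. p \<in> space borel \<and> fst (snd p) \<notin> frontier B} \<in> sets borel" by measurable
        then show ?thesis by simp
      qed
      have "frontier B \<in> null_sets unif" using B(3) by (auto simp: null_sets_def frontier_closed)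
      then have "AE z in unif. z \<notin> frontier B" by (rule AE_not_in)
      then show "AE z in unif. \<forall>x. AE s in expo. fst (snd (exp (- \<bar>s\<bar> / 2), z, x)) \<notin> frontier B"
        by (rule AE_mp) (auto intro!: AE_I2)
    qed
    then show ?thesis using m by (subst (asm) AE_iff_measurable[of "{p. fst (snd p) \<in> frontier B}"]) auto
  qed
  finally have "emeasure nu (frontier (slab B)) = 0" by simp
  moreover have "periodic3 (slab B)" using B(2) unfolding periodic3_def slab_def latper_def by auto
  moreover have "measure nu (slab B) = measure unif B"
  proof -
    have "measure nu (slab B) = measure (expo \<Otimes>\<^sub>M (unif \<Otimes>\<^sub>M unif)) (UNIV \<times> (B \<times> UNIV))"
    proof -
      have "(\<lambda>(s::real, z::complex, x::complex). (exp (- \<bar>s\<bar> / 2), z, x)) -` slab B \<inter> space (expo \<Otimes>\<^sub>M (unif \<Otimes>\<^sub>M unif)) = UNIV \<times> (B \<times> UNIV)"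
        unfolding slab_def by (auto simp: space_pair_measure)
      then show ?thesis unfolding nu_def using sm by (subst measure_distr[OF nu_measurable]) auto
    qed
    also have "\<dots> = measure expo UNIV * measure (unif \<Otimes>\<^sub>M unif) (B \<times> UNIV)"
      by (rule prob_measure_times[OF prob_expo prob_unif2]) (use B in auto)
    also have "measure (unif \<Otimes>\<^sub>M unif) (B \<times> UNIV) = measure unif B * measure unif UNIV"
      by (rule prob_measure_times[OF prob_unif prob_unif]) (use B in auto)
    finally show ?thesis using e.prob_space u.prob_space by simp
  qed
  ultimately show ?thesis using continuity_set_limit[OF sm] by simp
qed

end

section \<open>Farey fractions and their neighbours\<close>

context imaginary_order
begin

lemma proj_eq_iff: "proj K z = proj K z' \<longleftrightarrow> z - z' \<in> \<O>"
proof
  assume "proj K z = proj K z'"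
  moreover have "z \<in> proj K z" unfolding proj_def by (rule image_eqI[of _ _ 0]) auto
  ultimately obtain a where "a \<in> \<O>" "z = z' + a" unfolding proj_def by auto
  then show "z - z' \<in> \<O>" by simp
next
  assume a: "z - z' \<in> \<O>"
  have "proj K z \<subseteq> proj K z'" if "z - z' \<in> \<O>" for z z'
  proof
    fix y assume "y \<in> proj K z"
    then obtain b where b: "b \<in> \<O>" "y = z + b" unfolding proj_def by auto
    then have "y = z' + (z - z' + b)" "z - z' + b \<in> \<O>" using that by auto
    then show "y \<in> proj K z'" unfolding proj_def by blast
  qed
  then show "proj K z = proj K z'" using a O_minus[OF a] by (metis minus_diff_eq subset_antisym)
qed

lemma unit_norm: "u \<in> unit_group K \<Longrightarrow> cmod u = 1"
proof -
  assume "u \<in> unit_group K"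
  then obtain v where v: "u \<in> \<O>" "v \<in> \<O>" "u * v = 1" unfolding unit_group_def by blast
  then have "u \<noteq> 0" "v \<noteq> 0" by auto
  then have "1 \<le> cmod u" "1 \<le> cmod v" using v O_norm_ge1 by auto
  moreover have "cmod u * cmod v = 1" using v(3) by (metis norm_mult norm_one)
  ultimately show ?thesis by (metis mult_left_mono mult.right_neutral norm_ge_zero order_antisym)
qed

lemma finite_units: "finite (unit_group K)"
  by (rule O_finite_subset[of _ 1]) (use unit_norm in \<open>auto simp: unit_group_def\<close>)

lemma card_units_pos: "0 < card (unit_group K)"
proof -
  have "1 \<in> unit_group K" unfolding unit_group_def by (auto intro!: bexI[of _ 1])
  then show ?thesis using finite_units by (auto simp: card_gt_0_iff)
qed

definition frac_pt :: "complex \<times> complex \<Rightarrow> complex set" where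
  "frac_pt = (\<lambda>(q, p). proj K (p / q))"

lemma pairs_D: "(q, p) \<in> pairs Q \<longleftrightarrow> q \<in> \<O> \<and> q \<noteq> 0 \<and> cmod q \<le> Q \<and> p \<in> res q \<and> comaximal K p q"
  unfolding pairs_def qs_def ures_def by auto

lemma farey_eq: "farey K t = frac_pt ` pairs (exp (t / 2))"
proof (intro equalityI subsetI)
  fix r assume "r \<in> farey K t"
  then obtain p q where r: "r = proj K (p / q)" "p \<in> \<O>" "q \<in> \<O>" "comaximal K p q" "0 < cmod q" "cmod q \<le> exp (t / 2)"
    unfolding farey_def by blast
  then have q: "q \<noteq> 0" by auto
  have "comaximal K (redu q p) q" by (rule comaximal_cong[OF r(2) _ r(3) redu_cg(2) r(4)]) (use redu_res[OF r(3) q r(2)] res_O in blast)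
  then have "(q, redu q p) \<in> pairs (exp (t / 2))" unfolding pairs_D using r q redu_res by auto
  moreover have "frac_pt (q, redu q p) = r"
  proof -
    have "redu q p / q - p / q \<in> \<O>" unfolding redu_def using q by (simp add: diff_divide_distrib O_minus)
    then show ?thesis unfolding frac_pt_def r(1) by (simp add: proj_eq_iff)
  qed
  ultimately show "r \<in> frac_pt ` pairs (exp (t / 2))" by (metis image_eqI)
next
  fix r assume "r \<in> frac_pt ` pairs (exp (t / 2))"
  then obtain q p where "(q, p) \<in> pairs (exp (t / 2))" "r = proj K (p / q)" unfolding frac_pt_def by auto
  then have "r = proj K (p / q) \<and> p \<in> \<O> \<and> q \<in> \<O> \<and> comaximal K p q \<and> 0 < cmod q \<and> cmod q \<le> exp (t / 2)"
    unfolding pairs_D using res_O by auto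
  then show "r \<in> farey K t" unfolding farey_def by blast
qed

lemma finite_farey [simp]: "finite (farey K t)"
  unfolding farey_eq by simp

text \<open>Two representations of a Farey fraction by comaximal pairs differ by a unit.\<close>

lemma card_fibre:
  assumes r: "r \<in> frac_pt ` pairs Q"
  shows "card {qp \<in> pairs Q. frac_pt qp = r} = card (unit_group K)"
proof -
  obtain q0 p0 where 0: "(q0, p0) \<in> pairs Q" "r = proj K (p0 / q0)" using r unfolding frac_pt_def by auto
  have q0: "q0 \<in> \<O>" "q0 \<noteq> 0" "cmod q0 \<le> Q" and p0: "p0 \<in> \<O>" and c0: "comaximal K p0 q0"
    using 0(1) res_O unfolding pairs_D by auto
  obtain a0 b0 where ab0: "a0 \<in> \<O>" "b0 \<in> \<O>" "p0 * a0 + q0 * b0 = 1" using comaximal_iff[OF p0 q0(1)] c0 by blast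
  let ?f = "\<lambda>e. (e * q0, redu (e * q0) (e * p0))"
  have "bij_betw ?f (unit_group K) {qp \<in> pairs Q. frac_pt qp = r}"
    unfolding bij_betw_def
  proof
    show "inj_on ?f (unit_group K)" using q0 by (auto simp: inj_on_def)
    show "?f ` unit_group K = {qp \<in> pairs Q. frac_pt qp = r}"
    proof (intro equalityI subsetI)
      fix y assume "y \<in> ?f ` unit_group K"
      then obtain e where e: "e \<in> unit_group K" "y = ?f e" by blast
      then obtain e' where e': "e \<in> \<O>" "e' \<in> \<O>" "e * e' = 1" unfolding unit_group_def by blast
      have eq: "e * q0 \<in> \<O>" "e * q0 \<noteq> 0" "e * p0 \<in> \<O>" using e' q0 p0 by auto
      have "e * p0 * (e' * a0) + e * q0 * (e' * b0) = e * e' * (p0 * a0 + q0 * b0)" by (simp add: algebra_simps)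
      then have "e * p0 * (e' * a0) + e * q0 * (e' * b0) = 1" unfolding e'(3) ab0(3) by simp
      moreover have "e' * a0 \<in> \<O>" "e' * b0 \<in> \<O>" using e' ab0 by auto
      ultimately have cm: "comaximal K (e * p0) (e * q0)" using comaximal_iff[OF eq(3,1)] by blast
      have rr: "redu (e * q0) (e * p0) \<in> res (e * q0)" by (rule redu_res[OF eq])
      have "comaximal K (redu (e * q0) (e * p0)) (e * q0)"
        by (rule comaximal_cong[OF eq(3) res_O[OF rr] eq(1) redu_cg(2) cm])
      moreover have "cmod (e * q0) \<le> Q" using unit_norm[OF e(1)] q0 by (simp add: norm_mult)
      ultimately have "y \<in> pairs Q" unfolding e(2) pairs_D using eq rr by blast
      moreover have "frac_pt y = r"
      proof -
        have "redu (e * q0) (e * p0) / (e * q0) - p0 / q0 \<in> \<O>"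
        proof -
          have "redu (e * q0) (e * p0) / (e * q0) = e * p0 / (e * q0) - fl (e * p0 / (e * q0))"
            unfolding redu_def using eq by (simp add: diff_divide_distrib)
          also have "e * p0 / (e * q0) = p0 / q0" using eq by simp
          finally show ?thesis by (simp add: O_minus)
        qed
        then show ?thesis unfolding frac_pt_def 0(2) e(2) by (simp add: proj_eq_iff)
      qed
      ultimately show "y \<in> {qp \<in> pairs Q. frac_pt qp = r}" by blast
    next
      fix y assume y: "y \<in> {qp \<in> pairs Q. frac_pt qp = r}"
      obtain q p where qp: "y = (q, p)" by (cases y)
      have qpP: "(q, p) \<in> pairs Q" and pe: "proj K (p / q) = r" using y unfolding qp frac_pt_def by auto
      have q: "q \<in> \<O>" "q \<noteq> 0" and pr: "p \<in> res q" and c: "comaximal K p q"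
        using qpP unfolding pairs_D by auto
      have p: "p \<in> \<O>" using pr by (rule res_O)
      define d where "d = p / q - p0 / q0"
      have d: "d \<in> \<O>" using pe unfolding 0(2) proj_eq_iff d_def .
      have rel: "p * q0 = (p0 + d * q0) * q" unfolding d_def using q q0 by (simp add: field_simps)
      obtain a b where ab: "a \<in> \<O>" "b \<in> \<O>" "p * a + q * b = 1" using comaximal_iff[OF p q(1)] c by blast
      define e where "e = p * a0 + q * (b0 - d * a0)"
      define e' where "e' = (p0 + d * q0) * a + q0 * b"
      have e: "q = q0 * e"
      proof -
        have "q0 * e = (p * q0) * a0 + q * q0 * (b0 - d * a0)" unfolding e_def by (simp add: algebra_simps)
        also have "\<dots> = q * (p0 * a0 + q0 * b0)" unfolding rel by (simp add: algebra_simps)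
        finally show ?thesis unfolding ab0(3) by simp
      qed
      have e': "q0 = q * e'"
      proof -
        have "q * e' = ((p0 + d * q0) * q) * a + q * q0 * b" unfolding e'_def by (simp add: algebra_simps)
        also have "\<dots> = q0 * (p * a + q * b)" unfolding rel[symmetric] by (simp add: algebra_simps)
        finally show ?thesis unfolding ab(3) by simp
      qed
      have eO: "e \<in> \<O>" "e' \<in> \<O>" unfolding e_def e'_def using p q p0 q0 d ab ab0 by auto
      have "q0 * (e * e') = q0" using e e' by (metis mult.assoc)
      then have "e * e' = 1" using q0 by simp
      then have eU: "e \<in> unit_group K" unfolding unit_group_def using eO by blast
      have q': "e * q0 = q" using e by (simp add: mult.commute)
      have "p * q0 = (e * p0 + d * q) * q0" unfolding rel using e by (simp add: algebra_simps)
      then have pp: "p = e * p0 + d * q" using q0 by simp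
      have "redu q (e * p0) = p"
      proof (rule res_unique[OF q(2) _ pr])
        show "redu q (e * p0) \<in> res q" by (rule redu_res[OF q]) (use eO p0 in auto)
        have "cg q (e * p0) p" unfolding cg_def pp using O_minus[OF d] by (auto intro!: bexI[of _ "- d"])
        then show "cg q (redu q (e * p0)) p" using redu_cg(1) by (rule_tac cg_trans)
      qed
      then have "?f e = y" unfolding q' qp by simp
      then show "y \<in> ?f ` unit_group K" using eU by blast
    qed
  qed
  then show ?thesis by (rule bij_betw_same_card[symmetric])
qed

text \<open>Every fraction is represented once for each unit.\<close>

lemma card_pairs_farey:
  "card {qp \<in> pairs (exp (t / 2)). frac_pt qp \<in> S} = card (unit_group K) * card (farey K t \<inter> S)"
proof -
  let ?P = "pairs (exp (t / 2))"
  have "{qp \<in> ?P. frac_pt qp \<in> S} = (\<Union>r\<in>farey K t \<inter> S. {qp \<in> ?P. frac_pt qp = r})"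
    unfolding farey_eq by auto
  then have "card {qp \<in> ?P. frac_pt qp \<in> S} = (\<Sum>r\<in>farey K t \<inter> S. card {qp \<in> ?P. frac_pt qp = r})"
    by (simp only:) (rule card_UN_disjoint, auto)
  also have "\<dots> = (\<Sum>r\<in>farey K t \<inter> S. card (unit_group K))"
    by (rule sum.cong[OF refl]) (use card_fibre in \<open>auto simp: farey_eq\<close>)
  finally show ?thesis by simp
qed

text \<open>The other fractions in the coordinates \<open>(k, m)\<close> of the unimodular basis \<open>(p, q)\<close>, \<open>(b, a)\<close>.\<close>

lemma neighbour_of_hit:
  assumes qp: "(q, p) \<in> pairs Q" and h: "hit \<delta> (cmod q / Q) (invq q p / q)"
  obtains p' q' where "p' \<in> \<O>" "q' \<in> \<O>" "comaximal K p' q'" "0 < cmod q'" "cmod q' \<le> Q"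
    "p / q \<noteq> p' / q'" "cmod (p / q - p' / q') * Q\<^sup>2 \<le> \<delta>"
proof -
  have q: "q \<in> \<O>" "q \<noteq> 0" "cmod q \<le> Q" and p: "p \<in> \<O>" and c: "comaximal K p q" using qp res_O unfolding pairs_D by auto
  have Q: "0 < Q" using q by (auto intro: less_le_trans[of _ "cmod q"])
  define a where "a = invq q p"
  have a: "a \<in> \<O>" "cg q (p * a) 1" unfolding a_def using invq[OF p q(1) c] by auto
  obtain b where b: "b \<in> \<O>" "p * a - 1 = q * b" using a(2) unfolding cg_def by blast
  then have det: "p * a - q * b = 1" by (simp add: algebra_simps)
  obtain k m where km: "(k, m) \<in> cop" "reach \<delta> (cmod q / Q) (a / q) (k, m)" using h unfolding hit_def a_def by auto
  have O: "k \<in> \<O>" "m \<in> \<O>" "m \<noteq> 0" "comaximal K k m" using km(1) unfolding cop_def by auto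
  define p' where "p' = k * p + m * b"
  define q' where "q' = k * q + m * a"
  have u: "0 < cmod q / Q" using q Q by simp
  have kx: "k + m * (a / q) = q' / q" unfolding q'_def using q by (simp add: field_simps)
  have q'0: "0 < cmod q'" using reach_bounds(1)[OF km(1) u km(2)] unfolding kx by (auto simp: norm_divide)
  have r: "cmod q / Q * cmod (q' / q) \<le> 1" "cmod m \<le> \<delta> * (cmod q / Q)\<^sup>2 * cmod (q' / q)"
    using km(2) unfolding reach_def split_conv kx by auto
  have q'Q: "cmod q' \<le> Q" using r(1) q Q by (simp add: norm_divide field_simps)
  have pq: "p * q' - p' * q = m"
  proof -
    have "p * q' - p' * q = m * (p * a - q * b)" unfolding p'_def q'_def by (simp add: algebra_simps)
    then show ?thesis unfolding det by simp
  qed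
  have diff: "p / q - p' / q' = m / (q * q')" using q q'0 pq by (simp add: divide_simps)
  obtain c d where cd: "c \<in> \<O>" "d \<in> \<O>" "k * c + m * d = 1" using comaximal_iff[OF O(1,2)] O(4) by blast
  have O': "p' \<in> \<O>" "q' \<in> \<O>" unfolding p'_def q'_def using O p q a b by auto
  have "p' * (a * c - q * d) + q' * (p * d - b * c) = (k * c + m * d) * (p * a - q * b)"
    unfolding p'_def q'_def by (simp add: algebra_simps)
  then have "p' * (a * c - q * d) + q' * (p * d - b * c) = 1" unfolding cd(3) det by simp
  moreover have "a * c - q * d \<in> \<O>" "p * d - b * c \<in> \<O>" using a b cd p q by auto
  ultimately have cm: "comaximal K p' q'" using comaximal_iff[OF O'] by blast
  have "p / q \<noteq> p' / q'" using diff O(3) q q'0 by auto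
  moreover have "cmod (p / q - p' / q') * Q\<^sup>2 \<le> \<delta>"
    unfolding diff using r(2) q q'0 Q by (simp add: norm_divide norm_mult power_divide divide_simps power2_eq_square)
  ultimately show ?thesis using that[OF O' cm q'0 q'Q] by blast
qed

lemma hit_of_neighbour:
  assumes qp: "(q, p) \<in> pairs Q" and O': "p' \<in> \<O>" "q' \<in> \<O>" and cm: "comaximal K p' q'" and q': "0 < cmod q'" "cmod q' \<le> Q"
    and ne: "p / q \<noteq> p' / q'" and le: "cmod (p / q - p' / q') * Q\<^sup>2 \<le> \<delta>"
  shows "hit \<delta> (cmod q / Q) (invq q p / q)"
proof -
  have q: "q \<in> \<O>" "q \<noteq> 0" "cmod q \<le> Q" and p: "p \<in> \<O>" and c: "comaximal K p q" using qp res_O unfolding pairs_D by auto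
  have Q: "0 < Q" using q by (auto intro: less_le_trans[of _ "cmod q"])
  define a where "a = invq q p"
  have a: "a \<in> \<O>" "cg q (p * a) 1" unfolding a_def using invq[OF p q(1) c] by auto
  obtain b where b: "b \<in> \<O>" "p * a - 1 = q * b" using a(2) unfolding cg_def by blast
  then have det: "p * a - q * b = 1" by (simp add: algebra_simps)
  define k where "k = a * p' - b * q'"
  define m where "m = p * q' - q * p'"
  have kq: "k * q + m * a = q'"
  proof -
    have "k * q + m * a = q' * (p * a - q * b)" unfolding k_def m_def by (simp add: algebra_simps)
    then show ?thesis unfolding det by simp
  qed
  have diff: "p / q - p' / q' = m / (q * q')" unfolding m_def using q q' by (simp add: divide_simps)
  then have m0: "m \<noteq> 0" using ne by auto
  have O: "k \<in> \<O>" "m \<in> \<O>" unfolding k_def m_def using O' p q a b by auto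
  obtain c d where cd: "c \<in> \<O>" "d \<in> \<O>" "p' * c + q' * d = 1" using comaximal_iff[OF O'] cm by blast
  have "k * (p * c + q * d) + m * (b * c + a * d) = (p' * c + q' * d) * (p * a - q * b)"
    unfolding k_def m_def by (simp add: algebra_simps)
  then have "k * (p * c + q * d) + m * (b * c + a * d) = 1" unfolding cd(3) det by simp
  moreover have "p * c + q * d \<in> \<O>" "b * c + a * d \<in> \<O>" using a b cd p q by auto
  ultimately have "comaximal K k m" using comaximal_iff[OF O] by blast
  then have "(k, m) \<in> cop" unfolding cop_def using O m0 by auto
  moreover have "reach \<delta> (cmod q / Q) (a / q) (k, m)"
  proof -
    have kx: "k + m * (a / q) = q' / q" unfolding kq[symmetric] using q by (simp add: field_simps)
    have "cmod q / Q * cmod (q' / q) \<le> 1" using q q' Q by (simp add: norm_divide field_simps)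
    moreover have "cmod m \<le> \<delta> * (cmod q / Q)\<^sup>2 * cmod (q' / q)"
      using le q q' Q unfolding diff by (simp add: norm_divide norm_mult power_divide divide_simps power2_eq_square)
    ultimately show ?thesis unfolding reach_def split_conv kx by blast
  qed
  ultimately show ?thesis unfolding hit_def a_def by blast
qed

definition gap_val :: "real \<Rightarrow> complex set \<Rightarrow> real" where
  "gap_val t r = exp t * (INF s \<in> farey K t - {r}. torus_dist r s)"

lemma gap_val_nonneg: "farey K t - {r} \<noteq> {} \<Longrightarrow> 0 \<le> gap_val t r"
  unfolding gap_val_def torus_dist_def by (intro mult_nonneg_nonneg cINF_greatest) (auto simp: setdist_pos_le)

text \<open>The rescaled gap of a Farey fraction is at most \<open>\<delta>\<close> exactly if its limiting data has a neighbour;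
  the bound on \<open>\<delta>\<close> excludes the translates of the fraction itself.\<close>

lemma gap_val_le_iff:
  assumes qp: "(q, p) \<in> pairs (exp (t / 2))" and ne: "farey K t - {frac_pt (q, p)} \<noteq> {}" and d: "\<delta> < exp t"
  shows "gap_val t (frac_pt (q, p)) \<le> \<delta> \<longleftrightarrow> hit \<delta> (cmod q / exp (t / 2)) (invq q p / q)"
proof -
  let ?Q = "exp (t / 2)" and ?r = "frac_pt (q, p)"
  have Q2: "?Q\<^sup>2 = exp t" by (simp add: power2_eq_square exp_add[symmetric])
  have q: "q \<in> \<O>" "q \<noteq> 0" "cmod q \<le> ?Q" and p: "p \<in> \<O>" using qp res_O unfolding pairs_D by auto
  have r: "?r = proj K (p / q)" unfolding frac_pt_def by simp
  have bdd: "bdd_below (torus_dist ?r ` (farey K t - {?r}))"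
    unfolding torus_dist_def by (rule bdd_belowI[of _ 0]) (auto simp: setdist_pos_le)
  show ?thesis
  proof
    assume h: "hit \<delta> (cmod q / ?Q) (invq q p / q)"
    then obtain p' q' where n: "p' \<in> \<O>" "q' \<in> \<O>" "comaximal K p' q'" "0 < cmod q'" "cmod q' \<le> ?Q"
      "p / q \<noteq> p' / q'" "cmod (p / q - p' / q') * ?Q\<^sup>2 \<le> \<delta>" using neighbour_of_hit[OF qp] by metis
    let ?s = "proj K (p' / q')"
    have "?s \<in> farey K t" unfolding farey_def using n by blast
    moreover have "?s \<noteq> ?r"
    proof
      assume "?s = ?r"
      then have "p / q - p' / q' \<in> \<O>" unfolding r by (metis proj_eq_iff)
      then have "1 \<le> cmod (p / q - p' / q')" using n(6) by (intro O_norm_ge1) auto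
      then have "1 * ?Q\<^sup>2 \<le> cmod (p / q - p' / q') * ?Q\<^sup>2" by (intro mult_right_mono) auto
      then show False using n(7) d unfolding Q2 by linarith
    qed
    ultimately have "(INF s \<in> farey K t - {?r}. torus_dist ?r s) \<le> torus_dist ?r ?s"
      by (intro cINF_lower bdd) auto
    also have "\<dots> \<le> cmod (p / q - p' / q')" unfolding torus_dist_def r
    proof -
      have "p / q \<in> proj K (p / q)" "p' / q' \<in> proj K (p' / q')" unfolding proj_def by (rule image_eqI[of _ _ 0]; simp)+
      from setdist_le_dist[OF this] show "setdist (proj K (p / q)) (proj K (p' / q')) \<le> cmod (p / q - p' / q')" by (simp add: dist_norm)
    qed
    finally have "gap_val t ?r \<le> exp t * cmod (p / q - p' / q')" unfolding gap_val_def by (intro mult_left_mono) auto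
    then show "gap_val t ?r \<le> \<delta>" using n(7) Q2 by (simp add: mult.commute)
  next
    assume le: "gap_val t ?r \<le> \<delta>"
    show "hit \<delta> (cmod q / ?Q) (invq q p / q)"
    proof (rule hit_closed)
      show "0 < cmod q / ?Q" using q by simp
      fix \<delta>' assume dd: "\<delta> < \<delta>'"
      have "(INF s \<in> farey K t - {?r}. torus_dist ?r s) < \<delta>' / exp t"
        using le dd unfolding gap_val_def by (simp add: field_simps)
      then obtain s where s: "s \<in> farey K t" "s \<noteq> ?r" "torus_dist ?r s < \<delta>' / exp t"
        using cInf_lessD[of "torus_dist ?r ` (farey K t - {?r})" "\<delta>' / exp t"] ne by auto
      obtain p1 q1 where 1: "s = proj K (p1 / q1)" "p1 \<in> \<O>" "q1 \<in> \<O>" "comaximal K p1 q1" "0 < cmod q1" "cmod q1 \<le> ?Q"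
        using s(1) unfolding farey_def by blast
      have nonempty: "proj K z \<noteq> {}" for z unfolding proj_def using O_0 by blast
      obtain z z' where z: "z \<in> ?r" "z' \<in> s" "dist z z' < \<delta>' / exp t"
        using s(3) unfolding torus_dist_def by (rule setdist_ltE) (use nonempty r 1 in auto)
      obtain o1 o2 where o: "o1 \<in> \<O>" "o2 \<in> \<O>" "z = p / q + o1" "z' = p1 / q1 + o2" using z unfolding r 1 proj_def by auto
      define p' where "p' = p1 + q1 * (o2 - o1)"
      have q10: "q1 \<noteq> 0" using 1 by auto
      have p'q: "p' / q1 = p1 / q1 + (o2 - o1)" unfolding p'_def using q10 by (simp add: field_simps)
      have oo: "o2 - o1 \<in> \<O>" using o by blast
      have "cmod (p / q - p' / q1) < \<delta>' / exp t" using z(3) unfolding o p'q dist_norm by (simp add: algebra_simps)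
      then have "cmod (p / q - p' / q1) * ?Q\<^sup>2 \<le> \<delta>'" unfolding Q2 by (simp add: field_simps)
      moreover have "p / q \<noteq> p' / q1"
      proof
        assume "p / q = p' / q1"
        then have "p / q - p1 / q1 \<in> \<O>" unfolding p'q using oo by simp
        then show False using s(2) unfolding r 1 by (metis proj_eq_iff)
      qed
      moreover have "p' \<in> \<O>" unfolding p'_def using 1 oo by blast
      moreover have "comaximal K p' q1" unfolding p'_def by (rule comaximal_shear[OF 1(2,3) oo 1(4)])
      ultimately show "hit \<delta>' (cmod q / ?Q) (invq q p / q)" using hit_of_neighbour[OF qp _ 1(3) _ 1(5,6)] by blast
    qed
  qed
qed

lemma avg_indicator:
  "avg Q (indicator A :: _ \<Rightarrow> real) = real (card {qp \<in> pairs Q. pt Q qp \<in> A}) / card (pairs Q)"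
proof -
  have "(\<Sum>qp\<in>pairs Q. indicator A (pt Q qp) :: real) = card {qp \<in> pairs Q. pt Q qp \<in> A}"
    unfolding indicator_def by (simp add: sum.If_cases Int_def)
  then show ?thesis unfolding avg_def by (simp add: divide_inverse mult.commute)
qed

lemma farey_large: "\<forall>\<^sub>F t in at_top. c \<le> real (card (farey K t))"
proof -
  obtain k where k: "0 < k" "((\<lambda>Q. card (pairs Q) / Q ^ 4) \<longlongrightarrow> k) at_top" using pairs_growth by blast
  let ?U = "real (card (unit_group K))"
  have lim: "filterlim (\<lambda>Q::real. card (pairs Q) / Q ^ 4 * Q ^ 4) at_top at_top"
    by (rule filterlim_tendsto_pos_mult_at_top[OF k(2,1)]) (intro filterlim_pow_at_top filterlim_ident, simp)
  have "filterlim (\<lambda>t::real. exp (t / 2)) at_top at_top"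
    by (rule filterlim_compose[OF exp_at_top]) (use filterlim_at_top_mult_tendsto_pos[OF tendsto_const[of "1/2::real"] _ filterlim_ident] in simp)
  from filterlim_compose[OF lim this]
  have "filterlim (\<lambda>t::real. real (card (pairs (exp (t / 2))))) at_top at_top" by simp
  then have "\<forall>\<^sub>F t in at_top. ?U * c \<le> real (card (pairs (exp (t / 2))))" by (simp add: filterlim_at_top)
  then show ?thesis
  proof eventually_elim
    case (elim t)
    have "card (pairs (exp (t / 2))) = card (unit_group K) * card (farey K t)"
      using card_pairs_farey[of t UNIV] by simp
    then have "?U * c \<le> ?U * real (card (farey K t))" using elim by (metis of_nat_mult)
    then show ?case using card_units_pos by simp
  qed
qed

lemma farey_minus_nonempty: "\<forall>\<^sub>F t in at_top. \<forall>r. farey K t - {r} \<noteq> {}"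
  using farey_large[of 2]
proof eventually_elim
  case (elim t)
  show ?case
  proof
    fix r show "farey K t - {r} \<noteq> {}"
    proof
      assume "farey K t - {r} = {}"
      then have "farey K t \<subseteq> {r}" by blast
      then have "card (farey K t) \<le> 1" using card_mono[of "{r}" "farey K t"] by simp
      then show False using elim by simp
    qed
  qed
qed

lemma count_near:
  assumes ne: "\<And>r. farey K t - {r} \<noteq> {}" and d: "\<delta> < exp t"
  shows "card {qp \<in> pairs (exp (t / 2)). pt (exp (t / 2)) qp \<in> near (proj K -` B) \<delta>}
    = card (unit_group K) * card {r \<in> farey K t \<inter> B. gap_val t r \<le> \<delta>}"
proof -
  let ?Q = "exp (t / 2)"
  have "{qp \<in> pairs ?Q. pt ?Q qp \<in> near (proj K -` B) \<delta>} = {qp \<in> pairs ?Q. frac_pt qp \<in> {r \<in> B. gap_val t r \<le> \<delta>}}"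
  proof (rule Collect_cong, rule conj_cong[OF refl])
    fix qp assume qp: "qp \<in> pairs ?Q"
    obtain q p where e: "qp = (q, p)" by (cases qp)
    have "q \<noteq> 0" using qp unfolding e pairs_D by blast
    then show "pt ?Q qp \<in> near (proj K -` B) \<delta> \<longleftrightarrow> frac_pt qp \<in> {r \<in> B. gap_val t r \<le> \<delta>}"
      using gap_val_le_iff[OF qp[unfolded e] ne d] unfolding e pt_def near_def by (auto simp: frac_pt_def)
  qed
  then have "card {qp \<in> pairs ?Q. pt ?Q qp \<in> near (proj K -` B) \<delta>} = card (unit_group K) * card (farey K t \<inter> {r \<in> B. gap_val t r \<le> \<delta>})"
    by (simp only: card_pairs_farey)
  also have "farey K t \<inter> {r \<in> B. gap_val t r \<le> \<delta>} = {r \<in> farey K t \<inter> B. gap_val t r \<le> \<delta>}" by auto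
  finally show ?thesis .
qed

lemma count_slab:
  "card {qp \<in> pairs (exp (t / 2)). pt (exp (t / 2)) qp \<in> slab (proj K -` B)} = card (unit_group K) * card (farey K t \<inter> B)"
proof -
  have "{qp \<in> pairs (exp (t / 2)). pt (exp (t / 2)) qp \<in> slab (proj K -` B)} = {qp \<in> pairs (exp (t / 2)). frac_pt qp \<in> B}"
    unfolding slab_def pt_def frac_pt_def by auto
  then show ?thesis by (simp only: card_pairs_farey)
qed

lemma exp_half_at_top: "filterlim (\<lambda>t::real. exp (t / 2)) at_top at_top"
  by (rule filterlim_compose[OF exp_at_top]) (use filterlim_at_top_mult_tendsto_pos[OF tendsto_const[of "1/2::real"] _ filterlim_ident] in simp)

lemma latper_vimage: "latper (proj K -` B)"
proof -
  have "proj K (z + a) = proj K z" if "a \<in> \<O>" for z a using that by (simp add: proj_eq_iff)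
  then show ?thesis unfolding latper_def by simp
qed

lemma farey_meets:
  assumes B: "proj K -` B \<in> sets borel" "emeasure unif (frontier (proj K -` B)) = 0" and pos: "0 < measure unif (proj K -` B)"
  shows "\<forall>\<^sub>F t in at_top. farey K t \<inter> B \<noteq> {}"
proof -
  have "((\<lambda>t. avg (exp (t / 2)) (indicator (slab (proj K -` B)) :: _ \<Rightarrow> real)) \<longlongrightarrow> measure unif (proj K -` B)) at_top"
    by (rule filterlim_compose[OF slab_limit[OF B(1) latper_vimage B(2)] exp_half_at_top])
  then have "\<forall>\<^sub>F t in at_top. 0 < avg (exp (t / 2)) (indicator (slab (proj K -` B)) :: _ \<Rightarrow> real)"
    using pos by (rule order_tendstoD)
  then show ?thesis
  proof eventually_elim
    case (elim t)
    then show ?case unfolding avg_indicator count_slab by auto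
  qed
qed

lemma gap_proportion_limit:
  assumes B: "proj K -` B \<in> sets borel" "emeasure unif (frontier (proj K -` B)) = 0" and pos: "0 < measure unif (proj K -` B)"
  shows "((\<lambda>t. real (card {r \<in> farey K t \<inter> B. gap_val t r \<le> \<delta>}) / card (farey K t \<inter> B)) \<longlongrightarrow> limit_cdf \<delta>) at_top"
proof -
  let ?B = "proj K -` B"
  have "((\<lambda>t. avg (exp (t / 2)) (indicator (near ?B \<delta>) :: _ \<Rightarrow> real) / avg (exp (t / 2)) (indicator (slab ?B) :: _ \<Rightarrow> real))
      \<longlongrightarrow> measure unif ?B * limit_cdf \<delta> / measure unif ?B) at_top"
    by (intro tendsto_divide filterlim_compose[OF slab_limit[OF B(1) latper_vimage B(2)] exp_half_at_top]
        filterlim_compose[OF near_limit[OF B(1) latper_vimage B(2)] exp_half_at_top]) (use pos in simp)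
  then have "((\<lambda>t. avg (exp (t / 2)) (indicator (near ?B \<delta>) :: _ \<Rightarrow> real) / avg (exp (t / 2)) (indicator (slab ?B) :: _ \<Rightarrow> real))
      \<longlongrightarrow> limit_cdf \<delta>) at_top" using pos by simp
  moreover have "\<forall>\<^sub>F t in at_top. \<delta> < exp (t::real)"
    using exp_at_top by (simp add: filterlim_at_top_dense)
  with farey_minus_nonempty filterlim_iff[THEN iffD1, OF exp_half_at_top, rule_format, OF pairs_nonempty]
  have "\<forall>\<^sub>F t in at_top. avg (exp (t / 2)) (indicator (near ?B \<delta>) :: _ \<Rightarrow> real) / avg (exp (t / 2)) (indicator (slab ?B) :: _ \<Rightarrow> real)
      = real (card {r \<in> farey K t \<inter> B. gap_val t r \<le> \<delta>}) / card (farey K t \<inter> B)"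
  proof eventually_elim
    case (elim t)
    have "avg (exp (t / 2)) (indicator (near ?B \<delta>) :: _ \<Rightarrow> real)
        = real (card (unit_group K)) * card {r \<in> farey K t \<inter> B. gap_val t r \<le> \<delta>} / card (pairs (exp (t / 2)))"
      unfolding avg_indicator by (subst count_near) (use elim in auto)
    moreover have "avg (exp (t / 2)) (indicator (slab ?B) :: _ \<Rightarrow> real)
        = real (card (unit_group K)) * card (farey K t \<inter> B) / card (pairs (exp (t / 2)))"
      unfolding avg_indicator count_slab by simp
    moreover have "0 < real (card (pairs (exp (t / 2))))" "0 < real (card (unit_group K))" using elim(2) card_units_pos by linarith+
    moreover have "U * a / n / (U * b / n) = a / b" if "0 < n" "0 < U" for U a b n :: real using that by simp
    ultimately show ?case by (simp only:)
  qed
  ultimately show ?thesis by (rule Lim_transform_eventually)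
qed

text \<open>No mass escapes to infinity: discs of the rescaled radius \<open>\<delta> / 2\<close> around the fractions with gap
  larger than \<open>\<delta>\<close> are disjoint, so there are few of them.\<close>

lemma limit_cdf_tail: "\<exists>C. \<forall>\<delta>>0. 1 - limit_cdf \<delta> \<le> C / \<delta>\<^sup>2"
proof -
  obtain k where k: "0 < k" "((\<lambda>Q. card (pairs Q) / Q ^ 4) \<longlongrightarrow> k) at_top" using pairs_growth by blast
  let ?U = "real (card (unit_group K))"
  \<comment> \<open>The packing bound \<open>4 * (diam + 1)\<^sup>2 * (exp t)\<^sup>2 / \<delta>\<^sup>2\<close> is divided by a lower bound for the number of fractions.\<close>
  define C where "C = 8 * (diam + 1)\<^sup>2 * ?U / k"
  have "1 - limit_cdf \<delta> \<le> C / \<delta>\<^sup>2" if d: "0 < \<delta>" for \<delta>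
  proof (rule tendsto_upperbound)
    interpret prob_space unif by (rule prob_unif)
    have "((\<lambda>t. real (card {r \<in> farey K t \<inter> UNIV. gap_val t r \<le> \<delta>}) / card (farey K t \<inter> UNIV)) \<longlongrightarrow> limit_cdf \<delta>) at_top"
      by (rule gap_proportion_limit) (use prob_space in auto)
    then show "((\<lambda>t. 1 - real (card {r \<in> farey K t \<inter> UNIV. gap_val t r \<le> \<delta>}) / card (farey K t \<inter> UNIV)) \<longlongrightarrow> 1 - limit_cdf \<delta>) at_top"
      by (intro tendsto_intros)
    have ev1: "\<forall>\<^sub>F t in at_top. \<delta> < exp (t::real)"
      using exp_at_top by (simp add: filterlim_at_top_dense)
    have "\<forall>\<^sub>F Q in at_top. k / 2 < card (pairs Q) / Q ^ 4" by (rule order_tendstoD(1)[OF k(2)]) (use k in simp)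
    then have ev2: "\<forall>\<^sub>F t in at_top. k / 2 < card (pairs (exp (t / 2))) / exp (t / 2) ^ 4"
      by (rule filterlim_iff[THEN iffD1, OF exp_half_at_top, rule_format])
    show "\<forall>\<^sub>F t in at_top. 1 - real (card {r \<in> farey K t \<inter> UNIV. gap_val t r \<le> \<delta>}) / card (farey K t \<inter> UNIV) \<le> C / \<delta>\<^sup>2"
      using ev1 ev2 farey_large[of 2]
    proof eventually_elim
      case (elim t)
      let ?F = "farey K t" and ?E = "exp t"
      define S where "S = {r \<in> ?F. \<not> gap_val t r \<le> \<delta>}"
      define rep where "rep r = frc (SOME z. r = proj K z)" for r
      have rep: "proj K (rep r) = r" if "r \<in> ?F" for r
      proof -
        have "\<exists>z. r = proj K z" using that unfolding farey_def by blast
        then have "r = proj K (SOME z. r = proj K z)" by (rule someI_ex)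
        moreover have "proj K (frc z) = proj K z" for z unfolding proj_eq_iff frc_def by (simp add: O_minus)
        ultimately show ?thesis unfolding rep_def by simp
      qed
      have injrep: "inj_on rep S" unfolding S_def by (rule inj_onI) (metis (no_types, lifting) mem_Collect_eq rep)
      let ?d = "\<delta> / ?E"
      have d0: "0 < ?d" "?d \<le> 1" using d elim(1) by auto
      have "real (card (rep ` S)) * (?d / 2)\<^sup>2 \<le> (diam + ?d / 2)\<^sup>2"
      proof (rule planar_packing)
        show "finite (rep ` S)" unfolding S_def by simp
        show "cmod z \<le> diam" if "z \<in> rep ` S" for z using that para_bound[OF frc_para] unfolding rep_def diam_def by auto
        fix z z' assume "z \<in> rep ` S" "z' \<in> rep ` S" "z \<noteq> z'"
        then obtain r s where rs: "r \<in> S" "s \<in> S" "z = rep r" "z' = rep s" "r \<noteq> s" by blast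
        have F: "r \<in> ?F" "s \<in> ?F" using rs unfolding S_def by auto
        have "bdd_below (torus_dist r ` (?F - {r}))" unfolding torus_dist_def by (rule bdd_belowI[of _ 0]) (auto simp: setdist_pos_le)
        then have "(INF s \<in> ?F - {r}. torus_dist r s) \<le> torus_dist r s" using F rs by (intro cINF_lower) auto
        moreover have "\<delta> < ?E * (INF s \<in> ?F - {r}. torus_dist r s)" using rs(1) unfolding S_def gap_val_def by simp
        ultimately have "\<delta> < ?E * torus_dist r s" by (meson exp_ge_zero less_le_trans mult_left_mono)
        moreover have "torus_dist r s \<le> cmod (z - z')"
        proof -
          have "x \<in> proj K x" for x unfolding proj_def by (rule image_eqI[of _ _ 0]; simp)
          then have "z \<in> r" "z' \<in> s" using rep[OF F(1)] rep[OF F(2)] rs by metis+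
          then show ?thesis unfolding torus_dist_def using setdist_le_dist by (metis dist_norm)
        qed
        ultimately have "\<delta> < ?E * cmod (z - z')" by (meson exp_ge_zero less_le_trans mult_left_mono)
        then show "?d \<le> cmod (z - z')" by (simp add: field_simps)
      qed (use d0 diam_pos in auto)
      also have "\<dots> \<le> (diam + 1)\<^sup>2"
      proof (rule power_mono)
        have "x / 2 \<le> 1" if "x \<le> 1" for x :: real using that by simp
        from this[OF d0(2)] show "diam + ?d / 2 \<le> diam + 1" by (rule add_left_mono)
        show "0 \<le> diam + ?d / 2" using d diam_pos by (intro add_nonneg_nonneg divide_nonneg_nonneg) auto
      qed
      finally have "real (card S) * (?d / 2)\<^sup>2 \<le> (diam + 1)\<^sup>2" by (simp add: card_image[OF injrep])
      then have cS: "real (card S) \<le> 4 * (diam + 1)\<^sup>2 * ?E\<^sup>2 / \<delta>\<^sup>2" using d by (simp add: field_simps power2_eq_square)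
      have E4: "exp (t / 2) ^ 4 = ?E\<^sup>2" by (simp add: exp_of_nat_mult[symmetric])
      have "card (pairs (exp (t / 2))) = card (unit_group K) * card ?F" using card_pairs_farey[of t UNIV] by simp
      then have cF: "k / 2 * ?E\<^sup>2 \<le> ?U * real (card ?F)" using elim(2) unfolding E4 by (simp add: field_simps)
      have F0: "0 < real (card ?F)" using elim(3) by linarith
      have "{r \<in> ?F \<inter> UNIV. gap_val t r \<le> \<delta>} = ?F - S" unfolding S_def by auto
      moreover have "S \<subseteq> ?F" unfolding S_def by auto
      ultimately have "real (card {r \<in> ?F \<inter> UNIV. gap_val t r \<le> \<delta>}) = real (card ?F) - real (card S)"
        by (simp add: card_Diff_subset finite_subset[OF _ finite_farey] card_mono of_nat_diff)
      then have "1 - real (card {r \<in> ?F \<inter> UNIV. gap_val t r \<le> \<delta>}) / card (?F \<inter> UNIV) = real (card S) / card ?F"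
      proof -
        have "1 - (n - s) / n = s / n" if "0 < n" for n s :: real using that by (simp add: field_simps)
        from this[OF F0] show ?thesis using \<open>real (card {r \<in> ?F \<inter> UNIV. gap_val t r \<le> \<delta>}) = real (card ?F) - real (card S)\<close> by simp
      qed
      also have "\<dots> \<le> 4 * (diam + 1)\<^sup>2 * ?E\<^sup>2 / \<delta>\<^sup>2 / card ?F" using cS by (rule divide_right_mono) simp
      also have "\<dots> \<le> C / \<delta>\<^sup>2"
      proof -
        have "4 * (diam + 1)\<^sup>2 * ?E\<^sup>2 * k \<le> 8 * (diam + 1)\<^sup>2 * ?U * card ?F"
          using mult_left_mono[OF cF, of "8 * (diam + 1)\<^sup>2"] by (simp add: mult_ac)
        then have "4 * (diam + 1)\<^sup>2 * ?E\<^sup>2 / card ?F \<le> C" unfolding C_def using k F0 by (simp add: field_simps)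
        then have "4 * (diam + 1)\<^sup>2 * ?E\<^sup>2 / card ?F / \<delta>\<^sup>2 \<le> C / \<delta>\<^sup>2" by (rule divide_right_mono) simp
        then show ?thesis by (simp add: divide_divide_eq_left mult.commute)
      qed
      finally show ?case .
    qed
  qed simp
  then show ?thesis by blast
qed

end

section \<open>The limit law of the gaps\<close>

context imaginary_order
begin

text \<open>Outside of the range of heights that carries \<open>nu\<close>, the value 0 is a default.\<close>

definition gapmap :: "real \<times> complex \<times> complex \<Rightarrow> real" where
  "gapmap p = (if 0 < fst p \<and> fst p \<le> 1 then gap (fst p) (snd (snd p)) else 0)"

lemma limit_cdf_near: "limit_cdf \<delta> = measure nu (near UNIV \<delta>)"
  using near_measure[of UNIV \<delta>] prob_space.prob_space[OF prob_unif] by simp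

text \<open>The probability that there is a neighbour at distance at most \<open>n\<close> tends to 1 by \<open>limit_cdf_tail\<close>.\<close>

lemma AE_hit: "AE p in nu. 0 < fst p \<and> fst p \<le> 1 \<and> (\<exists>\<delta>. hit \<delta> (fst p) (snd (snd p)))"
proof -
  interpret prob_space nu by (rule prob_nu)
  obtain C where C: "\<And>\<delta>. 0 < \<delta> \<Longrightarrow> 1 - limit_cdf \<delta> \<le> C / \<delta>\<^sup>2" using limit_cdf_tail by blast
  let ?H = "\<Union>n::nat. near UNIV (real (Suc n))"
  have m: "?H \<in> sets nu" using near_borel[of UNIV] by auto
  have "(\<lambda>n. 1 - C / (real (Suc n))\<^sup>2) \<longlonglongrightarrow> 1 - 0"
    by (intro tendsto_diff tendsto_const tendsto_divide_0[OF tendsto_const] filterlim_at_top_imp_at_infinity filterlim_pow_at_top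
        filterlim_compose[OF filterlim_real_sequentially filterlim_Suc]) simp
  moreover have "1 - C / (real (Suc n))\<^sup>2 \<le> measure nu ?H" for n
  proof -
    have "1 - C / (real (Suc n))\<^sup>2 \<le> limit_cdf (real (Suc n))" using C[of "real (Suc n)"] by simp
    also have "\<dots> \<le> measure nu ?H" unfolding limit_cdf_near by (rule finite_measure_mono[OF _ m]) blast
    finally show ?thesis .
  qed
  ultimately have "1 \<le> measure nu ?H" by (intro LIMSEQ_le_const2[where X = "\<lambda>n. 1 - C / (real (Suc n))\<^sup>2" and x = 1]) auto
  then have "measure nu ?H = 1" using prob_le_1[of ?H] by linarith
  then have "AE p in nu. p \<in> ?H" using m by (simp add: prob_eq_1)
  then show ?thesis using AE_nu
    by (rule AE_mp[OF _ AE_mp]) (auto intro!: AE_I2 simp: near_def)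
qed

lemma gapmap_le_iff:
  "0 < fst p \<Longrightarrow> fst p \<le> 1 \<Longrightarrow> \<exists>\<delta>. hit \<delta> (fst p) (snd (snd p)) \<Longrightarrow> gapmap p \<le> \<delta> \<longleftrightarrow> hit \<delta> (fst p) (snd (snd p))"
  unfolding gapmap_def using gap_le_iff by auto

lemma gapmap_measurable [measurable]: "gapmap \<in> borel_measurable borel"
proof (rule borel_measurableI_le)
  fix a :: real
  define H where "H \<delta> = {p :: real \<times> complex \<times> complex. hit \<delta> (fst p) (snd (snd p))}" for \<delta>
  define E where "E = {p :: real \<times> complex \<times> complex. 0 < fst p} \<inter> {p. fst p \<le> 1} \<inter> (\<Union>n::nat. H (real n))"
  have H: "H \<delta> \<in> sets borel" for \<delta> unfolding H_def by (rule hit_measurable)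
  have "open {p :: real \<times> complex \<times> complex. 0 < fst p}" "closed {p :: real \<times> complex \<times> complex. fst p \<le> 1}"
    by (intro open_Collect_less closed_Collect_le continuous_intros)+
  then have E: "E \<in> sets borel" unfolding E_def
    by (intro sets.Int sets.countable_UN borel_open borel_closed image_subsetI H)
  have ex: "(\<exists>\<delta>. hit \<delta> (fst p) (snd (snd p))) \<longleftrightarrow> (\<exists>n::nat. hit (real n) (fst p) (snd (snd p)))" for p :: "real \<times> complex \<times> complex"
    using hit_mono real_arch_simple by blast
  have eq: "gapmap p \<le> a \<longleftrightarrow> (if 0 < fst p \<and> fst p \<le> 1 \<and> (\<exists>n::nat. hit (real n) (fst p) (snd (snd p))) then hit a (fst p) (snd (snd p)) else 0 \<le> a)" for p
  proof (cases "0 < fst p \<and> fst p \<le> 1 \<and> (\<exists>n::nat. hit (real n) (fst p) (snd (snd p)))")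
    case True
    then show ?thesis using gapmap_le_iff[of p a] by auto
  next
    case False
    then have "gapmap p = 0" unfolding gapmap_def gap_def ex by auto
    then show ?thesis unfolding if_not_P[OF False] by simp
  qed
  have "{p \<in> space borel. gapmap p \<le> a} = (E \<inter> H a) \<union> (if 0 \<le> a then - E else {})"
    unfolding eq E_def H_def by (auto split: if_splits)
  also have "\<dots> \<in> sets borel" using E H[of a] by auto
  finally show "{p \<in> space borel. gapmap p \<le> a} \<in> sets borel" .
qed

lemma gapmap_nonneg: "0 \<le> gapmap p"
proof (cases "0 < fst p \<and> fst p \<le> 1 \<and> (\<exists>\<delta>. hit \<delta> (fst p) (snd (snd p)))")
  case True
  then have "hit (gapmap p) (fst p) (snd (snd p))" using gapmap_le_iff[of p "gapmap p"] by simp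
  then have "1 \<le> gapmap p" using hit_ge1 True by blast
  then show ?thesis by simp
next
  case False
  then show ?thesis unfolding gapmap_def gap_def by auto
qed

lemma gapmap_cdf: "measure nu {p. gapmap p \<le> \<delta>} = limit_cdf \<delta>"
proof -
  interpret prob_space nu by (rule prob_nu)
  have m: "{p. gapmap p \<le> \<delta>} \<in> sets nu"
  proof -
    have "{p \<in> space borel. gapmap p \<le> \<delta>} \<in> sets borel" by measurable
    then show ?thesis by simp
  qed
  show ?thesis unfolding limit_cdf_near
  proof (rule finite_measure_eq_AE[OF _ m])
    show "AE p in nu. p \<in> {p. gapmap p \<le> \<delta>} \<longleftrightarrow> p \<in> near UNIV \<delta>"
      using AE_hit by (rule AE_mp) (use gapmap_le_iff in \<open>auto intro!: AE_I2 simp: near_def\<close>)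
    show "near UNIV \<delta> \<in> sets nu" using near_borel by simp
  qed
qed

text \<open>The law of the gap, on the half-line and on the whole line. The second form is the one to which the theory of weak convergence of
  real distributions applies.\<close>

definition law :: "real measure" where "law = distr nu (restrict_space borel {0..}) gapmap"

definition law0 :: "real measure" where "law0 = distr nu borel gapmap"

lemma gapmap_measurable_restrict: "gapmap \<in> measurable nu (restrict_space borel {0..})"
  by (rule measurable_restrict_space2) (use gapmap_nonneg in auto)

lemma gapmap_measurable_nu: "gapmap \<in> measurable nu borel"
  by measurable

lemma prob_law: "prob_space law"
  unfolding law_def by (rule prob_space.prob_space_distr[OF prob_nu gapmap_measurable_restrict])

lemma sets_law: "sets law = sets (restrict_space borel {0..})" and space_law: "space law = {0..}"
  unfolding law_def by (simp_all add: space_restrict_space)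

lemma real_distribution_law0: "real_distribution law0"
  unfolding law0_def by (rule real_distribution.intro[OF prob_space.prob_space_distr[OF prob_nu gapmap_measurable_nu]])
    (simp add: real_distribution_axioms_def)

lemma law_atMost:
  shows "measure law {0..\<delta>} = limit_cdf \<delta>"
proof -
  have "{0..\<delta>} = {..\<delta>} \<inter> {0..}" by auto
  then have s: "{0..\<delta>} \<in> sets (restrict_space borel {0..})" by (auto simp: sets_restrict_space image_iff intro!: bexI[of _ "{..\<delta>}"])
  have "measure law {0..\<delta>} = measure nu (gapmap -` {0..\<delta>} \<inter> space nu)"
    unfolding law_def by (rule measure_distr[OF gapmap_measurable_restrict s])
  also have "gapmap -` {0..\<delta>} \<inter> space nu = {p. gapmap p \<le> \<delta>}" using gapmap_nonneg by auto
  finally show ?thesis by (simp add: gapmap_cdf)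
qed

lemma law0_cdf: "cdf law0 \<delta> = limit_cdf \<delta>"
proof -
  have "measure law0 {..\<delta>} = measure nu (gapmap -` {..\<delta>} \<inter> space nu)"
    unfolding law0_def by (rule measure_distr[OF gapmap_measurable_nu]) simp
  also have "gapmap -` {..\<delta>} \<inter> space nu = {p. gapmap p \<le> \<delta>}" by auto
  finally show ?thesis by (simp add: gapmap_cdf cdf_def2)
qed

text \<open>Neighbours at rescaled distance at most one need height one, which has probability zero.\<close>

lemma law_unit: "measure law {0..1} = 0"
proof -
  have "AE s in expo. 1 * exp \<bar>s\<bar> \<notin> {1}" by (rule AE_expo_avoid) auto
  then have "AE s in expo. measure unif {x. hit 1 (exp (- \<bar>s\<bar> / 2)) x} = 0"
  proof (rule AE_mp, intro AE_I2 impI)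
    fix s :: real assume s: "1 * exp \<bar>s\<bar> \<notin> {1}"
    then have "exp (- \<bar>s\<bar> / 2) < (1::real)" by auto
    then have "\<not> hit 1 (exp (- \<bar>s\<bar> / 2)) x" for x using hit_ge[of "exp (- \<bar>s\<bar> / 2)" 1 x] by auto
    then show "measure unif {x. hit 1 (exp (- \<bar>s\<bar> / 2)) x} = 0" by simp
  qed
  then have "limit_cdf 1 = 0" unfolding limit_cdf_def by (rule integral_eq_zero_AE)
  then show ?thesis by (simp add: law_atMost)
qed

text \<open>The gap is one of countably many functions of the height coordinate, and each of these
  carries null sets back to null sets.\<close>

lemma law_absolutely_continuous: "absolutely_continuous (restrict_space lborel {0..}) law"
  unfolding absolutely_continuous_def
proof
  fix A :: "real set" assume A: "A \<in> null_sets (restrict_space lborel {0..})"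
  have A0: "A \<in> null_sets lborel" using A by (subst (asm) null_sets_restrict_space) auto
  then have bA [measurable]: "A \<in> sets borel" by auto
  let ?P = "\<lambda>p :: real \<times> complex \<times> complex. \<forall>km\<in>cop. 0 < cmod (fst km + snd km * snd (snd p)) \<longrightarrow>
     cmod (snd km) / ((fst p)\<^sup>2 * cmod (fst km + snd km * snd (snd p))) \<notin> A"
  have mP: "{p. ?P p} \<in> sets borel"
  proof -
    have "{p \<in> space borel. 0 < cmod (fst km + snd km * snd (snd p)) \<longrightarrow>
     cmod (snd km) / ((fst p)\<^sup>2 * cmod (fst km + snd km * snd (snd p))) \<notin> A} \<in> sets (borel :: (real \<times> complex \<times> complex) measure)" for km
      by measurable
    then have "- {p. 0 < cmod (fst km + snd km * snd (snd p)) \<longrightarrow>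
     cmod (snd km) / ((fst p)\<^sup>2 * cmod (fst km + snd km * snd (snd p))) \<notin> A} \<in> sets (borel :: (real \<times> complex \<times> complex) measure)" for km
      by (intro borel_comp) simp
    then have "(\<Union>km\<in>cop. - {p. 0 < cmod (fst km + snd km * snd (snd p)) \<longrightarrow>
     cmod (snd km) / ((fst p)\<^sup>2 * cmod (fst km + snd km * snd (snd p))) \<notin> A}) \<in> sets (borel :: (real \<times> complex \<times> complex) measure)"
      by (intro sets.countable_UN'[OF countable_cop]) blast
    from borel_comp[OF this] show ?thesis by (rule back_subst[of "\<lambda>X. X \<in> sets borel"]) blast
  qed
  have "AE p in nu. ?P p"
  proof (rule AE_nuI[OF mP], rule AE_I2, rule allI)
    fix z x
    have "AE s in expo. 0 < cmod (fst km + snd km * x) \<longrightarrow> cmod (snd km) / ((exp (- \<bar>s\<bar> / 2))\<^sup>2 * cmod (fst km + snd km * x)) \<notin> A"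
      if km: "km \<in> cop" for km
    proof (cases "0 < cmod (fst km + snd km * x)")
      case True
      have "0 < cmod (snd km) / cmod (fst km + snd km * x)" using True km unfolding cop_def by auto
      from AE_expo_avoid[OF this A0]
      have "AE s in expo. cmod (snd km) / cmod (fst km + snd km * x) * exp \<bar>s\<bar> \<notin> A" .
      moreover have "cmod (snd km) / cmod (fst km + snd km * x) * exp \<bar>s\<bar> = cmod (snd km) / ((exp (- \<bar>s\<bar> / 2))\<^sup>2 * cmod (fst km + snd km * x))" for s :: real
      proof -
        have "(exp (- \<bar>s\<bar> / 2))\<^sup>2 * exp \<bar>s\<bar> = 1" by (simp add: power2_eq_square exp_add[symmetric])
        then have "exp \<bar>s\<bar> = 1 / (exp (- \<bar>s\<bar> / 2))\<^sup>2" by (simp add: field_simps)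
        then show ?thesis by simp
      qed
      ultimately show ?thesis by simp
    qed simp
    then show "AE s in expo. ?P (exp (- \<bar>s\<bar> / 2), z, x)"
      by (subst AE_ball_countable[OF countable_cop]) simp
  qed
  then have "AE p in nu. gapmap p \<notin> A" using AE_hit
  proof eventually_elim
    case (elim p)
    obtain k m where km: "(k, m) \<in> cop" "0 < cmod (k + m * snd (snd p))" "gap (fst p) (snd (snd p)) = cmod m / ((fst p)\<^sup>2 * cmod (k + m * snd (snd p)))"
      using gap_attained elim(2) by blast
    have "gapmap p = cmod m / ((fst p)\<^sup>2 * cmod (k + m * snd (snd p)))" unfolding gapmap_def using elim(2) km(3) by simp
    then show ?case using elim(1)[rule_format, OF km(1)] km(2) by simp
  qed
  moreover have mA: "gapmap -` A \<in> sets nu" using measurable_sets[OF gapmap_measurable bA] by simp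
  ultimately have "emeasure nu (gapmap -` A) = 0" by (subst (asm) AE_iff_measurable[OF mA]) auto
  moreover have sA: "A \<in> sets (restrict_space borel {0..})" using A by (auto simp: sets_restrict_space null_sets_def)
  moreover from this have "emeasure law A = emeasure nu (gapmap -` A \<inter> space nu)"
    unfolding law_def by (rule emeasure_distr[OF gapmap_measurable_restrict])
  ultimately show "A \<in> null_sets law" by (simp add: null_sets_def sets_law)
qed

text \<open>Bounded continuous functions on the half-line are extended to the line by \<open>x \<mapsto> f (max 0 x)\<close>, and convergence of
  distribution functions implies weak convergence there.\<close>

lemma narrow_convergence:
  assumes B: "proj K -` B \<in> sets borel" "emeasure unif (frontier (proj K -` B)) = 0" and pos: "0 < measure unif (proj K -` B)"
  shows "narrowly_converges (\<lambda>t. gap_measure K t B) law at_top"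
  unfolding narrowly_converges_def space_law
proof (intro allI impI)
  fix f :: "real \<Rightarrow> real" assume f: "continuous_on {0..} f \<and> bounded (f ` {0..})"
  then obtain b where b: "\<And>x. 0 \<le> x \<Longrightarrow> \<bar>f x\<bar> \<le> b" unfolding bounded_iff by auto
  define g where "g x = f (max 0 x)" for x
  have gc: "isCont g x" for x
  proof -
    have "continuous_on UNIV (\<lambda>x. f (max 0 x))"
      by (rule continuous_on_compose2[of "{0..}" f]) (use f in \<open>auto intro!: continuous_intros\<close>)
    then show ?thesis unfolding g_def by (simp add: continuous_on_eq_continuous_at)
  qed
  have gb: "norm (g x) \<le> b" for x unfolding g_def using b by simp
  have gm: "g \<in> borel_measurable borel" using gc by (intro borel_measurable_continuous_onI) (simp add: continuous_on_eq_continuous_at)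
  have fm: "f \<in> borel_measurable (restrict_space borel {0..})" using f by (intro borel_measurable_continuous_on_restrict) auto
  let ?F = "\<lambda>t. farey K t \<inter> B"
  have lawg: "(\<integral>x. f x \<partial>law) = (\<integral>x. g x \<partial>law0)"
  proof -
    have "(\<integral>x. f x \<partial>law) = (\<integral>p. f (gapmap p) \<partial>nu)" unfolding law_def by (rule integral_distr[OF gapmap_measurable_restrict fm])
    also have "\<dots> = (\<integral>p. g (gapmap p) \<partial>nu)" unfolding g_def using gapmap_nonneg by (simp add: max_def)
    also have "\<dots> = (\<integral>x. g x \<partial>law0)" unfolding law0_def by (rule integral_distr[OF gapmap_measurable_nu gm, symmetric])
    finally show ?thesis .
  qed
  have good: "\<forall>\<^sub>F t in at_top. ?F t \<noteq> {} \<and> (\<forall>r. farey K t - {r} \<noteq> {})"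
    using farey_meets[OF B pos] farey_minus_nonempty by eventually_elim blast
  \<comment> \<open>Weak convergence concerns probability measures on the line, hence a default for the small values of \<open>t\<close>.\<close>
  define M where "M t = (if ?F t = {} then law0 else distr (uniform_count_measure (?F t)) borel (gap_val t))" for t
  have gm2: "gap_val t \<in> measurable (uniform_count_measure (?F t)) N'" if "gap_val t ` ?F t \<subseteq> space N'" for t and N' :: "real measure"
    using that by (auto simp: measurable_def sets_uniform_count_measure space_uniform_count_measure)
  have Md: "real_distribution (M t)" for t
  proof (cases "?F t = {}")
    case True then show ?thesis unfolding M_def using real_distribution_law0 by simp
  next
    case False
    have "prob_space (uniform_count_measure (?F t))" using False by (intro prob_space_uniform_count_measure) auto
    then have "prob_space (distr (uniform_count_measure (?F t)) borel (gap_val t))"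
      by (rule prob_space.prob_space_distr) (rule gm2, simp)
    then show ?thesis unfolding M_def using False by (simp add: real_distribution_def real_distribution_axioms_def)
  qed
  have conv: "((\<lambda>t. \<integral>x. g x \<partial>M t) \<longlongrightarrow> (\<integral>x. g x \<partial>law0)) at_top"
  proof (rule tendsto_at_topI_sequentially)
    fix X :: "nat \<Rightarrow> real" assume X: "filterlim X at_top sequentially"
    show "(\<lambda>n. \<integral>x. g x \<partial>M (X n)) \<longlonglongrightarrow> (\<integral>x. g x \<partial>law0)"
    proof (rule weak_conv_imp_integral_bdd_continuous_conv[OF _ _ _ gc gb])
      show "weak_conv_m (\<lambda>n. M (X n)) law0"
        unfolding weak_conv_m_def weak_conv_def
      proof (intro allI impI)
        fix d
        have "((\<lambda>t. real (card {r \<in> ?F t. gap_val t r \<le> d}) / card (?F t)) \<longlongrightarrow> limit_cdf d) at_top"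
          by (rule gap_proportion_limit[OF B pos])
        moreover have "\<forall>\<^sub>F t in at_top. real (card {r \<in> ?F t. gap_val t r \<le> d}) / card (?F t) = cdf (M t) d"
          using good
        proof eventually_elim
          case (elim t)
          have "cdf (M t) d = measure (uniform_count_measure (?F t)) (gap_val t -` {..d} \<inter> ?F t)"
            unfolding cdf_def2 M_def using elim by (simp add: measure_distr gm2 space_uniform_count_measure)
          also have "\<dots> = real (card (gap_val t -` {..d} \<inter> ?F t)) / card (?F t)"
            by (rule measure_uniform_count_measure) auto
          also have "gap_val t -` {..d} \<inter> ?F t = {r \<in> ?F t. gap_val t r \<le> d}" by auto
          finally show ?case by simp
        qed
        ultimately have "((\<lambda>t. cdf (M t) d) \<longlongrightarrow> limit_cdf d) at_top" by (rule Lim_transform_eventually)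
        from filterlim_compose[OF this X] show "(\<lambda>n. cdf (M (X n)) d) \<longlonglongrightarrow> cdf law0 d" unfolding law0_cdf .
      qed
    qed (auto intro: Md real_distribution_law0)
  qed
  have "\<forall>\<^sub>F t in at_top. (\<integral>x. g x \<partial>M t) = (\<integral>x. f x \<partial>gap_measure K t B)"
    using good
  proof eventually_elim
    case (elim t)
    have nn: "0 \<le> gap_val t r" for r using gap_val_nonneg elim by blast
    have e: "gap_measure K t B = distr (uniform_count_measure (?F t)) (restrict_space borel {0..}) (gap_val t)"
      unfolding gap_measure_def gap_val_def ..
    have "(\<integral>x. f x \<partial>gap_measure K t B) = (\<integral>r. f (gap_val t r) \<partial>uniform_count_measure (?F t))"
      unfolding e by (rule integral_distr[OF gm2 fm]) (use nn in \<open>auto simp: space_restrict_space\<close>)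
    also have "\<dots> = (\<integral>r. g (gap_val t r) \<partial>uniform_count_measure (?F t))" unfolding g_def using nn by (simp add: max_def)
    also have "\<dots> = (\<integral>x. g x \<partial>M t)" unfolding M_def using elim by (simp add: integral_distr[OF gm2 gm])
    finally show ?case by simp
  qed
  from Lim_transform_eventually[OF conv this]
  show "((\<lambda>t. \<integral>x. f x \<partial>gap_measure K t B) \<longlongrightarrow> (\<integral>x. f x \<partial>law)) at_top" unfolding lawg .
qed

section \<open>Haar measure of the torus\<close>

lemma fundamental_iff_bij: "F \<in> sets borel \<and> bij_betw (proj K) F (range (proj K)) \<longleftrightarrow> fundamental F"
proof
  assume F: "F \<in> sets borel \<and> bij_betw (proj K) F (range (proj K))"
  show "fundamental F" unfolding fundamental_def
  proof (intro conjI ballI allI impI)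
    fix x y assume "x \<in> F" "y \<in> F" "x - y \<in> \<O>"
    then show "x = y" using F unfolding bij_betw_def inj_on_def by (metis proj_eq_iff)
  next
    fix z
    have "proj K z \<in> proj K ` F" using F unfolding bij_betw_def by auto
    then show "\<exists>x\<in>F. z - x \<in> \<O>" by (metis imageE proj_eq_iff)
  qed (use F in auto)
next
  assume F: "fundamental F"
  show "F \<in> sets borel \<and> bij_betw (proj K) F (range (proj K))"
    unfolding bij_betw_def inj_on_def
  proof (intro conjI ballI impI)
    fix x y assume "x \<in> F" "y \<in> F" "proj K x = proj K y"
    then show "x = y" using F unfolding fundamental_def proj_eq_iff by blast
  next
    show "proj K ` F = range (proj K)"
    proof (intro equalityI subsetI)
      fix r assume "r \<in> range (proj K)"
      then obtain z where z: "r = proj K z" by blast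
      obtain x where "x \<in> F" "z - x \<in> \<O>" using F unfolding fundamental_def by blast
      then show "r \<in> proj K ` F" unfolding z using proj_eq_iff by blast
    qed auto
  qed (use F in \<open>auto simp: fundamental_def\<close>)
qed

text \<open>The Haar measure is defined through an arbitrary Borel set of representatives. Any such set gives the same
  measure to periodic sets as the parallelogram.\<close>

lemma fundamental_domain: "fundamental (fundamental_domain K)"
  unfolding fundamental_domain_def fundamental_iff_bij
  by (rule someI[of _ para]) (use fundamental_para in \<open>simp add: fundamental_iff_bij\<close>)

lemma space_torus_borel: "space (torus_borel K) = range (proj K)"
  unfolding torus_borel_def by (rule space_measure_of) (auto simp: openin_torus_topology)

lemma proj_measurable: "proj K \<in> measurable borel (torus_borel K)"
  unfolding torus_borel_def
  by (rule measurable_measure_of) (auto simp: openin_torus_topology intro: borel_open)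

lemma openin_torus_borel: "openin (torus_topology K) U \<Longrightarrow> U \<in> sets (torus_borel K)"
  unfolding torus_borel_def by (rule in_measure_of) (auto simp: openin_torus_topology)

lemma vimage_torus_borel: "X \<in> sets (torus_borel K) \<Longrightarrow> proj K -` X \<in> sets borel"
  using measurable_sets[OF proj_measurable] by fastforce

lemma emeasure_torus_haar:
  assumes X: "X \<in> sets (torus_borel K)"
  shows "emeasure (torus_haar K) X = emeasure lborel (para \<inter> proj K -` X)"
proof -
  let ?F = "fundamental_domain K"
  have F: "?F \<in> sets borel" using fundamental_domain unfolding fundamental_def by blast
  have "proj K \<in> measurable (restrict_space lborel ?F) (torus_borel K)"
    by (rule measurable_restrict_space1) (use proj_measurable in simp)
  then have "emeasure (torus_haar K) X = emeasure (restrict_space lborel ?F) (proj K -` X \<inter> space (restrict_space lborel ?F))"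
    unfolding torus_haar_def by (rule emeasure_distr[OF _ X])
  also have "proj K -` X \<inter> space (restrict_space lborel ?F) = proj K -` X \<inter> ?F" by (auto simp: space_restrict_space)
  also have "emeasure (restrict_space lborel ?F) (proj K -` X \<inter> ?F) = emeasure lborel (proj K -` X \<inter> ?F)"
    by (rule emeasure_restrict_space) (use F in auto)
  also have "\<dots> = emeasure lborel (proj K -` X \<inter> para)"
    by (rule fundamental_measure_eq[OF fundamental_domain fundamental_para vimage_torus_borel[OF X] latper_vimage])
  finally show ?thesis by (simp add: Int_commute)
qed

lemma measure_torus_haar: "X \<in> sets (torus_borel K) \<Longrightarrow> measure (torus_haar K) X = area * measure unif (proj K -` X)"
  using emeasure_torus_haar[of X] measure_unif[OF vimage_torus_borel, of X] area_pos by (simp add: measure_def)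

text \<open>The projection is open and continuous.\<close>

lemma frontier_vimage: "frontier (proj K -` B) \<subseteq> proj K -` (torus_topology K frontier_of B)"
proof
  fix x assume x: "x \<in> frontier (proj K -` B)"
  have "proj K x \<in> torus_topology K closure_of B"
    unfolding in_closure_of
  proof (intro conjI allI impI)
    show "proj K x \<in> topspace (torus_topology K)" by (simp add: topspace_torus_topology)
    fix T assume "proj K x \<in> T \<and> openin (torus_topology K) T"
    then have "open (proj K -` T)" "x \<in> proj K -` T" unfolding openin_torus_topology by auto
    moreover have "x \<in> closure (proj K -` B)" using x unfolding frontier_def by blast
    ultimately have "proj K -` B \<inter> proj K -` T \<noteq> {}" using open_Int_closure_eq_empty by blast
    then show "\<exists>y. y \<in> B \<and> y \<in> T" by blast
  qed
  moreover have "proj K x \<notin> torus_topology K interior_of B"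
  proof
    assume "proj K x \<in> torus_topology K interior_of B"
    then obtain T where "openin (torus_topology K) T" "proj K x \<in> T" "T \<subseteq> B" unfolding interior_of_def by blast
    then have "open (proj K -` T)" "x \<in> proj K -` T" "proj K -` T \<subseteq> proj K -` B" unfolding openin_torus_topology by auto
    then have "x \<in> interior (proj K -` B)" using interior_maximal by blast
    then show False using x unfolding frontier_def by blast
  qed
  ultimately show "x \<in> proj K -` (torus_topology K frontier_of B)" unfolding frontier_of_def by blast
qed

lemma frontier_of_sets: "torus_topology K frontier_of B \<in> sets (torus_borel K)"
proof -
  have "openin (torus_topology K) (topspace (torus_topology K) - torus_topology K frontier_of B)"
    using closedin_frontier_of[of "torus_topology K" B] unfolding closedin_def by blast
  then have "topspace (torus_topology K) - torus_topology K frontier_of B \<in> sets (torus_borel K)" by (rule openin_torus_borel)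
  then have "space (torus_borel K) - (topspace (torus_topology K) - torus_topology K frontier_of B) \<in> sets (torus_borel K)"
    by (rule sets.compl_sets)
  moreover have "space (torus_borel K) - (topspace (torus_topology K) - torus_topology K frontier_of B) = torus_topology K frontier_of B"
    using frontier_of_subset_topspace[of "torus_topology K" B] unfolding space_torus_borel topspace_torus_topology by blast
  ultimately show ?thesis by simp
qed

lemma narrow_convergence_torus:
  assumes B: "B \<in> sets (torus_borel K)" and pos: "0 < emeasure (torus_haar K) B"
    and fr: "emeasure (torus_haar K) (torus_topology K frontier_of B) = 0"
  shows "narrowly_converges (\<lambda>t. gap_measure K t B) law at_top"
proof (rule narrow_convergence)
  interpret prob_space unif by (rule prob_unif)
  show b: "proj K -` B \<in> sets borel" by (rule vimage_torus_borel[OF B])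
  have fm: "proj K -` (torus_topology K frontier_of B) \<in> sets borel" by (rule vimage_torus_borel[OF frontier_of_sets])
  have "emeasure unif (proj K -` (torus_topology K frontier_of B)) = 0"
    using fr unfolding emeasure_torus_haar[OF frontier_of_sets] unif_null_iff[OF fm] .
  moreover have "emeasure unif (frontier (proj K -` B)) \<le> emeasure unif (proj K -` (torus_topology K frontier_of B))"
    by (rule emeasure_mono[OF frontier_vimage]) (use fm in simp)
  ultimately show "emeasure unif (frontier (proj K -` B)) = 0" by simp
  have "emeasure unif (proj K -` B) \<noteq> 0"
    using pos unfolding emeasure_torus_haar[OF B] unif_null_iff[OF b] by auto
  then show "0 < measure unif (proj K -` B)" by (simp add: emeasure_eq_measure zero_less_measure_iff)
qed

text \<open>A rectangle is another fundamental domain.\<close>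

lemma area_eq: "area = Im w"
proof -
  let ?R = "{z. 0 \<le> Re z \<and> Re z < 1 \<and> 0 \<le> Im z \<and> Im z < Im w}"
  have "fundamental ?R" unfolding fundamental_def
  proof (intro conjI ballI allI impI)
    show "?R \<in> sets borel" by measurable
  next
    fix x y assume x: "x \<in> ?R" and y: "y \<in> ?R" and "x - y \<in> \<O>"
    then obtain a b where ab: "x - y = of_int a + of_int b * w" by (auto elim!: O_E)
    have "Im x - Im y = of_int b * Im w" using arg_cong[OF ab, of Im] by simp
    moreover have "\<bar>Im x - Im y\<bar> < Im w" using x y by auto
    ultimately have "\<bar>of_int b\<bar> * Im w < 1 * Im w" using Im_w by (simp add: abs_mult)
    then have "b = 0" using Im_w by (simp add: mult_less_cancel_right)
    then have "Re x - Re y = of_int a" "Im x = Im y" using arg_cong[OF ab, of Re] arg_cong[OF ab, of Im] by auto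
    moreover have "\<bar>Re x - Re y\<bar> < 1" using x y by auto
    ultimately have "a = 0" "Re x - Re y = of_int a" "Im x = Im y" by linarith+
    then show "x = y" by (simp add: complex_eq_iff)
  next
    fix z
    define b where "b = \<lfloor>Im z / Im w\<rfloor>"
    define a where "a = \<lfloor>Re (z - of_int b * w)\<rfloor>"
    let ?x = "z - (of_int a + of_int b * w)"
    have "of_int b * Im w \<le> Im z" "Im z < (of_int b + 1) * Im w"
      using floor_correct[of "Im z / Im w"] unfolding b_def
      by (simp_all only: pos_le_divide_eq[OF Im_w] pos_divide_less_eq[OF Im_w] of_int_add of_int_1)
    then have "0 \<le> Im ?x" "Im ?x < Im w" by (auto simp: algebra_simps)
    moreover have "0 \<le> Re ?x" "Re ?x < 1" using floor_correct[of "Re (z - of_int b * w)"] unfolding a_def by (auto simp: algebra_simps)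
    ultimately show "\<exists>x\<in>?R. z - x \<in> \<O>" by (intro bexI[of _ ?x]) auto
  qed
  from fundamental_measure_eq[OF fundamental_para this, of UNIV]
  have e: "emeasure lborel para = emeasure lborel ?R" by (simp add: latper_def)
  have "emeasure lborel (box 0 (Complex 1 (Im w))) \<le> emeasure lborel ?R"
    by (rule emeasure_mono) (auto simp: mem_box Basis_complex_def inner_complex_def intro: less_imp_le)
  moreover have "emeasure lborel ?R \<le> emeasure lborel (cbox 0 (Complex 1 (Im w)))"
    by (rule emeasure_mono) (auto simp: mem_box Basis_complex_def inner_complex_def)
  moreover have "emeasure lborel (box 0 (Complex 1 (Im w))) = ennreal (Im w)" "emeasure lborel (cbox 0 (Complex 1 (Im w))) = ennreal (Im w)"
    using Im_w by (simp_all add: emeasure_lborel_box_eq emeasure_lborel_cbox_eq Basis_complex_def inner_complex_def)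
  ultimately have "emeasure lborel ?R = ennreal (Im w)" by simp
  then show ?thesis unfolding area_def using e Im_w by (simp add: measure_def)
qed

lemma integral_basis_1w: "integral_basis K 1 w"
  unfolding integral_basis_def bij_betw_def
proof
  show "inj (\<lambda>(m, n). of_int m * 1 + of_int n * w)"
    by (rule injI, clarify) (metis co_of_int mult.right_neutral of_int_eq_iff)
  show "range (\<lambda>(m, n). of_int m * 1 + of_int n * w) = \<O>" unfolding ring_eq by auto
qed

text \<open>Two integral bases differ by an integer matrix that is invertible over the integers.\<close>

lemma discriminant_eq: "discriminant K = tr\<^sup>2 - 4 * nm"
  unfolding discriminant_def
proof (rule the_equality)
  let ?d = "\<lambda>w1 w2. w1 * cnj w2 - w2 * cnj w1"
  have val: "(?d 1 w)\<^sup>2 = of_int (tr\<^sup>2 - 4 * nm)"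
  proof -
    have d: "?d 1 w = of_int tr - 2 * w" unfolding cnj_w by simp
    have "(?d 1 w)\<^sup>2 = of_int tr * of_int tr - 4 * of_int tr * w + 4 * (w * w)"
      unfolding d by (simp add: power2_eq_square algebra_simps)
    then show ?thesis unfolding w_sq by (simp add: power2_eq_square algebra_simps)
  qed
  then show "\<exists>w1 w2. integral_basis K w1 w2 \<and> of_int (tr\<^sup>2 - 4 * nm) = (?d w1 w2)\<^sup>2"
    using integral_basis_1w by metis
  fix D assume "\<exists>w1 w2. integral_basis K w1 w2 \<and> of_int D = (?d w1 w2)\<^sup>2"
  then obtain w1 w2 where ib: "integral_basis K w1 w2" and D: "of_int D = (?d w1 w2)\<^sup>2" by blast
  have rng: "range (\<lambda>(m, n). of_int m * w1 + of_int n * w2) = \<O>" using ib unfolding integral_basis_def bij_betw_def by blast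
  have w12: "w1 \<in> \<O>" "w2 \<in> \<O>"
  proof -
    have "(\<lambda>(m, n). of_int m * w1 + of_int n * w2) (1, 0) \<in> \<O>" "(\<lambda>(m, n). of_int m * w1 + of_int n * w2) (0, 1) \<in> \<O>"
      using rng by blast+
    then show "w1 \<in> \<O>" "w2 \<in> \<O>" by simp_all
  qed
  then obtain a b c d where ab: "w1 = of_int a + of_int b * w" "w2 = of_int c + of_int d * w" by (auto elim!: O_E)
  have det: "?d w1 w2 = of_int (a * d - b * c) * ?d 1 w"
    unfolding ab by (simp add: algebra_simps)
  have "1 \<in> range (\<lambda>(m, n). of_int m * w1 + of_int n * w2)" "w \<in> range (\<lambda>(m, n). of_int m * w1 + of_int n * w2)"
    unfolding rng by auto
  then obtain m n m' n' where mn: "1 = of_int m * w1 + of_int n * w2" "w = of_int m' * w1 + of_int n' * w2" by auto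
  have "of_int 1 + of_int 0 * w = of_int (m * a + n * c) + of_int (m * b + n * d) * w"
    using mn(1) unfolding ab by (simp add: algebra_simps)
  then have 1: "m * a + n * c = 1" "m * b + n * d = 0" by (metis co_of_int of_int_eq_iff)+
  have "of_int 0 + of_int 1 * w = of_int (m' * a + n' * c) + of_int (m' * b + n' * d) * w"
    using mn(2) unfolding ab by (simp add: algebra_simps)
  then have 2: "m' * a + n' * c = 0" "m' * b + n' * d = 1" by (metis co_of_int of_int_eq_iff)+
  have "(m * n' - n * m') * (a * d - b * c) = (m * a + n * c) * (m' * b + n' * d) - (m * b + n * d) * (m' * a + n' * c)"
    by (simp add: algebra_simps)
  then have "(m * n' - n * m') * (a * d - b * c) = 1" unfolding 1 2 by simp
  then have "\<bar>(a * d - b * c) * (m * n' - n * m')\<bar> = 1" by (simp only: mult.commute abs_one)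
  then have "\<bar>a * d - b * c\<bar> = 1" by (rule abs_zmult_eq_1)
  then have "(a * d - b * c)\<^sup>2 = 1" using power2_abs[of "a * d - b * c"] by (simp only: one_power2)
  then have "(of_int (a * d - b * c) :: complex)\<^sup>2 = 1" by (simp only: of_int_power[symmetric] of_int_1)
  moreover have "of_int D = (of_int (a * d - b * c))\<^sup>2 * (?d 1 w)\<^sup>2" unfolding D det power_mult_distrib ..
  ultimately have "of_int D = (of_int (tr\<^sup>2 - 4 * nm) :: complex)" unfolding val by (simp only: mult_1_left)
  then show "D = tr\<^sup>2 - 4 * nm" by (simp only: of_int_eq_iff)
qed

lemma sqrt_discriminant: "sqrt (real_of_int \<bar>discriminant K\<bar>) = 2 * area"
proof -
  have d: "of_int tr - 2 * w = - (\<i> * complex_of_real (2 * Im w))"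
    using Re_w by (simp add: complex_eq_iff)
  have "(complex_of_real (2 * Im w))\<^sup>2 = - (of_int tr - 2 * w)\<^sup>2"
    unfolding d by (simp add: power_mult_distrib)
  also have "(of_int tr - 2 * w)\<^sup>2 = of_int tr * of_int tr - 4 * of_int tr * w + 4 * (w * w)"
    by (simp add: power2_eq_square algebra_simps)
  also have "\<dots> = of_int (tr\<^sup>2 - 4 * nm)" unfolding w_sq by (simp add: power2_eq_square algebra_simps)
  finally have "complex_of_real ((2 * Im w)\<^sup>2) = complex_of_real (- real_of_int (tr\<^sup>2 - 4 * nm))"
    by simp
  then have e: "(2 * Im w)\<^sup>2 = - real_of_int (tr\<^sup>2 - 4 * nm)" by (simp only: of_real_eq_iff)
  then have "real_of_int (tr\<^sup>2 - 4 * nm) \<le> 0" using zero_le_power2[of "2 * Im w"] by linarith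
  then have "real_of_int \<bar>tr\<^sup>2 - 4 * nm\<bar> = (2 * Im w)\<^sup>2" using e by simp
  then show ?thesis unfolding discriminant_eq area_eq using Im_w by (simp only: real_sqrt_abs abs_of_pos[of "2 * Im w"] mult_pos_pos zero_less_numeral)
qed

text \<open>The lattice points in the cone: those with vanishing first coordinate are the units.\<close>

lemma cone_card_iff:
  assumes s: "0 \<le> s" and d: "0 \<le> \<delta>"
  shows "card (cone_of (cball 0 \<delta>) \<inter> (\<lambda>v. (a_mat (- s) ** transpose (h_mat z)) *v v) ` primitive_vectors K)
      = card (unit_group K) \<longleftrightarrow> \<not> hit \<delta> (exp (- \<bar>s\<bar> / 2)) z"
proof -
  define u where "u = exp (- \<bar>s\<bar> / 2)"
  have u: "0 < u" "u \<le> 1" unfolding u_def by auto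
  have us: "exp (s / 2) = 1 / u" "exp (- s / 2) = u" unfolding u_def using s by (simp_all add: exp_minus field_simps)
  define f where "f v = (a_mat (- s) ** transpose (h_mat z)) *v v" for v
  have fv: "f (vector [m, k]) = vector [of_real (1 / u) * m, of_real u * (k + m * z)]" for m k
  proof -
    have "vec_nth (f (vector [m, k])) 1 = of_real (exp (s / 2)) * m" "vec_nth (f (vector [m, k])) 2 = of_real (exp (- s / 2)) * (k + m * z)"
      unfolding f_def a_mat_def h_mat_def matrix_matrix_mult_def matrix_vector_mult_def transpose_def
      by (simp_all add: sum_2 algebra_simps)
    then show ?thesis unfolding us by (simp add: vec_eq_iff forall_2)
  qed
  have cone: "vector [y, v] \<in> cone_of (cball 0 \<delta>) \<longleftrightarrow> 0 < cmod v \<and> cmod v \<le> 1 \<and> cmod y \<le> \<delta> * cmod v" for y v :: complex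
  proof
    assume "vector [y, v] \<in> cone_of (cball 0 \<delta>)"
    then obtain y' v' where *: "(vector [y, v] :: complex^2) = vector [y', v']" "v' \<in> cball 0 1 - {0}" "y' \<in> (\<lambda>w. v' * w) ` cball 0 \<delta>"
      unfolding cone_of_def by blast
    have "y = y'" "v = v'" using arg_cong[OF *(1), of "\<lambda>x. vec_nth x 1"] arg_cong[OF *(1), of "\<lambda>x. vec_nth x 2"] by simp_all
    then show "0 < cmod v \<and> cmod v \<le> 1 \<and> cmod y \<le> \<delta> * cmod v" using *(2,3)
      by (auto simp: norm_mult mult.commute[of \<delta>] intro!: mult_left_mono)
  next
    assume a: "0 < cmod v \<and> cmod v \<le> 1 \<and> cmod y \<le> \<delta> * cmod v"
    then have "y = v * (y / v)" "cmod (y / v) \<le> \<delta>" by (auto simp: norm_divide field_simps)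
    then have "y \<in> (\<lambda>w. v * w) ` cball 0 \<delta>" by (intro image_eqI[of _ _ "y / v"]) auto
    then show "vector [y, v] \<in> cone_of (cball 0 \<delta>)" unfolding cone_of_def using a by auto
  qed
  define Z where "Z = {(k, m). k \<in> \<O> \<and> m \<in> \<O> \<and> comaximal K k m \<and> 0 < cmod (k + m * z) \<and> u * cmod (k + m * z) \<le> 1 \<and> cmod m \<le> \<delta> * u\<^sup>2 * cmod (k + m * z)}"
  have "{m * a + k * b |a b. a \<in> \<O> \<and> b \<in> \<O>} \<subseteq> {k * a + m * b |a b. a \<in> \<O> \<and> b \<in> \<O>}" for m k
  proof
    fix x assume "x \<in> {m * a + k * b |a b. a \<in> \<O> \<and> b \<in> \<O>}"
    then obtain a b where ab: "x = m * a + k * b" "a \<in> \<O>" "b \<in> \<O>" by blast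
    then have "x = k * b + m * a" by simp
    then show "x \<in> {k * a + m * b |a b. a \<in> \<O> \<and> b \<in> \<O>}" using ab(2,3) by blast
  qed
  then have comm: "comaximal K m k = comaximal K k m" for m k
    unfolding comaximal_def by (intro arg_cong[of _ _ "\<lambda>X. X = \<O>"] equalityI)
  have mem: "f (vector [m, k]) \<in> cone_of (cball 0 \<delta>) \<longleftrightarrow> 0 < cmod (k + m * z) \<and> u * cmod (k + m * z) \<le> 1 \<and> cmod m \<le> \<delta> * u\<^sup>2 * cmod (k + m * z)" for m k
  proof -
    have "cmod m / u \<le> \<delta> * (u * cmod (k + m * z)) \<longleftrightarrow> cmod m \<le> \<delta> * u\<^sup>2 * cmod (k + m * z)"
      using u by (simp add: field_simps power2_eq_square)
    then show ?thesis unfolding fv cone using u by (simp add: norm_mult norm_divide zero_less_mult_iff)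
  qed
  have set: "cone_of (cball 0 \<delta>) \<inter> f ` primitive_vectors K = (\<lambda>(k, m). f (vector [m, k])) ` Z"
  proof (intro equalityI subsetI)
    fix y assume y: "y \<in> cone_of (cball 0 \<delta>) \<inter> f ` primitive_vectors K"
    then obtain m k where mk: "y = f (vector [m, k])" "m \<in> \<O>" "k \<in> \<O>" "comaximal K m k" unfolding primitive_vectors_def by auto
    then have "(k, m) \<in> Z" unfolding Z_def using y mem[of m k] comm[of m k] by auto
    then show "y \<in> (\<lambda>(k, m). f (vector [m, k])) ` Z" using mk by (intro image_eqI[of _ _ "(k, m)"]) auto
  next
    fix y assume "y \<in> (\<lambda>(k, m). f (vector [m, k])) ` Z"
    then obtain k m where km: "(k, m) \<in> Z" "y = f (vector [m, k])" by auto
    then show "y \<in> cone_of (cball 0 \<delta>) \<inter> f ` primitive_vectors K"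
      unfolding Z_def primitive_vectors_def using mem[of m k] comm[of m k] by auto
  qed
  have "inj_on (\<lambda>(k, m). f (vector [m, k])) Z"
  proof (rule inj_onI, clarify)
    fix k m k' m' assume "f (vector [m, k]) = f (vector [m', k'])"
    then have e: "(vector [of_real (1 / u) * m, of_real u * (k + m * z)] :: complex^2) = vector [of_real (1 / u) * m', of_real u * (k' + m' * z)]"
      unfolding fv .
    have "of_real (1 / u) * m = of_real (1 / u) * m'" using arg_cong[OF e, of "\<lambda>x. vec_nth x 1"] by simp
    then have "m = m'" using u by simp
    moreover have "of_real u * (k + m * z) = of_real u * (k' + m' * z)" using arg_cong[OF e, of "\<lambda>x. vec_nth x 2"] by simp
    ultimately show "k = k' \<and> m = m'" using u by simp
  qed
  then have c: "card (cone_of (cball 0 \<delta>) \<inter> f ` primitive_vectors K) = card Z" unfolding set by (rule card_image)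
  let ?U = "(\<lambda>e. (e, 0 :: complex)) ` unit_group K"
  have U: "{km \<in> Z. snd km = 0} = ?U"
  proof (intro equalityI subsetI)
    fix km assume "km \<in> {km \<in> Z. snd km = 0}"
    then obtain k where k: "km = (k, 0)" "k \<in> \<O>" "comaximal K k 0" unfolding Z_def by auto
    then obtain a b where "a \<in> \<O>" "k * a + 0 * b = 1" using comaximal_iff[of k 0] by auto
    then have "k \<in> unit_group K" unfolding unit_group_def using k by auto
    then show "km \<in> ?U" using k by blast
  next
    fix km assume "km \<in> ?U"
    then obtain e where e: "e \<in> unit_group K" "km = (e, 0)" by blast
    then obtain e' where e': "e \<in> \<O>" "e' \<in> \<O>" "e * e' = 1" unfolding unit_group_def by blast
    have "e * e' + 0 * 0 = 1" using e' by simp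
    then have "comaximal K e 0" using comaximal_iff[of e 0] e' O_0 by blast
    then show "km \<in> {km \<in> Z. snd km = 0}" unfolding Z_def e(2) using unit_norm[OF e(1)] u e' d by auto
  qed
  have cU: "card ?U = card (unit_group K)" by (rule card_image) (simp add: inj_on_def)
  have hitZ: "hit \<delta> u z \<longleftrightarrow> (\<exists>km\<in>Z. snd km \<noteq> 0)"
  proof
    assume "hit \<delta> u z"
    then obtain k m where km: "(k, m) \<in> cop" "reach \<delta> u z (k, m)" unfolding hit_def by auto
    then have "(k, m) \<in> Z" "m \<noteq> 0" using reach_bounds(1)[OF km(1) u(1) km(2)] unfolding Z_def cop_def reach_def by auto
    then show "\<exists>km\<in>Z. snd km \<noteq> 0" by (intro bexI[of _ "(k, m)"]) auto
  next
    assume "\<exists>km\<in>Z. snd km \<noteq> 0"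
    then show "hit \<delta> u z" unfolding hit_def Z_def cop_def reach_def by auto
  qed
  have finZ: "finite Z"
  proof (rule finite_subset)
    show "Z \<subseteq> {k \<in> \<O>. cmod k \<le> 1 / u + \<delta> * u * cmod z} \<times> {m \<in> \<O>. cmod m \<le> \<delta> * u}"
    proof
      fix km assume "km \<in> Z"
      then obtain k m where kx: "km = (k, m)" and km: "(k, m) \<in> Z" by (cases km) auto
      have uk: "u * cmod (k + m * z) \<le> 1" "cmod m \<le> \<delta> * u\<^sup>2 * cmod (k + m * z)" "k \<in> \<O>" "m \<in> \<O>" using km unfolding Z_def by auto
      have "cmod m \<le> \<delta> * u * (u * cmod (k + m * z))" using uk by (simp add: power2_eq_square mult_ac)
      also have "\<dots> \<le> \<delta> * u * 1" using uk d u by (intro mult_left_mono) auto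
      finally have m: "cmod m \<le> \<delta> * u" by simp
      have "cmod k \<le> cmod (k + m * z) + cmod (m * z)" using norm_triangle_ineq4[of "k + m * z" "m * z"] by simp
      also have "\<dots> \<le> 1 / u + \<delta> * u * cmod z"
      proof (rule add_mono)
        show "cmod (k + m * z) \<le> 1 / u" using uk(1) u by (simp add: field_simps)
        show "cmod (m * z) \<le> \<delta> * u * cmod z" unfolding norm_mult by (rule mult_right_mono[OF m]) simp
      qed
      finally show "km \<in> {k \<in> \<O>. cmod k \<le> 1 / u + \<delta> * u * cmod z} \<times> {m \<in> \<O>. cmod m \<le> \<delta> * u}"
        unfolding kx using m uk by blast
    qed
  qed (intro finite_SigmaI O_ball_finite)
  have "card Z = card (unit_group K) \<longleftrightarrow> Z = {km \<in> Z. snd km = 0}"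
  proof
    assume "card Z = card (unit_group K)"
    then have "card {km \<in> Z. snd km = 0} = card Z" unfolding U cU by simp
    then show "Z = {km \<in> Z. snd km = 0}" using finZ by (intro card_subset_eq[symmetric]) auto
  next
    assume "Z = {km \<in> Z. snd km = 0}"
    then show "card Z = card (unit_group K)" unfolding U using cU by simp
  qed
  also have "\<dots> \<longleftrightarrow> \<not> hit \<delta> u z" unfolding hitZ by blast
  finally show ?thesis unfolding c[unfolded f_def] u_def .
qed

text \<open>In a convergent sequence of points with a neighbour, one of finitely many pairs \<open>(k, m)\<close> occurs infinitely often, and its two
  inequalities pass to the limit.\<close>

lemma hit_open_complement:
  assumes u: "0 < u"
  shows "open {z. \<not> hit \<delta> u z}"
proof -
  have "closed {z. hit \<delta> u z}"
    unfolding closed_sequential_limits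
  proof (intro allI impI, elim conjE)
    fix X l assume X: "\<forall>n. X n \<in> {z. hit \<delta> u z}" and l: "X \<longlonglongrightarrow> l"
    have "bounded (range X)" using l by (rule convergent_imp_bounded)
    then obtain b where b: "\<And>n. cmod (X n) \<le> b" unfolding bounded_iff by auto
    define S where "S = {(k, m) \<in> cop. cmod k \<le> 1 / u + \<bar>\<delta>\<bar> * u * b \<and> cmod m \<le> \<bar>\<delta>\<bar> * u}"
    have fin: "finite S" unfolding S_def by (rule finite_cop_bounded)
    have "\<exists>km\<in>S. reach \<delta> u (X n) km" for n
    proof -
      obtain k m where km: "(k, m) \<in> cop" "reach \<delta> u (X n) (k, m)" using X unfolding hit_def by fastforce
      note rb = reach_bounds[OF km(1) u km(2)]
      have 1: "\<delta> * u \<le> \<bar>\<delta>\<bar> * u" using u by (intro mult_right_mono) auto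
      have "\<delta> * u * cmod (X n) \<le> \<bar>\<delta>\<bar> * u * b" using 1 b[of n] u by (intro mult_mono) auto
      then have "(k, m) \<in> S" unfolding S_def using km(1) rb 1 by auto
      then show ?thesis using km(2) by blast
    qed
    then have "\<exists>km\<in>S. \<exists>\<^sub>F n in sequentially. reach \<delta> u (X n) km"
      using fin frequently_bex_finite[of S "\<lambda>n km. reach \<delta> u (X n) km" sequentially] by (simp add: frequently_const)
    then obtain k m where km: "(k, m) \<in> S" "\<exists>\<^sub>F n in sequentially. reach \<delta> u (X n) (k, m)" by auto
    have t1: "(\<lambda>n. u * cmod (k + m * X n)) \<longlonglongrightarrow> u * cmod (k + m * l)" by (intro tendsto_intros l)
    have t2: "(\<lambda>n. \<delta> * u\<^sup>2 * cmod (k + m * X n)) \<longlonglongrightarrow> \<delta> * u\<^sup>2 * cmod (k + m * l)" by (intro tendsto_intros l)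
    have "reach \<delta> u l (k, m)"
    proof (rule ccontr)
      assume "\<not> reach \<delta> u l (k, m)"
      then consider "1 < u * cmod (k + m * l)" | "\<delta> * u\<^sup>2 * cmod (k + m * l) < cmod m" unfolding reach_def by force
      then have "\<forall>\<^sub>F n in sequentially. \<not> reach \<delta> u (X n) (k, m)"
      proof cases
        case 1
        show ?thesis using order_tendstoD(1)[OF t1 1] by (rule eventually_mono) (simp add: reach_def)
      next
        case 2
        show ?thesis using order_tendstoD(2)[OF t2 2] by (rule eventually_mono) (simp add: reach_def)
      qed
      then show False using km(2) by (simp add: frequently_def)
    qed
    then show "l \<in> {z. hit \<delta> u z}" using km(1) unfolding hit_def S_def by auto
  qed
  then show ?thesis by (simp add: closed_def Collect_neg_eq)
qed

text \<open>The lattice in the cone consists of the units alone exactly if there is no neighbour, so the integrand is the probability of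
  a gap larger than \<open>\<delta>\<close> at height \<open>exp (- s / 2)\<close>, up to the area of the torus and the exponential
  density of \<open>s\<close>.\<close>

lemma law_formula:
  assumes d: "0 \<le> \<delta>"
  shows "measure law {0..\<delta>} =
       1 - 4 / sqrt (real_of_int \<bar>discriminant K\<bar>) *
         (LBINT s:{0..}. measure (torus_haar K)
            (proj K ` {z. card (cone_of (cball 0 \<delta>) \<inter>
                (\<lambda>v. (a_mat (- s) ** transpose (h_mat z)) *v v) ` primitive_vectors K)
              = card (unit_group K)})
            * exp (- 2 * s))"
proof -
  interpret e: prob_space expo by (rule prob_expo)
  interpret u: prob_space unif by (rule prob_unif)
  let ?h = "\<lambda>s. measure unif {x. hit \<delta> (exp (- \<bar>s\<bar> / 2)) x}"
  let ?m = "\<lambda>s. measure (torus_haar K) (proj K ` {z. card (cone_of (cball 0 \<delta>) \<inter>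
                (\<lambda>v. (a_mat (- s) ** transpose (h_mat z)) *v v) ` primitive_vectors K) = card (unit_group K)})"
  have ms: "?m s = area * (1 - ?h s)" if s: "0 \<le> s" for s
  proof -
    let ?u = "exp (- \<bar>s\<bar> / 2)"
    let ?X = "proj K ` {z. \<not> hit \<delta> ?u z}"
    have vX: "proj K -` ?X = {z. \<not> hit \<delta> ?u z}"
    proof (intro equalityI subsetI)
      fix z assume "z \<in> proj K -` ?X"
      then obtain z' where z': "proj K z = proj K z'" "\<not> hit \<delta> ?u z'" by auto
      have "z - z' \<in> \<O>" using z'(1) by (simp add: proj_eq_iff)
      then have "hit \<delta> ?u (z' + (z - z')) = hit \<delta> ?u z'" by (rule hit_shift)
      then show "z \<in> {z. \<not> hit \<delta> ?u z}" using z'(2) by simp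
    qed auto
    have "openin (torus_topology K) ?X" unfolding openin_torus_topology vX using hit_open_complement by auto
    then have X: "?X \<in> sets (torus_borel K)" by (rule openin_torus_borel)
    have hm: "{z. hit \<delta> ?u z} \<in> sets borel" using borel_comp[OF borel_open[OF hit_open_complement[of ?u \<delta>]]] by (simp add: Collect_neg_eq)
    have "?m s = measure (torus_haar K) ?X" by (simp only: cone_card_iff[OF s d])
    also have "\<dots> = area * measure unif {z. \<not> hit \<delta> ?u z}" unfolding measure_torus_haar[OF X] vX ..
    also have "measure unif {z. \<not> hit \<delta> ?u z} = 1 - ?h s"
      using u.prob_compl[of "{z. hit \<delta> ?u z}"] hm by (simp add: Collect_neg_eq Compl_eq_Diff_UNIV)
    finally show ?thesis .
  qed
  have hmeas: "?h \<in> borel_measurable borel"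
  proof -
    let ?S = "{p :: real \<times> complex. hit \<delta> (exp (- \<bar>fst p\<bar> / 2)) (snd p)}"
    have "(\<lambda>p :: real \<times> complex. (exp (- \<bar>fst p\<bar> / 2), 0 :: complex, snd p)) \<in> borel_measurable borel"
      by (intro borel_measurable_continuous_onI continuous_intros) simp
    from measurable_sets[OF this hit_measurable[of \<delta>]] have "?S \<in> sets borel" by simp
    then have S: "?S \<in> sets (borel \<Otimes>\<^sub>M unif)" by (simp add: borel_prod[symmetric] cong: sets_pair_measure_cong)
    have "(\<lambda>s. emeasure unif (Pair s -` ?S)) \<in> borel_measurable borel" by (rule u.measurable_emeasure_Pair[OF S])
    then have "(\<lambda>s. enn2real (emeasure unif (Pair s -` ?S))) \<in> borel_measurable borel" by measurable
    then show ?thesis by (simp add: measure_def vimage_def)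
  qed
  have hb: "0 \<le> ?h s" "?h s \<le> 1" for s by (auto simp: u.prob_le_1)
  have ih: "integrable expo ?h"
    by (rule e.integrable_const_bound[of _ 1]) (use hmeas hb in auto)
  have "1 - limit_cdf \<delta> = (\<integral>s. 1 - ?h s \<partial>expo)"
    unfolding limit_cdf_def using ih e.prob_space by simp
  also have "\<dots> = (\<integral>s. exponential_density 2 s *\<^sub>R (1 - ?h s) \<partial>lborel)"
    unfolding expo_def by (rule integral_density) (use hmeas in \<open>auto simp: exponential_density_def\<close>)
  also have "\<dots> = (\<integral>s. (2 / area) * (indicator {0..} s *\<^sub>R (?m s * exp (- 2 * s))) \<partial>lborel)"
  proof (rule Bochner_Integration.integral_cong[OF refl])
    fix s :: real
    show "exponential_density 2 s *\<^sub>R (1 - ?h s) = (2 / area) * (indicator {0..} s *\<^sub>R (?m s * exp (- 2 * s)))"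
    proof (cases "0 \<le> s")
      case True
      have "exponential_density 2 s = 2 * exp (- 2 * s)" using True by (simp add: exponential_density_def)
      then show ?thesis unfolding ms[OF True] using True area_pos by (simp add: mult_ac)
    qed (simp add: exponential_density_def)
  qed
  also have "\<dots> = (2 / area) * (LBINT s:{0..}. ?m s * exp (- 2 * s))" unfolding set_lebesgue_integral_def by simp
  finally have "limit_cdf \<delta> = 1 - (2 / area) * (LBINT s:{0..}. ?m s * exp (- 2 * s))" by simp
  moreover have "4 / sqrt (real_of_int \<bar>discriminant K\<bar>) = 2 / area" unfolding sqrt_discriminant using area_pos by simp
  ultimately show ?thesis by (simp only: law_atMost)
qed

end

section \<open>The integers of an imaginary quadratic field\<close>

lemma rat_denominator:
  obtains q :: int where "0 < q" "of_int q * (r :: rat) \<in> \<int>"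
proof -
  obtain u v where uv: "quotient_of r = (u, v)" by (cases "quotient_of r")
  have "0 < v" using quotient_of_denom_pos[OF uv] .
  moreover have "of_int v * r = of_int u" using quotient_of_div[OF uv] \<open>0 < v\<close> by simp
  ultimately show ?thesis using that[of v] by simp
qed

lemma Im_of_rat [simp]: "Im (of_rat r) = 0" and cnj_of_rat [simp]: "cnj (of_rat r) = of_rat r"
  by (cases r, simp add: of_rat_rat)+

text \<open>The powers of the denominator of \<open>n\<close> all divide \<open>C\<close>.\<close>

lemma rat_int_of_bounded_denominators:
  fixes n :: rat
  assumes C: "0 < C" and pow: "\<And>k. of_int C * n ^ k \<in> \<int>"
  shows "n \<in> \<int>"
proof -
  obtain u v where uv: "quotient_of n = (u, v)" by (cases "quotient_of n")
  have v: "0 < v" and cop: "coprime u v" and n: "n = of_int u / of_int v"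
    using quotient_of_denom_pos[OF uv] quotient_of_coprime[OF uv] quotient_of_div[OF uv] .
  have dv: "v ^ k dvd C" for k
  proof -
    obtain m where m: "of_int C * n ^ k = (of_int m :: rat)" using pow[of k] by (auto elim: Ints_cases)
    then have "(of_int (C * u ^ k) :: rat) = of_int (m * v ^ k)" using v unfolding n by (simp add: power_divide field_simps)
    then have "C * u ^ k = m * v ^ k" by (simp only: of_int_eq_iff)
    then have "v ^ k dvd C * u ^ k" by simp
    moreover have "coprime (v ^ k) (u ^ k)" using cop by (simp add: coprime_commute)
    ultimately show ?thesis using coprime_dvd_mult_left_iff by blast
  qed
  have "v = 1"
  proof (rule ccontr)
    assume "v \<noteq> 1"
    then have "2 \<le> v" using v by simp
    then have "2 ^ nat C \<le> v ^ nat C" by (intro power_mono) auto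
    moreover have "v ^ nat C \<le> C" using zdvd_imp_le[OF dv C] .
    moreover have "int (nat C) < 2 ^ nat C" using less_exp[of "nat C"] by (metis of_nat_less_iff of_nat_numeral of_nat_power)
    ultimately show False using C by simp
  qed
  then show ?thesis unfolding n by simp
qed

text \<open>
  The powers of an algebraic integer have bounded denominators with respect to \<open>1, x\<close>, so
  the powers of its norm have bounded denominators as well.
\<close>

lemma norm_of_algebraic_int:
  fixes x :: complex and t n :: rat
  assumes alg: "algebraic_int x" and t: "x + cnj x = of_rat t" and n: "x * cnj x = of_rat n"
  shows "n \<in> \<int>"
proof -
  obtain p where p: "lead_coeff p = 1" "\<And>i. coeff p i \<in> \<int>" "poly p x = 0"
    using alg by (auto elim: algebraic_int.cases)
  define d where "d = degree p"
  define G where "G M y \<longleftrightarrow> (\<exists>a b :: int. of_int M * y = of_int a + of_int b * x)" for M :: int and y :: complex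
  have add: "G M (y + z)" if y: "G M y" and z: "G M z" for M y z
  proof -
    obtain a b a' b' :: int where "of_int M * y = of_int a + of_int b * x" "of_int M * z = of_int a' + of_int b' * x"
      using y z unfolding G_def by blast
    then have "of_int M * (y + z) = of_int (a + a') + of_int (b + b') * x" by (simp add: algebra_simps)
    then show ?thesis unfolding G_def by blast
  qed
  have mul: "G M (of_int c * y)" if y: "G M y" for M c y
  proof -
    obtain a b :: int where "of_int M * y = of_int a + of_int b * x" using y unfolding G_def by blast
    then have "of_int c * (of_int M * y) = of_int c * (of_int a + of_int b * x)" by simp
    then have "of_int M * (of_int c * y) = of_int (c * a) + of_int (c * b) * x" by (simp add: algebra_simps)
    then show ?thesis unfolding G_def by blast
  qed
  have scale: "G (c * M) y" if y: "G M y" for c M y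
    using mul[OF y, of c] unfolding G_def by (simp add: mult_ac)
  have "G M 0" for M unfolding G_def by (intro exI[of _ 0]) simp
  then have sum: "(\<And>i. i \<in> S \<Longrightarrow> G M (f i)) \<Longrightarrow> finite S \<Longrightarrow> G M (sum f S)" for M and S :: "nat set" and f
    by (induction S rule: infinite_finite_induct) (auto intro: add)
  obtain q1 where q1: "0 < q1" "of_int q1 * t \<in> \<int>" by (rule rat_denominator)
  obtain q2 where q2: "0 < q2" "of_int q2 * n \<in> \<int>" by (rule rat_denominator)
  define q where "q = q1 * q2"
  have q: "0 < q" using q1 q2 by (simp add: q_def)
  have "of_int q * t = of_int q2 * (of_int q1 * t)" "of_int q * n = of_int q1 * (of_int q2 * n)"
    unfolding q_def by simp_all
  then have "of_int q * t \<in> \<int>" "of_int q * n \<in> \<int>" using q1(2) q2(2) by (simp_all only: Ints_mult Ints_of_int)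
  then obtain T N where TN: "of_int q * t = of_int T" "of_int q * n = of_int N" by (auto elim!: Ints_cases)
  have qt: "of_int q * (of_rat t :: complex) = of_int T" "of_int q * (of_rat n :: complex) = of_int N"
    using arg_cong[OF TN(1), of "of_rat :: rat \<Rightarrow> complex"] arg_cong[OF TN(2), of "of_rat :: rat \<Rightarrow> complex"]
    by (simp_all add: of_rat_mult)
  have "x * x = x * (x + cnj x) - x * cnj x" by (simp add: algebra_simps)
  then have sq: "x * x = of_rat t * x - of_rat n" unfolding t n by (simp add: mult.commute)
  have single: "\<exists>M>0. G M (x ^ k)" for k
  proof (induction k)
    case 0
    have "G 1 (x ^ 0)" unfolding G_def by (intro exI[of _ 1] exI[of _ 0]) simp
    then show ?case by (intro exI[of _ 1]) simp
  next
    case (Suc k)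
    then obtain M a b where M: "0 < M" "of_int M * x ^ k = of_int a + of_int b * x" unfolding G_def by blast
    have "of_int (q * M) * x ^ Suc k = of_int q * x * (of_int M * x ^ k)" by (simp add: mult_ac)
    also have "\<dots> = of_int (q * a) * x + of_int b * (of_int q * (x * x))" unfolding M(2) by (simp add: algebra_simps)
    also have "of_int q * (x * x) = (of_int q * of_rat t) * x - of_int q * of_rat n" unfolding sq by (simp add: algebra_simps)
    also have "\<dots> = of_int T * x - of_int N" unfolding qt ..
    finally have "of_int (q * M) * x ^ Suc k = of_int (- b * N) + of_int (q * a + b * T) * x" by (simp add: algebra_simps)
    then have "G (q * M) (x ^ Suc k)" unfolding G_def by blast
    then show ?case using q M(1) by (intro exI[of _ "q * M"]) simp
  qed
  have "\<exists>M>0. \<forall>i<m. G M (x ^ i)" for m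
  proof (induction m)
    case 0
    show ?case by (intro exI[of _ 1]) simp
  next
    case (Suc m)
    obtain M where M: "0 < M" "\<forall>i<m. G M (x ^ i)" using Suc by blast
    obtain M' where M': "0 < M'" "G M' (x ^ m)" using single by blast
    have "G (M' * M) (x ^ i)" if i: "i < Suc m" for i
    proof (cases "i = m")
      case True
      then show ?thesis using scale[OF M'(2), of M] by (simp add: mult.commute)
    next
      case False
      then show ?thesis using i M(2) by (intro scale) simp
    qed
    then show ?case using M(1) M'(1) by (intro exI[of _ "M' * M"]) simp
  qed
  then obtain M where M: "0 < M" "\<forall>i<d. G M (x ^ i)" by blast
  have all: "G M (x ^ k)" for k
  proof (induction k rule: less_induct)
    case (less k)
    show ?case
    proof (cases "k < d")
      case False
      define j where "j = k - d"
      have k: "k = j + d" using False by (simp add: j_def)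
      have "(\<Sum>i<d. coeff p i * x ^ i) + x ^ d = 0"
        using p(3) p(1) unfolding poly_altdef d_def by (simp add: lessThan_Suc_atMost[symmetric])
      then have "x ^ d = (\<Sum>i<d. - (coeff p i * x ^ i))" by (simp add: sum_negf eq_neg_iff_add_eq_0 add.commute)
      then have "x ^ k = (\<Sum>i<d. - coeff p i * x ^ (j + i))"
        unfolding k power_add by (simp add: sum_distrib_left mult_ac)
      moreover have "G M (- coeff p i * x ^ (j + i))" if i: "i \<in> {..<d}" for i
      proof -
        obtain c where c: "coeff p i = of_int c" using p(2)[of i] by (auto elim: Ints_cases)
        have "G M (x ^ (j + i))" using i by (intro less) (simp add: k)
        from mul[OF this, of "- c"] show ?thesis unfolding c by simp
      qed
      ultimately show ?thesis using sum[of "{..<d}"] by simp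
    qed (use M in simp)
  qed
  have "of_int (q * M\<^sup>2) * n ^ k \<in> \<int>" for k
  proof -
    obtain a b :: int where ab: "of_int M * x ^ k = of_int a + of_int b * x" using all[of k] unfolding G_def by blast
    have "of_int (M\<^sup>2) * of_rat n ^ k = (of_int M * x ^ k) * cnj (of_int M * x ^ k)"
      unfolding n[symmetric] by (simp add: power2_eq_square power_mult_distrib mult_ac)
    also have "\<dots> = of_int (a * a) + of_int (a * b) * (x + cnj x) + of_int (b * b) * (x * cnj x)"
      unfolding ab by (simp add: algebra_simps)
    finally have e: "of_int (M\<^sup>2) * of_rat n ^ k = (of_int (a * a) + of_int (a * b) * of_rat t + of_int (b * b) * of_rat n :: complex)"
      unfolding t n .
    have "(of_rat (of_int (q * M\<^sup>2) * n ^ k) :: complex) = of_int q * (of_int (M\<^sup>2) * of_rat n ^ k)"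
      by (simp add: of_rat_mult of_rat_power)
    also have "\<dots> = of_int (q * (a * a)) + of_int (a * b) * (of_int q * of_rat t) + of_int (b * b) * (of_int q * of_rat n)"
      unfolding e by (simp add: algebra_simps)
    also have "\<dots> = of_rat (of_int (q * (a * a) + a * b * T + b * b * N))"
      unfolding qt of_rat_of_int_eq by (simp only: of_int_add of_int_mult)
    finally have "of_int (q * M\<^sup>2) * n ^ k = of_int (q * (a * a) + a * b * T + b * b * N)" by (simp only: of_rat_eq_iff)
    then show ?thesis by (simp only: Ints_of_int)
  qed
  moreover have "0 < q * M\<^sup>2" using q M(1) by simp
  ultimately show ?thesis by (rule rat_int_of_bounded_denominators[rotated])
qed

lemma algebraic_int_plus_1:
  fixes x :: complex
  assumes "algebraic_int x"
  shows "algebraic_int (x + 1)"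
proof -
  obtain p where p: "lead_coeff p = 1" "\<And>i. coeff p i \<in> \<int>" "poly p x = 0"
    using assms by (auto elim: algebraic_int.cases)
  show ?thesis
  proof (rule algebraic_int.intros)
    show "lead_coeff (pcompose p [:-1, 1:]) = 1" using p(1) by (subst lead_coeff_comp) auto
    show "\<forall>i. coeff (pcompose p [:-1, 1:]) i \<in> \<int>"
      by (intro allI coeff_pcompose_semiring_closed p(2)) (auto simp: coeff_pCons split: nat.splits)
    show "poly (pcompose p [:-1, 1:]) (x + 1) = 0" using p(3) by (simp add: poly_pcompose)
  qed
qed

text \<open>The trace is an integer because the norm of \<open>x + 1\<close> is one.\<close>

lemma algebraic_int_iff_trace_norm:
  fixes x :: complex and t n :: rat
  assumes t: "x + cnj x = of_rat t" and n: "x * cnj x = of_rat n"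
  shows "algebraic_int x \<longleftrightarrow> t \<in> \<int> \<and> n \<in> \<int>"
proof
  assume alg: "algebraic_int x"
  have nI: "n \<in> \<int>" by (rule norm_of_algebraic_int[OF alg t n])
  have "(x + 1) + cnj (x + 1) = of_rat (t + 2)" using t by (simp add: of_rat_add algebra_simps)
  moreover have "(x + 1) * cnj (x + 1) = x * cnj x + (x + cnj x) + 1" by (simp add: algebra_simps)
  then have "(x + 1) * cnj (x + 1) = of_rat (n + t + 1)" unfolding t n by (simp add: of_rat_add)
  ultimately have "n + t + 1 \<in> \<int>" by (rule norm_of_algebraic_int[OF algebraic_int_plus_1[OF alg]])
  then have "n + t + 1 - n - 1 \<in> \<int>" using nI by (intro Ints_diff Ints_1)
  then show "t \<in> \<int> \<and> n \<in> \<int>" using nI by simp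
next
  assume "t \<in> \<int> \<and> n \<in> \<int>"
  then obtain T N where TN: "t = of_int T" "n = of_int N" by (auto elim!: Ints_cases)
  have "x * x = x * (x + cnj x) - x * cnj x" by (simp add: algebra_simps)
  then have sq: "x * x = of_int T * x - of_int N" unfolding t n TN by (simp add: mult.commute)
  show "algebraic_int x"
  proof (rule algebraic_int.intros)
    show "lead_coeff [:of_int N, - of_int T, 1 :: complex:] = 1" by simp
    show "\<forall>i. coeff [:of_int N, - of_int T, 1 :: complex:] i \<in> \<int>" by (auto simp: coeff_pCons split: nat.splits)
    show "poly [:of_int N, - of_int T, 1:] x = 0" using sq by (simp add: algebra_simps)
  qed
qed

text \<open>Any element outside the real line generates the field, by comparison of dimensions. Completing the
  square, clearing the denominator and extracting the square part normalize it.\<close>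

lemma imaginary_quadratic_generator:
  assumes K: "imaginary_quadratic_field K"
  obtains D :: nat where "squarefree D" "K = {of_rat a + of_rat b * (\<i> * complex_of_real (sqrt (real D))) | a b. True}"
proof -
  interpret Q: vector_space "\<lambda>(q::rat) (z::complex). of_rat q * z"
    by unfold_locales (simp_all add: algebra_simps of_rat_add of_rat_mult)
  have add: "x + y \<in> K" and mul: "x * y \<in> K" if "x \<in> K" "y \<in> K" for x y
    using K that unfolding imaginary_quadratic_field_def by blast+
  have inv: "- x \<in> K" "inverse x \<in> K" if "x \<in> K" for x using K that unfolding imaginary_quadratic_field_def by blast+
  have one: "1 \<in> K" and zero: "0 \<in> K" and dim: "Q.dim K = 2" and nr: "\<not> K \<subseteq> \<real>"
    using K unfolding imaginary_quadratic_field_def by blast+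
  have nat: "of_nat m \<in> K" for m by (induction m) (auto intro: zero one add)
  have int: "of_int m \<in> K" for m by (cases m rule: int_cases2) (auto intro: nat inv)
  have rat: "of_rat r \<in> K" for r
  proof -
    obtain u v where "quotient_of r = (u, v)" by (cases "quotient_of r")
    then have "r = of_int u / of_int v" by (rule quotient_of_div)
    then have "of_rat r = (of_int u * inverse (of_int v) :: complex)" by (simp add: of_rat_divide field_simps)
    then show ?thesis by (simp add: mul int inv)
  qed
  have gen: "K = {of_rat a + of_rat b * x | a b. True}" if x: "x \<in> K" "Im x \<noteq> 0" for x
  proof (intro equalityI subsetI)
    fix y assume "y \<in> {of_rat a + of_rat b * x | a b. True}"
    then show "y \<in> K" using x(1) by (auto intro!: add mul rat)
  next
    fix y assume y: "y \<in> K"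
    have ind: "Q.independent {x, 1}"
    proof -
      have "x \<notin> Q.span {1}"
      proof
        assume "x \<in> Q.span {1}"
        then obtain k where "x = of_rat k" unfolding Q.span_singleton by auto
        then show False using x(2) by simp
      qed
      moreover have "x \<noteq> 1" using x(2) by auto
      ultimately show ?thesis by (simp add: Q.independent_insert)
    qed
    have "y \<in> Q.span {x, 1}"
    proof (rule ccontr)
      assume n: "y \<notin> Q.span {x, 1}"
      then have i3: "Q.independent (insert y {x, 1})" using ind by (rule Q.independent_insertI)
      obtain B where B: "B \<subseteq> K" "Q.independent B" "K \<subseteq> Q.span B" "card B = 2"
        using Q.basis_exists[of K] unfolding dim by blast
      have "finite B" using B(4) by (metis card.infinite zero_neq_numeral)
      moreover have "insert y {x, 1} \<subseteq> Q.span B" using B(3) x(1) y one by blast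
      ultimately have "card (insert y {x, 1}) \<le> card B" using Q.independent_span_bound i3 by blast
      moreover have "y \<notin> {x, 1}" using n Q.span_base by blast
      moreover have "x \<noteq> 1" using x(2) by auto
      ultimately show False using B(4) by simp
    qed
    then obtain b where "y - of_rat b * x \<in> Q.span {1}" unfolding Q.span_insert[of x "{1}"] by blast
    then obtain a where "y - of_rat b * x = of_rat a" unfolding Q.span_singleton by auto
    then have "y = of_rat a + of_rat b * x" by (simp add: algebra_simps)
    then show "y \<in> {of_rat a + of_rat b * x | a b. True}" by blast
  qed
  obtain x where "x \<in> K" "x \<notin> \<real>" using nr by blast
  then have x: "x \<in> K" "Im x \<noteq> 0" by (auto simp: complex_is_Real_iff)
  have "x * x \<in> {of_rat a + of_rat b * x | a b. True}" using mul[OF x(1) x(1)] gen[OF x] by simp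
  then obtain a b where ab: "x * x = of_rat a + of_rat b * x" by blast
  define y where "y = 2 * x - of_rat b"
  have yK: "y \<in> K" unfolding y_def using mul[OF int[of 2] x(1)] add[OF _ inv(1)[OF rat[of b]]] by simp
  have Iy: "Im y \<noteq> 0" unfolding y_def using x(2) by simp
  have "y * y = 4 * (x * x) - 4 * of_rat b * x + of_rat (b * b)" unfolding y_def by (simp add: algebra_simps of_rat_mult)
  also have "\<dots> = of_rat (4 * a + b * b)" unfolding ab by (simp add: algebra_simps of_rat_mult of_rat_add)
  finally have yy: "y * y = of_rat (4 * a + b * b)" .
  obtain u v where uv: "quotient_of (4 * a + b * b) = (u, v)" by (cases "quotient_of (4 * a + b * b)")
  have v: "0 < v" using quotient_of_denom_pos[OF uv] .
  have yy2: "y * y = of_int u / of_int v" unfolding yy quotient_of_div[OF uv] by (simp add: of_rat_divide)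
  define z where "z = of_int v * y"
  have zK: "z \<in> K" unfolding z_def by (intro mul int yK)
  have Iz: "Im z \<noteq> 0" unfolding z_def using Iy v by simp
  have zz: "z * z = of_int (u * v)"
  proof -
    have "z * z = of_int v * of_int v * (y * y)" unfolding z_def by (simp add: mult_ac)
    also have "\<dots> = of_int (u * v)" unfolding yy2 using v by simp
    finally show ?thesis .
  qed
  have "Im (z * z) = 0" unfolding zz by simp
  then have "Re z = 0" using Iz by simp
  then have z: "z = \<i> * of_real (Im z)" by (simp add: complex_eq_iff)
  have "Re (z * z) = of_int (u * v)" unfolding zz by simp
  then have Im2: "(Im z)\<^sup>2 = - of_int (u * v)" using \<open>Re z = 0\<close> by (simp add: power2_eq_square)
  have "0 < (Im z)\<^sup>2" using Iz by simp
  then have "real_of_int (u * v) < 0" using Im2 by linarith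
  then have uv0: "u * v < 0" by (simp only: of_int_less_0_iff)
  define E where "E = nat (- (u * v))"
  have E: "real E = (Im z)\<^sup>2" unfolding Im2 E_def using uv0 by simp
  define D s where "D = squarefree_part E" and "s = square_part E"
  have Ds: "E = D * s\<^sup>2" unfolding D_def s_def by (rule squarefree_decompose)
  have "0 < E" unfolding E_def using uv0 by simp
  then have s: "0 < s" unfolding Ds by (cases s) auto
  have sD: "squarefree D" unfolding D_def by simp
  have "\<bar>Im z\<bar> = sqrt (real E)" unfolding E by simp
  also have "\<dots> = sqrt (real D) * real s" unfolding Ds by (simp add: real_sqrt_mult)
  finally have Iabs: "\<bar>Im z\<bar> = sqrt (real D) * real s" .
  define g where "g = \<i> * complex_of_real (sqrt (real D))"
  have "g = z * inverse (of_nat s) \<or> g = - (z * inverse (of_nat s))"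
  proof (cases "0 \<le> Im z")
    case True
    then have "z = g * of_nat s" unfolding g_def using Iabs by (subst z) simp
    then show ?thesis using s by (simp add: field_simps)
  next
    case False
    then have "Im z = - (sqrt (real D) * real s)" using Iabs by simp
    then have "z = - (g * of_nat s)" unfolding g_def by (subst z) simp
    then show ?thesis using s by (simp add: field_simps)
  qed
  then have gK: "g \<in> K" using mul[OF zK inv(2)[OF nat[of s]]] inv(1) by auto
  have "Im g \<noteq> 0" unfolding g_def using sD by (auto intro: ccontr)
  from gen[OF gK this] show ?thesis using that[OF sD] unfolding g_def by blast
qed

lemma squarefree_mult_square_int:
  fixes b :: rat
  assumes D: "squarefree (D :: nat)" and i: "of_nat D * b\<^sup>2 \<in> \<int>"
  shows "b \<in> \<int>"
proof -
  obtain u v where uv: "quotient_of b = (u, v)" by (cases "quotient_of b")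
  have v: "0 < v" and cop: "coprime u v" and b: "b = of_int u / of_int v"
    using quotient_of_denom_pos[OF uv] quotient_of_coprime[OF uv] quotient_of_div[OF uv] .
  obtain m where m: "of_nat D * b\<^sup>2 = (of_int m :: rat)" using i by (auto elim: Ints_cases)
  then have "(of_int (int D * u\<^sup>2) :: rat) = of_int (m * v\<^sup>2)" using v unfolding b by (simp add: power_divide field_simps)
  then have "int D * u\<^sup>2 = m * v\<^sup>2" by (simp only: of_int_eq_iff)
  then have "v\<^sup>2 dvd int D * u\<^sup>2" by simp
  moreover have "coprime (v\<^sup>2) (u\<^sup>2)" using cop by (simp add: coprime_commute)
  ultimately have "v\<^sup>2 dvd int D" using coprime_dvd_mult_left_iff by blast
  then have "int ((nat v)\<^sup>2) dvd int D" using v by simp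
  then have "(nat v)\<^sup>2 dvd D" by (simp only: int_dvd_int_iff)
  then have "nat v dvd 1" by (rule squarefreeD[OF D])
  then have "v = 1" using v by simp
  then show ?thesis unfolding b by simp
qed

text \<open>
  An element \<open>a + b * g\<close> with \<open>g\<^sup>2 = - D\<close> is integral if and only if \<open>2 * a\<close> and
  \<open>a\<^sup>2 + D * b\<^sup>2\<close> are integers. As \<open>D\<close> is squarefree, \<open>2 * b\<close> is an integer too, and reduction modulo 4
  leaves the two classical cases.
\<close>

lemma integers_of_generator:
  fixes D :: nat
  defines "g \<equiv> \<i> * complex_of_real (sqrt (real D))"
  assumes D: "squarefree D"
    and K: "K = {of_rat a + of_rat b * g | a b. True}"
  shows "ring_of_integers K = {of_int a + of_int b * (if D mod 4 = 3 then (1 + g) / 2 else g) | a b. True}"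
proof -
  have cg: "cnj g = - g" unfolding g_def by simp
  have gg: "g * g = - of_nat D" unfolding g_def by (simp add: complex_eq_iff)
  have int: "algebraic_int (of_rat a + of_rat b * g) \<longleftrightarrow> 2 * a \<in> \<int> \<and> a\<^sup>2 + of_nat D * b\<^sup>2 \<in> \<int>" for a b
  proof (rule algebraic_int_iff_trace_norm)
    show "of_rat a + of_rat b * g + cnj (of_rat a + of_rat b * g) = of_rat (2 * a)"
      using cg by (simp add: of_rat_mult cnj_of_rat)
    have "(of_rat a + of_rat b * g) * cnj (of_rat a + of_rat b * g) = of_rat (a\<^sup>2) - of_rat (b\<^sup>2) * (g * g)"
      using cg by (simp add: algebra_simps power2_eq_square of_rat_mult cnj_of_rat)
    then show "(of_rat a + of_rat b * g) * cnj (of_rat a + of_rat b * g) = of_rat (a\<^sup>2 + of_nat D * b\<^sup>2)"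
      unfolding gg by (simp add: of_rat_add of_rat_mult mult.commute)
  qed
  have n4: "\<not> 4 dvd D"
  proof
    assume "4 dvd D"
    then have "2\<^sup>2 dvd D" by simp
    then have "(2::nat) dvd 1" by (rule squarefreeD[OF D])
    then show False by simp
  qed
  have half: "\<exists>A B. 2 * a = of_int A \<and> 2 * b = of_int B \<and> 4 dvd A\<^sup>2 + int D * B\<^sup>2"
    if h: "2 * a \<in> \<int>" "a\<^sup>2 + of_nat D * b\<^sup>2 \<in> \<int>" for a b :: rat
  proof -
    obtain A where A: "2 * a = of_int A" using h(1) by (auto elim: Ints_cases)
    obtain m where m: "a\<^sup>2 + of_nat D * b\<^sup>2 = of_int m" using h(2) by (auto elim: Ints_cases)
    have "of_nat D * (2 * b)\<^sup>2 = 4 * (a\<^sup>2 + of_nat D * b\<^sup>2) - (2 * a)\<^sup>2" by (simp add: algebra_simps power2_eq_square)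
    also have "\<dots> = of_int (4 * m - A\<^sup>2)" unfolding A m by simp
    finally have e: "of_nat D * (2 * b)\<^sup>2 = of_int (4 * m - A\<^sup>2)" .
    then have "2 * b \<in> \<int>" using squarefree_mult_square_int[OF D, of "2 * b"] by simp
    then obtain B where B: "2 * b = of_int B" by (auto elim: Ints_cases)
    have "(of_int (int D * B\<^sup>2) :: rat) = of_int (4 * m - A\<^sup>2)" using e unfolding B by simp
    then have "int D * B\<^sup>2 = 4 * m - A\<^sup>2" by (simp only: of_int_eq_iff)
    then show ?thesis using A B by (intro exI[of _ A] exI[of _ B]) simp
  qed
  have sq4: "(X::int)\<^sup>2 mod 4 = (if even X then 0 else 1)" for X
  proof (cases "even X")
    case True
    then obtain Y where "X = 2 * Y" by blast
    then show ?thesis by (simp add: power_mult_distrib)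
  next
    case False
    then obtain Y where "X = 2 * Y + 1" by (auto elim: oddE)
    then have e: "X\<^sup>2 = 1 + 4 * (Y\<^sup>2 + Y)" by (simp add: algebra_simps power2_eq_square)
    show ?thesis unfolding e mod_mult_self2 using False by simp
  qed
  have red: "(A\<^sup>2 + int D * B\<^sup>2) mod 4 = (A\<^sup>2 mod 4 + (int D mod 4) * (B\<^sup>2 mod 4)) mod 4" for A B
  proof -
    have "(A\<^sup>2 + int D * B\<^sup>2) mod 4 = (A\<^sup>2 mod 4 + int D * B\<^sup>2 mod 4) mod 4" by (rule mod_add_eq[symmetric])
    also have "int D * B\<^sup>2 mod 4 = (int D mod 4) * (B\<^sup>2 mod 4) mod 4" by (rule mod_mult_eq[symmetric])
    finally show ?thesis unfolding mod_add_right_eq .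
  qed
  have Dm: "int D mod 4 = int (D mod 4)" by (simp add: zmod_int)
  show ?thesis
  proof (cases "D mod 4 = 3")
    case True
    have D3: "int D mod 4 = 3" unfolding Dm True by simp
    show ?thesis
    proof (intro equalityI subsetI)
      fix x assume x: "x \<in> ring_of_integers K"
      then obtain a b where xab: "x = of_rat a + of_rat b * g" unfolding ring_of_integers_def K by blast
      obtain A B where AB: "2 * a = of_int A" "2 * b = of_int B" "4 dvd A\<^sup>2 + int D * B\<^sup>2"
        using half[of a b] x int[of a b] unfolding ring_of_integers_def xab by blast
      have "even A \<longleftrightarrow> even B" using AB(3) red[of A B] unfolding sq4 D3 by (auto split: if_splits)
      then have "even (A - B)" by simp
      then obtain C where "A - B = 2 * C" by (rule evenE)
      then have C: "A = B + 2 * C" by simp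
      have a: "a = of_int A / 2" and b: "b = of_int B / 2" using AB(1,2) by linarith+
      have "a = of_int C + of_int B / 2" unfolding a C by simp
      then have "(of_rat a :: complex) = of_int C + of_int B / 2" by (simp add: of_rat_divide of_rat_add)
      moreover have "(of_rat b :: complex) = of_int B / 2" unfolding b by (simp add: of_rat_divide)
      ultimately have "x = of_int C + of_int B * ((1 + g) / 2)" unfolding xab by (simp add: algebra_simps)
      then show "x \<in> {of_int a + of_int b * (if D mod 4 = 3 then (1 + g) / 2 else g) | a b. True}" using True by auto
    next
      fix x assume "x \<in> {of_int a + of_int b * (if D mod 4 = 3 then (1 + g) / 2 else g) | a b. True}"
      then obtain a b where x: "x = of_int a + of_int b * ((1 + g) / 2)" using True by auto
      define r q :: rat where "r = of_int a + of_int b / 2" and "q = of_int b / 2"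
      have "(of_rat r :: complex) = of_int a + of_int b / 2" "(of_rat q :: complex) = of_int b / 2"
        unfolding r_def q_def by (simp_all add: of_rat_add of_rat_divide)
      then have xrq: "x = of_rat r + of_rat q * g" unfolding x by (simp add: algebra_simps add_divide_distrib)
      obtain k where k: "D = 4 * k + 3" using True by (metis mult_div_mod_eq)
      have "2 * r = of_int (2 * a + b)" unfolding r_def by simp
      moreover have "r\<^sup>2 + of_nat D * q\<^sup>2 = of_int (a\<^sup>2 + a * b + b\<^sup>2 * (int k + 1))"
        unfolding r_def q_def k by (simp add: field_simps power2_eq_square)
      ultimately have "algebraic_int x" unfolding xrq int by (simp only: Ints_of_int)
      then show "x \<in> ring_of_integers K" unfolding ring_of_integers_def K using xrq by blast
    qed
  next
    case False
    have "int D mod 4 = 1 \<or> int D mod 4 = 2" using False n4 unfolding Dm dvd_eq_mod_eq_0 by linarith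
    then have ev: "even A \<and> even B" if "4 dvd A\<^sup>2 + int D * B\<^sup>2" for A B
      using that red[of A B] unfolding sq4 by (auto split: if_splits)
    show ?thesis
    proof (intro equalityI subsetI)
      fix x assume x: "x \<in> ring_of_integers K"
      then obtain a b where xab: "x = of_rat a + of_rat b * g" unfolding ring_of_integers_def K by blast
      obtain A B where AB: "2 * a = of_int A" "2 * b = of_int B" "4 dvd A\<^sup>2 + int D * B\<^sup>2"
        using half[of a b] x int[of a b] unfolding ring_of_integers_def xab by blast
      obtain A' B' where "A = 2 * A'" "B = 2 * B'" using ev[OF AB(3)] by blast
      then have "a = of_int A'" "b = of_int B'" using AB by simp_all
      then have "x = of_int A' + of_int B' * g" unfolding xab by simp
      then show "x \<in> {of_int a + of_int b * (if D mod 4 = 3 then (1 + g) / 2 else g) | a b. True}" using False by auto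
    next
      fix x assume "x \<in> {of_int a + of_int b * (if D mod 4 = 3 then (1 + g) / 2 else g) | a b. True}"
      then obtain a b where "x = of_int a + of_int b * g" using False by auto
      then have x: "x = of_rat (of_int a) + of_rat (of_int b) * g" by simp
      have "2 * of_int a = (of_int (2 * a) :: rat)" "(of_int a)\<^sup>2 + of_nat D * (of_int b)\<^sup>2 = (of_int (a\<^sup>2 + int D * b\<^sup>2) :: rat)" by simp_all
      then have "algebraic_int x" unfolding x int by (simp only: Ints_of_int)
      then show "x \<in> ring_of_integers K" unfolding ring_of_integers_def K using x by blast
    qed
  qed
qed

lemma imaginary_quadratic_field_order:
  assumes K: "imaginary_quadratic_field K"
  obtains w tr nm where "imaginary_order K w tr nm"
proof -
  obtain D :: nat where D: "squarefree D" and KD: "K = {of_rat a + of_rat b * (\<i> * complex_of_real (sqrt (real D))) | a b. True}"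
    using imaginary_quadratic_generator[OF K] .
  have pos: "0 < D" using D by (auto intro: ccontr)
  define g where "g = \<i> * complex_of_real (sqrt (real D))"
  have gg: "g * g = - of_nat D" unfolding g_def by (simp add: complex_eq_iff)
  note ring = integers_of_generator[OF D KD]
  show ?thesis
  proof (cases "D mod 4 = 3")
    case True
    then obtain k where k: "D = 4 * k + 3" by (metis mult_div_mod_eq)
    have "(1 + g) / 2 * ((1 + g) / 2) = (1 + 2 * g + g * g) / 4" by (simp add: field_simps)
    also have "\<dots> = of_int 1 * ((1 + g) / 2) - of_int (int k + 1)"
      unfolding gg k by (simp add: field_simps)
    finally have sq: "(1 + g) / 2 * ((1 + g) / 2) = of_int 1 * ((1 + g) / 2) - of_int (int k + 1)" .
    have "imaginary_order K ((1 + g) / 2) 1 (int k + 1)"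
    proof
      show "0 < Im ((1 + g) / 2)" unfolding g_def using pos by simp
      show "ring_of_integers K = {of_int a + of_int b * ((1 + g) / 2) |a b. True}" using ring True unfolding g_def by simp
    qed (rule sq)
    then show ?thesis by (rule that)
  next
    case False
    have "imaginary_order K g 0 (int D)"
    proof
      show "0 < Im g" unfolding g_def using pos by simp
      show "g * g = of_int 0 * g - of_int (int D)" unfolding gg by simp
      show "ring_of_integers K = {of_int a + of_int b * g |a b. True}" using ring False unfolding g_def by simp
    qed
    then show ?thesis by (rule that)
  qed
qed

section \<open>The limiting gap distribution\<close>

theorem theorem2p6:
  fixes K :: "complex set"
  assumes "imaginary_quadratic_field K"
  shows "\<exists>\<mu> :: real measure.
    prob_space \<mu> \<and>
    sets \<mu> = sets (restrict_space borel {0..}) \<and>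
    absolutely_continuous (restrict_space lborel {0..}) \<mu> \<and>
    (\<forall>B. B \<in> sets (torus_borel K) \<and>
         emeasure (torus_haar K) B > 0 \<and>
         emeasure (torus_haar K) (torus_topology K frontier_of B) = 0 \<longrightarrow>
         narrowly_converges (\<lambda>t. gap_measure K t B) \<mu> at_top) \<and>
    measure \<mu> {0..1} = 0 \<and>
    (\<forall>\<delta>\<ge>0. measure \<mu> {0..\<delta>} =
       1 - 4 / sqrt (real_of_int \<bar>discriminant K\<bar>) *
         (LBINT s:{0..}. measure (torus_haar K)
            (proj K ` {z. card (cone_of (cball 0 \<delta>) \<inter>
                (\<lambda>v. (a_mat (- s) ** transpose (h_mat z)) *v v) ` primitive_vectors K)
              = card (unit_group K)})
            * exp (- 2 * s)))"
proof -
  obtain w tr nm where "imaginary_order K w tr nm"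
    using imaginary_quadratic_field_order[OF assms] .
  then interpret imaginary_order K w tr nm .
  show ?thesis
  proof (intro exI[of _ law] conjI allI impI)
    show "prob_space law" by (rule prob_law)
    show "sets law = sets (restrict_space borel {0..})" by (rule sets_law)
    show "absolutely_continuous (restrict_space lborel {0..}) law" by (rule law_absolutely_continuous)
    show "measure law {0..1} = 0" by (rule law_unit)
  next
    fix B
    assume "B \<in> sets (torus_borel K) \<and> 0 < emeasure (torus_haar K) B \<and>
      emeasure (torus_haar K) (torus_topology K frontier_of B) = 0"
    then show "narrowly_converges (\<lambda>t. gap_measure K t B) law at_top"
      by (intro narrow_convergence_torus) auto
  next
    fix \<delta> :: real assume "0 \<le> \<delta>"
    then show "measure law {0..\<delta>} =
       1 - 4 / sqrt (real_of_int \<bar>discriminant K\<bar>) *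
         (LBINT s:{0..}. measure (torus_haar K)
            (proj K ` {z. card (cone_of (cball 0 \<delta>) \<inter>
                (\<lambda>v. (a_mat (- s) ** transpose (h_mat z)) *v v) ` primitive_vectors K)
              = card (unit_group K)})
            * exp (- 2 * s))"
      by (rule law_formula)
  qed
qed

end
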